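(* Let $c>0$, let $(\lambda_1,\lambda_2)$ be in the unstable regime, and let $a_0>0$ be such that $E_a$ restricted to $S(c)$ admits a ground state for every $a\in(0,a_0]$ (such an $a_0$ exists). Then there exists $a_1\in(0,a_0]$ such that for every $a\in(0,a_1]$ and every ground state $u$ of $E_a$ restricted to $S(c)$, the number $\mu\in\mathbb{R}$ for which $$-\tfrac12\Delta u+\tfrac{a^2}{2}|x|^2u+\lambda_1|u|^2u+\lambda_2(K\star|u|^2)u+\mu u=0$$ satisfies $\mu<0$.
   Context: $f\mapsto K\star f$ is the Fourier multiplier with symbol $\hat K(\xi)=\frac43\pi\,\frac{2\xi_3^2-\xi_1^2-\xi_2^2}{|\xi|^2}$ (convolution with the dipolar kernel $K(x)=\frac{1-3\cos^2\theta}{|x|^3}$, $\theta$ the angle between $x$ and $(0,0,1)$). The pair $(\lambda_1,\lambda_2)\in\mathbb{R}^2$ with $\lambda_2\ne0$ is in the unstable regime if $\lambda_1-\frac43\pi\lambda_2<0$ when $\lambda_2>0$, and $\lambda_1+\frac83\pi\lambda_2<0$ when $\lambda_2<0$. $\Sigma=\{u\in H^1(\mathbb{R}^3,\mathbb{C}):\int|x|^2|u|^2dx<\infty\}$ with norm $\|u\|_\Sigma^2=\|u\|_{H^1}^2+\||x|u\|_2^2$; $S(c)=\{u\in\Sigma:\|u\|_2^2=c\}$; and $$E_a(u)=\tfrac12\|\nabla u\|_2^2+\tfrac{a^2}{2}\||x|u\|_2^2+\tfrac{\lambda_1}2\|u\|_4^4+\tfrac{\lambda_2}2\int_{\mathbb{R}^3}(K\star|u|^2)|u|^2dx.$$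 Ground state of $E_a$ on $S(c)$: a critical point $u\in S(c)$ of $E_a|_{S(c)}$ with $E_a(u)=\inf\{E_a(w):w\in S(c),\ E_a'|_{S(c)}(w)=0\}$. Any critical point of $E_a|_{S(c)}$ solves the displayed equation for a unique $\mu\in\mathbb{R}$ (the Lagrange multiplier). *)

theory Defs
  imports "HOL-Analysis.Analysis"
begin

text \<open>
  Elements of function spaces are represented by Borel functions on \<open>\<real>\<^sup>3\<close>; no quotient by
  almost-everywhere equality is formed, and all quantities below are invariant under it.
\<close>

subsection \<open>Test functions\<close>

definition partial :: "3 \<Rightarrow> (real ^ 3 \<Rightarrow> real) \<Rightarrow> real ^ 3 \<Rightarrow> real" where
  "partial i f x = frechet_derivative f (at x) (axis i 1)"

primrec k_times_cont_diff :: "nat \<Rightarrow> (real ^ 3 \<Rightarrow> real) \<Rightarrow> bool" where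
  "k_times_cont_diff 0 f \<longleftrightarrow> continuous_on UNIV f"
| "k_times_cont_diff (Suc k) f \<longleftrightarrow>
     (\<forall>x. f differentiable (at x)) \<and> (\<forall>i. k_times_cont_diff k (partial i f))"

definition test_functions :: "(real ^ 3 \<Rightarrow> real) set" where
  "test_functions = {\<phi>. (\<forall>k. k_times_cont_diff k \<phi>) \<and> compact (closure {x. \<phi> x \<noteq> 0})}"

definition laplacian :: "(real ^ 3 \<Rightarrow> real) \<Rightarrow> real ^ 3 \<Rightarrow> real" where
  "laplacian \<phi> x = (\<Sum>i\<in>UNIV. partial i (partial i \<phi>) x)"


subsection \<open>The spaces $L^2$, $H^1$ and the energy space\<close>

definition L2 :: "(real ^ 3 \<Rightarrow> complex) set" where
  "L2 = {f \<in> borel_measurable lborel. integrable lborel (\<lambda>x. (norm (f x))\<^sup>2)}"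

definition is_weak_partial :: "3 \<Rightarrow> (real ^ 3 \<Rightarrow> complex) \<Rightarrow> (real ^ 3 \<Rightarrow> complex) \<Rightarrow> bool" where
  "is_weak_partial i u g \<longleftrightarrow> g \<in> L2 \<and>
     (\<forall>\<phi>\<in>test_functions.
        (LINT x|lborel. u x * of_real (partial i \<phi> x)) = - (LINT x|lborel. g x * of_real (\<phi> x)))"

definition H1 :: "(real ^ 3 \<Rightarrow> complex) set" where
  "H1 = {u \<in> L2. \<forall>i. \<exists>g. is_weak_partial i u g}"

text \<open>Determined up to a null set for \<open>u \<in> H1\<close>.\<close>

definition weak_partial :: "3 \<Rightarrow> (real ^ 3 \<Rightarrow> complex) \<Rightarrow> real ^ 3 \<Rightarrow> complex" where
  "weak_partial i u = (SOME g. is_weak_partial i u g)"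

definition mass :: "(real ^ 3 \<Rightarrow> complex) \<Rightarrow> real" where
  "mass u = (LINT x|lborel. (norm (u x))\<^sup>2)"

definition gradient_sq :: "(real ^ 3 \<Rightarrow> complex) \<Rightarrow> real" where
  "gradient_sq u = (\<Sum>i\<in>UNIV. LINT x|lborel. (norm (weak_partial i u x))\<^sup>2)"

definition moment_sq :: "(real ^ 3 \<Rightarrow> complex) \<Rightarrow> real" where
  "moment_sq u = (LINT x|lborel. (norm x)\<^sup>2 * (norm (u x))\<^sup>2)"

definition energy_space :: "(real ^ 3 \<Rightarrow> complex) set" where
  "energy_space = {u \<in> H1. integrable lborel (\<lambda>x. (norm x)\<^sup>2 * (norm (u x))\<^sup>2)}"

definition energy_space_norm :: "(real ^ 3 \<Rightarrow> complex) \<Rightarrow> real" where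
  "energy_space_norm u = sqrt (mass u + gradient_sq u + moment_sq u)"

definition mass_sphere :: "real \<Rightarrow> (real ^ 3 \<Rightarrow> complex) set" where
  "mass_sphere c = {u \<in> energy_space. mass u = c}"


subsection \<open>The dipolar convolution as a Fourier multiplier\<close>

text \<open>
  \<open>F\<close> is the Fourier--Plancherel transform of \<open>f\<close>: the \<open>L2\<close>-limit, as \<open>R\<close> tends to infinity, of
  the Fourier integrals of \<open>f\<close> truncated to the ball of radius \<open>R\<close>. The symbol below is homogeneous
  of degree 0, so the operator does not depend on the normalisation of the transform.
\<close>

definition has_fourier_transform ::
    "(real ^ 3 \<Rightarrow> complex) \<Rightarrow> (real ^ 3 \<Rightarrow> complex) \<Rightarrow> bool" where
  "has_fourier_transform f F \<longleftrightarrow> f \<in> L2 \<and> F \<in> L2 \<and>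
     ((\<lambda>R::real. \<integral>\<^sup>+ \<xi>. ennreal ((norm (F \<xi> -
          (LINT x|lborel. indicator (cball 0 R) x * (cis (- (\<xi> \<bullet> x)) * f x))))\<^sup>2) \<partial>lborel)
        \<longlongrightarrow> 0) at_top"

text \<open>For \<open>f \<in> L2\<close> and a bounded measurable symbol the result is determined up to a null set.\<close>

definition fourier_multiplier ::
    "(real ^ 3 \<Rightarrow> complex) \<Rightarrow> (real ^ 3 \<Rightarrow> complex) \<Rightarrow> real ^ 3 \<Rightarrow> complex" where
  "fourier_multiplier m f =
     (SOME g. \<exists>F. has_fourier_transform f F \<and> has_fourier_transform g (\<lambda>\<xi>. m \<xi> * F \<xi>))"

definition dipolar_symbol :: "real ^ 3 \<Rightarrow> real" where
  "dipolar_symbol \<xi> = 4 / 3 * pi * ((2 * (\<xi> $ 3)\<^sup>2 - (\<xi> $ 1)\<^sup>2 - (\<xi> $ 2)\<^sup>2) / (norm \<xi>)\<^sup>2)"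

definition dipolar_conv :: "(real ^ 3 \<Rightarrow> complex) \<Rightarrow> real ^ 3 \<Rightarrow> complex" where
  "dipolar_conv f = fourier_multiplier (\<lambda>\<xi>. of_real (dipolar_symbol \<xi>)) f"

definition particle_density :: "(real ^ 3 \<Rightarrow> complex) \<Rightarrow> real ^ 3 \<Rightarrow> complex" where
  "particle_density u x = of_real ((norm (u x))\<^sup>2)"


subsection \<open>Energy, critical points and ground states\<close>

definition unstable_regime :: "real \<Rightarrow> real \<Rightarrow> bool" where
  "unstable_regime lam1 lam2 \<longleftrightarrow>
     (lam2 > 0 \<and> lam1 - 4 / 3 * pi * lam2 < 0) \<or> (lam2 < 0 \<and> lam1 + 8 / 3 * pi * lam2 < 0)"

text \<open>
  The symbol is real and even, so the dipolar integral is real; \<^const>\<open>Re\<close> only adjusts the type.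
\<close>

definition energy :: "real \<Rightarrow> real \<Rightarrow> real \<Rightarrow> (real ^ 3 \<Rightarrow> complex) \<Rightarrow> real" where
  "energy lam1 lam2 a u =
     1 / 2 * gradient_sq u + a\<^sup>2 / 2 * moment_sq u
     + lam1 / 2 * (LINT x|lborel. (norm (u x)) ^ 4)
     + lam2 / 2 * Re (LINT x|lborel. dipolar_conv (particle_density u) x * particle_density u x)"

text \<open>
  \<open>D\<close> is the Frechet derivative of \<open>F\<close> at \<open>u\<close> on the energy space, regarded as a real Hilbert space.
\<close>

definition has_energy_space_derivative ::
    "((real ^ 3 \<Rightarrow> complex) \<Rightarrow> real) \<Rightarrow> ((real ^ 3 \<Rightarrow> complex) \<Rightarrow> real) \<Rightarrow>
      (real ^ 3 \<Rightarrow> complex) \<Rightarrow> bool" where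
  "has_energy_space_derivative F D u \<longleftrightarrow>
     (\<forall>h\<in>energy_space. \<forall>k\<in>energy_space. D (\<lambda>x. h x + k x) = D h + D k) \<and>
     (\<forall>r::real. \<forall>h\<in>energy_space. D (\<lambda>x. of_real r * h x) = r * D h) \<and>
     (\<exists>C. \<forall>h\<in>energy_space. \<bar>D h\<bar> \<le> C * energy_space_norm h) \<and>
     (\<forall>\<epsilon>>0. \<exists>\<delta>>0. \<forall>h\<in>energy_space. energy_space_norm h < \<delta> \<longrightarrow>
        \<bar>F (\<lambda>x. u x + h x) - F u - D h\<bar> \<le> \<epsilon> * energy_space_norm h)"

text \<open>
  The derivative vanishes on the tangent space of the sphere at \<open>u\<close>, that is, on the \<open>h\<close> that are
  orthogonal to \<open>u\<close> in the real inner product of \<open>L2\<close>.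
\<close>

definition constrained_critical_point ::
    "real \<Rightarrow> real \<Rightarrow> real \<Rightarrow> real \<Rightarrow> (real ^ 3 \<Rightarrow> complex) \<Rightarrow> bool" where
  "constrained_critical_point lam1 lam2 a c u \<longleftrightarrow> u \<in> mass_sphere c \<and>
     (\<exists>D. has_energy_space_derivative (energy lam1 lam2 a) D u \<and>
        (\<forall>h\<in>energy_space. Re (LINT x|lborel. u x * cnj (h x)) = 0 \<longrightarrow> D h = 0))"

text \<open>The infimum is taken in \<^typ>\<open>ereal\<close>, where it exists without a lower bound on the set.\<close>

definition ground_state ::
    "real \<Rightarrow> real \<Rightarrow> real \<Rightarrow> real \<Rightarrow> (real ^ 3 \<Rightarrow> complex) \<Rightarrow> bool" where
  "ground_state lam1 lam2 a c u \<longleftrightarrow> constrained_critical_point lam1 lam2 a c u \<and>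
     ereal (energy lam1 lam2 a u) =
       (INF w\<in>{w. constrained_critical_point lam1 lam2 a c w}. ereal (energy lam1 lam2 a w))"

text \<open>
  The stationary equation
  $-\frac12\Delta u+\frac{a^2}{2}|x|^2u+\lambda_1|u|^2u+\lambda_2(K\star|u|^2)u+\mu u=0$
  in the sense of distributions. Real test functions suffice, since the equation is linear in them.
\<close>

definition solves_stationary ::
    "real \<Rightarrow> real \<Rightarrow> real \<Rightarrow> real \<Rightarrow> (real ^ 3 \<Rightarrow> complex) \<Rightarrow> bool" where
  "solves_stationary lam1 lam2 a \<mu> u \<longleftrightarrow>
     (\<forall>\<phi>\<in>test_functions.
        (LINT x|lborel.
           - (1 / 2) * u x * of_real (laplacian \<phi> x)
           + (of_real (a\<^sup>2 / 2 * (norm x)\<^sup>2) * u x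
              + of_real lam1 * particle_density u x * u x
              + of_real lam2 * dipolar_conv (particle_density u) x * u x
              + of_real \<mu> * u x) * of_real (\<phi> x)) = 0)"

end

theory Submission
  imports Defs "HOL-Probability.Characteristic_Functions" "HOL-Complex_Analysis.Great_Picard" "HOL-Library.Diagonal_Subsequence"
begin

text \<open>
  Write \<open>A = \<parallel>\<nabla>u\<parallel>\<^sup>2\<close>, \<open>D = \<parallel>|x|u\<parallel>\<^sup>2\<close>
      and \<open>N\<close> for \<open>\<lambda>\<^sub>1 \<parallel>u\<parallel>\<^sup>4 + \<lambda>\<^sub>2 \<integral>(K \<star> |u|\<^sup>2)|u|\<^sup>2\<close>, so that
  \<open>2 E = A + a\<^sup>2 D + N\<close>. Testing the equation with \<open>u\<close> gives \<open>- 2 \<mu> c = A + a\<^sup>2 D + 2 N\<close>, and the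
  Gagliardo-Nirenberg inequality makes \<open>|N| \<le> A / 4\<close> as soon as \<open>A\<close> is below a threshold that depends
  only on \<open>c\<close>; so it suffices that ground states have small \<open>A\<close>. The virial identity
  \<open>A - a\<^sup>2 D + 3 N / 2 = 0\<close> turns the energy of every critical point into \<open>E = A / 6 + 5 a\<^sup>2 D / 6\<close>, hence
  critical points of small energy have small \<open>A\<close>. Critical points of small energy exist: the energy
  is almost convex where \<open>A\<close> is below the threshold, a minimiser over that region exists by
  compactness, and by comparison with a dilated profile its energy is \<open>O(a)\<close>, which keeps it
  in the interior.

  A critical point need not be regular enough to be differentiated along the mass-preserving
  dilations \<open>u\<^sub>t\<close>. The virial identity is obtained instead from the one-sided estimate
  \<open>E(u\<^sub>t) - E(u) \<ge> E'(u)(u\<^sub>t - u) - C \<parallel>u\<^sub>t - u\<parallel>\<^sup>2\<close>, whose right-hand side is \<open>o(t - 1)\<close> because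
  \<open>\<langle>u\<^sub>t, u\<rangle>\<close> is differentiable and maximal at \<open>t = 1\<close>.
\<close>

subsection \<open>The space of square-integrable functions\<close>

text \<open>The trap makes bounded sets precompact in L2, and a midpoint argument of parallelogram
  type bounds the energy norm of the difference of two almost minimisers by their energy defect plus
  terms that vanish with their L2 distance. Minimising sequences are therefore Cauchy in the energy
  norm, up to a subsequence.

  One critical point of small energy controls all ground states at once, since these have the least
  energy among critical points. The strict sign of the multiplier comes from the moment term, which
  is positive for a nonzero function.

  Weak derivatives and the multiplier are given by choices, so facts are proved for arbitrary
  representatives; that the multiplier has an image at all rests on Plancherel and on surjectivity
  of the transform. Weak differentiability is exploited without regularising \<open>u\<close>: the
  fundamental theorem of calculus is applied to test functions along translations or dilations and
  transferred to \<open>u\<close> by duality.\<close>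

definition l2n :: "(real ^ 3 \<Rightarrow> complex) \<Rightarrow> real" where
  "l2n f = sqrt (LINT x|lborel. (norm (f x))\<^sup>2)"

text \<open>The real part makes this the inner product of a real Hilbert space, the structure in
  which the energy is differentiated; it is symmetric, and bilinear over the reals.\<close>

definition ip :: "(real ^ 3 \<Rightarrow> complex) \<Rightarrow> (real ^ 3 \<Rightarrow> complex) \<Rightarrow> real" where
  "ip f g = Re (LINT x|lborel. f x * cnj (g x))"

lemma L2_meas: "f \<in> L2 \<Longrightarrow> f \<in> borel_measurable borel"
  by (simp add: L2_def)

lemma L2_int: "f \<in> L2 \<Longrightarrow> integrable lborel (\<lambda>x. (norm (f x))\<^sup>2)"
  by (simp add: L2_def)

lemma L2I:
  assumes [measurable]: "f \<in> borel_measurable borel" and "integrable lborel (\<lambda>x. (norm (f x))\<^sup>2)"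
  shows "f \<in> L2"
  using assms by (simp add: L2_def)

lemma L2_bound:
  assumes f[measurable]: "f \<in> borel_measurable borel" and g: "integrable lborel g"
    and b: "\<And>x. (norm (f x))\<^sup>2 \<le> g x"
  shows "f \<in> L2"
proof (rule L2I[OF f])
  show "integrable lborel (\<lambda>x. (norm (f x))\<^sup>2)"
    by (rule Bochner_Integration.integrable_bound[OF g]) (use b in \<open>auto intro: order_trans[OF b] simp: abs_of_nonneg order_trans[OF zero_le_power2 b]\<close>)
qed

lemma L2_mult_integrable:
  assumes f: "f \<in> L2" and g: "g \<in> L2"
  shows "integrable lborel (\<lambda>x. f x * g x)"
proof -
  note [measurable] = L2_meas[OF f] L2_meas[OF g]
  show ?thesis
  proof (rule Bochner_Integration.integrable_bound)
    show "integrable lborel (\<lambda>x. (norm (f x))\<^sup>2 + (norm (g x))\<^sup>2)"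
      using L2_int[OF f] L2_int[OF g] by simp
    have "a * b \<le> a\<^sup>2 + b\<^sup>2" if "a \<ge> 0" "b \<ge> 0" for a b :: real
      using sum_squares_bound[of a b] that mult_nonneg_nonneg[OF that] by linarith
    then show "AE x in lborel. norm (f x * g x) \<le> norm ((norm (f x))\<^sup>2 + (norm (g x))\<^sup>2)"
      by (intro AE_I2) (simp add: norm_mult)
  qed measurable
qed

lemma L2_cnj: "f \<in> L2 \<Longrightarrow> (\<lambda>x. cnj (f x)) \<in> L2"
  using L2_meas[of f] L2_int[of f] by (intro L2I) (auto intro: borel_measurable_continuous_on[where f=cnj] simp: continuous_on_cnj)

lemma ip_integrable: "f \<in> L2 \<Longrightarrow> g \<in> L2 \<Longrightarrow> integrable lborel (\<lambda>x. f x * cnj (g x))"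
  by (intro L2_mult_integrable L2_cnj)

lemma L2_add: assumes f: "f \<in> L2" and g: "g \<in> L2" shows "(\<lambda>x. f x + g x) \<in> L2"
proof -
  note [measurable] = L2_meas[OF f] L2_meas[OF g]
  show ?thesis
  proof (rule L2_bound)
    show "integrable lborel (\<lambda>x. 2 * (norm (f x))\<^sup>2 + 2 * (norm (g x))\<^sup>2)"
      using L2_int[OF f] L2_int[OF g] by simp
    fix x
    have "(norm (f x + g x))\<^sup>2 \<le> (norm (f x) + norm (g x))\<^sup>2"
      by (intro power_mono norm_triangle_ineq) auto
    also have "\<dots> \<le> 2 * (norm (f x))\<^sup>2 + 2 * (norm (g x))\<^sup>2"
      using sum_squares_bound[of "norm (f x)" "norm (g x)"] by (simp add: power2_sum)
    finally show "(norm (f x + g x))\<^sup>2 \<le> 2 * (norm (f x))\<^sup>2 + 2 * (norm (g x))\<^sup>2" .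
  qed measurable
qed

lemma L2_mult_bounded:
  assumes f: "f \<in> L2" and m[measurable]: "m \<in> borel_measurable borel" and b: "\<And>x. norm (m x) \<le> B"
  shows "(\<lambda>x. m x * f x) \<in> L2" "l2n (\<lambda>x. m x * f x) \<le> B * l2n f"
proof -
  note [measurable] = L2_meas[OF f]
  have B: "B \<ge> 0" using norm_ge_zero[of "m undefined"] b[of undefined] by linarith
  have le: "(norm (m x * f x))\<^sup>2 \<le> B\<^sup>2 * (norm (f x))\<^sup>2" for x
    unfolding norm_mult power_mult_distrib by (intro mult_right_mono power_mono b) auto
  have i: "integrable lborel (\<lambda>x. B\<^sup>2 * (norm (f x))\<^sup>2)" using L2_int[OF f] by simp
  show L: "(\<lambda>x. m x * f x) \<in> L2"
    by (rule L2_bound[OF _ i le]) measurable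
  have "(LINT x|lborel. (norm (m x * f x))\<^sup>2) \<le> (LINT x|lborel. B\<^sup>2 * (norm (f x))\<^sup>2)"
    by (intro integral_mono L2_int[OF L] i le)
  also have "\<dots> = B\<^sup>2 * (LINT x|lborel. (norm (f x))\<^sup>2)" by simp
  finally have "sqrt (LINT x|lborel. (norm (m x * f x))\<^sup>2) \<le> sqrt (B\<^sup>2 * (LINT x|lborel. (norm (f x))\<^sup>2))"
    by (rule real_sqrt_le_mono)
  then show "l2n (\<lambda>x. m x * f x) \<le> B * l2n f"
    using B by (simp add: l2n_def real_sqrt_mult)
qed

lemma L2_scale: "f \<in> L2 \<Longrightarrow> (\<lambda>x. c * f x) \<in> L2"
  by (rule L2_mult_bounded(1)[where B="norm c"]) auto

lemma L2_uminus: "f \<in> L2 \<Longrightarrow> (\<lambda>x. - f x) \<in> L2"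
  using L2_scale[of f "-1"] by simp

lemma L2_diff: "f \<in> L2 \<Longrightarrow> g \<in> L2 \<Longrightarrow> (\<lambda>x. f x - g x) \<in> L2"
  using L2_add[of f "\<lambda>x. - g x"] L2_uminus[of g] by simp

lemma L2_zero: "(\<lambda>x. 0) \<in> L2" by (simp add: L2_def)

lemma l2n_nonneg[simp]: "0 \<le> l2n f" by (simp add: l2n_def)

lemma l2n_sq: "(l2n f)\<^sup>2 = (LINT x|lborel. (norm (f x))\<^sup>2)" by (simp add: l2n_def)

lemma mass_l2n: "mass u = (l2n u)\<^sup>2" by (simp add: l2n_sq mass_def)

lemma nn_l2n: "f \<in> L2 \<Longrightarrow> (\<integral>\<^sup>+x. ennreal ((norm (f x))\<^sup>2) \<partial>lborel) = ennreal ((l2n f)\<^sup>2)"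
  by (simp add: l2n_sq nn_integral_eq_integral L2_int)

text \<open>Membership and norm bound come together from one extended nonnegative integral, so no
  integrability has to be known in advance.\<close>

lemma L2_nnI:
  assumes [measurable]: "f \<in> borel_measurable borel"
    and "(\<integral>\<^sup>+x. ennreal ((norm (f x))\<^sup>2) \<partial>lborel) \<le> ennreal (B\<^sup>2)" "B \<ge> 0"
  shows "f \<in> L2" "l2n f \<le> B"
proof -
  have "(\<integral>\<^sup>+x. ennreal (norm ((norm (f x))\<^sup>2)) \<partial>lborel) < \<infinity>"
    using assms(2) by (auto simp: less_top[symmetric] top_unique)
  then show L: "f \<in> L2" by (intro L2I integrableI_bounded) auto
  show "l2n f \<le> B" using assms(2,3) unfolding nn_l2n[OF L] 
    by (simp add: abs_le_square_iff[symmetric])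
qed

lemma ip_sym: "ip f g = ip g f"
proof -
  have "cnj (LINT x|lborel. f x * cnj (g x)) = (LINT x|lborel. cnj (f x * cnj (g x)))"
    by (subst Bochner_Integration.integral_cnj) simp
  also have "\<dots> = (LINT x|lborel. g x * cnj (f x))" by (simp add: mult.commute)
  finally have "Re (cnj (LINT x|lborel. f x * cnj (g x))) = Re (LINT x|lborel. g x * cnj (f x))" by (rule arg_cong)
  then show ?thesis unfolding ip_def by simp
qed

lemma ip_add_left: "f \<in> L2 \<Longrightarrow> g \<in> L2 \<Longrightarrow> h \<in> L2 \<Longrightarrow> ip (\<lambda>x. f x + g x) h = ip f h + ip g h"
  unfolding ip_def by (simp add: distrib_right ip_integrable)

lemma ip_add_right: "f \<in> L2 \<Longrightarrow> g \<in> L2 \<Longrightarrow> h \<in> L2 \<Longrightarrow> ip h (\<lambda>x. f x + g x) = ip h f + ip h g"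
  using ip_add_left[of f g h] by (simp add: ip_sym)

lemma ip_scale_left: "ip (\<lambda>x. of_real r * f x) g = r * ip f g"
proof -
  have "(LINT x|lborel. of_real r * f x * cnj (g x)) = of_real r * (LINT x|lborel. f x * cnj (g x))"
    by (simp add: mult.assoc)
  then show ?thesis by (simp add: ip_def)
qed

lemma ip_scale_right: "ip g (\<lambda>x. of_real r * f x) = r * ip g f"
  using ip_scale_left[of r f g] by (simp add: ip_sym)

lemma ip_uminus_right: "ip g (\<lambda>x. - f x) = - ip g f"
  using ip_scale_right[of g "-1" f] by simp

lemma ip_diff_right: "f \<in> L2 \<Longrightarrow> g \<in> L2 \<Longrightarrow> h \<in> L2 \<Longrightarrow> ip h (\<lambda>x. f x - g x) = ip h f - ip h g"
  using ip_add_right[of f "\<lambda>x. - g x" h] L2_uminus[of g] by (simp add: ip_uminus_right)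

lemma ip_diff_left: "f \<in> L2 \<Longrightarrow> g \<in> L2 \<Longrightarrow> h \<in> L2 \<Longrightarrow> ip (\<lambda>x. f x - g x) h = ip f h - ip g h"
  using ip_diff_right[of f g h] by (simp add: ip_sym)

lemma ip_self: "ip f f = (l2n f)\<^sup>2"
proof -
  have "(LINT x|lborel. f x * cnj (f x)) = (LINT x|lborel. complex_of_real ((norm (f x))\<^sup>2))"
    by (simp add: complex_norm_square[symmetric] del: of_real_power)
  then show ?thesis by (simp add: ip_def l2n_sq del: of_real_power)
qed

lemma l2n_add_sq: "f \<in> L2 \<Longrightarrow> g \<in> L2 \<Longrightarrow> (l2n (\<lambda>x. f x + g x))\<^sup>2 = (l2n f)\<^sup>2 + 2 * ip f g + (l2n g)\<^sup>2"
  using ip_sym[of f g] by (simp add: ip_self[symmetric] ip_add_left ip_add_right L2_add)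

lemma l2n_diff_sq: "f \<in> L2 \<Longrightarrow> g \<in> L2 \<Longrightarrow> (l2n (\<lambda>x. f x - g x))\<^sup>2 = (l2n f)\<^sup>2 - 2 * ip f g + (l2n g)\<^sup>2"
  using ip_sym[of f g] by (simp add: ip_self[symmetric] ip_diff_left ip_diff_right L2_diff)

lemma l2n_scale: "l2n (\<lambda>x. c * f x) = norm c * l2n f"
  by (simp add: l2n_def norm_mult power_mult_distrib real_sqrt_mult)

lemma l2n_uminus: "l2n (\<lambda>x. - f x) = l2n f" by (simp add: l2n_def)

lemma l2n_diff_sym: "l2n (\<lambda>x. f x - g x) = l2n (\<lambda>x. g x - f x)"
  by (simp add: l2n_def norm_minus_commute)

lemma nn_mult_le:
  assumes f: "f \<in> L2" and g: "g \<in> L2"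
  shows "(LINT x|lborel. norm (f x * g x)) \<le> l2n f * l2n g"
proof -
  note [measurable] = L2_meas[OF f] L2_meas[OF g]
  have "(\<integral>\<^sup>+x. ennreal (norm (f x)) * ennreal (norm (g x)) \<partial>lborel)\<^sup>2 \<le>
     (\<integral>\<^sup>+x. (ennreal (norm (f x)))\<^sup>2 \<partial>lborel) * (\<integral>\<^sup>+x. (ennreal (norm (g x)))\<^sup>2 \<partial>lborel)"
    by (rule Cauchy_Schwarz_nn_integral) auto
  also have "\<dots> = ennreal ((l2n f)\<^sup>2) * ennreal ((l2n g)\<^sup>2)"
    by (simp add: nn_l2n[OF f, symmetric] nn_l2n[OF g, symmetric] ennreal_power)
  also have "\<dots> = ennreal ((l2n f * l2n g)\<^sup>2)" by (simp add: ennreal_mult power_mult_distrib)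
  also have "(\<integral>\<^sup>+x. ennreal (norm (f x)) * ennreal (norm (g x)) \<partial>lborel) = ennreal (LINT x|lborel. norm (f x * g x))"
    by (subst nn_integral_eq_integral[symmetric]) (auto simp: norm_mult ennreal_mult intro!: integrable_norm[OF L2_mult_integrable[OF f g], simplified norm_mult])
  finally have "(LINT x|lborel. norm (f x * g x))\<^sup>2 \<le> (l2n f * l2n g)\<^sup>2"
    by (simp add: ennreal_power integral_nonneg)
  then show ?thesis by (rule power2_le_imp_le) simp
qed

lemma norm_int_mult_le:
  assumes f: "f \<in> L2" and g: "g \<in> L2"
  shows "norm (LINT x|lborel. f x * g x) \<le> l2n f * l2n g"
  using nn_mult_le[OF f g] integral_norm_bound[of lborel "\<lambda>x. f x * g x"] by linarith

lemma l2n_cnj: "l2n (\<lambda>x. cnj (f x)) = l2n f" by (simp add: l2n_def)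

lemma ip_le: assumes f: "f \<in> L2" and g: "g \<in> L2" shows "\<bar>ip f g\<bar> \<le> l2n f * l2n g"
  using norm_int_mult_le[OF f L2_cnj[OF g]] abs_Re_le_cmod[of "LINT x|lborel. f x * cnj (g x)"]
  by (simp add: ip_def l2n_cnj)

lemma l2n_triangle: assumes f: "f \<in> L2" and g: "g \<in> L2" shows "l2n (\<lambda>x. f x + g x) \<le> l2n f + l2n g"
proof (rule power2_le_imp_le)
  show "(l2n (\<lambda>x. f x + g x))\<^sup>2 \<le> (l2n f + l2n g)\<^sup>2"
    using ip_le[OF f g] by (simp add: l2n_add_sq[OF f g] power2_sum)
qed simp

lemma l2n_triangle_diff: assumes f: "f \<in> L2" and g: "g \<in> L2" shows "l2n (\<lambda>x. f x - g x) \<le> l2n f + l2n g"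
  using l2n_triangle[OF f L2_uminus[OF g]] by (simp add: l2n_uminus)

lemma l2n_dist_triangle: assumes f: "f \<in> L2" and g: "g \<in> L2" and h: "h \<in> L2"
  shows "l2n (\<lambda>x. f x - h x) \<le> l2n (\<lambda>x. f x - g x) + l2n (\<lambda>x. g x - h x)"
  using l2n_triangle[OF L2_diff[OF f g] L2_diff[OF g h]] by simp

lemma l2n_abs_diff: assumes f: "f \<in> L2" and g: "g \<in> L2" shows "\<bar>l2n f - l2n g\<bar> \<le> l2n (\<lambda>x. f x - g x)"
  using l2n_triangle[OF L2_diff[OF f g] g] l2n_triangle[OF L2_diff[OF g f] f] l2n_diff_sym[of f g] by simp

lemma l2n_zero_AE: assumes f: "f \<in> L2" and "l2n f = 0" shows "AE x in lborel. f x = 0"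
proof -
  have "(LINT x|lborel. (norm (f x))\<^sup>2) = 0" using assms(2) by (simp add: l2n_def)
  then have "AE x in lborel. (norm (f x))\<^sup>2 = 0"
    using integral_nonneg_eq_0_iff_AE[OF L2_int[OF f]] by auto
  then show ?thesis by auto
qed

lemma L2_AE:
  assumes f: "f \<in> L2" and [measurable]: "g \<in> borel_measurable borel" and ae: "AE x in lborel. f x = g x"
  shows "g \<in> L2"
proof (rule L2I)
  note [measurable] = L2_meas[OF f]
  show "integrable lborel (\<lambda>x. (norm (g x))\<^sup>2)"
    by (rule integrable_cong_AE_imp[OF L2_int[OF f]]) (use ae in auto)
qed simp

lemma l2n_AE:
  assumes [measurable]: "f \<in> borel_measurable borel" "g \<in> borel_measurable borel" and ae: "AE x in lborel. f x = g x"
  shows "l2n f = l2n g"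
proof -
  have "(LINT x|lborel. (norm (f x))\<^sup>2) = (LINT x|lborel. (norm (g x))\<^sup>2)"
    by (rule integral_cong_AE) (use ae in auto)
  then show ?thesis by (simp add: l2n_def)
qed

text \<open>An eventual bound on the norms is enough; this is what lets limits of subsequences
  inherit membership in \<open>L2\<close>.\<close>

lemma L2_Fatou:
  assumes u: "\<And>n. u n \<in> L2" and [measurable]: "f \<in> borel_measurable borel"
    and ae: "AE x in lborel. (\<lambda>n. u n x) \<longlonglongrightarrow> f x"
    and b: "\<forall>\<^sub>F n in sequentially. l2n (u n) \<le> B" and B: "B \<ge> 0"
  shows "f \<in> L2" "l2n f \<le> B"
proof -
  note [measurable] = L2_meas[OF u]
  have "(\<integral>\<^sup>+x. ennreal ((norm (f x))\<^sup>2) \<partial>lborel)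
      = (\<integral>\<^sup>+x. liminf (\<lambda>n. ennreal ((norm (u n x))\<^sup>2)) \<partial>lborel)"
  proof (rule nn_integral_cong_AE)
    show "AE x in lborel. ennreal ((norm (f x))\<^sup>2) = liminf (\<lambda>n. ennreal ((norm (u n x))\<^sup>2))"
      using ae
    proof eventually_elim
      case (elim x)
      then have "(\<lambda>n. ennreal ((norm (u n x))\<^sup>2)) \<longlonglongrightarrow> ennreal ((norm (f x))\<^sup>2)"
        by (intro tendsto_ennrealI tendsto_intros)
      then show ?case by (intro lim_imp_Liminf[symmetric]) auto
    qed
  qed
  also have "\<dots> \<le> liminf (\<lambda>n. \<integral>\<^sup>+x. ennreal ((norm (u n x))\<^sup>2) \<partial>lborel)"
    by (rule nn_integral_liminf) auto
  also have "\<dots> = liminf (\<lambda>n. ennreal ((l2n (u n))\<^sup>2))" by (simp add: nn_l2n[OF u])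
  also have "\<dots> \<le> limsup (\<lambda>n. ennreal ((l2n (u n))\<^sup>2))" by (rule Liminf_le_Limsup) auto
  also have "\<dots> \<le> ennreal (B\<^sup>2)"
    by (rule Limsup_bounded) (use b in \<open>auto elim!: eventually_mono intro!: ennreal_leI power_mono\<close>)
  finally show "f \<in> L2" "l2n f \<le> B" using L2_nnI[of f B] B by auto
qed

text \<open>Along a subsequence with increments \<open>d n\<close> of norm at most
  \<open>(1/2)^n\<close>, the weights \<open>2^n\<close> still leave a summable series of squared
  norms. Hence almost everywhere \<open>2^n * |d n x|^2\<close> tends to 0, so the increments decay
  geometrically. The subsequence is part of the conclusion because weighted functions are later
  treated by Fatou along it.\<close>

lemma L2_complete:
  assumes u: "\<And>n. u n \<in> L2"
    and C: "\<And>e. e > 0 \<Longrightarrow> \<exists>N. \<forall>m\<ge>N. \<forall>n\<ge>N. l2n (\<lambda>x. u m x - u n x) \<le> e"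
  shows "\<exists>f\<in>L2. \<exists>r. strict_mono (r::nat\<Rightarrow>nat) \<and> (\<lambda>n. l2n (\<lambda>x. u n x - f x)) \<longlonglongrightarrow> 0 \<and>
     (AE x in lborel. (\<lambda>n. u (r n) x) \<longlonglongrightarrow> f x)"
proof -
  note [measurable] = L2_meas[OF u]
  have "\<exists>r::nat\<Rightarrow>nat. \<forall>n. (\<forall>m\<ge>r n. \<forall>k\<ge>r n. l2n (\<lambda>x. u m x - u k x) \<le> (1/2)^n) \<and> r n < r (Suc n)"
  proof (rule dependent_nat_choice)
    show "\<exists>x. \<forall>m\<ge>x. \<forall>k\<ge>x. l2n (\<lambda>xa. u m xa - u k xa) \<le> (1 / 2) ^ 0" using C[of 1] by auto
    fix x :: nat and n :: nat
    obtain N where N: "\<forall>m\<ge>N. \<forall>k\<ge>N. l2n (\<lambda>xa. u m xa - u k xa) \<le> (1 / 2) ^ Suc n" using C[of "(1/2)^Suc n"] by auto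
    show "\<exists>y. (\<forall>m\<ge>y. \<forall>k\<ge>y. l2n (\<lambda>x. u m x - u k x) \<le> (1 / 2) ^ Suc n) \<and> x < y"
      by (rule exI[of _ "max N (Suc x)"]) (use N in auto)
  qed
  then obtain r where r: "\<And>n m k. m \<ge> r n \<Longrightarrow> k \<ge> r n \<Longrightarrow> l2n (\<lambda>x. u m x - u k x) \<le> (1/2)^n"
    and rs: "\<And>n. r n < r (Suc n)" by auto
  have sm: "strict_mono r" using rs by (simp add: strict_mono_Suc_iff)
  define d where "d n x = u (r (Suc n)) x - u (r n) x" for n x
  have dL: "d n \<in> L2" for n unfolding d_def by (intro L2_diff u)
  note [measurable] = L2_meas[OF dL]
  have dn: "l2n (d n) \<le> (1/2)^n" for n unfolding d_def by (rule r) (use rs[of n] in auto)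
  have "(\<integral>\<^sup>+x. (\<Sum>n. ennreal (2^n * (norm (d n x))\<^sup>2)) \<partial>lborel)
      = (\<Sum>n. \<integral>\<^sup>+x. ennreal (2^n * (norm (d n x))\<^sup>2) \<partial>lborel)"
    by (rule nn_integral_suminf) auto
  also have "\<dots> = (\<Sum>n. ennreal (2^n * (l2n (d n))\<^sup>2))"
    by (simp add: ennreal_mult nn_integral_cmult nn_l2n[OF dL])
  also have "\<dots> \<le> (\<Sum>n. ennreal ((1/2)^n))"
  proof (rule suminf_le)
    fix n
    have "(l2n (d n))\<^sup>2 \<le> ((1/2)^n)\<^sup>2" by (intro power_mono dn) auto
    then have "2^n * (l2n (d n))\<^sup>2 \<le> 2^n * ((1/2)^n)\<^sup>2" by simp
    also have "\<dots> = (1/2)^n" by (simp add: power2_eq_square power_divide)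
    finally show "ennreal (2^n * (l2n (d n))\<^sup>2) \<le> ennreal ((1/2)^n)" by (rule ennreal_leI)
  qed auto
  also have "\<dots> = ennreal (\<Sum>n. (1/2)^n)" by (rule suminf_ennreal2) (auto intro: summable_geometric)
  finally have "(\<integral>\<^sup>+x. (\<Sum>n. ennreal (2^n * (norm (d n x))\<^sup>2)) \<partial>lborel) \<noteq> \<infinity>"
    by (auto simp: top_unique)
  then have "AE x in lborel. (\<Sum>n. ennreal (2^n * (norm (d n x))\<^sup>2)) \<noteq> \<infinity>"
    by (intro nn_integral_PInf_AE) auto
  then have conv: "AE x in lborel. convergent (\<lambda>n. u (r n) x)"
  proof eventually_elim
    case (elim x)
    then have "summable (\<lambda>n. 2^n * (norm (d n x))\<^sup>2)"
      by (intro summable_suminf_not_top) auto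
    then have "(\<lambda>n. 2^n * (norm (d n x))\<^sup>2) \<longlonglongrightarrow> 0" by (rule summable_LIMSEQ_zero)
    then have "\<forall>\<^sub>F n in sequentially. 2^n * (norm (d n x))\<^sup>2 < 1"
      by (rule order_tendstoD) simp
    then have ev: "\<forall>\<^sub>F n in sequentially. norm (d n x) \<le> (1 / sqrt 2) ^ n"
    proof eventually_elim
      case (elim n)
      have "(norm (d n x))\<^sup>2 \<le> (1/2)^n" using elim by (simp add: field_simps power_divide)
      also have "(1/2::real)^n = ((1 / sqrt 2) ^ n)\<^sup>2"
        by (simp add: power_divide power_mult[symmetric] mult.commute[of n] power_mult)
      finally show ?case by (rule power2_le_imp_le) simp
    qed
    have "summable (\<lambda>n. (1 / sqrt 2) ^ n)" by (rule summable_geometric) simp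
    then have "summable (\<lambda>n. d n x)" using summable_comparison_test_ev[OF ev] by simp
    then have "convergent (\<lambda>n. \<Sum>i<n. d i x)" by (simp add: summable_iff_convergent)
    moreover have "(\<Sum>i<n. d i x) = u (r n) x - u (r 0) x" for n
      unfolding d_def by (rule sum_lessThan_telescope)
    ultimately have "convergent (\<lambda>n. (u (r n) x - u (r 0) x) + u (r 0) x)" by (intro convergent_add) (auto simp: convergent_const)
    then show ?case by simp
  qed
  define f where "f x = lim (\<lambda>n. u (r n) x)" for x
  have fm[measurable]: "f \<in> borel_measurable borel" unfolding f_def by (rule borel_measurable_lim_metric) auto
  have lim: "AE x in lborel. (\<lambda>n. u (r n) x) \<longlonglongrightarrow> f x"
    using conv by eventually_elim (simp add: f_def convergent_LIMSEQ_iff)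
  have key: "(\<lambda>x. f x - u n x) \<in> L2 \<and> l2n (\<lambda>x. f x - u n x) \<le> e"
    if N: "\<forall>m\<ge>N. \<forall>n\<ge>N. l2n (\<lambda>x. u m x - u n x) \<le> e" and "n \<ge> N" "e > 0" for n N e
  proof -
    have ae: "AE x in lborel. (\<lambda>k. u (r k) x - u n x) \<longlonglongrightarrow> f x - u n x"
      using lim by eventually_elim (intro tendsto_intros)
    have "\<forall>\<^sub>F k in sequentially. r k \<ge> N"
      using filterlim_subseq[OF sm] by (simp add: filterlim_at_top)
    then have ev: "\<forall>\<^sub>F k in sequentially. l2n (\<lambda>x. u (r k) x - u n x) \<le> e"
      by eventually_elim (use N that in auto)
    show ?thesis
      using L2_Fatou[of "\<lambda>k x. u (r k) x - u n x", OF _ _ ae ev] u L2_diff \<open>e > 0\<close> by auto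
  qed
  obtain N where N: "\<forall>m\<ge>N. \<forall>n\<ge>N. l2n (\<lambda>x. u m x - u n x) \<le> 1" using C[of 1] by auto
  have "(\<lambda>x. f x - u N x) \<in> L2" using key[OF N] by auto
  from L2_add[OF this u[of N]] have fL: "f \<in> L2" by simp
  have "(\<lambda>n. l2n (\<lambda>x. u n x - f x)) \<longlonglongrightarrow> 0"
  proof (rule LIMSEQ_I)
    fix e :: real assume "e > 0"
    then obtain N where N: "\<forall>m\<ge>N. \<forall>n\<ge>N. l2n (\<lambda>x. u m x - u n x) \<le> e/2" using C[of "e/2"] by auto
    have "l2n (\<lambda>x. u n x - f x) < e" if "n \<ge> N" for n
      using key[OF N that] \<open>e > 0\<close> l2n_diff_sym[of "u n" f] by auto
    then show "\<exists>no. \<forall>n\<ge>no. norm (l2n (\<lambda>x. u n x - f x) - 0) < e" by auto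
  qed
  then show ?thesis using fL sm lim by auto
qed

lemma L2_dominated:
  assumes u: "\<And>n. u n \<in> L2" and f[measurable]: "f \<in> borel_measurable borel" and g: "g \<in> L2"
    and lim: "AE x in lborel. (\<lambda>n. u n x) \<longlonglongrightarrow> f x"
    and b: "\<forall>\<^sub>F n in sequentially. \<forall>x. norm (u n x) \<le> norm (g x)"
  shows "f \<in> L2" "(\<lambda>n. l2n (\<lambda>x. u n x - f x)) \<longlonglongrightarrow> 0"
proof -
  note [measurable] = L2_meas[OF u] L2_meas[OF g]
  obtain N where N: "\<And>n x. n \<ge> N \<Longrightarrow> norm (u n x) \<le> norm (g x)" using b by (auto simp: eventually_sequentially)
  have "l2n (u n) \<le> l2n g" if "n \<ge> N" for n
    unfolding l2n_def by (intro real_sqrt_le_mono integral_mono L2_int u g power_mono N that) auto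
  then have ev: "\<forall>\<^sub>F n in sequentially. l2n (u n) \<le> l2n g" by (auto simp: eventually_sequentially)
  show fL: "f \<in> L2" by (rule L2_Fatou(1)[OF u f lim ev]) simp
  have fg: "AE x in lborel. norm (f x) \<le> norm (g x)"
    using lim
  proof eventually_elim
    case (elim x)
    show ?case by (rule LIMSEQ_le_const2[OF tendsto_norm[OF elim]]) (use N in auto)
  qed
  have "(\<lambda>n. LINT x|lborel. (norm (u (n + N) x - f x))\<^sup>2) \<longlonglongrightarrow> (LINT x|(lborel :: (real^3) measure). 0)"
  proof (rule integral_dominated_convergence[where w="\<lambda>x. 4 * (norm (g x))\<^sup>2"])
    show "integrable lborel (\<lambda>x. 4 * (norm (g x))\<^sup>2)" using L2_int[OF g] by simp
    show "AE x in lborel. (\<lambda>n. (norm (u (n + N) x - f x))\<^sup>2) \<longlonglongrightarrow> 0"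
      using lim
    proof eventually_elim
      case (elim x)
      from LIMSEQ_ignore_initial_segment[OF this, of N]
      have "(\<lambda>n. (norm (u (n + N) x - f x))\<^sup>2) \<longlonglongrightarrow> (norm (f x - f x))\<^sup>2" by (intro tendsto_intros)
      then show ?case by simp
    qed
    show "AE x in lborel. norm ((norm (u (n + N) x - f x))\<^sup>2) \<le> 4 * (norm (g x))\<^sup>2" for n
      using fg
    proof eventually_elim
      case (elim x)
      have "norm (u (n + N) x - f x) \<le> 2 * norm (g x)"
        using norm_triangle_ineq4[of "u (n + N) x" "f x"] N[of "n + N" x] elim by simp
      then have "(norm (u (n + N) x - f x))\<^sup>2 \<le> (2 * norm (g x))\<^sup>2" by (intro power_mono) auto
      then show ?case by (simp add: power_mult_distrib)
    qed
  qed measurable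
  then have "(\<lambda>n. LINT x|lborel. (norm (u n x - f x))\<^sup>2) \<longlonglongrightarrow> 0"
    by (simp add: LIMSEQ_offset)
  then show "(\<lambda>n. l2n (\<lambda>x. u n x - f x)) \<longlonglongrightarrow> 0"
    unfolding l2n_def using tendsto_real_sqrt by fastforce
qed

subsection \<open>Density of continuous functions with bounded support\<close>

definition Cc :: "(real ^ 3 \<Rightarrow> complex) set" where
  "Cc = {\<phi>. continuous_on UNIV \<phi> \<and> (\<exists>R. \<forall>x. norm x > R \<longrightarrow> \<phi> x = 0)}"

lemma Cc_bounded:
  assumes "\<phi> \<in> Cc" obtains R M where "R > 0" "M > 0" "\<And>x. norm (\<phi> x) \<le> M * indicator (cball 0 R) x"
proof -
  obtain R where R: "\<And>x. norm x > R \<Longrightarrow> \<phi> x = 0" and c: "continuous_on UNIV \<phi>" using assms by (auto simp: Cc_def)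
  have "compact (\<phi> ` cball 0 (max R 1))"
    by (intro compact_continuous_image continuous_on_subset[OF c]) auto
  then obtain M where M: "M > 0" "\<And>y. y \<in> \<phi> ` cball 0 (max R 1) \<Longrightarrow> norm y \<le> M"
    using compact_imp_bounded bounded_pos by metis
  show ?thesis
  proof (rule that[of "max R 1" M])
    fix x show "norm (\<phi> x) \<le> M * indicator (cball 0 (max R 1)) x"
    proof (cases "x \<in> cball 0 (max R 1)")
      case True then show ?thesis using M(2)[of "\<phi> x"] by simp
    next
      case False then have "norm x > R" by simp
      then show ?thesis using R False by simp
    qed
  qed (use M in auto)
qed

lemma L2_indicator:
  assumes [measurable]: "A \<in> sets borel" and "emeasure lborel A < \<infinity>"
  shows "(\<lambda>x. c * indicator A x :: complex) \<in> L2"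
proof (rule L2_scale, rule L2I)
  have "(\<lambda>x. (norm (indicator A x :: complex))\<^sup>2) = (indicator A :: _ \<Rightarrow> real)"
    by (auto simp: fun_eq_iff indicator_def)
  then show "integrable lborel (\<lambda>x. (norm (indicator A x :: complex))\<^sup>2)"
    using assms by (simp add: integrable_indicator_iff)
qed simp

lemma L2_indicator_cball: "(\<lambda>x. c * indicator (cball 0 R) x :: complex) \<in> L2"
  using emeasure_lborel_cball_finite[of "0::real^3" R] by (intro L2_indicator) auto

lemma Cc_L2: assumes "\<phi> \<in> Cc" shows "\<phi> \<in> L2"
proof -
  obtain R M where RM: "\<And>x. norm (\<phi> x) \<le> M * indicator (cball 0 R) x" "M > 0"
    by (rule Cc_bounded[OF assms]) auto
  have c: "continuous_on UNIV \<phi>" using assms by (auto simp: Cc_def)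
  have m: "\<phi> \<in> borel_measurable borel" by (rule borel_measurable_continuous_onI[OF c])
  show ?thesis
  proof (rule L2_bound[OF m])
    show "integrable lborel (\<lambda>x::real^3. (norm (of_real M * indicator (cball 0 R) x :: complex))\<^sup>2)"
      by (rule L2_int[OF L2_indicator_cball])
    show "(norm (\<phi> x))\<^sup>2 \<le> (norm (of_real M * indicator (cball 0 R) x :: complex))\<^sup>2" for x
      using RM(1)[of x] RM(2) by (intro power_mono) (auto simp: norm_mult indicator_def split: if_splits)
  qed
qed

definition Cc_approx :: "(real ^ 3 \<Rightarrow> complex) \<Rightarrow> bool" where
  "Cc_approx f \<longleftrightarrow> f \<in> L2 \<and> (\<forall>e>0. \<exists>\<phi>\<in>Cc. l2n (\<lambda>x. f x - \<phi> x) < e)"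

lemma Cc_approx_add:
  assumes "Cc_approx f" "Cc_approx g" shows "Cc_approx (\<lambda>x. f x + g x)"
  unfolding Cc_approx_def
proof (intro conjI allI impI)
  have L: "f \<in> L2" "g \<in> L2" using assms by (auto simp: Cc_approx_def)
  then show "(\<lambda>x. f x + g x) \<in> L2" by (rule L2_add)
  fix e :: real assume "e > 0"
  then obtain \<phi> \<psi> where p: "\<phi> \<in> Cc" "l2n (\<lambda>x. f x - \<phi> x) < e/2" "\<psi> \<in> Cc" "l2n (\<lambda>x. g x - \<psi> x) < e/2"
    using assms unfolding Cc_approx_def by (meson half_gt_zero)
  have "(\<lambda>x. \<phi> x + \<psi> x) \<in> Cc"
  proof -
    obtain R S where "\<And>x. norm x > R \<Longrightarrow> \<phi> x = 0" "\<And>x. norm x > S \<Longrightarrow> \<psi> x = 0" using p unfolding Cc_def by auto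
    then have "\<forall>x. norm x > max R S \<longrightarrow> \<phi> x + \<psi> x = 0" by auto
    then have "\<exists>R. \<forall>x. norm x > R \<longrightarrow> \<phi> x + \<psi> x = 0" by blast
    then show ?thesis using p unfolding Cc_def by (simp add: continuous_on_add)
  qed
  moreover have "l2n (\<lambda>x. f x + g x - (\<phi> x + \<psi> x)) < e"
    using l2n_triangle[OF L2_diff[OF L(1) Cc_L2[OF p(1)]] L2_diff[OF L(2) Cc_L2[OF p(3)]]] p
    by (simp add: algebra_simps)
  ultimately show "\<exists>\<phi>\<in>Cc. l2n (\<lambda>x. f x + g x - \<phi> x) < e" by (intro bexI[of _ "\<lambda>x. \<phi> x + \<psi> x"])
qed

lemma Cc_zero: "(\<lambda>x. 0) \<in> Cc" by (auto simp: Cc_def)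

lemma Cc_approx_sum: "finite I \<Longrightarrow> (\<And>i. i \<in> I \<Longrightarrow> Cc_approx (f i)) \<Longrightarrow> Cc_approx (\<lambda>x. \<Sum>i\<in>I. f i x)"
proof (induction I rule: finite_induct)
  case empty
  show ?case unfolding Cc_approx_def by (auto simp: L2_zero l2n_def intro!: bexI[OF _ Cc_zero])
next
  case (insert i I)
  then show ?case using Cc_approx_add[of "f i" "\<lambda>x. \<Sum>i\<in>I. f i x"] by simp
qed

lemma Cc_approx_limit:
  assumes "\<And>n. Cc_approx (u n)" "f \<in> L2" "(\<lambda>n. l2n (\<lambda>x. u n x - f x)) \<longlonglongrightarrow> 0"
  shows "Cc_approx f"
  unfolding Cc_approx_def
proof (intro conjI allI impI)
  show fL: "f \<in> L2" by fact
  fix e :: real assume "e > 0"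
  then obtain n where n: "l2n (\<lambda>x. u n x - f x) < e/2"
    using LIMSEQ_D[OF assms(3), of "e/2"] by auto
  obtain \<phi> where p: "\<phi> \<in> Cc" "l2n (\<lambda>x. u n x - \<phi> x) < e/2"
    using assms(1)[of n] \<open>e > 0\<close> unfolding Cc_approx_def by (meson half_gt_zero)
  have "l2n (\<lambda>x. f x - \<phi> x) \<le> l2n (\<lambda>x. f x - u n x) + l2n (\<lambda>x. u n x - \<phi> x)"
    using assms(1)[of n] by (intro l2n_dist_triangle fL Cc_L2[OF p(1)]) (simp add: Cc_approx_def)
  then show "\<exists>\<phi>\<in>Cc. l2n (\<lambda>x. f x - \<phi> x) < e" using n p l2n_diff_sym[of f "u n"] by (intro bexI[OF _ p(1)]) auto
qed

text \<open>An indicator lies between a closed set inside and an open set outside; an Urysohn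
  function for the two is continuous and differs from the indicator only on the thin gaps.
  Intersecting the open set with the ball bounds the support.\<close>

lemma Cc_approx_indicator:
  assumes A[measurable]: "A \<in> sets borel" and AR: "A \<subseteq> ball 0 R"
  shows "Cc_approx (\<lambda>x. c * indicator A x)"
  unfolding Cc_approx_def
proof (intro conjI allI impI)
  have fin: "emeasure lborel A < \<infinity>"
    using emeasure_mono[OF AR, of lborel] emeasure_lborel_ball_finite[of "0::real^3" R] by auto
  show L: "(\<lambda>x. c * indicator A x) \<in> L2" by (rule L2_indicator[OF A fin])
  fix e :: real assume "e > 0"
  \<comment> \<open>The two gaps have total measure below \<open>2 * d\<close>, so the squared error
    is at most half of \<open>(norm c * e / (norm c + 1))^2\<close>. The summand 1 covers
    \<open>c = 0\<close>.\<close>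
  define d where "d = (e / (norm c + 1))\<^sup>2 / 4"
  have c1: "norm c + 1 > 0" by (simp add: add_nonneg_pos)
  have "d > 0" using \<open>e > 0\<close> c1 by (simp add: d_def)
  have AL: "A \<in> sets lebesgue" using A by auto
  obtain S where S: "open S" "A \<subseteq> S" "(S - A) \<in> lmeasurable" "emeasure lebesgue (S - A) < ennreal d"
    by (rule sets_lebesgue_outer_open[OF AL \<open>d > 0\<close>])
  obtain T where T: "closed T" "T \<subseteq> A" "(A - T) \<in> lmeasurable" "emeasure lebesgue (A - T) < ennreal d"
    by (rule sets_lebesgue_inner_closed[OF AL \<open>d > 0\<close>])
  define S' where "S' = S \<inter> ball 0 R"
  have S': "open S'" "A \<subseteq> S'" using S AR by (auto simp: S'_def)
  obtain f :: "real^3 \<Rightarrow> real" where f: "continuous_on UNIV f" "\<And>x. f x \<in> closed_segment 1 0" "\<And>x. x \<in> T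
      \<Longrightarrow> f x = 1" "\<And>x. x \<in> - S' \<Longrightarrow> f x = 0"
    using Urysohn_local[of UNIV T "- S'" 1 0] T(1,2) S' by (auto simp: closed_Compl)
  have f01: "0 \<le> f x" "f x \<le> 1" for x using f(2)[of x] by (auto simp: closed_segment_eq_real_ivl)
  have [measurable]: "f \<in> borel_measurable borel" using f(1) by (rule borel_measurable_continuous_onI)
  have [measurable]: "S \<in> sets borel" "T \<in> sets borel" using S T by auto
  define \<phi> where "\<phi> x = c * of_real (f x)" for x
  have "\<phi> \<in> Cc"
    unfolding Cc_def \<phi>_def using f(1) f(4) by (auto intro!: continuous_intros exI[of _ R] simp: S'_def)
  moreover have "l2n (\<lambda>x. c * indicator A x - \<phi> x) < e"
  proof -
    have bd: "(norm (c * indicator A x - \<phi> x))\<^sup>2 \<le> (norm c)\<^sup>2 * indicator ((S - A) \<union> (A - T)) x" for x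
    proof -
      have "norm (indicator A x - complex_of_real (f x)) \<le> indicator ((S - A) \<union> (A - T)) x"
      proof -
        have "indicator A x - complex_of_real (f x) = of_real (indicator A x - f x)" by (simp add: indicator_def)
        moreover have "\<bar>indicator A x - f x\<bar> \<le> indicator ((S - A) \<union> (A - T)) x"
          using f01[of x] f(3)[of x] f(4)[of x] S' S(2) T(2) by (auto simp: indicator_def S'_def)
        ultimately show ?thesis by (simp only: norm_of_real)
      qed
      then have "(norm (indicator A x - complex_of_real (f x)))\<^sup>2 \<le> (indicator ((S - A) \<union> (A - T)) x)\<^sup>2" by (intro power_mono) auto
      moreover have "c * indicator A x - \<phi> x = c * (indicator A x - complex_of_real (f x))" by (simp add: \<phi>_def algebra_simps)
      ultimately have "(norm (c * indicator A x - \<phi> x))\<^sup>2 \<le> (norm c)\<^sup>2 * (indicator ((S - A) \<union> (A - T)) x)\<^sup>2"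
        by (simp only: norm_mult power_mult_distrib) (rule mult_left_mono, auto)
      moreover have "(indicator ((S - A) \<union> (A - T)) x :: real)\<^sup>2 = indicator ((S - A) \<union> (A - T)) x"
        by (cases "x \<in> (S - A) \<union> (A - T)") auto
      ultimately show ?thesis by (simp only:)
    qed
    have "(\<integral>\<^sup>+x. ennreal ((norm (c * indicator A x - \<phi> x))\<^sup>2) \<partial>lborel)
        \<le> (\<integral>\<^sup>+x. ennreal ((norm c)\<^sup>2) * indicator ((S - A) \<union> (A - T)) x \<partial>lborel)"
      by (rule nn_integral_mono) (use bd in \<open>auto simp: ennreal_mult'[symmetric] ennreal_indicator[symmetric] intro!: ennreal_leI simp del:
          ennreal_indicator\<close>)
    also have "\<dots> = ennreal ((norm c)\<^sup>2) * emeasure lborel ((S - A) \<union> (A - T))"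
      by (rule nn_integral_cmult_indicator) measurable
    also have "\<dots> \<le> ennreal ((norm c)\<^sup>2) * (ennreal d + ennreal d)"
    proof (rule mult_left_mono)
      have "emeasure lborel ((S - A) \<union> (A - T)) \<le> emeasure lborel (S - A) + emeasure lborel (A - T)"
        by (rule emeasure_subadditive) auto
      also have "\<dots> \<le> ennreal d + ennreal d"
        using S(4) T(4) by (intro add_mono) (auto simp: emeasure_completion)
      finally show "emeasure lborel ((S - A) \<union> (A - T)) \<le> ennreal d + ennreal d" .
    qed simp
    also have "\<dots> = ennreal ((norm c)\<^sup>2 * (2 * d))"
      using \<open>d > 0\<close> by (simp add: ennreal_mult' ennreal_plus[symmetric] del: ennreal_plus)
    also have "(norm c)\<^sup>2 * (2 * d) = (norm c * (e / (norm c + 1)))\<^sup>2 / 2" by (simp add: d_def power_mult_distrib power_divide)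
    also have "\<dots> = (norm c * (e / (norm c + 1)) / sqrt 2)\<^sup>2" by (simp add: power_divide power_mult_distrib)
    finally have "l2n (\<lambda>x. c * indicator A x - \<phi> x) \<le> norm c * (e / (norm c + 1)) / sqrt 2"
      using \<open>e > 0\<close> by (intro L2_nnI(2)) (auto simp: \<phi>_def)
    also have "\<dots> \<le> norm c * (e / (norm c + 1)) / 1"
      using \<open>e > 0\<close> c1 by (intro divide_left_mono) auto
    also have "\<dots> < e" using \<open>e > 0\<close> using c1 by (simp add: divide_less_eq field_simps)
    finally show ?thesis .
  qed
  ultimately show "\<exists>\<phi>\<in>Cc. l2n (\<lambda>x. c * indicator A x - \<phi> x) < e" by blast
qed

text \<open>Approximating simple functions are cut off to growing balls, so that each level set is
  bounded; domination by \<open>2 * f\<close> gives convergence in norm.\<close>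

theorem Cc_dense:
  assumes f: "f \<in> L2" shows "Cc_approx f"
proof -
  note [measurable] = L2_meas[OF f]
  have fm: "f \<in> borel_measurable (lborel)" by simp
  obtain F where F: "\<And>i. simple_function lborel (F i)" "\<And>x. (\<lambda>i. F i x) \<longlonglongrightarrow> f x" "\<And>i x. dist (F i x) 0
      \<le> 2 * dist (f x) 0"
    using borel_measurable_implies_sequence_metric[OF fm, of 0] by auto
  note [measurable] = borel_measurable_simple_function[OF F(1)]
  define u where "u i x = F i x * indicator (ball 0 (real i)) x" for i x
  have app: "Cc_approx (u i)" for i
  proof -
    have fin: "finite (range (F i))" using simple_functionD(1)[OF F(1)[of i]] by simp
    have "u i = (\<lambda>x. \<Sum>y\<in>range (F i). y * indicator ((F i -` {y}) \<inter> ball 0 (real i)) x)"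
    proof
      fix x
      have "(\<Sum>y\<in>range (F i). y * indicator ((F i -` {y}) \<inter> ball 0 (real i)) x) = (\<Sum>y\<in>range (F i). if y = F i x then u i x else 0)"
        by (intro sum.cong) (auto simp: u_def indicator_def)
      also have "\<dots> = u i x" using fin by (simp add: sum.delta')
      finally show "u i x = (\<Sum>y\<in>range (F i). y * indicator ((F i -` {y}) \<inter> ball 0 (real i)) x)" by simp
    qed
    moreover have "Cc_approx (\<lambda>x. \<Sum>y\<in>range (F i). y * indicator ((F i -` {y}) \<inter> ball 0 (real i)) x)"
    proof (intro Cc_approx_sum fin Cc_approx_indicator)
      fix y
      have "F i -` {y} \<inter> space lborel \<in> sets lborel" by (rule simple_functionD(2)[OF F(1)])
      then show "F i -` {y} \<inter> ball 0 (real i) \<in> sets borel" by auto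
    qed auto
    ultimately show ?thesis by simp
  qed
  have uL: "u i \<in> L2" for i using app by (simp add: Cc_approx_def)
  have "(\<lambda>n. l2n (\<lambda>x. u n x - f x)) \<longlonglongrightarrow> 0"
  proof (rule L2_dominated(2)[OF uL _ L2_scale[OF f, of 2]])
    show "AE x in lborel. (\<lambda>n. u n x) \<longlonglongrightarrow> f x"
    proof (intro AE_I2)
      fix x
      have "\<forall>\<^sub>F n in sequentially. F n x = u n x"
        unfolding u_def eventually_sequentially
        by (rule exI[of _ "nat \<lceil>norm x\<rceil> + 1"]) (auto simp: indicator_def, linarith)
      then show "(\<lambda>n. u n x) \<longlonglongrightarrow> f x" using F(2)[of x] by (rule Lim_transform_eventually[rotated])
    qed
    show "\<forall>\<^sub>F n in sequentially. \<forall>x. norm (u n x) \<le> norm (2 * f x)"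
      using F(3) by (auto simp: u_def norm_mult indicator_def)
  qed simp
  then show ?thesis by (rule Cc_approx_limit[OF app f])
qed

section \<open>Affine changes of variables and their strong continuity on L2\<close>

lemma integral_affine:
  fixes f :: "real ^ 3 \<Rightarrow> 'b::{banach, second_countable_topology}"
  assumes [measurable]: "f \<in> borel_measurable borel" and c: "c \<noteq> 0"
  shows "(LINT x|lborel. f (t + c *\<^sub>R x)) = (1 / \<bar>c\<bar>^3) *\<^sub>R (LINT x|lborel. f x)"
proof -
  have "(LINT x|lborel. f x) = (LINT x|density (distr lborel borel (\<lambda>x. t + c *\<^sub>R x)) (\<lambda>_. \<bar>c\<bar>^3). f x)"
    using lborel_affine[OF c, of t] by simp
  also have "\<dots> = (LINT x|distr lborel borel (\<lambda>x. t + c *\<^sub>R x). \<bar>c\<bar>^3 *\<^sub>R f x)"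
    by (subst integral_density) auto
  also have "\<dots> = \<bar>c\<bar>^3 *\<^sub>R (LINT x|lborel. f (t + c *\<^sub>R x))"
    by (subst integral_distr) auto
  finally show ?thesis using c by simp
qed

lemma integrable_affine:
  fixes f :: "real ^ 3 \<Rightarrow> 'b::{banach, second_countable_topology}"
  assumes f: "integrable lborel f" and c: "c \<noteq> 0"
  shows "integrable lborel (\<lambda>x. f (t + c *\<^sub>R x))"
proof -
  have [measurable]: "f \<in> borel_measurable borel" using f by (auto dest: borel_measurable_integrable)
  have "integrable (density (distr lborel borel (\<lambda>x. t + c *\<^sub>R x)) (\<lambda>_. \<bar>c\<bar>^3)) f"
    using lborel_affine[OF c, of t] f by simp
  then have "integrable (distr lborel borel (\<lambda>x. t + c *\<^sub>R x)) (\<lambda>x. \<bar>c\<bar>^3 *\<^sub>R f x)"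
    by (subst (asm) integrable_density) auto
  then have "integrable lborel (\<lambda>x. \<bar>c\<bar>^3 *\<^sub>R f (t + c *\<^sub>R x))"
    by (subst (asm) integrable_distr_eq) auto
  then have "integrable lborel (\<lambda>x. (1 / \<bar>c\<bar>^3) *\<^sub>R (\<bar>c\<bar>^3 *\<^sub>R f (t + c *\<^sub>R x)))"
    by (rule integrable_scaleR_right[rotated])
  then show ?thesis using c by simp
qed

lemma nn_integral_affine:
  assumes [measurable]: "f \<in> borel_measurable (borel :: (real^3) measure)" and c: "c \<noteq> 0"
  shows "(\<integral>\<^sup>+x. f (t + c *\<^sub>R x) \<partial>lborel) = ennreal (1 / \<bar>c\<bar>^3) * (\<integral>\<^sup>+x. f x \<partial>lborel)"
proof -
  have "(\<integral>\<^sup>+x. f x \<partial>lborel) = (\<integral>\<^sup>+x. f x \<partial>density (distr lborel borel (\<lambda>x. t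
      + c *\<^sub>R x)) (\<lambda>_. \<bar>c\<bar>^3))"
    using lborel_affine[OF c, of t] by simp
  also have "\<dots> = (\<integral>\<^sup>+x. ennreal (\<bar>c\<bar>^3) * f x \<partial>distr lborel borel (\<lambda>x. t + c *\<^sub>R x))"
    by (subst nn_integral_density) auto
  also have "\<dots> = ennreal (\<bar>c\<bar>^3) * (\<integral>\<^sup>+x. f (t + c *\<^sub>R x) \<partial>lborel)"
    by (subst nn_integral_distr) (auto simp: nn_integral_cmult)
  finally have "ennreal (1 / \<bar>c\<bar>^3) * (\<integral>\<^sup>+x. f x \<partial>lborel)
      = ennreal (1 / \<bar>c\<bar>^3) * ennreal (\<bar>c\<bar>^3) * (\<integral>\<^sup>+x. f (t + c *\<^sub>R x) \<partial>lborel)"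
    by (simp add: mult.assoc)
  also have "ennreal (1 / \<bar>c\<bar>^3) * ennreal (\<bar>c\<bar>^3) = 1" using c by (simp add: ennreal_mult'[symmetric])
  finally show ?thesis by simp
qed

lemma L2_affine:
  assumes f: "f \<in> L2" and c: "c \<noteq> 0"
  shows "(\<lambda>x. f (t + c *\<^sub>R x)) \<in> L2" "l2n (\<lambda>x. f (t + c *\<^sub>R x)) = sqrt (1 / \<bar>c\<bar>^3) * l2n f"
proof -
  note [measurable] = L2_meas[OF f]
  show "(\<lambda>x. f (t + c *\<^sub>R x)) \<in> L2"
    using integrable_affine[OF L2_int[OF f] c] by (intro L2I) auto
  show "l2n (\<lambda>x. f (t + c *\<^sub>R x)) = sqrt (1 / \<bar>c\<bar>^3) * l2n f"
    unfolding l2n_def using integral_affine[of "\<lambda>x. (norm (f x))\<^sup>2" c t] c by (simp add: real_sqrt_mult[symmetric])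
qed

text \<open>By density it suffices to treat a continuous function with bounded support, where
  dominated convergence applies. The transfer back costs at most a factor 2, because the affine
  substitutions have operator norm below 2 once \<open>s n\<close> is near 1.\<close>

lemma affine_continuity:
  assumes f: "f \<in> L2" and s: "s \<longlonglongrightarrow> (1::real)" and h: "h \<longlonglongrightarrow> (0::real^3)" and s0: "\<And>n. s n \<noteq> 0"
  shows "(\<lambda>n. l2n (\<lambda>x. f (h n + s n *\<^sub>R x) - f x)) \<longlonglongrightarrow> 0"
proof (rule LIMSEQ_I)
  fix e :: real assume "e > 0"
  obtain \<phi> where p: "\<phi> \<in> Cc" "l2n (\<lambda>x. f x - \<phi> x) < e/4"
    using Cc_dense[OF f] \<open>e > 0\<close> unfolding Cc_approx_def by (meson zero_less_divide_iff zero_less_numeral)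
  have pL: "\<phi> \<in> L2" by (rule Cc_L2[OF p(1)])
  note [measurable] = L2_meas[OF pL]
  have pc: "continuous_on UNIV \<phi>" using p(1) by (simp add: Cc_def)
  obtain R M where RM: "R > 0" "M > 0" "\<And>x. norm (\<phi> x) \<le> M * indicator (cball 0 R) x" using Cc_bounded[OF p(1)] by metis
  have es: "\<forall>\<^sub>F n in sequentially. s n > 1/2" by (rule order_tendstoD[OF s]) simp
  have eh: "\<forall>\<^sub>F n in sequentially. norm (h n) < 1" using order_tendstoD(2)[OF tendsto_norm_zero[OF h], of 1] by simp
  have lim: "(\<lambda>n. l2n (\<lambda>x. \<phi> (h n + s n *\<^sub>R x) - \<phi> x)) \<longlonglongrightarrow> 0"
  \<comment> \<open>The dominating ball has radius \<open>2 * (R + 1)\<close>: for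
    \<open>s n > 1/2\<close> and \<open>norm (h n) < 1\<close>, a point outside it is mapped outside
    the ball of radius \<open>R\<close>.\<close>
  proof (rule L2_dominated(2)[OF L2_affine(1)[OF pL s0] _ L2_indicator_cball[of "of_real M" "2 * (R + 1)"]])
    show "AE x in lborel. (\<lambda>n. \<phi> (h n + s n *\<^sub>R x)) \<longlonglongrightarrow> \<phi> x"
    proof (intro AE_I2)
      fix x
      have "(\<lambda>n. h n + s n *\<^sub>R x) \<longlonglongrightarrow> 0 + 1 *\<^sub>R x" by (intro tendsto_intros h s)
      then show "(\<lambda>n. \<phi> (h n + s n *\<^sub>R x)) \<longlonglongrightarrow> \<phi> x"
        using continuous_on_tendsto_compose[OF pc] by simp
    qed
    show "\<forall>\<^sub>F n in sequentially. \<forall>x. norm (\<phi> (h n + s n *\<^sub>R x)) \<le> norm (of_real M * indicator (cball 0 (2 * (R + 1))) x :: complex)"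
      using es eh
    proof eventually_elim
      case (elim n)
      show ?case
      proof
        fix x
        show "norm (\<phi> (h n + s n *\<^sub>R x)) \<le> norm (of_real M * indicator (cball 0 (2 * (R + 1))) x :: complex)"
        proof (cases "norm x \<le> 2 * (R + 1)")
          case True then show ?thesis using RM(2) order_trans[OF RM(3)[of "h n + s n *\<^sub>R x"], of M] by (auto simp: indicator_def norm_mult)
        next
          case False
          have "s n * norm x \<ge> (1/2) * norm x" using elim by (intro mult_right_mono) auto
          then have "norm (s n *\<^sub>R x) \<ge> (1/2) * norm x" using elim by simp
          moreover have "norm (h n + s n *\<^sub>R x) \<ge> norm (s n *\<^sub>R x) - norm (h n)" by (metis add.commute norm_diff_ineq)
          ultimately have "norm (h n + s n *\<^sub>R x) > R" using False elim by simp
          then show ?thesis using RM(3)[of "h n + s n *\<^sub>R x"] by (auto simp: indicator_def)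
        qed
      qed
    qed
  qed simp
  have "\<forall>\<^sub>F n in sequentially. l2n (\<lambda>x. \<phi> (h n + s n *\<^sub>R x) - \<phi> x) < e/4"
    by (rule order_tendstoD[OF lim]) (use \<open>e > 0\<close> in simp)
  moreover have "(\<lambda>n. sqrt (1 / \<bar>s n\<bar>^3)) \<longlonglongrightarrow> sqrt (1 / \<bar>1\<bar>^3)"
    by (intro tendsto_intros s) auto
  then have "\<forall>\<^sub>F n in sequentially. sqrt (1 / \<bar>s n\<bar>^3) < 2"
    by (rule order_tendstoD) simp
  ultimately have "\<forall>\<^sub>F n in sequentially. l2n (\<lambda>x. f (h n + s n *\<^sub>R x) - f x) < e"
  proof eventually_elim
    case (elim n)
    let ?T = "\<lambda>x. h n + s n *\<^sub>R x"
    have L: "(\<lambda>x. f (?T x)) \<in> L2" "(\<lambda>x. \<phi> (?T x)) \<in> L2" using L2_affine(1)[OF f s0] L2_affine(1)[OF pL s0] by auto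
    have "l2n (\<lambda>x. f (?T x) - f x) \<le> l2n (\<lambda>x. f (?T x) - \<phi> (?T x)) + (l2n (\<lambda>x. \<phi> (?T x) - \<phi> x)
        + l2n (\<lambda>x. \<phi> x - f x))"
      using l2n_dist_triangle[OF L(1) L(2) f] l2n_dist_triangle[OF L(2) pL f] by simp
    also have "l2n (\<lambda>x. f (?T x) - \<phi> (?T x)) = sqrt (1 / \<bar>s n\<bar>^3) * l2n (\<lambda>x. f x - \<phi> x)"
      using L2_affine(2)[OF L2_diff[OF f pL] s0] by simp
    also have "\<dots> \<le> 2 * l2n (\<lambda>x. f x - \<phi> x)" using elim by (intro mult_right_mono) auto
    finally show ?case using p(2) elim l2n_diff_sym[of \<phi> f] by simp
  qed
  then show "\<exists>no. \<forall>n\<ge>no. norm (l2n (\<lambda>x. f (h n + s n *\<^sub>R x) - f x) - 0) < e"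
    by (auto simp: eventually_sequentially)
qed

subsection \<open>The Fourier transform\<close>

definition v3 :: "real \<times> real \<times> real \<Rightarrow> real ^ 3" where
  "v3 p = fst p *\<^sub>R axis 1 1 + fst (snd p) *\<^sub>R axis 2 1 + snd (snd p) *\<^sub>R axis 3 1"

lemma v3_nth[simp]: "v3 (x, y, z) $ 1 = x" "v3 (x, y, z) $ 2 = y" "v3 (x, y, z) $ 3 = z"
  by (simp_all add: v3_def axis_def)

lemma v3_measurable[measurable]: "v3 \<in> borel_measurable borel"
  unfolding v3_def by (intro borel_measurable_continuous_onI continuous_intros)

lemma prod_Basis3: "(\<Prod>b\<in>(Basis :: (real^3) set). f b) = f (axis 1 1) * f (axis 2 1) * f (axis 3 1)"
proof -
  have B: "(Basis :: (real^3) set) = {axis 1 1, axis 2 1, axis 3 1}"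
    by (auto simp: Basis_vec_def UNIV_3)
  have "axis 1 1 \<noteq> (axis 2 1 :: real^3)" "axis 1 1 \<noteq> (axis 3 1 :: real^3)" "axis 2 1 \<noteq> (axis 3 1 :: real^3)"
    by (simp_all add: axis_eq_axis)
  then show ?thesis unfolding B by (simp add: mult.assoc)
qed

text \<open>Both measures agree on boxes. The nested pairs allow Fubini one coordinate at a time, as
  needed for Gaussians and for integrals along lines.\<close>

lemma lborel_v3: "distr (lborel \<Otimes>\<^sub>M (lborel \<Otimes>\<^sub>M lborel)) borel v3 = lborel"
proof (rule lborel_eqI[symmetric])
  fix l u :: "real^3"
  assume le: "\<And>b. b \<in> Basis \<Longrightarrow> l \<bullet> b \<le> u \<bullet> b"
  have le': "l $ i \<le> u $ i" for i using le[of "axis i 1"] by (simp add: inner_axis)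
  have pre: "v3 -` box l u = {l$1<..<u$1} \<times> ({l$2<..<u$2} \<times> {l$3<..<u$3})"
    by (auto simp: mem_box_cart forall_3)
  have "emeasure (distr (lborel \<Otimes>\<^sub>M (lborel \<Otimes>\<^sub>M lborel)) borel v3) (box l u)
     = emeasure (lborel \<Otimes>\<^sub>M (lborel \<Otimes>\<^sub>M lborel)) ({l$1<..<u$1} \<times> ({l$2<..<u$2} \<times> {l$3<..<u$3}))"
    by (subst emeasure_distr) (auto simp: pre lborel_prod space_pair_measure)
  also have "\<dots> = ennreal (u$1 - l$1) * (ennreal (u$2 - l$2) * ennreal (u$3 - l$3))"
  proof -
    have sf: "sigma_finite_measure (lborel \<Otimes>\<^sub>M lborel :: (real \<times> real) measure)"
      by (simp add: lborel_prod sigma_finite_lborel)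
    show ?thesis
      by (subst sigma_finite_measure.emeasure_pair_measure_Times[OF sf], simp, simp,
          subst lborel.emeasure_pair_measure_Times) (use le' in simp_all)
  qed
  also have "\<dots> = (\<Prod>b\<in>Basis. (u - l) \<bullet> b)"
    using le' by (simp add: prod_Basis3 inner_axis ennreal_mult[symmetric] mult.assoc)
  finally show "emeasure (distr (lborel \<Otimes>\<^sub>M (lborel \<Otimes>\<^sub>M lborel)) borel v3) (box l u) = (\<Prod>b\<in>Basis. (u - l) \<bullet> b)" .
qed simp

lemma nn_integral3:
  assumes [measurable]: "f \<in> borel_measurable (borel :: (real^3) measure)"
  shows "(\<integral>\<^sup>+x. f x \<partial>lborel) = (\<integral>\<^sup>+x. \<integral>\<^sup>+y. \<integral>\<^sup>+z. f (v3 (x, y, z))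
      \<partial>lborel \<partial>lborel \<partial>lborel)"
proof -
  have m: "(\<lambda>p. f (v3 p)) \<in> borel_measurable (borel \<Otimes>\<^sub>M (borel \<Otimes>\<^sub>M borel))" by (simp add: borel_prod)
  have m2: "(\<lambda>q. f (v3 (x, q))) \<in> borel_measurable (lborel \<Otimes>\<^sub>M lborel)" for x
  proof -
    have "(\<lambda>q. v3 (x, q)) \<in> borel_measurable borel"
      unfolding v3_def fst_conv snd_conv by (intro borel_measurable_continuous_onI continuous_intros)
    then have "(\<lambda>q. f (v3 (x, q))) \<in> borel_measurable borel" by (rule measurable_compose[OF _ assms])
    then show ?thesis unfolding lborel_prod by simp
  qed
  have "(\<integral>\<^sup>+x. f x \<partial>lborel) = (\<integral>\<^sup>+p. f (v3 p) \<partial>(lborel \<Otimes>\<^sub>M (lborel \<Otimes>\<^sub>M lborel)))"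
    by (subst lborel_v3[symmetric], subst nn_integral_distr) (auto simp: lborel_prod)
  also have "\<dots> = (\<integral>\<^sup>+x. \<integral>\<^sup>+q. f (v3 (x, q)) \<partial>(lborel \<Otimes>\<^sub>M lborel) \<partial>lborel)"
    using m by (subst sigma_finite_measure.nn_integral_fst[symmetric]) (auto simp: lborel_prod sigma_finite_lborel borel_prod)
  also have "\<dots> = (\<integral>\<^sup>+x. \<integral>\<^sup>+y. \<integral>\<^sup>+z. f (v3 (x, y, z)) \<partial>lborel \<partial>lborel \<partial>lborel)"
    using m2 by (intro nn_integral_cong, subst sigma_finite_measure.nn_integral_fst[symmetric]) (auto simp: sigma_finite_lborel borel_prod)
  finally show ?thesis .
qed

lemma pair_product_integral:
  fixes f :: "'a::euclidean_space \<Rightarrow> complex" and g :: "'b::euclidean_space \<Rightarrow> complex"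
  assumes f: "integrable lborel f" and g: "integrable lborel g"
  shows "integrable (lborel \<Otimes>\<^sub>M lborel) (\<lambda>p. f (fst p) * g (snd p))"
    "(LINT p|(lborel \<Otimes>\<^sub>M lborel). f (fst p) * g (snd p)) = (LINT x|lborel. f x) * (LINT y|lborel. g y)"
proof -
  have [measurable]: "f \<in> borel_measurable borel" "g \<in> borel_measurable borel"
    using f g by (auto dest: borel_measurable_integrable)
  show i: "integrable (lborel \<Otimes>\<^sub>M lborel) (\<lambda>p. f (fst p) * g (snd p))"
  proof (rule lborel_pair.Fubini_integrable)
    show "integrable lborel (\<lambda>x. LINT y|lborel. norm (f (fst (x, y)) * g (snd (x, y))))"
      using f by (simp add: norm_mult)
    show "AE x in lborel. integrable lborel (\<lambda>y. f (fst (x, y)) * g (snd (x, y)))"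
      using g by simp
  qed measurable
  show "(LINT p|(lborel \<Otimes>\<^sub>M lborel). f (fst p) * g (snd p)) = (LINT x|lborel. f x) * (LINT y|lborel. g y)"
    using lborel_pair.integral_fst'[OF i] by simp
qed

lemma integral3_product:
  fixes f g h :: "real \<Rightarrow> complex"
  assumes f: "integrable lborel f" and g: "integrable lborel g" and h: "integrable lborel h"
  shows "integrable lborel (\<lambda>x::real^3. f (x$1) * (g (x$2) * h (x$3)))"
    "(LINT x|(lborel :: (real^3) measure). f (x$1) * (g (x$2) * h (x$3))) = (LINT x|lborel. f x) * ((LINT x|lborel. g x) * (LINT x|lborel. h x))"
proof -
  have [measurable]: "f \<in> borel_measurable borel" "g \<in> borel_measurable borel" "h \<in> borel_measurable borel"
    using f g h by (auto dest: borel_measurable_integrable)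
  have [measurable]: "(\<lambda>x::real^3. x $ i) \<in> borel_measurable borel" for i
    by (intro borel_measurable_continuous_onI continuous_intros)
  have gh: "integrable lborel (\<lambda>p. g (fst p) * h (snd p))" using pair_product_integral(1)[OF g h] by (simp add: lborel_prod)
  have e: "v3 p $ 1 = fst p" "v3 p $ 2 = fst (snd p)" "v3 p $ 3 = snd (snd p)" for p
    by (cases p, simp)+
  note P = pair_product_integral[OF f gh]
  have i: "integrable (distr (lborel \<Otimes>\<^sub>M (lborel \<Otimes>\<^sub>M lborel)) borel v3) (\<lambda>x::real^3. f (x$1) * (g (x$2) * h (x$3)))"
    by (subst integrable_distr_eq) (use P(1) in \<open>auto simp: e lborel_prod\<close>)
  then show "integrable lborel (\<lambda>x::real^3. f (x$1) * (g (x$2) * h (x$3)))" by (simp add: lborel_v3)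
  have "(LINT x|(distr (lborel \<Otimes>\<^sub>M (lborel \<Otimes>\<^sub>M lborel)) borel v3). f (x$1) * (g (x$2) * h (x$3)))
      = (LINT x|lborel. f x) * (LINT p|lborel. g (fst p) * h (snd p))"
    by (subst integral_distr) (use P(2) in \<open>auto simp: e lborel_prod\<close>)
  also have "(LINT p|lborel. g (fst p) * h (snd p)) = (LINT x|lborel. g x) * (LINT x|lborel. h x)"
    using pair_product_integral(2)[OF g h] by (simp add: lborel_prod)
  finally show "(LINT x|(lborel :: (real^3) measure). f (x$1) * (g (x$2) * h (x$3))) = (LINT x|lborel. f x) * ((LINT x|lborel. g x) * (LINT x|lborel. h x))"
    by (simp add: lborel_v3)
qed

section \<open>Gaussians and their Fourier integrals\<close>

lemma cnj_measurable[measurable]: "cnj \<in> borel_measurable borel"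
  by (intro borel_measurable_continuous_onI continuous_on_cnj continuous_on_id)

lemma cis_measurable[measurable]: "cis \<in> borel_measurable borel"
  by (intro borel_measurable_continuous_onI) (simp add: cis_conv_exp continuous_intros)

text \<open>The integral is, up to the factor \<open>sqrt (2 * pi)\<close>, the characteristic
  function of the standard normal distribution.\<close>

lemma gauss_1d:
  "integrable lborel (\<lambda>x::real. cis (- (x * t)) * of_real (exp (- x\<^sup>2 / 2)))"
  "(LINT x|lborel. cis (- (x * t)) * of_real (exp (- x\<^sup>2 / 2))) = of_real (sqrt (2 * pi) * exp (- t\<^sup>2 / 2))"
proof -
  have d: "exp (- x\<^sup>2 / 2) = sqrt (2 * pi) * std_normal_density x" for x
    by (simp add: std_normal_density_def)
  have i0: "integrable lborel (\<lambda>x. complex_of_real (exp (- x\<^sup>2 / 2)))"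
    unfolding d by (intro integrable_of_real integrable_mult_right) simp
  show "integrable lborel (\<lambda>x::real. cis (- (x * t)) * of_real (exp (- x\<^sup>2 / 2)))"
    by (rule Bochner_Integration.integrable_bound[OF i0]) (auto simp: norm_mult)
  have "(LINT x|lborel. cis (- (x * t)) * of_real (exp (- x\<^sup>2 / 2))) = (LINT x|lborel. of_real (sqrt (2 * pi)) * (std_normal_density x *\<^sub>R iexp (- t * x)))"
    unfolding d by (intro Bochner_Integration.integral_cong) (simp_all add: cis_conv_exp scaleR_conv_of_real mult_ac)
  also have "\<dots> = of_real (sqrt (2 * pi)) * (LINT x|lborel. std_normal_density x *\<^sub>R iexp (- t * x))"
    by (rule integral_mult_right_zero)
  also have "(LINT x|lborel. std_normal_density x *\<^sub>R iexp (- t * x)) = char std_normal_distribution (- t)"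
    unfolding char_def by (subst integral_density) auto
  finally show "(LINT x|lborel. cis (- (x * t)) * of_real (exp (- x\<^sup>2 / 2))) = of_real (sqrt (2 * pi) * exp (- t\<^sup>2 / 2))"
    by (simp add: char_std_normal_distribution)
qed

text \<open>No normalising factor, so that the weight is bounded by 1 and its Fourier integral is a
  constant multiple of itself.\<close>

definition gauss :: "real ^ 3 \<Rightarrow> real" where "gauss x = exp (- (norm x)\<^sup>2 / 2)"

lemma gauss_measurable[measurable]: "gauss \<in> borel_measurable borel"
  unfolding gauss_def by measurable

lemma gauss_pos: "gauss x > 0" and gauss_le: "gauss x \<le> 1" and gauss_uminus: "gauss (- x) = gauss x"
  by (auto simp: gauss_def)

lemma norm3_sq: "(norm (x::real^3))\<^sup>2 = (x$1)\<^sup>2 + (x$2)\<^sup>2 + (x$3)\<^sup>2"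
  by (simp add: norm_vec_def L2_set_def sum_3 sum_nonneg)

lemma inner3: "(x::real^3) \<bullet> y = x$1 * y$1 + x$2 * y$2 + x$3 * y$3"
  by (simp add: inner_vec_def sum_3)

lemma gauss_fourier:
  "integrable lborel (\<lambda>x. cis (- (x \<bullet> w)) * of_real (gauss x))"
  "(LINT x|lborel. cis (- (x \<bullet> w)) * of_real (gauss x)) = of_real (sqrt ((2 * pi)^3) * gauss w)"
proof -
  let ?g = "\<lambda>t x. cis (- (x * t)) * complex_of_real (exp (- x\<^sup>2 / 2))"
  have eq: "cis (- (x \<bullet> w)) * of_real (gauss x) = ?g (w$1) (x$1) * (?g (w$2) (x$2) * ?g (w$3) (x$3))" for x
  proof -
    have "gauss x = exp (- (x$1)\<^sup>2 / 2) * exp (- (x$2)\<^sup>2 / 2) * exp (- (x$3)\<^sup>2 / 2)"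
      unfolding gauss_def norm3_sq exp_add[symmetric] by (rule arg_cong[of _ _ exp]) (simp add: field_simps)
    moreover have "cis (- (x \<bullet> w)) = cis (- (x$1 * w$1)) * cis (- (x$2 * w$2)) * cis (- (x$3 * w$3))"
      by (simp add: cis_mult inner3)
    ultimately show ?thesis by (simp add: mult_ac)
  qed
  show "integrable lborel (\<lambda>x. cis (- (x \<bullet> w)) * of_real (gauss x))"
    unfolding eq by (rule integral3_product(1)) (rule gauss_1d)+
  have "(LINT x|lborel. cis (- (x \<bullet> w)) * of_real (gauss x))
      = of_real (sqrt (2 * pi) * exp (- (w$1)\<^sup>2 / 2)) * (of_real (sqrt (2 * pi) * exp (- (w$2)\<^sup>2 / 2)) * of_real (sqrt (2 * pi) * exp (- (w$3)\<^sup>2 / 2)))"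
    unfolding eq by (subst integral3_product(2)[OF gauss_1d(1) gauss_1d(1) gauss_1d(1)]) (simp only: gauss_1d(2))
  also have "\<dots> = of_real (sqrt ((2 * pi)^3) * gauss w)"
  proof -
    have "gauss w = exp (- (w$1)\<^sup>2 / 2) * exp (- (w$2)\<^sup>2 / 2) * exp (- (w$3)\<^sup>2 / 2)"
      unfolding gauss_def norm3_sq exp_add[symmetric] by (rule arg_cong[of _ _ exp]) (simp add: field_simps)
    moreover have "sqrt ((2 * pi)^3) = sqrt (2 * pi) * sqrt (2 * pi) * sqrt (2 * pi)"
      by (simp only: real_sqrt_mult power3_eq_cube)
    ultimately show ?thesis by (simp only: of_real_mult[symmetric] mult_ac)
  qed
  finally show "(LINT x|lborel. cis (- (x \<bullet> w)) * of_real (gauss x)) = of_real (sqrt ((2 * pi)^3) * gauss w)" .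
qed

lemma gauss_integral: "integrable lborel gauss" "(LINT x|lborel. gauss x) = sqrt ((2 * pi)^3)"
proof -
  have "integrable lborel (\<lambda>x. complex_of_real (gauss x))" using gauss_fourier(1)[of 0] by simp
  then show i: "integrable lborel gauss" by (simp only: complex_of_real_integrable_eq)
  have "complex_of_real (LINT x|lborel. gauss x) = of_real (sqrt ((2 * pi)^3))"
    using gauss_fourier(2)[of 0] by (simp add: gauss_def[of 0])
  then show "(LINT x|lborel. gauss x) = sqrt ((2 * pi)^3)" by (simp only: of_real_eq_iff)
qed

section \<open>The Fourier integral of integrable functions\<close>

definition FI :: "(real ^ 3 \<Rightarrow> complex) \<Rightarrow> real ^ 3 \<Rightarrow> complex" where
  "FI f \<xi> = (LINT x|lborel. cis (- (\<xi> \<bullet> x)) * f x)"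

lemma FI_integrable:
  assumes f: "integrable lborel f" shows "integrable lborel (\<lambda>x. cis (- (\<xi> \<bullet> x)) * f x)"
proof -
  have [measurable]: "f \<in> borel_measurable borel" using f by (auto dest: borel_measurable_integrable)
  show ?thesis by (rule Bochner_Integration.integrable_bound[OF f]) (auto simp: norm_mult)
qed

lemma FI_bound: "integrable lborel f \<Longrightarrow> norm (FI f \<xi>) \<le> (LINT x|lborel. norm (f x))"
  unfolding FI_def using integral_norm_bound[of lborel "\<lambda>x. cis (- (\<xi> \<bullet> x)) * f x"] by (simp add: norm_mult)

lemma FI_measurable:
  assumes [measurable]: "f \<in> borel_measurable borel" shows "FI f \<in> borel_measurable borel"
  unfolding FI_def by measurable

lemma FI_add: "integrable lborel f \<Longrightarrow> integrable lborel g \<Longrightarrow> FI (\<lambda>x. f x + g x) \<xi> = FI f \<xi> + FI g \<xi>"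
  unfolding FI_def by (simp add: distrib_left FI_integrable)

lemma FI_scale: "FI (\<lambda>x. c * f x) \<xi> = c * FI f \<xi>"
  unfolding FI_def by (simp add: mult.left_commute)

lemma FI_diff: "integrable lborel f \<Longrightarrow> integrable lborel g \<Longrightarrow> FI (\<lambda>x. f x - g x) \<xi> = FI f \<xi> - FI g \<xi>"
  unfolding FI_def by (simp add: right_diff_distrib FI_integrable)

lemma FI_cnj: "FI (\<lambda>x. cnj (f x)) \<xi> = cnj (FI f (- \<xi>))"
proof -
  have "cnj (FI f (- \<xi>)) = (LINT x|lborel. cnj (cis (- ((- \<xi>) \<bullet> x)) * f x))"
    unfolding FI_def by (rule Bochner_Integration.integral_cnj[symmetric])
  then show ?thesis by (simp add: FI_def cis_cnj)
qed

text \<open>Fubini, with the product of the two integrable functions as majorant; the phase is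
  symmetric in the two variables.\<close>

lemma FI_multiplication:
  assumes f: "integrable lborel f" and h: "integrable lborel h"
  shows "(LINT \<xi>|lborel. FI f \<xi> * h \<xi>) = (LINT x|lborel. f x * FI h x)"
proof -
  have [measurable]: "f \<in> borel_measurable borel" "h \<in> borel_measurable borel"
    using f h by (auto dest: borel_measurable_integrable)
  have i: "integrable (lborel \<Otimes>\<^sub>M lborel) (\<lambda>(\<xi>, x). h \<xi> * (cis (- (\<xi> \<bullet> x)) * f x))"
    by (rule Bochner_Integration.integrable_bound[OF pair_product_integral(1)[OF h f]])
       (auto simp: norm_mult)
  have "(LINT \<xi>|lborel. FI f \<xi> * h \<xi>) = (LINT \<xi>|lborel. LINT x|lborel. h \<xi> * (cis (- (\<xi> \<bullet> x)) * f x))"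
    by (simp add: FI_def mult.commute)
  also have "\<dots> = (LINT x|lborel. LINT \<xi>|lborel. h \<xi> * (cis (- (\<xi> \<bullet> x)) * f x))"
    by (rule lborel_pair.Fubini_integral[OF i, symmetric])
  also have "\<dots> = (LINT x|lborel. f x * FI h x)"
  proof (intro Bochner_Integration.integral_cong refl)
    fix x
    have "(LINT \<xi>|lborel. h \<xi> * (cis (- (\<xi> \<bullet> x)) * f x)) = (LINT \<xi>|lborel. f x * (cis (- (x \<bullet> \<xi>)) * h \<xi>))"
      by (intro Bochner_Integration.integral_cong) (auto simp: mult_ac inner_commute)
    then show "(LINT \<xi>|lborel. h \<xi> * (cis (- (\<xi> \<bullet> x)) * f x)) = f x * FI h x" by (simp add: FI_def)
  qed
  finally show ?thesis .
qed

lemma gauss_scaled: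
  assumes e: "e > 0"
  shows "integrable lborel (\<lambda>x. gauss (e *\<^sub>R x))"
    "(LINT x|lborel. cis (- (x \<bullet> w)) * of_real (gauss (e *\<^sub>R x))) = of_real (1 / e^3 * (sqrt ((2 * pi)^3) * gauss ((1/e) *\<^sub>R w)))"
proof -
  show "integrable lborel (\<lambda>x. gauss (e *\<^sub>R x))"
    using integrable_affine[OF gauss_integral(1), of e 0] e by simp
  have "(LINT x|lborel. cis (- ((0 + e *\<^sub>R x) \<bullet> ((1/e) *\<^sub>R w))) * of_real (gauss (0 + e *\<^sub>R x)))
      = (1 / \<bar>e\<bar>^3) *\<^sub>R (LINT x|lborel. cis (- (x \<bullet> ((1/e) *\<^sub>R w))) * of_real (gauss x))"
    by (rule integral_affine) (use e in auto)
  then show "(LINT x|lborel. cis (- (x \<bullet> w)) * of_real (gauss (e *\<^sub>R x))) = of_real (1 / e^3 * (sqrt ((2 * pi)^3) * gauss ((1/e) *\<^sub>R w)))"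
    using e by (simp only: gauss_fourier(2)) (simp add: scaleR_conv_of_real[of _ "_ :: complex"])
qed

text \<open>Gaussian regularisation of \<open>\<integral>\<bar>FI f\<bar>\<^sup>2\<close>: the weight turns into an approximate identity on the space side.\<close>

lemma plancherel_regularised:
  assumes f: "integrable lborel f" and fL: "f \<in> L2" and e: "e > 0"
  shows "(LINT \<xi>|lborel. FI f \<xi> * (of_real (gauss (e *\<^sub>R \<xi>)) * cnj (FI f \<xi>))) =
    of_real (sqrt ((2 * pi)^3)) * (LINT z|lborel. of_real (gauss z) * (LINT x|lborel. f x * cnj (f (x + e *\<^sub>R z))))"
proof -
  have fm[measurable]: "f \<in> borel_measurable borel" by (rule L2_meas[OF fL])
  note [measurable] = FI_measurable[OF fm]
  let ?K = "sqrt ((2 * pi)^3)"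
  define h where "h \<xi> = of_real (gauss (e *\<^sub>R \<xi>)) * cnj (FI f \<xi>)" for \<xi>
  have hi: "integrable lborel h"
  proof (rule Bochner_Integration.integrable_bound)
    show "integrable lborel (\<lambda>x. gauss (e *\<^sub>R x) * (LINT x|lborel. norm (f x)))"
      using gauss_scaled(1)[OF e] by simp
    show "AE x in lborel. norm (h x) \<le> norm (gauss (e *\<^sub>R x) * (LINT x|lborel. norm (f x)))"
      using FI_bound[OF f] by (intro AE_I2) (auto simp: h_def norm_mult abs_mult gauss_pos less_imp_le integral_nonneg intro!: mult_left_mono)
    show "h \<in> borel_measurable lborel" unfolding h_def by measurable
  qed
  \<comment> \<open>The multiplication formula is applied once more: the transform of a modulated
    Gaussian is a Gaussian kernel of width \<open>e\<close> centred at \<open>x\<close>, and the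
    substitution \<open>y = x + e z\<close> removes the width from the weight.\<close>
  have FIh: "FI h x = of_real ?K * (LINT z|lborel. of_real (gauss z) * cnj (f (x + e *\<^sub>R z)))" for x
  proof -
    define k where "k \<xi> = cis (\<xi> \<bullet> x) * of_real (gauss (e *\<^sub>R \<xi>))" for \<xi>
    have ki: "integrable lborel k"
    proof (rule Bochner_Integration.integrable_bound[OF gauss_scaled(1)[OF e]])
      show "k \<in> borel_measurable lborel" unfolding k_def by measurable
    qed (auto simp: k_def norm_mult gauss_pos less_imp_le)
    have "FI h x = (LINT \<xi>|lborel. k (- \<xi>) * FI (\<lambda>x. cnj (f x)) (- \<xi>))"
      unfolding FI_def[of h] h_def k_def by (intro Bochner_Integration.integral_cong) (auto simp: FI_cnj inner_commute gauss_uminus)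
    also have "\<dots> = (LINT \<xi>|lborel. k \<xi> * FI (\<lambda>x. cnj (f x)) \<xi>)"
    proof -
      have [measurable]: "FI (\<lambda>x. cnj (f x)) \<in> borel_measurable borel" by (intro FI_measurable) measurable
      have "(\<lambda>\<xi>. k \<xi> * FI (\<lambda>x. cnj (f x)) \<xi>) \<in> borel_measurable borel" unfolding k_def by measurable
      from integral_affine[OF this, of "-1" 0] show ?thesis by simp
    qed
    also have "\<dots> = (LINT \<xi>|lborel. FI (\<lambda>x. cnj (f x)) \<xi> * k \<xi>)" by (simp add: mult.commute)
    also have "\<dots> = (LINT y|lborel. cnj (f y) * FI k y)" using f by (intro FI_multiplication ki) auto
    also have "\<dots> = (LINT y|lborel. cnj (f y) * of_real (1 / e^3 * (?K * gauss ((1/e) *\<^sub>R (y - x)))))"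
    proof (intro Bochner_Integration.integral_cong refl arg_cong2[of _ _ _ _ "(*)"])
      fix y
      have "FI k y = (LINT \<xi>|lborel. cis (- (\<xi> \<bullet> (y - x))) * of_real (gauss (e *\<^sub>R \<xi>)))"
        unfolding FI_def k_def
        by (intro Bochner_Integration.integral_cong) (auto simp: mult.assoc[symmetric] cis_mult inner_commute[of y] inner_diff_right)
      then show "FI k y = of_real (1 / e^3 * (?K * gauss ((1/e) *\<^sub>R (y - x))))" by (simp only: gauss_scaled(2)[OF e])
    qed
    also have "\<dots> = e^3 *\<^sub>R (LINT z|lborel. cnj (f (x + e *\<^sub>R z)) * of_real (1 / e^3 * (?K * gauss ((1/e) *\<^sub>R ((x + e *\<^sub>R z) - x)))))"
      by (subst integral_affine[of "\<lambda>y. cnj (f y) * of_real (1 / e^3 * (?K * gauss ((1/e) *\<^sub>R (y - x))))" e x]) (use e in auto)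
    also have "\<dots> = of_real ?K * (LINT z|lborel. of_real (gauss z) * cnj (f (x + e *\<^sub>R z)))"
      using e by (subst integral_scaleR_right[symmetric], subst integral_mult_right_zero[symmetric])
        (intro Bochner_Integration.integral_cong, auto simp: scaleR_conv_of_real[of _ "_ :: complex"])
    finally show ?thesis .
  qed
  \<comment> \<open>Absolute integrability on the product: for fixed \<open>z\<close>,
    Cauchy-Schwarz bounds the \<open>x\<close>-integral by the squared norm of \<open>f\<close>, and
    the Gaussian is integrable in \<open>z\<close>.\<close>
  have "integrable (lborel \<Otimes>\<^sub>M lborel) (\<lambda>(z, x). f x * (of_real (gauss z) * cnj (f (x + e *\<^sub>R z))))"
  proof (rule lborel_pair.Fubini_integrable)
    have shift: "(\<lambda>x. f (x + e *\<^sub>R z)) \<in> L2 \<and> l2n (\<lambda>x. f (x + e *\<^sub>R z)) = l2n f" for z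
      using L2_affine[OF fL, of 1 "e *\<^sub>R z"] by (simp add: add.commute)
    show "AE z in lborel. integrable lborel (\<lambda>x. case (z, x) of (z, x) \<Rightarrow> f x * (of_real (gauss z) * cnj (f (x + e *\<^sub>R z))))"
      using shift by (auto intro!: L2_mult_integrable fL L2_scale L2_cnj)
    show "integrable lborel (\<lambda>z. LINT x|lborel. norm (case (z, x) of (z, x) \<Rightarrow> f x * (of_real (gauss z) * cnj (f (x + e *\<^sub>R z)))))"
    proof (rule Bochner_Integration.integrable_bound)
      show "integrable lborel (\<lambda>z. gauss z * (l2n f * l2n f))" using gauss_integral(1) by simp
      show "AE z in lborel. norm (LINT x|lborel. norm (case (z, x) of (z, x) \<Rightarrow> f x * (of_real (gauss z) * cnj (f (x
          + e *\<^sub>R z))))) \<le> norm (gauss z * (l2n f * l2n f))"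
      proof (intro AE_I2)
        fix z
        have "(LINT x|lborel. norm (f x * (of_real (gauss z) * cnj (f (x + e *\<^sub>R z)))))
            \<le> l2n f * l2n (\<lambda>x. of_real (gauss z) * cnj (f (x + e *\<^sub>R z)))"
          using shift by (intro nn_mult_le fL L2_scale L2_cnj) auto
        also have "\<dots> = gauss z * (l2n f * l2n f)" using shift by (simp add: l2n_scale l2n_cnj gauss_pos less_imp_le)
        finally show "norm (LINT x|lborel. norm (case (z, x) of (z, x) \<Rightarrow> f x * (of_real (gauss z) * cnj (f (x + e *\<^sub>R z)))))
            \<le> norm (gauss z * (l2n f * l2n f))"
          by (simp add: integral_nonneg gauss_pos less_imp_le)
      qed
      show "(\<lambda>z. LINT x|lborel. norm (case (z, x) of (z, x) \<Rightarrow> f x * (of_real (gauss z) * cnj (f (x + e *\<^sub>R z))))) \<in> borel_measurable lborel"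
        by measurable
    qed
  qed measurable
  note Fub = lborel_pair.Fubini_integral[OF this]
  have "(LINT \<xi>|lborel. FI f \<xi> * h \<xi>) = (LINT x|lborel. f x * FI h x)" by (rule FI_multiplication[OF f hi])
  also have "\<dots> = (LINT x|lborel. of_real ?K * (LINT z|lborel. f x * (of_real (gauss z) * cnj (f (x + e *\<^sub>R z)))))"
    by (intro Bochner_Integration.integral_cong) (auto simp: FIh)
  also have "\<dots> = of_real ?K * (LINT x|lborel. LINT z|lborel. f x * (of_real (gauss z) * cnj (f (x + e *\<^sub>R z))))" by simp
  also have "\<dots> = of_real ?K * (LINT z|lborel. LINT x|lborel. f x * (of_real (gauss z) * cnj (f (x + e *\<^sub>R z))))"
    by (simp only: Fub)
  also have "\<dots> = of_real ?K * (LINT z|lborel. of_real (gauss z) * (LINT x|lborel. f x * cnj (f (x + e *\<^sub>R z))))"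
  proof (intro arg_cong2[of _ _ _ _ "(*)"] refl Bochner_Integration.integral_cong)
    fix z
    have "(LINT x|lborel. f x * (of_real (gauss z) * cnj (f (x + e *\<^sub>R z)))) = (LINT x|lborel. of_real (gauss z) * (f x * cnj (f (x + e *\<^sub>R z))))"
      by (intro Bochner_Integration.integral_cong) (auto simp: mult_ac)
    then show "(LINT x|lborel. f x * (of_real (gauss z) * cnj (f (x + e *\<^sub>R z)))) = of_real (gauss z) * (LINT x|lborel. f x * cnj (f (x + e *\<^sub>R z)))"
      by (simp only: integral_mult_right_zero)
  qed
  finally show ?thesis unfolding h_def .
qed

section \<open>Plancherel's identity, with constant \<open>KF = (2 * pi)^(3/2)\<close>\<close>

abbreviation "KF \<equiv> sqrt ((2 * pi) ^ 3)"

lemma KF_pos: "KF > 0" by simp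

text \<open>An arbitrary filter is allowed because truncation radii tend to infinity through the
  reals while other approximations are sequences.\<close>

lemma L2_int_mult_tendsto:
  assumes u: "\<And>n. u n \<in> L2" "f \<in> L2" "((\<lambda>n. l2n (\<lambda>x. u n x - f x)) \<longlongrightarrow> 0) \<F>"
    and v: "\<And>n. v n \<in> L2" "g \<in> L2" "((\<lambda>n. l2n (\<lambda>x. v n x - g x)) \<longlongrightarrow> 0) \<F>"
  shows "((\<lambda>n. LINT x|lborel. u n x * v n x) \<longlongrightarrow> (LINT x|lborel. f x * g x)) \<F>"
proof (rule tendsto_norm_zero_cancel[THEN LIM_zero_cancel], rule Lim_null_comparison)
  let ?b = "\<lambda>n. l2n (\<lambda>x. u n x - f x) * (l2n g + l2n (\<lambda>x. v n x - g x)) + l2n f * l2n (\<lambda>x. v n x - g x)"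
  show "\<forall>\<^sub>F n in \<F>. norm (norm ((LINT x|lborel. u n x * v n x) - (LINT x|lborel. f x * g x))) \<le> ?b n"
  proof (intro always_eventually allI)
    fix n
    have "(LINT x|lborel. u n x * v n x) - (LINT x|lborel. f x * g x) = (LINT x|lborel. (u n x - f x) * v n x) + (LINT x|lborel. f x * (v n x - g x))"
      using u v by (simp add: left_diff_distrib right_diff_distrib L2_mult_integrable)
    then have "norm ((LINT x|lborel. u n x * v n x) - (LINT x|lborel. f x * g x)) \<le> norm (LINT x|lborel. (u n x - f x) * v n x)
        + norm (LINT x|lborel. f x * (v n x - g x))"
      by (simp only: norm_triangle_ineq)
    moreover have "norm (LINT x|lborel. (u n x - f x) * v n x) \<le> l2n (\<lambda>x. u n x - f x) * l2n (v n)"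
      using u v by (intro norm_int_mult_le L2_diff)
    moreover have "l2n (\<lambda>x. u n x - f x) * l2n (v n) \<le> l2n (\<lambda>x. u n x - f x) * (l2n g + l2n (\<lambda>x. v n x - g x))"
      using l2n_abs_diff[OF v(1)[of n] v(2)] by (intro mult_left_mono) auto
    moreover have "norm (LINT x|lborel. f x * (v n x - g x)) \<le> l2n f * l2n (\<lambda>x. v n x - g x)"
      using u v by (intro norm_int_mult_le L2_diff)
    ultimately show "norm (norm ((LINT x|lborel. u n x * v n x) - (LINT x|lborel. f x * g x))) \<le> ?b n"
      by (simp only: real_norm_def abs_norm_cancel)
  qed
  have "(?b \<longlongrightarrow> 0 * (l2n g + 0) + l2n f * 0) \<F>" by (intro tendsto_intros u v)
  then show "(?b \<longlongrightarrow> 0) \<F>" by simp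
qed

lemma l2n_tendsto:
  assumes "\<And>n. u n \<in> L2" "f \<in> L2" "((\<lambda>n. l2n (\<lambda>x. u n x - f x)) \<longlongrightarrow> 0) \<F>"
  shows "((\<lambda>n. l2n (u n)) \<longlongrightarrow> l2n f) \<F>"
  by (rule LIM_zero_cancel, rule Lim_null_comparison[OF _ assms(3)])
     (use l2n_abs_diff[OF assms(1,2)] in \<open>auto intro: always_eventually\<close>)

text \<open>The Gaussian weight of \<open>plancherel_regularised\<close> is let tend to 1. The right
  side converges by continuity of translations, Fatou makes \<open>FI f\<close> square-integrable,
  and domination then identifies its norm.\<close>

lemma plancherel_L1:
  assumes f: "integrable lborel f" and fL: "f \<in> L2"
  shows "FI f \<in> L2" "l2n (FI f) = KF * l2n f"
proof -
  have fm[measurable]: "f \<in> borel_measurable borel" by (rule L2_meas[OF fL])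
  note FIm[measurable] = FI_measurable[OF fm]
  \<comment> \<open>The weight is put on the function as \<open>gauss (x / (n + 1))\<close>; its
    square, which enters the norm, is the Gaussian at scale \<open>sqrt 2 / (n + 1)\<close>.\<close>
  define e where "e n = sqrt 2 / real (Suc n)" for n
  have e0: "e n > 0" for n by (simp add: e_def)
  have elim: "e \<longlonglongrightarrow> 0" unfolding e_def by real_asymp
  define g where "g n \<xi> = of_real (gauss ((1 / real (Suc n)) *\<^sub>R \<xi>)) * FI f \<xi>" for n \<xi>
  have sq: "(gauss ((1 / real (Suc n)) *\<^sub>R \<xi>))\<^sup>2 = gauss (e n *\<^sub>R \<xi>)" for n \<xi>
    unfolding gauss_def exp_double[symmetric]
    by (rule arg_cong[of _ _ exp]) (simp add: e_def power_mult_distrib power_divide)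
  have gsq: "(norm (g n \<xi>))\<^sup>2 = gauss (e n *\<^sub>R \<xi>) * (norm (FI f \<xi>))\<^sup>2" for n \<xi>
    unfolding g_def norm_mult power_mult_distrib norm_of_real power2_abs sq ..
  have gm[measurable]: "g n \<in> borel_measurable borel" for n unfolding g_def by measurable
  have gL: "g n \<in> L2" for n
  proof (rule L2_bound[OF gm])
    show "integrable lborel (\<lambda>\<xi>. gauss (e n *\<^sub>R \<xi>) * (LINT x|lborel. norm (f x))\<^sup>2)"
      using gauss_scaled(1)[OF e0] by simp
    show "(norm (g n \<xi>))\<^sup>2 \<le> gauss (e n *\<^sub>R \<xi>) * (LINT x|lborel. norm (f x))\<^sup>2" for \<xi>
      unfolding gsq by (intro mult_left_mono power_mono FI_bound f) (auto simp: gauss_pos less_imp_le)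
  qed
  define I where "I n z = (LINT x|lborel. f x * cnj (f (x + e n *\<^sub>R z)))" for n z
  have shift: "(\<lambda>x. f (x + w)) \<in> L2 \<and> l2n (\<lambda>x. f (x + w)) = l2n f" for w
    using L2_affine[OF fL, of 1 "w"] by (simp add: add.commute)
  have gn: "complex_of_real ((l2n (g n))\<^sup>2) = of_real KF * (LINT z|lborel. of_real (gauss z) * I n z)" for n
  proof -
    have "complex_of_real ((l2n (g n))\<^sup>2) = (LINT x|lborel. of_real ((norm (g n x))\<^sup>2))"
      unfolding l2n_sq by (rule integral_complex_of_real[symmetric])
    also have "\<dots> = (LINT \<xi>|lborel. FI f \<xi> * (of_real (gauss (e n *\<^sub>R \<xi>)) * cnj (FI f \<xi>)))"
      unfolding gsq by (intro Bochner_Integration.integral_cong refl) (simp add: complex_norm_square mult_ac del: of_real_power)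
    also have "\<dots> = of_real KF * (LINT z|lborel. of_real (gauss z) * I n z)"
      unfolding I_def by (rule plancherel_regularised[OF f fL e0])
    finally show ?thesis .
  qed
  have Ilim: "(\<lambda>n. I n z) \<longlonglongrightarrow> of_real ((l2n f)\<^sup>2)" for z
  proof -
    have "(\<lambda>n. l2n (\<lambda>x. f (e n *\<^sub>R z + 1 *\<^sub>R x) - f x)) \<longlonglongrightarrow> 0"
      by (rule affine_continuity[OF fL]) (auto intro!: tendsto_eq_intros elim)
    then have "(\<lambda>n. l2n (\<lambda>x. cnj (f (x + e n *\<^sub>R z)) - cnj (f x))) \<longlonglongrightarrow> 0"
      using l2n_cnj[of "\<lambda>x. f (x + e n *\<^sub>R z) - f x" for n] by (simp add: add.commute)
    then have "(\<lambda>n. I n z) \<longlonglongrightarrow> (LINT x|lborel. f x * cnj (f x))"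
      unfolding I_def using shift
      by (intro L2_int_mult_tendsto) (auto intro: fL L2_cnj simp: l2n_def)
    also have "(LINT x|lborel. f x * cnj (f x)) = (LINT x|lborel. of_real ((norm (f x))\<^sup>2))"
      by (simp add: complex_norm_square del: of_real_power)
    also have "\<dots> = of_real ((l2n f)\<^sup>2)" unfolding l2n_sq by (rule integral_complex_of_real)
    finally show ?thesis .
  qed
  have "(\<lambda>n. LINT z|lborel. of_real (gauss z) * I n z) \<longlonglongrightarrow> (LINT z|lborel. of_real (gauss z) * of_real ((l2n f)\<^sup>2))"
  proof (rule integral_dominated_convergence[where w="\<lambda>z. gauss z * (l2n f)\<^sup>2"])
    show "integrable lborel (\<lambda>z. gauss z * (l2n f)\<^sup>2)" using gauss_integral(1) by simp
    show "AE z in lborel. (\<lambda>n. of_real (gauss z) * I n z) \<longlonglongrightarrow> of_real (gauss z) * of_real ((l2n f)\<^sup>2)"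
      by (intro AE_I2 tendsto_intros Ilim)
    show "AE z in lborel. norm (of_real (gauss z) * I n z) \<le> gauss z * (l2n f)\<^sup>2" for n
    proof (intro AE_I2)
      fix z
      have "norm (I n z) \<le> l2n f * l2n (\<lambda>x. cnj (f (x + e n *\<^sub>R z)))"
        unfolding I_def using shift by (intro norm_int_mult_le fL L2_cnj) auto
      then show "norm (of_real (gauss z) * I n z) \<le> gauss z * (l2n f)\<^sup>2"
        using shift by (simp add: norm_mult l2n_cnj power2_eq_square gauss_pos less_imp_le)
    qed
    show "(\<lambda>z. of_real (gauss z) * I n z) \<in> borel_measurable lborel" for n unfolding I_def by measurable
    show "(\<lambda>z. of_real (gauss z) * of_real ((l2n f)\<^sup>2) :: complex) \<in> borel_measurable lborel" by measurable
  qed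
  moreover have "(LINT z|lborel. of_real (gauss z) * complex_of_real ((l2n f)\<^sup>2)) = of_real KF * of_real ((l2n f)\<^sup>2)"
  proof -
    have "(LINT z|lborel. of_real (gauss z) * complex_of_real ((l2n f)\<^sup>2)) = (LINT z|lborel. of_real (gauss z)) * complex_of_real ((l2n f)\<^sup>2)"
      by (rule integral_mult_left_zero)
    also have "(LINT z|lborel. complex_of_real (gauss z)) = of_real KF"
      by (simp only: integral_complex_of_real gauss_integral(2))
    finally show ?thesis .
  qed
  ultimately have "(\<lambda>n. complex_of_real ((l2n (g n))\<^sup>2)) \<longlonglongrightarrow> of_real KF * (of_real KF * of_real ((l2n f)\<^sup>2))"
    unfolding gn by (intro tendsto_mult_left) (simp only:)
  then have "(\<lambda>n. Re (complex_of_real ((l2n (g n))\<^sup>2))) \<longlonglongrightarrow> Re (of_real KF * (of_real KF * of_real ((l2n f)\<^sup>2)))"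
    by (rule tendsto_Re)
  then have "(\<lambda>n. sqrt ((l2n (g n))\<^sup>2)) \<longlonglongrightarrow> sqrt (KF * (KF * (l2n f)\<^sup>2))"
    by (intro tendsto_real_sqrt) (simp only: Re_complex_of_real of_real_mult[symmetric])
  moreover have "sqrt (KF * (KF * (l2n f)\<^sup>2)) = KF * l2n f"
  proof -
    have "KF * (KF * (l2n f)\<^sup>2) = (KF * l2n f)\<^sup>2" by (simp add: power2_eq_square mult_ac)
    then show ?thesis by (simp only: real_sqrt_abs) (simp add: abs_mult)
  qed
  ultimately have lim: "(\<lambda>n. l2n (g n)) \<longlonglongrightarrow> KF * l2n f" by simp
  have glim: "AE \<xi> in lborel. (\<lambda>n. g n \<xi>) \<longlonglongrightarrow> FI f \<xi>"
  proof (intro AE_I2)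
    fix \<xi>
    have "(\<lambda>n. complex_of_real (exp (- (1 / real (Suc n) * norm \<xi>)\<^sup>2 / 2)) * FI f \<xi>) \<longlonglongrightarrow> of_real (exp (-
        (0 * norm \<xi>)\<^sup>2 / 2)) * FI f \<xi>"
      by (intro tendsto_intros LIMSEQ_Suc lim_1_over_n) auto
    then show "(\<lambda>n. g n \<xi>) \<longlonglongrightarrow> FI f \<xi>" unfolding g_def gauss_def by simp
  qed
  have ev: "\<forall>\<^sub>F n in sequentially. l2n (g n) \<le> KF * l2n f + 1"
    using order_tendstoD(2)[OF lim, of "KF * l2n f + 1"] by (auto elim: eventually_mono)
  show FL: "FI f \<in> L2" by (rule L2_Fatou(1)[OF gL FIm glim ev]) simp
  have "(\<lambda>n. l2n (\<lambda>x. g n x - FI f x)) \<longlonglongrightarrow> 0"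
    by (rule L2_dominated(2)[OF gL FIm FL glim])
       (auto simp: g_def norm_mult gauss_pos gauss_le less_imp_le intro!: always_eventually mult_left_le_one_le)
  from l2n_tendsto[OF gL FL this] lim show "l2n (FI f) = KF * l2n f" by (rule LIMSEQ_unique)
qed

section \<open>The Fourier-Plancherel transform on L2\<close>

definition trunc :: "real \<Rightarrow> (real ^ 3 \<Rightarrow> complex) \<Rightarrow> real ^ 3 \<Rightarrow> complex" where
  "trunc R f x = indicator (cball 0 R) x * f x"

lemma trunc_L2: "f \<in> L2 \<Longrightarrow> trunc R f \<in> L2"
  unfolding trunc_def by (rule L2_mult_bounded(1)[where B=1]) (auto simp: indicator_def)

lemma trunc_integrable: "f \<in> L2 \<Longrightarrow> integrable lborel (trunc R f)"
  unfolding trunc_def using L2_mult_integrable[OF L2_indicator_cball[of 1 R], of f] by simp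

lemma trunc_tendsto: assumes f: "f \<in> L2" shows "((\<lambda>R. l2n (\<lambda>x. trunc R f x - f x)) \<longlongrightarrow> 0) at_top"
proof (rule tendsto_at_topI_sequentially)
  fix X :: "nat \<Rightarrow> real" assume X: "filterlim X at_top sequentially"
  show "(\<lambda>n. l2n (\<lambda>x. trunc (X n) f x - f x)) \<longlonglongrightarrow> 0"
  proof (rule L2_dominated(2)[OF trunc_L2[OF f] L2_meas[OF f] f])
    show "AE x in lborel. (\<lambda>n. trunc (X n) f x) \<longlonglongrightarrow> f x"
    proof (intro AE_I2)
      fix x :: "real^3"
      have "\<forall>\<^sub>F n in sequentially. norm x \<le> X n" using X by (simp add: filterlim_at_top)
      then have "\<forall>\<^sub>F n in sequentially. trunc (X n) f x = f x"
        by eventually_elim (simp add: trunc_def)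
      then show "(\<lambda>n. trunc (X n) f x) \<longlonglongrightarrow> f x" by (rule tendsto_eventually)
    qed
  qed (auto simp: trunc_def indicator_def)
qed

abbreviation "hft \<equiv> has_fourier_transform"

lemma FT_L2: "f \<in> L2 \<Longrightarrow> FI (trunc R f) \<in> L2" and FT_norm: "f \<in> L2 \<Longrightarrow> l2n (FI (trunc R f)) = KF * l2n (trunc R f)"
  using plancherel_L1[OF trunc_integrable trunc_L2] by auto

text \<open>Replaces the extended integral of the definition by a norm; this needs the transform of
  each truncation to be square-integrable, which is \<open>FT_L2\<close>.\<close>

lemma hft_iff: "hft f F \<longleftrightarrow> f \<in> L2 \<and> F \<in> L2
    \<and> ((\<lambda>R. l2n (\<lambda>\<xi>. FI (trunc R f) \<xi> - F \<xi>)) \<longlongrightarrow> 0) at_top"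
proof (cases "f \<in> L2 \<and> F \<in> L2")
  case True
  have eq: "(LINT x|lborel. indicator (cball 0 R) x * (cis (- (\<xi> \<bullet> x)) * f x)) = FI (trunc R f) \<xi>" for R \<xi>
    unfolding FI_def trunc_def by (simp add: mult.left_commute)
  have "(\<integral>\<^sup>+ \<xi>. ennreal ((norm (F \<xi> - FI (trunc R f) \<xi>))\<^sup>2) \<partial>lborel)
      = ennreal ((l2n (\<lambda>\<xi>. FI (trunc R f) \<xi> - F \<xi>))\<^sup>2)" for R
    using nn_l2n[OF L2_diff[OF _ FT_L2[of f R]], of F] True by (simp add: l2n_diff_sym[of F])
  moreover have "((\<lambda>R. ennreal ((l2n (\<lambda>\<xi>. FI (trunc R f) \<xi> - F \<xi>))\<^sup>2)) \<longlongrightarrow> ennreal 0) at_top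
      \<longleftrightarrow> ((\<lambda>R. (l2n (\<lambda>\<xi>. FI (trunc R f) \<xi> - F \<xi>))\<^sup>2) \<longlongrightarrow> 0) at_top"
    by (rule tendsto_ennreal_iff) auto
  moreover have "((\<lambda>R. (l2n (\<lambda>\<xi>. FI (trunc R f) \<xi> - F \<xi>))\<^sup>2) \<longlongrightarrow> 0) at_top
      \<longleftrightarrow> ((\<lambda>R. l2n (\<lambda>\<xi>. FI (trunc R f) \<xi> - F \<xi>)) \<longlongrightarrow> 0) at_top"
  proof
    assume "((\<lambda>R. (l2n (\<lambda>\<xi>. FI (trunc R f) \<xi> - F \<xi>))\<^sup>2) \<longlongrightarrow> 0) at_top"
    from tendsto_real_sqrt[OF this] show "((\<lambda>R. l2n (\<lambda>\<xi>. FI (trunc R f) \<xi> - F \<xi>)) \<longlongrightarrow> 0) at_top" by simp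
  next
    assume "((\<lambda>R. l2n (\<lambda>\<xi>. FI (trunc R f) \<xi> - F \<xi>)) \<longlongrightarrow> 0) at_top"
    from tendsto_power[OF this, of 2] show "((\<lambda>R. (l2n (\<lambda>\<xi>. FI (trunc R f) \<xi> - F \<xi>))\<^sup>2) \<longlongrightarrow> 0) at_top" by simp
  qed
  ultimately show ?thesis using True unfolding has_fourier_transform_def eq by simp
next
  case False then show ?thesis by (auto simp: has_fourier_transform_def)
qed

lemma hft_L2: assumes "hft f F" shows "f \<in> L2" "F \<in> L2"
  using assms by (auto simp: hft_iff)

lemma hft_lim: "hft f F \<Longrightarrow> ((\<lambda>R. l2n (\<lambda>\<xi>. FI (trunc R f) \<xi> - F \<xi>)) \<longlongrightarrow> 0) at_top"
  by (simp add: hft_iff)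

lemma trunc_add: "trunc R (\<lambda>x. f x + g x) = (\<lambda>x. trunc R f x + trunc R g x)"
  by (auto simp: trunc_def distrib_left)

lemma hft_norm: assumes "hft f F" shows "l2n F = KF * l2n f"
proof -
  note L = hft_L2[OF assms]
  have "((\<lambda>R. l2n (FI (trunc R f))) \<longlongrightarrow> l2n F) at_top"
    by (rule l2n_tendsto[OF FT_L2[OF L(1)] L(2) hft_lim[OF assms]])
  moreover have "((\<lambda>R. l2n (FI (trunc R f))) \<longlongrightarrow> KF * l2n f) at_top"
    unfolding FT_norm[OF L(1)] by (intro tendsto_intros l2n_tendsto[OF trunc_L2[OF L(1)] L(1) trunc_tendsto[OF L(1)]])
  ultimately show ?thesis by (rule tendsto_unique[rotated]) simp
qed

text \<open>By Plancherel the transforms of truncations are as close as the truncations, up to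
  \<open>KF\<close>, hence Cauchy. The limit is taken along integer radii and then compared with
  real radii.\<close>

lemma hft_exists: assumes f: "f \<in> L2" shows "\<exists>F. hft f F"
proof -
  have d: "l2n (\<lambda>\<xi>. FI (trunc R f) \<xi> - FI (trunc S f) \<xi>) = KF * l2n (\<lambda>x. trunc R f x - trunc S f x)" for R S
  proof -
    have "FI (\<lambda>x. trunc R f x - trunc S f x) = (\<lambda>\<xi>. FI (trunc R f) \<xi> - FI (trunc S f) \<xi>)"
      by (intro ext FI_diff trunc_integrable f)
    then show ?thesis
      using plancherel_L1(2)[of "\<lambda>x. trunc R f x - trunc S f x"] trunc_integrable[OF f] trunc_L2[OF f]
      by (simp add: L2_diff)
  qed
  have "\<exists>F\<in>L2. \<exists>r::nat\<Rightarrow>nat. strict_mono r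
      \<and> (\<lambda>n. l2n (\<lambda>x. FI (trunc (real n) f) x - F x)) \<longlonglongrightarrow> 0
      \<and> (AE x in lborel. (\<lambda>n. FI (trunc (real (r n)) f) x) \<longlonglongrightarrow> F x)"
  proof (rule L2_complete[OF FT_L2[OF f]])
    fix e :: real assume "e > 0"
    have "((\<lambda>n. l2n (\<lambda>x. trunc (real n) f x - f x)) \<longlonglongrightarrow> 0)"
      by (rule filterlim_compose[OF trunc_tendsto[OF f] filterlim_real_sequentially])
    then obtain N where N: "\<And>n. n \<ge> N \<Longrightarrow> l2n (\<lambda>x. trunc (real n) f x - f x) < e / KF / 2"
      using LIMSEQ_D[of _ 0 "e / KF / 2"] \<open>e > 0\<close> KF_pos by fastforce
    have "l2n (\<lambda>x. FI (trunc (real m) f) x - FI (trunc (real n) f) x) \<le> e" if "m \<ge> N" "n \<ge> N" for m n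
    proof -
      have "l2n (\<lambda>x. trunc (real m) f x - trunc (real n) f x) \<le> l2n (\<lambda>x. trunc (real m) f x - f x) + l2n (\<lambda>x. f x - trunc (real n) f x)"
        by (intro l2n_dist_triangle trunc_L2 f)
      also have "\<dots> \<le> e / KF" using N[OF that(1)] N[OF that(2)] l2n_diff_sym[of f "trunc (real n) f"] by simp
      finally have "KF * l2n (\<lambda>x. trunc (real m) f x - trunc (real n) f x) \<le> KF * (e / KF)"
        by (intro mult_left_mono) auto
      then show ?thesis unfolding d by simp
    qed
    then show "\<exists>N. \<forall>m\<ge>N. \<forall>n\<ge>N. l2n (\<lambda>x. FI (trunc (real m) f) x - FI (trunc (real n) f) x) \<le> e" by blast
  qed
  then obtain F where F: "F \<in> L2" "(\<lambda>n. l2n (\<lambda>x. FI (trunc (real n) f) x - F x)) \<longlonglongrightarrow> 0" by blast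
  have "((\<lambda>R. l2n (\<lambda>\<xi>. FI (trunc R f) \<xi> - F \<xi>)) \<longlongrightarrow> 0) at_top"
  proof (rule tendstoI)
    fix e :: real assume "e > 0"
    have "\<forall>\<^sub>F R in at_top. l2n (\<lambda>x. trunc R f x - f x) < e / KF / 4"
      by (rule order_tendstoD[OF trunc_tendsto[OF f]]) (use \<open>e > 0\<close> KF_pos in simp)
    then obtain R0 where R0: "\<And>R. R \<ge> R0 \<Longrightarrow> l2n (\<lambda>x. trunc R f x - f x) < e / KF / 4"
      by (auto simp: eventually_at_top_linorder)
    obtain N where N: "\<And>n. n \<ge> N \<Longrightarrow> l2n (\<lambda>x. FI (trunc (real n) f) x - F x) < e / 2"
      using LIMSEQ_D[OF F(2), of "e/2"] \<open>e > 0\<close> by auto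
    define n where "n = max N (nat \<lceil>R0\<rceil>)"
    have n: "n \<ge> N" "real n \<ge> R0" unfolding n_def by (auto simp: le_nat_iff) linarith
    have "l2n (\<lambda>\<xi>. FI (trunc R f) \<xi> - F \<xi>) < e" if R: "R \<ge> R0" for R
    proof -
      have "l2n (\<lambda>\<xi>. FI (trunc R f) \<xi> - F \<xi>) \<le> l2n (\<lambda>\<xi>. FI (trunc R f) \<xi> - FI (trunc (real n) f) \<xi>)
          + l2n (\<lambda>\<xi>. FI (trunc (real n) f) \<xi> - F \<xi>)"
        by (intro l2n_dist_triangle FT_L2 f F)
      moreover have "l2n (\<lambda>x. trunc R f x - trunc (real n) f x) \<le> l2n (\<lambda>x. trunc R f x - f x) + l2n (\<lambda>x. f x - trunc (real n) f x)"
        by (intro l2n_dist_triangle trunc_L2 f)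
      moreover have "\<dots> \<le> e / KF / 2" using R0[OF R] R0[OF n(2)] l2n_diff_sym[of f "trunc (real n) f"] by simp
      ultimately have "KF * l2n (\<lambda>x. trunc R f x - trunc (real n) f x) \<le> KF * (e / KF / 2)"
        by (intro mult_left_mono) auto
      then show ?thesis unfolding d using N[OF n(1)] d[of R n] \<open>l2n (\<lambda>\<xi>. FI (trunc R f) \<xi> - F \<xi>) \<le> _\<close> by simp
    qed
    then show "\<forall>\<^sub>F R in at_top. dist (l2n (\<lambda>\<xi>. FI (trunc R f) \<xi> - F \<xi>)) 0 < e"
      by (auto simp: eventually_at_top_linorder)
  qed
  then show ?thesis using f F by (auto simp: hft_iff)
qed

lemma hft_add: assumes "hft f F" "hft g G" shows "hft (\<lambda>x. f x + g x) (\<lambda>x. F x + G x)"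
proof -
  note L = hft_L2[OF assms(1)] hft_L2[OF assms(2)]
  have eq: "FI (trunc R (\<lambda>x. f x + g x)) \<xi> - (F \<xi> + G \<xi>) = (FI (trunc R f) \<xi> - F \<xi>) + (FI (trunc R g) \<xi> - G \<xi>)" for R \<xi>
    using L by (simp add: trunc_add FI_add trunc_integrable)
  have "((\<lambda>R. l2n (\<lambda>\<xi>. FI (trunc R (\<lambda>x. f x + g x)) \<xi> - (F \<xi> + G \<xi>))) \<longlongrightarrow> 0) at_top"
  proof (rule Lim_null_comparison)
    show "\<forall>\<^sub>F R in at_top. norm (l2n (\<lambda>\<xi>. FI (trunc R (\<lambda>x. f x + g x)) \<xi> - (F \<xi> + G \<xi>)))
        \<le> l2n (\<lambda>\<xi>. FI (trunc R f) \<xi> - F \<xi>) + l2n (\<lambda>\<xi>. FI (trunc R g) \<xi> - G \<xi>)"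
      unfolding eq using L by (intro always_eventually allI) (simp add: l2n_triangle L2_diff FT_L2)
    show "((\<lambda>R. l2n (\<lambda>\<xi>. FI (trunc R f) \<xi> - F \<xi>) + l2n (\<lambda>\<xi>. FI (trunc R g) \<xi> - G \<xi>)) \<longlongrightarrow> 0) at_top"
      using tendsto_add[OF hft_lim[OF assms(1)] hft_lim[OF assms(2)]] by simp
  qed
  then show ?thesis using L by (auto simp: hft_iff L2_add)
qed

lemma hft_scale: assumes "hft f F" shows "hft (\<lambda>x. c * f x) (\<lambda>x. c * F x)"
proof -
  note L = hft_L2[OF assms(1)]
  have t: "trunc R (\<lambda>x. c * f x) = (\<lambda>x. c * trunc R f x)" for R by (auto simp: trunc_def)
  have eq: "FI (trunc R (\<lambda>x. c * f x)) \<xi> - c * F \<xi> = c * (FI (trunc R f) \<xi> - F \<xi>)" for R \<xi>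
    by (simp add: t FI_scale right_diff_distrib)
  have "((\<lambda>R. norm c * l2n (\<lambda>\<xi>. FI (trunc R f) \<xi> - F \<xi>)) \<longlongrightarrow> norm c * 0) at_top"
    by (intro tendsto_intros hft_lim assms)
  then show ?thesis using L by (auto simp: hft_iff L2_scale eq l2n_scale)
qed

lemma hft_diff: assumes "hft f F" "hft g G" shows "hft (\<lambda>x. f x - g x) (\<lambda>x. F x - G x)"
  using hft_add[OF assms(1) hft_scale[OF assms(2), of "-1"]] by simp

lemma hft_unique: assumes "hft f F" "hft f G" shows "AE x in lborel. F x = G x"
proof -
  have "l2n (\<lambda>x. F x - G x) = 0" using hft_norm[OF hft_diff[OF assms]] by (simp add: l2n_def)
  then have "AE x in lborel. F x - G x = 0" using hft_L2 assms by (intro l2n_zero_AE L2_diff) auto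
  then show ?thesis by simp
qed

lemma hft_inj: assumes "hft f F" "hft g F" shows "AE x in lborel. f x = g x"
proof -
  have "KF * l2n (\<lambda>x. f x - g x) = 0" using hft_norm[OF hft_diff[OF assms]] by (simp add: l2n_def)
  then have "l2n (\<lambda>x. f x - g x) = 0" by simp
  then have "AE x in lborel. f x - g x = 0" using hft_L2 assms by (intro l2n_zero_AE L2_diff) auto
  then show ?thesis by simp
qed

lemma hft_cong: assumes "hft f F" and G: "G \<in> borel_measurable borel" and ae: "AE x in lborel. F x = G x"
  shows "hft f G"
proof -
  note L = hft_L2[OF assms(1)]
  note [measurable] = L2_meas[OF L(1)] L2_meas[OF L(2)] G
  have GL: "G \<in> L2" by (rule L2_AE[OF L(2) G ae])
  have "l2n (\<lambda>\<xi>. FI (trunc R f) \<xi> - F \<xi>) = l2n (\<lambda>\<xi>. FI (trunc R f) \<xi> - G \<xi>)" for R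
    by (rule l2n_AE) (use ae L2_meas[OF FT_L2[OF L(1)]] in auto)
  then show ?thesis using hft_lim[OF assms(1)] L GL by (simp add: hft_iff)
qed

lemma hft_multiplication: assumes "hft f F" "hft g G"
  shows "(LINT x|lborel. F x * g x) = (LINT x|lborel. f x * G x)"
proof -
  note L = hft_L2[OF assms(1)] hft_L2[OF assms(2)]
  have 1: "((\<lambda>R. LINT x|lborel. FI (trunc R f) x * trunc R g x) \<longlongrightarrow> (LINT x|lborel. F x * g x)) at_top"
    by (intro L2_int_mult_tendsto FT_L2 trunc_L2 L hft_lim[OF assms(1)] trunc_tendsto)
  have 2: "((\<lambda>R. LINT x|lborel. trunc R f x * FI (trunc R g) x) \<longlongrightarrow> (LINT x|lborel. f x * G x)) at_top"
    by (intro L2_int_mult_tendsto FT_L2 trunc_L2 L hft_lim[OF assms(2)] trunc_tendsto)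
  have "(LINT x|lborel. FI (trunc R f) x * trunc R g x) = (LINT x|lborel. trunc R f x * FI (trunc R g) x)" for R
    using L by (intro FI_multiplication trunc_integrable)
  then show ?thesis using 1 2 tendsto_unique[OF _ 1] by simp
qed

text \<open>The transform is an isometry up to a factor and symmetric for the bilinear pairing
  \<open>\<integral> f g\<close>; these two facts already force it to be onto.\<close>

lemma hft_surj: assumes G: "G \<in> L2" shows "\<exists>g. hft g G"
proof -
  obtain H where H: "hft (\<lambda>x. cnj (G x)) H" using hft_exists[OF L2_cnj[OF G]] by blast
  note HL = hft_L2(2)[OF H]
  define k where "k = 1 / (2 * pi)^3"
  have KF2: "KF * KF = (2 * pi)^3" by simp
  have kK: "k * (KF * KF) = 1" unfolding KF2 by (simp add: k_def)
  have k0: "k > 0" by (simp add: k_def)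
  \<comment> \<open>The expected preimage: inversion is the transform conjugated on both sides,
    divided by \<open>KF^2 = (2 * pi)^3\<close>. Its transform \<open>G'\<close> has the norm of
    \<open>G\<close> and pairs with \<open>G\<close> to the squared norm, so the expansion of the
    squared norm of \<open>G' - G\<close> vanishes.\<close>
  define g where "g x = of_real k * cnj (H x)" for x
  have gL: "g \<in> L2" unfolding g_def by (intro L2_scale L2_cnj HL)
  obtain G' where G': "hft g G'" using hft_exists[OF gL] by blast
  note GL' = hft_L2(2)[OF G']
  have Hn: "l2n H = KF * l2n G" using hft_norm[OF H] by (simp add: l2n_cnj)
  have "g = (\<lambda>x. of_real k * cnj (H x))" by (simp add: g_def fun_eq_iff)
  then have "l2n g = k * l2n H" using k0 by (simp add: l2n_scale l2n_cnj)
  then have "l2n G' = KF * (k * l2n H)" using hft_norm[OF G'] by simp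
  also have "\<dots> = (k * (KF * KF)) * l2n G" unfolding Hn by (simp only: mult_ac)
  finally have G'n: "l2n G' = l2n G" unfolding kK by simp
  have "ip G' G = Re (LINT x|lborel. G' x * cnj (G x))" by (simp add: ip_def)
  also have "(LINT x|lborel. G' x * cnj (G x)) = (LINT x|lborel. g x * H x)"
    by (rule hft_multiplication[OF G' H])
  also have "\<dots> = (LINT x|lborel. of_real k * (H x * cnj (H x)))"
    by (simp add: g_def mult_ac)
  also have "\<dots> = of_real k * (LINT x|lborel. H x * cnj (H x))" by (rule integral_mult_right_zero)
  also have "Re \<dots> = k * ip H H" by (simp add: ip_def)
  also have "\<dots> = (k * (KF * KF)) * (l2n G)\<^sup>2" unfolding ip_self Hn power2_eq_square by (simp only: mult_ac)
  finally have "ip G' G = (l2n G)\<^sup>2" unfolding kK by simp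
  then have "(l2n (\<lambda>x. G' x - G x))\<^sup>2 = 0" by (simp add: l2n_diff_sq GL' G G'n)
  then have "AE x in lborel. G' x - G x = 0" by (intro l2n_zero_AE L2_diff GL' G) simp
  then have "AE x in lborel. G' x = G x" by simp
  from hft_cong[OF G' L2_meas[OF G] this] show ?thesis by blast
qed

text \<open>Polarisation of \<open>hft_norm\<close>.\<close>

lemma hft_ip: assumes "hft f F" "hft g G" shows "ip F G = KF\<^sup>2 * ip f g"
proof -
  note L = hft_L2[OF assms(1)] hft_L2[OF assms(2)]
  have "(l2n (\<lambda>x. F x + G x))\<^sup>2 = KF\<^sup>2 * (l2n (\<lambda>x. f x + g x))\<^sup>2"
    by (simp only: hft_norm[OF hft_add[OF assms]] power_mult_distrib)
  then have "(l2n F)\<^sup>2 + 2 * ip F G + (l2n G)\<^sup>2 = KF\<^sup>2 * ((l2n f)\<^sup>2 + 2 * ip f g + (l2n g)\<^sup>2)"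
    by (simp only: l2n_add_sq L)
  then show ?thesis unfolding hft_norm[OF assms(1)] hft_norm[OF assms(2)] power_mult_distrib distrib_left by linarith
qed

text \<open>The reflection in frequency is the reason why evenness of a real symbol makes its
  multiplier commute with conjugation.\<close>

lemma hft_cnj: assumes "hft f F" shows "hft (\<lambda>x. cnj (f x)) (\<lambda>\<xi>. cnj (F (- \<xi>)))"
proof -
  note L = hft_L2[OF assms]
  have t: "trunc R (\<lambda>x. cnj (f x)) = (\<lambda>x. cnj (trunc R f x))" for R by (auto simp: trunc_def indicator_def)
  have "l2n (\<lambda>\<xi>. FI (trunc R (\<lambda>x. cnj (f x))) \<xi> - cnj (F (- \<xi>))) = l2n (\<lambda>\<xi>. FI (trunc R f) \<xi> - F \<xi>)" for R
  proof -
    have "l2n (\<lambda>\<xi>. FI (trunc R (\<lambda>x. cnj (f x))) \<xi> - cnj (F (- \<xi>))) = l2n (\<lambda>\<xi>. cnj (FI (trunc R f) (- \<xi>) - F (- \<xi>)))"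
      by (simp add: t FI_cnj)
    also have "\<dots> = l2n (\<lambda>\<xi>. FI (trunc R f) (- \<xi>) - F (- \<xi>))" by (rule l2n_cnj)
    also have "\<dots> = l2n (\<lambda>\<xi>. FI (trunc R f) \<xi> - F \<xi>)"
      using L2_affine(2)[OF L2_diff[OF FT_L2[OF L(1)] L(2)], of "-1" R 0] by simp
    finally show ?thesis .
  qed
  then show ?thesis using hft_lim[OF assms] L2_cnj[OF L(1)] L2_cnj[OF L2_affine(1)[OF L(2), of "-1" 0]] by (simp add: hft_iff)
qed

text \<open>A dilation turns truncation at radius \<open>R\<close> into truncation at radius
  \<open>c * R\<close>, so convergence for the dilated function is convergence for \<open>f\<close>
  along rescaled radii.\<close>

lemma hft_dilation: assumes "hft f F" and c: "c > 0"
  shows "hft (\<lambda>x. f (c *\<^sub>R x)) (\<lambda>\<xi>. of_real (1 / c^3) * F ((1 / c) *\<^sub>R \<xi>))"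
proof -
  note L = hft_L2[OF assms(1)]
  note [measurable] = L2_meas[OF L(1)] L2_meas[OF L(2)]
  have FIeq: "FI (trunc R (\<lambda>x. f (c *\<^sub>R x))) \<xi> = of_real (1 / c^3) * FI (trunc (c * R) f) ((1/c) *\<^sub>R \<xi>)" for R \<xi>
  proof -
    have ind: "indicator (cball 0 R) x = (indicator (cball 0 (c * R)) (c *\<^sub>R x) :: complex)" for x :: "real^3"
      using c by (auto simp: indicator_def)
    have "FI (trunc R (\<lambda>x. f (c *\<^sub>R x))) \<xi> = (LINT x|lborel. cis (- (((1/c) *\<^sub>R \<xi>) \<bullet> (0
        + c *\<^sub>R x))) * trunc (c * R) f (0 + c *\<^sub>R x))"
      unfolding FI_def trunc_def ind using c by (intro Bochner_Integration.integral_cong) auto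
    also have "\<dots> = (1 / \<bar>c\<bar>^3) *\<^sub>R FI (trunc (c * R) f) ((1/c) *\<^sub>R \<xi>)"
      unfolding FI_def
    proof (rule integral_affine)
      show "(\<lambda>x. cis (- ((1 / c) *\<^sub>R \<xi> \<bullet> x)) * trunc (c * R) f x) \<in> borel_measurable borel"
        by (rule borel_measurable_times[OF _ L2_meas[OF trunc_L2[OF L(1)]]]) measurable
    qed (use c in auto)
    finally show ?thesis using c by (simp add: scaleR_conv_of_real[of _ "_ :: complex"])
  qed
  have "l2n (\<lambda>\<xi>. FI (trunc R (\<lambda>x. f (c *\<^sub>R x))) \<xi> - of_real (1 / c^3) * F ((1 / c) *\<^sub>R \<xi>))
      = 1/c^3 * (sqrt (1 / \<bar>1/c\<bar>^3) * l2n (\<lambda>\<xi>. FI (trunc (c * R) f) \<xi> - F \<xi>))" for R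
  proof -
    have "l2n (\<lambda>\<xi>. FI (trunc R (\<lambda>x. f (c *\<^sub>R x))) \<xi> - of_real (1 / c^3) * F ((1 / c) *\<^sub>R \<xi>))
        = l2n (\<lambda>\<xi>. of_real (1 / c^3) * (FI (trunc (c * R) f) (0 + (1/c) *\<^sub>R \<xi>) - F (0 + (1 / c) *\<^sub>R \<xi>)))"
      unfolding FIeq by (simp add: right_diff_distrib)
    also have "\<dots> = 1/c^3 * l2n (\<lambda>\<xi>. FI (trunc (c * R) f) (0 + (1/c) *\<^sub>R \<xi>) - F (0 + (1 / c) *\<^sub>R \<xi>))"
      unfolding l2n_scale using c by (simp add: norm_divide norm_power)
    also have "l2n (\<lambda>\<xi>. FI (trunc (c * R) f) (0 + (1/c) *\<^sub>R \<xi>) - F (0 + (1 / c) *\<^sub>R \<xi>))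
        = sqrt (1 / \<bar>1/c\<bar>^3) * l2n (\<lambda>\<xi>. FI (trunc (c * R) f) \<xi> - F \<xi>)"
      by (rule L2_affine(2)[OF L2_diff[OF FT_L2[OF L(1)] L(2)]]) (use c in auto)
    finally show ?thesis .
  qed
  moreover have "((\<lambda>R. 1/c^3 * (sqrt (1 / \<bar>1/c\<bar>^3) * l2n (\<lambda>\<xi>. FI (trunc (c * R) f) \<xi> - F \<xi>)))
      \<longlongrightarrow> 1/c^3 * (sqrt (1 / \<bar>1/c\<bar>^3) * 0)) at_top"
  proof (intro tendsto_intros)
    have "filterlim (\<lambda>R. c * R) at_top at_top"
      by (rule filterlim_tendsto_pos_mult_at_top[OF tendsto_const c filterlim_ident])
    from filterlim_compose[OF hft_lim[OF assms(1)] this]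
    show "((\<lambda>R. l2n (\<lambda>\<xi>. FI (trunc (c * R) f) \<xi> - F \<xi>)) \<longlongrightarrow> 0) at_top" .
  qed
  ultimately show ?thesis
    using L2_affine(1)[OF L(1), of c 0] L2_scale[OF L2_affine(1)[OF L(2), of "1/c" 0], of "of_real (1 / c^3)"] c by (simp add: hft_iff)
qed

subsection \<open>Real Fourier multipliers\<close>

text \<open>A relation in place of \<open>fourier_multiplier\<close>, whose value is a choice: facts
  are proved for every image and reach the chosen one through uniqueness almost everywhere.\<close>

definition is_multiplier_image :: "(real ^ 3 \<Rightarrow> real) \<Rightarrow> (real ^ 3 \<Rightarrow> complex) \<Rightarrow> (real ^ 3 \<Rightarrow>
    complex) \<Rightarrow> bool" where
  "is_multiplier_image m f g \<longleftrightarrow> (\<exists>F. hft f F \<and> hft g (\<lambda>\<xi>. of_real (m \<xi>) * F \<xi>))"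

text \<open>The choice in \<open>fourier_multiplier\<close> is meaningful only if some image exists;
  \<open>hft_surj\<close> supplies one.\<close>

lemma multiplier_image:
  assumes f: "f \<in> L2" and m: "m \<in> borel_measurable borel" and b: "\<And>x. \<bar>m x\<bar> \<le> B"
  shows "is_multiplier_image m f (fourier_multiplier (\<lambda>\<xi>. of_real (m \<xi>)) f)"
proof -
  obtain F where F: "hft f F" using hft_exists[OF f] by blast
  have "(\<lambda>\<xi>. of_real (m \<xi>) * F \<xi>) \<in> L2"
    by (rule L2_mult_bounded(1)[where B=B, OF hft_L2(2)[OF F]]) (use m b in auto)
  then obtain g where "hft g (\<lambda>\<xi>. of_real (m \<xi>) * F \<xi>)" using hft_surj by blast
  with F have "\<exists>g F. hft f F \<and> hft g (\<lambda>\<xi>. of_real (m \<xi>) * F \<xi>)" by blast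
  then show ?thesis unfolding is_multiplier_image_def fourier_multiplier_def by (rule someI_ex)
qed

lemma multiplier_image_L2: "is_multiplier_image m f g \<Longrightarrow> f \<in> L2" "is_multiplier_image m f g \<Longrightarrow> g \<in> L2"
  by (auto simp: is_multiplier_image_def dest: hft_L2)

lemma multiplier_image_at:
  assumes "is_multiplier_image m f g" "hft f F" and m[measurable]: "m \<in> borel_measurable borel"
  shows "hft g (\<lambda>\<xi>. of_real (m \<xi>) * F \<xi>)"
proof -
  obtain F' where F': "hft f F'" "hft g (\<lambda>\<xi>. of_real (m \<xi>) * F' \<xi>)" using assms(1) by (auto simp: is_multiplier_image_def)
  note [measurable] = L2_meas[OF hft_L2(2)[OF assms(2)]]
  show ?thesis by (rule hft_cong[OF F'(2)]) (use hft_unique[OF F'(1) assms(2)] in auto)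
qed

lemma multiplier_image_unique:
  assumes "is_multiplier_image m f g" "is_multiplier_image m f h" "m \<in> borel_measurable borel"
  shows "AE x in lborel. g x = h x"
proof -
  obtain F where F: "hft f F" using hft_exists multiplier_image_L2(1)[OF assms(1)] by blast
  show ?thesis using multiplier_image_at[OF assms(1) F assms(3)] multiplier_image_at[OF assms(2) F assms(3)] by (rule hft_inj)
qed

lemma multiplier_image_bound:
  assumes "is_multiplier_image m f g" and m: "m \<in> borel_measurable borel" and b: "\<And>x. \<bar>m x\<bar> \<le> B"
  shows "l2n g \<le> B * l2n f"
proof -
  obtain F where F: "hft f F" "hft g (\<lambda>\<xi>. of_real (m \<xi>) * F \<xi>)" using assms(1) by (auto simp: is_multiplier_image_def)
  have "KF * l2n g = l2n (\<lambda>\<xi>. of_real (m \<xi>) * F \<xi>)" using hft_norm[OF F(2)] by simp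
  also have "\<dots> \<le> B * l2n F"
    by (rule L2_mult_bounded(2)[OF hft_L2(2)[OF F(1)]]) (use m b in auto)
  also have "\<dots> = KF * (B * l2n f)" unfolding hft_norm[OF F(1)] by (simp only: mult_ac)
  finally show ?thesis by (rule mult_left_le_imp_le) (rule KF_pos)
qed

text \<open>A real symbol may be moved across the inner product on the frequency side.\<close>

lemma multiplier_image_symmetric:
  assumes "is_multiplier_image m f g" "is_multiplier_image m f' g'"
  shows "ip g f' = ip f g'"
proof -
  obtain F where F: "hft f F" "hft g (\<lambda>\<xi>. of_real (m \<xi>) * F \<xi>)" using assms(1) by (auto simp: is_multiplier_image_def)
  obtain F' where F': "hft f' F'" "hft g' (\<lambda>\<xi>. of_real (m \<xi>) * F' \<xi>)" using assms(2) by (auto simp: is_multiplier_image_def)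
  have "KF\<^sup>2 * ip g f' = ip (\<lambda>\<xi>. of_real (m \<xi>) * F \<xi>) F'" by (simp only: hft_ip[OF F(2) F'(1)])
  also have "\<dots> = ip F (\<lambda>\<xi>. of_real (m \<xi>) * F' \<xi>)" by (simp add: ip_def mult_ac)
  also have "\<dots> = KF\<^sup>2 * ip f g'" by (simp only: hft_ip[OF F(1) F'(2)])
  finally have "KF\<^sup>2 * ip g f' = KF\<^sup>2 * ip f g'" .
  moreover have "KF\<^sup>2 \<noteq> 0" using KF_pos by (metis less_irrefl zero_eq_power2)
  ultimately show ?thesis by (simp only: mult_cancel_left) blast
qed

lemma multiplier_image_cnj:
  assumes "is_multiplier_image m f g" and even: "\<And>x. m (- x) = m x"
  shows "is_multiplier_image m (\<lambda>x. cnj (f x)) (\<lambda>x. cnj (g x))"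
proof -
  obtain F where F: "hft f F" "hft g (\<lambda>\<xi>. of_real (m \<xi>) * F \<xi>)" using assms(1) by (auto simp: is_multiplier_image_def)
  show ?thesis using hft_cnj[OF F(1)] hft_cnj[OF F(2)] unfolding is_multiplier_image_def by (auto simp: even)
qed

text \<open>Dilation in space is the inverse dilation in frequency, which a symbol homogeneous of
  degree 0 does not see.\<close>

lemma multiplier_image_dilation:
  assumes "is_multiplier_image m f g" and hom: "\<And>c x. c > 0 \<Longrightarrow> m (c *\<^sub>R x) = m x" and c: "c > 0"
  shows "is_multiplier_image m (\<lambda>x. f (c *\<^sub>R x)) (\<lambda>x. g (c *\<^sub>R x))"
proof -
  obtain F where F: "hft f F" "hft g (\<lambda>\<xi>. of_real (m \<xi>) * F \<xi>)" using assms(1) by (auto simp: is_multiplier_image_def)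
  have "m ((1 / c) *\<^sub>R \<xi>) = m \<xi>" for \<xi> using hom[of "1/c"] c by simp
  then show ?thesis using hft_dilation[OF F(1) c] hft_dilation[OF F(2) c] unfolding is_multiplier_image_def by (auto simp: mult_ac)
qed

subsection \<open>Test functions\<close>

abbreviation "kd \<equiv> k_times_cont_diff"

lemma partial_eq: "(f has_derivative f') (at x) \<Longrightarrow> partial i f x = f' (axis i 1)"
  unfolding partial_def using frechet_derivative_at[of f f' x] by simp

lemma kd_continuous: "kd k f \<Longrightarrow> continuous_on UNIV f"
proof (cases k)
  case (Suc n)
  assume "kd k f"
  with Suc have "\<forall>x. f differentiable (at x)" by simp
  then show ?thesis by (auto intro!: continuous_at_imp_continuous_on differentiable_imp_continuous_within)
qed simp

lemma kd_Suc_imp: "kd (Suc k) f \<Longrightarrow> kd k f"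
proof (induction k arbitrary: f)
  case 0
  then show ?case using kd_continuous[OF 0] by simp
next
  case (Suc k)
  from Suc.prems have d: "\<forall>x. f differentiable at x" and p: "\<forall>i. kd (Suc k) (partial i f)"
    unfolding k_times_cont_diff.simps(2)[of "Suc k"] by auto
  from p Suc.IH have "\<forall>i. kd k (partial i f)" by blast
  with d show ?case by simp
qed

lemma partial_has_derivative: "f differentiable (at x) \<Longrightarrow> (f has_derivative frechet_derivative f (at x)) (at x)"
  by (simp add: frechet_derivative_works)

lemma kd_const: "kd k (\<lambda>x. c)"
proof (induction k arbitrary: c)
  case (Suc k)
  have "partial i (\<lambda>x. c) = (\<lambda>x. 0)" for i
    by (rule ext, subst partial_eq[OF has_derivative_const]) simp
  then show ?case using Suc by (auto simp: continuous_on_const)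
qed simp

lemma partial_add: "f differentiable (at x) \<Longrightarrow> g differentiable (at x) \<Longrightarrow> partial i (\<lambda>x. f x + g x) x
    = partial i f x + partial i g x"
  by (subst partial_eq[OF has_derivative_add[OF partial_has_derivative partial_has_derivative]]) (auto simp: partial_def)

lemma partial_mult: "f differentiable (at x) \<Longrightarrow> g differentiable (at x) \<Longrightarrow> partial i (\<lambda>x. f x * g x) x
    = f x * partial i g x + partial i f x * g x"
  by (subst partial_eq[OF has_derivative_mult[OF partial_has_derivative partial_has_derivative]]) (auto simp: partial_def)

lemma kd_add: "kd k f \<Longrightarrow> kd k g \<Longrightarrow> kd k (\<lambda>x. f x + g x)"
proof (induction k arbitrary: f g)
  case (Suc k)
  then have "partial i (\<lambda>x. f x + g x) = (\<lambda>x. partial i f x + partial i g x)" for i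
    by (intro ext partial_add) auto
  with Suc show ?case by auto
qed (auto intro: continuous_on_add)

lemma kd_mult: "kd k f \<Longrightarrow> kd k g \<Longrightarrow> kd k (\<lambda>x. f x * g x)"
proof (induction k arbitrary: f g)
  case (Suc k)
  then have "partial i (\<lambda>x. f x * g x) = (\<lambda>x. f x * partial i g x + partial i f x * g x)" for i
    by (intro ext partial_mult) auto
  moreover have "kd k f" "kd k g" using Suc kd_Suc_imp by blast+
  ultimately show ?case using Suc by (auto intro!: kd_add)
qed (auto intro: continuous_on_mult)

text \<open>A smooth function of one variable is given with the whole tower \<open>F\<close> of its
  derivatives. Differentiating \<open>F n (g x)\<close> produces \<open>F (Suc n) (g x)\<close>, so
  the induction runs over all \<open>n\<close> at once.\<close>

lemma kd_chain:
  assumes F: "\<And>n t. (F n has_real_derivative F (Suc n) t) (at t)"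
  shows "kd k g \<Longrightarrow> kd k (\<lambda>x. F n (g x))"
proof (induction k arbitrary: n)
  case 0
  have "continuous_on UNIV (F n)"
    using F DERIV_continuous by (blast intro: continuous_at_imp_continuous_on)
  then show ?case using 0 by (auto intro: continuous_on_compose2)
next
  case (Suc k)
  have der: "((\<lambda>x. F n (g x)) has_derivative (\<lambda>h. frechet_derivative g (at x) h * F (Suc n) (g x))) (at x)" for x
    using Suc.prems by (intro has_derivative_in_compose2[of UNIV "F n" "\<lambda>y h. h * F (Suc n) y" g UNIV x, simplified] partial_has_derivative)
       (use F in \<open>auto simp: has_field_derivative_def mult_commute_abs\<close>)
  then have "partial i (\<lambda>x. F n (g x)) = (\<lambda>x. partial i g x * F (Suc n) (g x))" for i
    by (intro ext) (simp add: partial_eq[OF der] partial_def)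
  moreover have "(\<lambda>x. F n (g x)) differentiable (at x)" for x using der by (auto simp: differentiable_def)
  moreover have "kd k (\<lambda>x. F (Suc n) (g x))" using Suc.IH Suc.prems kd_Suc_imp by blast
  ultimately show ?case using Suc.prems by (auto intro: kd_mult)
qed

lemma partial_affine:
  assumes "\<And>x. f differentiable (at x)"
  shows "((\<lambda>x. f (t + c *\<^sub>R x)) has_derivative (\<lambda>h. frechet_derivative f (at (t + c *\<^sub>R x)) (c *\<^sub>R h))) (at x)"
    "partial i (\<lambda>x. f (t + c *\<^sub>R x)) x = c * partial i f (t + c *\<^sub>R x)"
proof -
  have a: "((\<lambda>x. t + c *\<^sub>R x) has_derivative (\<lambda>h. c *\<^sub>R h)) (at x)"
    by (auto intro!: derivative_eq_intros)
  show d: "((\<lambda>x. f (t + c *\<^sub>R x)) has_derivative (\<lambda>h. frechet_derivative f (at (t + c *\<^sub>R x)) (c *\<^sub>R h))) (at x)"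
    by (rule has_derivative_compose[OF a partial_has_derivative[OF assms]])
  show "partial i (\<lambda>x. f (t + c *\<^sub>R x)) x = c * partial i f (t + c *\<^sub>R x)"
    by (subst partial_eq[OF d]) (simp add: partial_def linear_cmul[OF linear_frechet_derivative[OF assms]])
qed

lemma kd_affine: "kd k f \<Longrightarrow> kd k (\<lambda>x. f (t + c *\<^sub>R x))"
proof (induction k arbitrary: f)
  case 0 then show ?case by (auto intro!: continuous_on_compose2[of UNIV f] continuous_intros)
next
  case (Suc k)
  then have d: "\<And>x. f differentiable (at x)" by simp
  have "partial i (\<lambda>x. f (t + c *\<^sub>R x)) = (\<lambda>x. c * partial i f (t + c *\<^sub>R x))" for i
    by (rule ext) (rule partial_affine(2)[OF d])
  moreover have "(\<lambda>x. f (t + c *\<^sub>R x)) differentiable (at x)" for x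
    using partial_affine(1)[OF d] by (auto simp: differentiable_def)
  ultimately show ?case using Suc by (auto intro!: kd_mult kd_const)
qed

lemma partial_coord: "partial i (\<lambda>x. x $ j) x = (if i = j then 1 else 0)"
proof -
  have "((\<lambda>x::real^3. x $ j) has_derivative (\<lambda>x. x $ j)) (at x)"
    by (rule bounded_linear_imp_has_derivative) (rule bounded_linear_vec_nth)
  from partial_eq[OF this] show ?thesis by (simp add: axis_def)
qed

lemma coord_differentiable: "(\<lambda>x::real^3. x $ j) differentiable (at x)"
  by (rule bounded_linear_imp_differentiable) (rule bounded_linear_vec_nth)

lemma kd_coord: "kd k (\<lambda>x. x $ j)"
proof (cases k)
  case 0 then show ?thesis by (auto intro!: continuous_intros)
next
  case (Suc n)
  have "partial i (\<lambda>x. x $ j) = (\<lambda>x. if i = j then 1 else 0)" for i by (rule ext) (rule partial_coord)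
  then show ?thesis using Suc by (auto simp: coord_differentiable kd_const)
qed

section \<open>Flat functions and smooth cut-offs\<close>

text \<open>\<open>flat P t = P(1/t) exp(-1/t)\<close> for \<open>t > 0\<close>; this class of functions is closed under differentiation.\<close>

definition flat :: "real poly \<Rightarrow> real \<Rightarrow> real" where
  "flat P t = (if t > 0 then poly P (1 / t) * exp (- (1 / t)) else 0)"

lemma poly_exp_tendsto: "((\<lambda>s. poly P s * exp (- s)) \<longlongrightarrow> (0::real)) at_top"
proof -
  have "((\<lambda>s. \<Sum>i\<le>degree P. coeff P i * (s ^ i / exp s)) \<longlongrightarrow> (\<Sum>i\<le>degree P. coeff P i * 0)) at_top"
    by (intro tendsto_sum tendsto_mult_left tendsto_power_div_exp_0)
  moreover have "(\<Sum>i\<le>degree P. coeff P i * (s ^ i / exp s)) = poly P s * exp (- s)" for s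
    unfolding poly_altdef sum_distrib_right by (intro sum.cong refl) (simp add: exp_minus divide_inverse)
  ultimately show ?thesis by simp
qed

lemma flat_deriv: "(flat P has_real_derivative flat (monom 1 2 * (P - pderiv P)) t) (at t)"
proof -
  consider "t > 0" | "t < 0" | "t = 0" by linarith
  then show ?thesis
  proof cases
    case 1
    have "((\<lambda>t. poly P (1 / t) * exp (- (1 / t))) has_real_derivative flat (monom 1 2 * (P - pderiv P)) t) (at t)"
      using 1 by (auto intro!: derivative_eq_intros simp: flat_def poly_monom field_simps power2_eq_square)
    moreover have e: "\<forall>\<^sub>F s in nhds t. poly P (1 / s) * exp (- (1 / s)) = flat P s"
      using eventually_nhds_in_open[of "{0<..}" t] 1 by (auto simp: flat_def elim: eventually_mono)
    ultimately show ?thesis by (simp only: DERIV_cong_ev[OF refl e refl])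
  next
    case 2
    have e: "\<forall>\<^sub>F s in nhds t. 0 = flat P s"
      using eventually_nhds_in_open[of "{..<0}" t] 2 by (auto simp: flat_def elim: eventually_mono)
    moreover have "((\<lambda>t. 0) has_real_derivative flat (monom 1 2 * (P - pderiv P)) t) (at t)"
      using 2 by (simp add: flat_def)
    ultimately show ?thesis by (simp only: DERIV_cong_ev[OF refl e refl])
  next
    case 3
    \<comment> \<open>From the right the difference quotient is
      \<open>s * poly P s * exp (- s)\<close> with \<open>s = 1 / h\<close>, hence the polynomial
      \<open>pCons 0 P\<close>; from the left it is 0.\<close>
    have "((\<lambda>h. flat P h / h) \<longlongrightarrow> 0) (at_right 0)"
    proof -
      have "((\<lambda>h. poly (pCons 0 P) (inverse h) * exp (- inverse h)) \<longlongrightarrow> 0) (at_right 0)"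
        by (rule filterlim_compose[OF poly_exp_tendsto filterlim_inverse_at_top_right])
      moreover have "\<forall>\<^sub>F h in at_right 0. poly (pCons 0 P) (inverse h) * exp (- inverse h) = flat P h / h"
        by (rule eventually_at_rightI[of 0 1]) (auto simp: flat_def field_simps)
      ultimately show ?thesis by (rule Lim_transform_eventually)
    qed
    moreover have "((\<lambda>h. flat P h / h) \<longlongrightarrow> 0) (at_left 0)"
    proof (rule tendsto_eventually)
      show "\<forall>\<^sub>F h in at_left 0. flat P h / h = 0"
        by (rule eventually_at_leftI[of "-1"]) (auto simp: flat_def)
    qed
    ultimately have "((\<lambda>h. flat P h / h) \<longlongrightarrow> 0) (at 0)" by (simp add: filterlim_split_at)
    then show ?thesis using 3 by (simp add: DERIV_def flat_def[of _ 0])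
  qed
qed

text \<open>The polynomials in \<open>1 / t\<close> that multiply \<open>exp (- 1 / t)\<close> in
  its successive derivatives; they form the tower required by \<open>kd_chain\<close>.\<close>

primrec flat_poly :: "nat \<Rightarrow> real poly" where
  "flat_poly 0 = 1"
| "flat_poly (Suc n) = monom 1 2 * (flat_poly n - pderiv (flat_poly n))"

lemma kd_flat: "kd k g \<Longrightarrow> kd k (\<lambda>x. flat 1 (g x))"
  using kd_chain[of "\<lambda>n. flat (flat_poly n)" k g 0] flat_deriv by simp

lemma kd_one_minus_exp:
  assumes "kd k g" shows "kd k (\<lambda>x. 1 - exp (- (a * g x)))"
proof -
  define F where "F n t = (if n = 0 then 1 - exp (- (a * t)) else - ((- a) ^ n * exp (- (a * t))))" for n :: nat and t :: real
  have "(F n has_real_derivative F (Suc n) t) (at t)" for n t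
    unfolding F_def by (cases "n = 0") (auto intro!: derivative_eq_intros)
  from kd_chain[of F k g 0, OF this assms] show ?thesis by (simp add: F_def)
qed

lemma test_kd: "\<phi> \<in> test_functions \<Longrightarrow> kd k \<phi>" by (simp add: test_functions_def)

lemma test_support: assumes "\<phi> \<in> test_functions" obtains R where "R > 0" "\<And>x. norm x > R \<Longrightarrow> \<phi> x = 0"
proof -
  have "bounded {x. \<phi> x \<noteq> 0}" using assms compact_imp_bounded bounded_closure_image bounded_subset[OF _ closure_subset]
    by (auto simp: test_functions_def)
  then obtain R where "R > 0" "\<And>x. \<phi> x \<noteq> 0 \<Longrightarrow> norm x \<le> R" by (auto simp: bounded_pos)
  then show ?thesis using that[of R] by force
qed

lemma testI:
  assumes "\<And>k. kd k \<phi>" "\<And>x. norm x > R \<Longrightarrow> \<phi> x = 0" shows "\<phi> \<in> test_functions"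
proof -
  have "{x. \<phi> x \<noteq> 0} \<subseteq> cball 0 R" using assms(2) by (auto simp: not_less[symmetric])
  then have "bounded {x. \<phi> x \<noteq> 0}" using bounded_cball bounded_subset by blast
  then show ?thesis using assms(1) by (simp add: test_functions_def compact_closure)
qed

lemma test_differentiable: "\<phi> \<in> test_functions \<Longrightarrow> \<phi> differentiable (at x)"
  using test_kd[of \<phi> "Suc 0"] by simp

lemma test_partial: assumes "\<phi> \<in> test_functions" shows "partial i \<phi> \<in> test_functions"
proof -
  obtain R where R: "R > 0" "\<And>x. norm x > R \<Longrightarrow> \<phi> x = 0" using test_support[OF assms] by metis
  show ?thesis
  proof (rule testI)
    show "kd k (partial i \<phi>)" for k using test_kd[OF assms, of "Suc k"] by simp
    fix x :: "real^3" assume x: "norm x > R"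
    have op: "open {x::real^3. norm x > R}" by (intro open_Collect_less continuous_intros)
    have "(\<phi> has_derivative (\<lambda>h. 0)) (at x)"
      by (rule has_derivative_transform_within_open[OF has_derivative_const[of 0] op]) (use x R in auto)
    from partial_eq[OF this] show "partial i \<phi> x = 0" by simp
  qed
qed

lemma test_mult_kd: assumes "\<phi> \<in> test_functions" "\<And>k. kd k g" shows "(\<lambda>x. g x * \<phi> x) \<in> test_functions"
proof -
  obtain R where R: "R > 0" "\<And>x. norm x > R \<Longrightarrow> \<phi> x = 0" using test_support[OF assms(1)] by metis
  show ?thesis by (rule testI[of _ R]) (use R assms test_kd in \<open>auto intro: kd_mult\<close>)
qed

lemma test_scale: "\<phi> \<in> test_functions \<Longrightarrow> (\<lambda>x. c * \<phi> x) \<in> test_functions"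
  using test_mult_kd[of \<phi> "\<lambda>x. c"] kd_const by blast

lemma test_mult: "\<phi> \<in> test_functions \<Longrightarrow> \<psi> \<in> test_functions \<Longrightarrow> (\<lambda>x. \<psi> x * \<phi> x) \<in> test_functions"
  using test_mult_kd[of \<phi> \<psi>] test_kd by blast

lemma test_affine: assumes "\<phi> \<in> test_functions" "c \<noteq> 0" shows "(\<lambda>x. \<phi> (t + c *\<^sub>R x)) \<in> test_functions"
proof -
  obtain R where R: "R > 0" "\<And>x. norm x > R \<Longrightarrow> \<phi> x = 0" using test_support[OF assms(1)] by metis
  show ?thesis
  proof (rule testI)
    show "kd k (\<lambda>x. \<phi> (t + c *\<^sub>R x))" for k by (intro kd_affine test_kd assms)
    fix x :: "real^3" assume "norm x > (R + norm t) / \<bar>c\<bar>"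
    then have "norm (c *\<^sub>R x) > R + norm t" using assms(2) by (simp add: divide_less_eq mult.commute)
    then have "norm (t + c *\<^sub>R x) > R" using norm_diff_ineq[of "c *\<^sub>R x" t] by (simp add: add.commute)
    then show "\<phi> (t + c *\<^sub>R x) = 0" by (rule R)
  qed
qed

lemma test_Cc: assumes "\<phi> \<in> test_functions" shows "(\<lambda>x. of_real (\<phi> x)) \<in> Cc"
proof -
  obtain R where R: "R > 0" "\<And>x. norm x > R \<Longrightarrow> \<phi> x = 0" using test_support[OF assms(1)] by metis
  then show ?thesis using kd_continuous[OF test_kd[OF assms, of 0]] unfolding Cc_def
    by (auto intro!: continuous_intros exI[of _ R])
qed

lemma test_L2: "\<phi> \<in> test_functions \<Longrightarrow> (\<lambda>x. of_real (\<phi> x)) \<in> L2" by (intro Cc_L2 test_Cc)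

lemma test_measurable: "\<phi> \<in> test_functions \<Longrightarrow> \<phi> \<in> borel_measurable borel"
  using kd_continuous[OF test_kd[of \<phi> 0]] borel_measurable_continuous_onI by blast

text \<open>A product of six flat functions is positive exactly on the box. Passing to
  \<open>1 - exp (- n p)\<close> keeps the values in \<open>[0, 1]\<close> and the zeros outside,
  and tends to 1 wherever \<open>p > 0\<close>.\<close>

lemma test_box:
  obtains \<phi> :: "nat \<Rightarrow> real^3 \<Rightarrow> real" where "\<And>n. \<phi> n \<in> test_functions" "\<And>n x. 0
      \<le> \<phi> n x" "\<And>n x. \<phi> n x \<le> 1"
    "\<And>n x. x \<notin> box a b \<Longrightarrow> \<phi> n x = 0" "\<And>x. x \<in> box a b \<Longrightarrow> (\<lambda>n. \<phi> n x) \<longlonglongrightarrow> 1"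
proof -
  define p where "p x = (flat 1 (x$1 - a$1) * flat 1 (b$1 - x$1)) * ((flat 1 (x$2 - a$2) * flat 1 (b$2 - x$2)) * (flat 1 (x$3 - a$3) * flat 1 (b$3 -
      x$3)))" for x :: "real^3"
  have kc: "kd k (\<lambda>x. x$i - c)" "kd k (\<lambda>x. c - x$i)" for k i and c :: real
    using kd_add[OF kd_coord[of k i] kd_const[of k "-c"]] kd_add[OF kd_const[of k c] kd_mult[OF kd_const[of k "-1"] kd_coord[of k i]]] by simp_all
  have kp: "kd k p" for k unfolding p_def by (intro kd_mult kd_flat kc)
  have f0: "flat 1 t \<ge> 0" "flat 1 t > 0 \<longleftrightarrow> t > 0" "t \<le> 0 \<Longrightarrow> flat 1 t = 0" for t by (auto simp: flat_def)
  have p0: "p x \<ge> 0" for x by (simp add: p_def f0)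
  have pin: "p x > 0" if "x \<in> box a b" for x
    using that unfolding p_def by (intro mult_pos_pos) (auto simp: f0 mem_box_cart)
  have pout: "p x = 0" if "x \<notin> box a b" for x
  proof -
    from that obtain i where "x$i \<le> a$i \<or> b$i \<le> x$i" by (auto simp: mem_box_cart not_less)
    then have "flat 1 (x$i - a$i) = 0 \<or> flat 1 (b$i - x$i) = 0" by (auto simp: f0)
    moreover have "i = 1 \<or> i = 2 \<or> i = 3" using exhaust_3 by blast
    ultimately show ?thesis by (auto simp: p_def)
  qed
  define \<phi> where "\<phi> n x = 1 - exp (- (real n * p x))" for n x
  show ?thesis
  proof (rule that[of \<phi>])
    have "bounded (box a b)" by (rule bounded_box)
    then obtain R where R: "\<And>x. x \<in> box a b \<Longrightarrow> norm x \<le> R" by (auto simp: bounded_iff)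
    show "\<phi> n \<in> test_functions" for n
    proof (rule testI[of _ R])
      show "kd k (\<phi> n)" for k unfolding \<phi>_def by (rule kd_one_minus_exp[OF kp])
      show "\<phi> n x = 0" if "norm x > R" for x using pout[of x] R[of x] that by (auto simp: \<phi>_def)
    qed
    show "0 \<le> \<phi> n x" "\<phi> n x \<le> 1" for n x using p0[of x] by (auto simp: \<phi>_def)
    show "\<phi> n x = 0" if "x \<notin> box a b" for n x using pout[OF that] by (simp add: \<phi>_def)
    show "(\<lambda>n. \<phi> n x) \<longlonglongrightarrow> 1" if "x \<in> box a b" for x
      using pin[OF that] unfolding \<phi>_def by real_asymp
  qed
qed

section \<open>The fundamental lemma of the calculus of variations\<close>

definition loc_L2 :: "(real ^ 3 \<Rightarrow> complex) \<Rightarrow> bool" where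
  "loc_L2 f \<longleftrightarrow> (\<forall>R. (\<lambda>x. indicator (cball 0 R) x * f x) \<in> L2)"

lemma loc_L2_mult_test:
  assumes f: "loc_L2 f" and p: "\<phi> \<in> test_functions"
  shows "integrable lborel (\<lambda>x. f x * of_real (\<phi> x))"
proof -
  obtain R where R: "R > 0" "\<And>x. norm x > R \<Longrightarrow> \<phi> x = 0" using test_support[OF p] by metis
  have "integrable lborel (\<lambda>x. (indicator (cball 0 R) x * f x) * of_real (\<phi> x))"
    using f by (intro L2_mult_integrable test_L2 p) (auto simp: loc_L2_def)
  moreover have "(indicator (cball 0 R) x * f x) * of_real (\<phi> x) = f x * of_real (\<phi> x)" for x
    using R(2)[of x] by (auto simp: indicator_def)
  ultimately show ?thesis by simp
qed

text \<open>The sets over which \<open>f\<close> integrates to 0 form a Dynkin system containing the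
  intersection-stable boxes, hence all Borel sets. Complements require the total integral to vanish,
  which follows by exhausting space with boxes.\<close>

lemma box_integrals_zero_AE:
  fixes f :: "real ^ 3 \<Rightarrow> complex"
  assumes f: "integrable lborel f" and z: "\<And>a b. (LINT x|lborel. indicator (box a b) x * f x) = 0"
  shows "AE x in lborel. f x = 0"
proof -
  have [measurable]: "f \<in> borel_measurable borel" using f by (auto dest: borel_measurable_integrable)
  have si: "set_integrable lborel A f" if "A \<in> sets borel" for A
    unfolding set_integrable_def by (rule integrable_mult_indicator) (use that f in auto)
  have eq: "set_lebesgue_integral lborel A f = (LINT x|lborel. indicator A x * f x)" for A
    unfolding set_lebesgue_integral_def by (intro Bochner_Integration.integral_cong) (auto simp: indicator_def)
  have total: "(LINT x|lborel. f x) = 0"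
  proof -
    have "(\<lambda>n. LINT x|lborel. indicator (box (- real n *\<^sub>R One) (real n *\<^sub>R One)) x * f x) \<longlonglongrightarrow> (LINT x|lborel. f x)"
    proof (rule integral_dominated_convergence[where w="\<lambda>x. norm (f x)"])
      show "AE x in lborel. (\<lambda>n. indicator (box (- real n *\<^sub>R One) (real n *\<^sub>R One)) x * f x) \<longlonglongrightarrow> f x"
      proof (intro AE_I2 tendsto_eventually)
        fix x :: "real^3"
        show "\<forall>\<^sub>F n in sequentially. indicator (box (- real n *\<^sub>R One) (real n *\<^sub>R One)) x * f x = f x"
          unfolding eventually_sequentially
        proof (rule exI[of _ "nat \<lceil>norm x\<rceil> + 1"], intro allI impI)
          fix n assume n: "n \<ge> nat \<lceil>norm x\<rceil> + 1"
          have "- real n < x \<bullet> b \<and> x \<bullet> b < real n" if "b \<in> Basis" for b using Basis_le_norm[OF that, of x] n by linarith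
          then have "x \<in> box (- real n *\<^sub>R One) (real n *\<^sub>R One)" by (auto simp: mem_box)
          then show "indicator (box (- real n *\<^sub>R One) (real n *\<^sub>R One)) x * f x = f x" by simp
        qed
      qed
    qed (use f in \<open>auto simp: norm_mult indicator_def\<close>)
    then show ?thesis unfolding z by (simp add: LIMSEQ_const_iff)
  qed
  have IS: "Int_stable (range (\<lambda>(a, b). box a b :: (real^3) set))"
    by (auto simp: Int_stable_def box_Int_box)
  have SU: "range (\<lambda>(a, b). box a b :: (real^3) set) \<subseteq> Pow UNIV" by simp
  have all: "A \<in> sigma_sets UNIV (range (\<lambda>(a, b). box a b :: (real^3) set)) \<Longrightarrow> set_lebesgue_integral lborel A f = 0" for A
  proof (induction A rule: sigma_sets_induct_disjoint[OF IS SU, consumes 1])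
    fix A :: "(real^3) set" assume "A \<in> range (\<lambda>(a, b). box a b)"
    then show "set_lebesgue_integral lborel A f = 0" using z by (auto simp: eq)
  next
    show "set_lebesgue_integral lborel {} f = 0" by (simp add: eq)
  next
    fix A :: "(real^3) set" assume A: "A \<in> sigma_sets UNIV (range (\<lambda>(a, b). box a b))" "set_lebesgue_integral lborel A f = 0"
    then have [measurable]: "A \<in> sets borel" by (simp add: borel_eq_box)
    have "(LINT x|lborel. f x) = (LINT x|lborel. indicator A x * f x + indicator (UNIV - A) x * f x)"
      by (intro Bochner_Integration.integral_cong) (auto simp: indicator_def)
    also have "\<dots> = (LINT x|lborel. indicator A x * f x) + (LINT x|lborel. indicator (UNIV - A) x * f x)"
      by (rule Bochner_Integration.integral_add; rule Bochner_Integration.integrable_bound[OF f]) (auto simp: norm_mult indicator_def)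
    finally show "set_lebesgue_integral lborel (UNIV - A) f = 0" using A(2) total by (simp add: eq)
  next
    fix A :: "nat \<Rightarrow> (real^3) set"
    assume A: "disjoint_family A" "range A \<subseteq> sigma_sets UNIV (range (\<lambda>(a, b). box a b))" "\<And>i. set_lebesgue_integral lborel (A i) f = 0"
    have m: "A i \<in> sets borel" for i using A(2) by (auto simp: borel_eq_box)
    have "set_lebesgue_integral lborel (\<Union>i. A i) f = (\<Sum>i. set_lebesgue_integral lborel (A i) f)"
      by (rule lebesgue_integral_countable_add) (use A(1) m in \<open>auto simp: disjoint_family_on_def intro!: si\<close>)
    then show "set_lebesgue_integral lborel (\<Union>i. A i) f = 0" using A(3) by simp
  qed
  show ?thesis
    by (rule sigma_finite_measure.density_zero[OF sigma_finite_lborel f]) (use all in \<open>auto simp: borel_eq_box\<close>)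
qed

text \<open>The cut-offs of \<open>test_box\<close> make the integral over every box vanish. As
  \<open>f\<close> is integrable only locally, \<open>box_integrals_zero_AE\<close> is applied to
  its restrictions to growing boxes; intersections of boxes are boxes.\<close>

theorem fundamental_lemma:
  assumes f: "loc_L2 f" and z: "\<And>\<phi>. \<phi> \<in> test_functions \<Longrightarrow> (LINT x|lborel. f x * of_real (\<phi> x)) = 0"
  shows "AE x in lborel. f x = 0"
proof -
  have i: "integrable lborel (\<lambda>x. indicator (box a b) x * f x)" and bz: "(LINT x|lborel. indicator (box a b) x * f x) = 0" for a b
  proof -
    have "bounded (box a b)" by (rule bounded_box)
    then obtain R where R: "\<And>x. x \<in> box a b \<Longrightarrow> norm x \<le> R" by (auto simp: bounded_iff)
    have e: "indicator (box a b) x * f x = (1 * indicator (box a b) x) * (indicator (cball 0 R) x * f x)" for x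
      using R[of x] by (auto simp: indicator_def)
    show i: "integrable lborel (\<lambda>x. indicator (box a b) x * f x)"
      unfolding e using f emeasure_lborel_box_finite[of a b] by (intro L2_mult_integrable L2_indicator) (auto simp: loc_L2_def)
    then have [measurable]: "(\<lambda>x. indicator (box a b) x * f x) \<in> borel_measurable borel" by (auto dest: borel_measurable_integrable)
    obtain \<phi> :: "nat \<Rightarrow> real^3 \<Rightarrow> real" where p: "\<And>n. \<phi> n \<in> test_functions" "\<And>n x. 0
        \<le> \<phi> n x" "\<And>n x. \<phi> n x \<le> 1"
      "\<And>n x. x \<notin> box a b \<Longrightarrow> \<phi> n x = 0" "\<And>x. x \<in> box a b
          \<Longrightarrow> (\<lambda>n. \<phi> n x) \<longlonglongrightarrow> 1" using test_box[of a b] by metis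
    have "(\<lambda>n. LINT x|lborel. f x * of_real (\<phi> n x)) \<longlonglongrightarrow> (LINT x|lborel. indicator (box a b) x * f x)"
    proof (rule integral_dominated_convergence[where w="\<lambda>x. norm (indicator (box a b) x * f x)"])
      show "integrable lborel (\<lambda>x. norm (indicator (box a b) x * f x))" using i by (rule integrable_norm)
      show "AE x in lborel. (\<lambda>n. f x * of_real (\<phi> n x)) \<longlonglongrightarrow> indicator (box a b) x * f x"
      proof (intro AE_I2)
        fix x show "(\<lambda>n. f x * of_real (\<phi> n x)) \<longlonglongrightarrow> indicator (box a b) x * f x"
        proof (cases "x \<in> box a b")
          case True
          have "(\<lambda>n. f x * of_real (\<phi> n x)) \<longlonglongrightarrow> f x * of_real 1" by (intro tendsto_intros p(5) True)
          then show ?thesis using True by simp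
        qed (simp add: p(4))
      qed
      show "AE x in lborel. norm (f x * of_real (\<phi> n x)) \<le> norm (indicator (box a b) x * f x)" for n
        using p(2,3)[of n] p(4)[of _ n] by (intro AE_I2) (auto simp: norm_mult indicator_def mult_left_le)
      show "(\<lambda>x. f x * of_real (\<phi> n x)) \<in> borel_measurable lborel" for n
        using loc_L2_mult_test[OF f p(1)] by (rule borel_measurable_integrable)
    qed simp
    then show "(LINT x|lborel. indicator (box a b) x * f x) = 0" unfolding z[OF p(1)] by (simp add: LIMSEQ_const_iff)
  qed
  have "AE x in lborel. indicator (box (- real n *\<^sub>R One) (real n *\<^sub>R One)) x * f x = 0" for n
  proof (rule box_integrals_zero_AE[OF i])
    fix a b :: "real^3"
    obtain c d where "box a b \<inter> box (- real n *\<^sub>R One) (real n *\<^sub>R One) = box c d" by (simp add: box_Int_box) 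
    then have eq: "indicator (box a b) x * (indicator (box (- real n *\<^sub>R One) (real n *\<^sub>R One)) x * f x) = indicator (box c d) x * f x" for x
      by (auto simp: indicator_def)
    show "(LINT x|lborel. indicator (box a b) x * (indicator (box (- real n *\<^sub>R One) (real n *\<^sub>R One)) x * f x)) = 0" unfolding eq by (rule bz)
  qed
  then have "AE x in lborel. \<forall>n. indicator (box (- real n *\<^sub>R One) (real n *\<^sub>R One)) x * f x = 0" by (rule AE_all_countable[THEN iffD2, rule_format])
  then show ?thesis
  proof eventually_elim
    case (elim x)
    obtain n where n: "real n > norm x" using reals_Archimedean2 by blast
    have "- real n < x \<bullet> b \<and> x \<bullet> b < real n" if "b \<in> Basis" for b using Basis_le_norm[OF that, of x] n by linarith
    then have "x \<in> box (- real n *\<^sub>R One) (real n *\<^sub>R One)" by (auto simp: mem_box)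
    moreover have "indicator (box (- real n *\<^sub>R One) (real n *\<^sub>R One)) x * f x = 0" using elim by (rule spec)
    ultimately show ?case by simp
  qed
qed

lemma L2_loc_L2: "f \<in> L2 \<Longrightarrow> loc_L2 f"
  using trunc_L2[of f] by (simp add: loc_L2_def trunc_def[abs_def])

lemma loc_L2_add: "loc_L2 f \<Longrightarrow> loc_L2 g \<Longrightarrow> loc_L2 (\<lambda>x. f x + g x)"
  unfolding loc_L2_def distrib_left by (auto intro: L2_add)

lemma loc_L2_diff: "loc_L2 f \<Longrightarrow> loc_L2 g \<Longrightarrow> loc_L2 (\<lambda>x. f x - g x)"
  unfolding loc_L2_def right_diff_distrib by (auto intro: L2_diff)

text \<open>A coordinate factor can destroy global square-integrability; this is why
  \<open>fundamental_lemma\<close> is stated for \<open>loc_L2\<close>.\<close>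

lemma loc_L2_coord: assumes "f \<in> L2" shows "loc_L2 (\<lambda>x. of_real (x $ i) * f x)"
  unfolding loc_L2_def
proof
  fix R
  have m: "(\<lambda>x::real^3. indicator (cball 0 R) x * of_real (x $ i) :: complex) \<in> borel_measurable borel"
    by (intro borel_measurable_times borel_measurable_indicator borel_measurable_of_real borel_measurable_continuous_onI continuous_intros) auto
  have "norm (indicator (cball 0 R) x * of_real (x $ i) :: complex) \<le> \<bar>R\<bar>" for x :: "real^3"
    using component_le_norm_cart[of x i] by (auto simp: indicator_def)
  from L2_mult_bounded(1)[OF assms m this]
  show "(\<lambda>x. indicator (cball 0 R) x * (of_real (x $ i) * f x)) \<in> L2" by (simp add: mult.assoc)
qed

lemma L2_test_integrable: "f \<in> L2 \<Longrightarrow> \<phi> \<in> test_functions \<Longrightarrow> integrable lborel (\<lambda>x. f x * of_real (\<phi> x))"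
  by (intro L2_mult_integrable test_L2)

subsection \<open>Weak derivatives\<close>

lemma wpD:
  assumes "is_weak_partial i u g"
  shows "g \<in> L2" "\<And>\<phi>. \<phi> \<in> test_functions \<Longrightarrow> (LINT x|lborel. u x * of_real (partial i \<phi> x))
      = - (LINT x|lborel. g x * of_real (\<phi> x))"
  using assms by (auto simp: is_weak_partial_def)

lemma wp_unique: assumes "is_weak_partial i u g" "is_weak_partial i u h" shows "AE x in lborel. g x = h x"
proof -
  have "AE x in lborel. g x - h x = 0"
  proof (rule fundamental_lemma)
    show "loc_L2 (\<lambda>x. g x - h x)" using wpD(1) assms by (intro L2_loc_L2 L2_diff) auto
    fix \<phi> assume p: "\<phi> \<in> test_functions"
    show "(LINT x|lborel. (g x - h x) * of_real (\<phi> x)) = 0"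
      using wpD(2)[OF assms(1) p] wpD(2)[OF assms(2) p] L2_test_integrable[OF wpD(1)[OF assms(1)] p] L2_test_integrable[OF wpD(1)[OF assms(2)] p]
      by (simp add: left_diff_distrib)
  qed
  then show ?thesis by simp
qed

lemma wp_add:
  assumes "is_weak_partial i u g" "is_weak_partial i v h" "u \<in> L2" "v \<in> L2"
  shows "is_weak_partial i (\<lambda>x. u x + v x) (\<lambda>x. g x + h x)"
  unfolding is_weak_partial_def
proof (intro conjI ballI)
  show "(\<lambda>x. g x + h x) \<in> L2" using wpD(1) assms by (intro L2_add) auto
  fix \<phi> assume p: "\<phi> \<in> test_functions"
  note q = test_partial[OF p]
  show "(LINT x|lborel. (u x + v x) * of_real (partial i \<phi> x)) = - (LINT x|lborel. (g x + h x) * of_real (\<phi> x))"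
    using wpD(2)[OF assms(1) p] wpD(2)[OF assms(2) p] L2_test_integrable[OF wpD(1)[OF assms(1)] p] L2_test_integrable[OF wpD(1)[OF assms(2)] p]
      L2_test_integrable[OF assms(3) q] L2_test_integrable[OF assms(4) q]
    by (simp add: distrib_right)
qed

lemma wp_scale:
  assumes "is_weak_partial i u g" shows "is_weak_partial i (\<lambda>x. c * u x) (\<lambda>x. c * g x)"
  using assms by (auto simp: is_weak_partial_def L2_scale mult.assoc)

text \<open>Weak differentiation is a closed operation: both sides of its defining identity are
  continuous under convergence in \<open>L2\<close>.\<close>

lemma wp_limit:
  assumes "\<And>n. is_weak_partial i (u n) (g n)" "\<And>n. u n \<in> L2" "v \<in> L2" "h \<in> L2"
    "(\<lambda>n. l2n (\<lambda>x. u n x - v x)) \<longlonglongrightarrow> 0" "(\<lambda>n. l2n (\<lambda>x. g n x - h x)) \<longlonglongrightarrow> 0"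
  shows "is_weak_partial i v h"
  unfolding is_weak_partial_def
proof (intro conjI ballI)
  fix \<phi> assume p: "\<phi> \<in> test_functions"
  have z: "(\<lambda>n. l2n (\<lambda>x. of_real (\<psi> x) - of_real (\<psi> x))) \<longlonglongrightarrow> 0" for \<psi> :: "real^3 \<Rightarrow> real"
    by (simp add: l2n_def)
  have 1: "(\<lambda>n. LINT x|lborel. u n x * of_real (partial i \<phi> x)) \<longlonglongrightarrow> (LINT x|lborel. v x * of_real (partial i \<phi> x))"
    by (intro L2_int_mult_tendsto assms z test_L2 test_partial p)
  have 2: "(\<lambda>n. - (LINT x|lborel. g n x * of_real (\<phi> x))) \<longlonglongrightarrow> - (LINT x|lborel. h x * of_real (\<phi> x))"
    by (intro tendsto_minus L2_int_mult_tendsto assms z test_L2 p wpD(1)[OF assms(1)])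
  show "(LINT x|lborel. v x * of_real (partial i \<phi> x)) = - (LINT x|lborel. h x * of_real (\<phi> x))"
    using 1 2 unfolding wpD(2)[OF assms(1) p] by (rule LIMSEQ_unique)
qed (rule assms)

lemma wp_dilation:
  assumes w: "is_weak_partial i u g" and u: "u \<in> L2" and c: "c > 0"
  shows "is_weak_partial i (\<lambda>x. u (c *\<^sub>R x)) (\<lambda>x. of_real c * g (c *\<^sub>R x))"
  unfolding is_weak_partial_def
proof (intro conjI ballI)
  have g: "g \<in> L2" by (rule wpD(1)[OF w])
  show "(\<lambda>x. of_real c * g (c *\<^sub>R x)) \<in> L2" using L2_affine(1)[OF g, of c 0] c by (intro L2_scale) simp
  fix \<phi> assume p: "\<phi> \<in> test_functions"
  define \<psi> where "\<psi> x = \<phi> (0 + (1/c) *\<^sub>R x)" for x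
  have ps: "\<psi> \<in> test_functions" unfolding \<psi>_def using c by (intro test_affine p) auto
  have pp: "partial i \<psi> x = (1/c) * partial i \<phi> (0 + (1/c) *\<^sub>R x)" for x
    unfolding \<psi>_def by (rule partial_affine(2)[OF test_differentiable[OF p]])
  have "(\<lambda>x. u x * of_real (partial i \<psi> x)) \<in> borel_measurable borel"
    using L2_test_integrable[OF u test_partial[OF ps]] by (auto dest: borel_measurable_integrable)
  from integral_affine[OF this, of c 0]
  have 1: "(LINT x|lborel. u (c *\<^sub>R x) * of_real ((1/c) * partial i \<phi> x)) = (1 / c^3) *\<^sub>R (LINT x|lborel. u x * of_real (partial i \<psi> x))"
    using c by (simp add: pp)
  have "(\<lambda>x. g x * of_real (\<psi> x)) \<in> borel_measurable borel"
    using L2_test_integrable[OF g ps] by (auto dest: borel_measurable_integrable)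
  from integral_affine[OF this, of c 0]
  have 2: "(LINT x|lborel. g (c *\<^sub>R x) * of_real (\<phi> x)) = (1 / c^3) *\<^sub>R (LINT x|lborel. g x * of_real (\<psi> x))"
    using c by (simp add: \<psi>_def)
  have "(LINT x|lborel. u (c *\<^sub>R x) * of_real (partial i \<phi> x)) = (LINT x|lborel. of_real c * (u (c *\<^sub>R x) * of_real ((1/c) * partial i \<phi> x)))"
    using c by (intro Bochner_Integration.integral_cong) auto
  also have "\<dots> = of_real c * (LINT x|lborel. u (c *\<^sub>R x) * of_real ((1/c) * partial i \<phi> x))" by (rule integral_mult_right_zero)
  also have "\<dots> = - (of_real c * (LINT x|lborel. g (c *\<^sub>R x) * of_real (\<phi> x)))" unfolding 1 2 wpD(2)[OF w ps] by simp
  also have "\<dots> = - (LINT x|lborel. of_real c * g (c *\<^sub>R x) * of_real (\<phi> x))" by (simp add: mult.assoc)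
  finally show "(LINT x|lborel. u (c *\<^sub>R x) * of_real (partial i \<phi> x)) = - (LINT x|lborel. of_real c * g (c *\<^sub>R x) * of_real (\<phi> x))" .
qed

subsection \<open>Translations and dilations of weakly differentiable functions\<close>

text \<open>Minkowski's integral inequality for averages: Cauchy-Schwarz in \<open>s\<close> costs a
  factor \<open>\<kappa>\<close>, and Tonelli then integrates in \<open>x\<close>. The parameter
  space is general because intervals of shifts or scales and balls of shifts both occur.\<close>

lemma L2_average_set:
  fixes G :: "'a::euclidean_space \<Rightarrow> real ^ 3 \<Rightarrow> complex"
  assumes m: "(\<lambda>(s, x). G s x) \<in> borel_measurable (borel \<Otimes>\<^sub>M borel)"
    and L: "\<And>s. s \<in> K \<Longrightarrow> G s \<in> L2" and B: "\<And>s. s \<in> K \<Longrightarrow> l2n (G s) \<le> B" and B0: "B \<ge> 0"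
    and K[measurable]: "K \<in> sets borel" and ab: "emeasure lborel K = ennreal \<kappa>" "\<kappa> \<ge> 0"
  shows "(\<lambda>x. LINT s|lborel. indicator K s *\<^sub>R G s x) \<in> L2"
    "l2n (\<lambda>x. LINT s|lborel. indicator K s *\<^sub>R G s x) \<le> \<kappa> * B"
    "(\<integral>\<^sup>+x. \<integral>\<^sup>+s. indicator K s * ennreal ((norm (G s x))\<^sup>2) \<partial>lborel \<partial>lborel)
        \<le> ennreal (\<kappa> * B\<^sup>2)"
    "w \<in> L2 \<Longrightarrow> integrable lborel (\<lambda>s. indicator K s *\<^sub>R (LINT x|lborel. G s x * w x))"
    "w \<in> L2 \<Longrightarrow> (LINT x|lborel. (LINT s|lborel. indicator K s *\<^sub>R G s x) * w x)
        = (LINT s|lborel. indicator K s *\<^sub>R (LINT x|lborel. G s x * w x))"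
proof -
  note [measurable] = m
  have m2[measurable]: "(\<lambda>(x, s). G s x) \<in> borel_measurable (borel \<Otimes>\<^sub>M borel)"
    using measurable_compose[OF measurable_pair_swap'[of borel borel] m] by (simp add: case_prod_beta')
  let ?v = "\<lambda>x. LINT s|lborel. indicator K s *\<^sub>R G s x"
  have vm[measurable]: "?v \<in> borel_measurable borel" by measurable
  have pt: "ennreal ((norm (?v x))\<^sup>2) \<le> ennreal \<kappa> * (\<integral>\<^sup>+s. indicator K s * ennreal ((norm (G s x))\<^sup>2) \<partial>lborel)" for x
  proof -
    have Gm[measurable]: "(\<lambda>s. G s x) \<in> borel_measurable borel" using m by measurable
    have "ennreal (norm (?v x)) \<le> (\<integral>\<^sup>+s. ennreal (norm (indicator K s *\<^sub>R G s x)) \<partial>lborel)"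
    \<comment> \<open>If the integrand is not integrable, its Bochner integral is 0 by convention
      and the bound is trivial.\<close>
    proof (cases "integrable lborel (\<lambda>s. indicator K s *\<^sub>R G s x)")
      case True then show ?thesis by (rule integral_norm_bound_ennreal)
    qed (simp add: not_integrable_integral_eq)
    also have "\<dots> = (\<integral>\<^sup>+s. indicator K s * (indicator K s * ennreal (norm (G s x))) \<partial>lborel)"
      by (intro nn_integral_cong) (auto simp: indicator_def)
    finally have "(ennreal (norm (?v x)))\<^sup>2 \<le> (\<integral>\<^sup>+s. indicator K s * (indicator K s * ennreal (norm (G s x))) \<partial>lborel)\<^sup>2"
      by (rule power_mono) simp
    also have "\<dots> \<le> (\<integral>\<^sup>+s. (indicator K s)\<^sup>2 \<partial>lborel) * (\<integral>\<^sup>+s. (indicator K s * ennreal (norm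
        (G s x)))\<^sup>2 \<partial>lborel)"
      by (rule Cauchy_Schwarz_nn_integral) measurable
    also have "(\<integral>\<^sup>+s. (indicator K s :: ennreal)\<^sup>2 \<partial>lborel) = (\<integral>\<^sup>+s. indicator K s \<partial>lborel)"
      by (intro nn_integral_cong) (auto simp: indicator_def)
    also have "\<dots> = ennreal \<kappa>" using ab by simp
    also have "(\<integral>\<^sup>+s. (indicator K s * ennreal (norm (G s x)))\<^sup>2 \<partial>lborel)
        = (\<integral>\<^sup>+s. indicator K s * ennreal ((norm (G s x))\<^sup>2) \<partial>lborel)"
      by (intro nn_integral_cong) (auto simp: indicator_def ennreal_power)
    finally show ?thesis by (simp add: ennreal_power)
  qed
  have "(\<integral>\<^sup>+x. \<integral>\<^sup>+s. indicator K s * ennreal ((norm (G s x))\<^sup>2) \<partial>lborel \<partial>lborel)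
      = (\<integral>\<^sup>+s. \<integral>\<^sup>+x. indicator K s * ennreal ((norm (G s x))\<^sup>2) \<partial>lborel \<partial>lborel)"
    by (rule lborel_pair.Fubini') measurable
  also have "\<dots> \<le> (\<integral>\<^sup>+s. ennreal (B\<^sup>2) * indicator K s \<partial>lborel)"
  proof (rule nn_integral_mono)
    fix s :: 'a
    show "(\<integral>\<^sup>+x. indicator K s * ennreal ((norm (G s x))\<^sup>2) \<partial>lborel) \<le> ennreal (B\<^sup>2) * indicator K s"
      using L[of s] B[of s] by (auto simp: indicator_def nn_l2n intro!: ennreal_leI power_mono)
  qed
  also have "\<dots> = ennreal (B\<^sup>2) * emeasure lborel K" by (rule nn_integral_cmult_indicator) simp
  also have "\<dots> = ennreal (\<kappa> * B\<^sup>2)" using ab by (simp add: ennreal_mult mult.commute)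
  finally show nn: "(\<integral>\<^sup>+x. \<integral>\<^sup>+s. indicator K s * ennreal ((norm (G s x))\<^sup>2) \<partial>lborel \<partial>lborel)
      \<le> ennreal (\<kappa> * B\<^sup>2)" .
  have "(\<integral>\<^sup>+x. ennreal ((norm (?v x))\<^sup>2) \<partial>lborel)
      \<le> (\<integral>\<^sup>+x. ennreal \<kappa> * (\<integral>\<^sup>+s. indicator K s * ennreal ((norm (G s x))\<^sup>2) \<partial>lborel) \<partial>lborel)"
    by (intro nn_integral_mono pt)
  also have "\<dots> = ennreal \<kappa> * (\<integral>\<^sup>+x. \<integral>\<^sup>+s. indicator K s * ennreal ((norm (G s x))\<^sup>2)
      \<partial>lborel \<partial>lborel)"
    by (rule nn_integral_cmult) measurable
  also have "\<dots> \<le> ennreal \<kappa> * ennreal (\<kappa> * B\<^sup>2)" by (intro mult_left_mono nn) simp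
  also have "\<dots> = ennreal ((\<kappa> * B)\<^sup>2)" using ab B0 by (simp add: ennreal_mult[symmetric] power2_eq_square mult_ac)
  finally have fin: "(\<integral>\<^sup>+x. ennreal ((norm (?v x))\<^sup>2) \<partial>lborel) \<le> ennreal ((\<kappa> * B)\<^sup>2)" .
  show "?v \<in> L2" "l2n ?v \<le> \<kappa> * B" using L2_nnI[OF vm fin] ab B0 by auto
  assume w: "w \<in> L2"
  note [measurable] = L2_meas[OF w]
  have int: "integrable (lborel \<Otimes>\<^sub>M lborel) (\<lambda>(s, x). indicator K s *\<^sub>R (G s x * w x))"
  proof (rule lborel_pair.Fubini_integrable)
    show "AE s in lborel. integrable lborel (\<lambda>x. case (s, x) of (s, x) \<Rightarrow> indicator K s *\<^sub>R (G s x * w x))"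
      using L w by (auto simp: indicator_def L2_mult_integrable)
    show "integrable lborel (\<lambda>s. LINT x|lborel. norm (case (s, x) of (s, x) \<Rightarrow> indicator K s *\<^sub>R (G s x * w x)))"
    proof (rule Bochner_Integration.integrable_bound)
      show "integrable lborel (\<lambda>s. indicator K s * (B * l2n w))" using ab by (intro integrable_mult_left integrable_real_indicator) auto
      show "AE s in lborel. norm (LINT x|lborel. norm (case (s, x) of (s, x) \<Rightarrow> indicator K s *\<^sub>R (G s x * w x)))
          \<le> norm (indicator K s * (B * l2n w))"
      proof (intro AE_I2)
        fix s
        show "norm (LINT x|lborel. norm (case (s, x) of (s, x) \<Rightarrow> indicator K s *\<^sub>R (G s x * w x))) \<le> norm (indicator K s * (B * l2n w))"
        proof (cases "s \<in> K")
          case True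
          have "(LINT x|lborel. norm (G s x * w x)) \<le> l2n (G s) * l2n w" using L w True by (intro nn_mult_le) auto
          also have "\<dots> \<le> B * l2n w" using B True by (intro mult_right_mono) auto
          finally show ?thesis using True B0 by (simp add: integral_nonneg)
        qed simp
      qed
    qed measurable
  qed measurable
  have "integrable lborel (\<lambda>s. LINT x|lborel. indicator K s *\<^sub>R (G s x * w x))"
    using lborel_pair.integrable_fst'[OF int] by simp
  then show "integrable lborel (\<lambda>s. indicator K s *\<^sub>R (LINT x|lborel. G s x * w x))" by simp
  have "(LINT x|lborel. ?v x * w x) = (LINT x|lborel. LINT s|lborel. indicator K s *\<^sub>R (G s x * w x))"
  proof (intro Bochner_Integration.integral_cong refl)
    fix x
    have "(LINT s|lborel. indicator K s *\<^sub>R (G s x * w x)) = (LINT s|lborel. (indicator K s *\<^sub>R G s x) * w x)" by simp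
    then show "?v x * w x = (LINT s|lborel. indicator K s *\<^sub>R (G s x * w x))" by (simp only: integral_mult_left_zero)
  qed
  also have "\<dots> = (LINT s|lborel. LINT x|lborel. indicator K s *\<^sub>R (G s x * w x))"
    by (rule lborel_pair.Fubini_integral[OF int])
  finally show "(LINT x|lborel. ?v x * w x) = (LINT s|lborel. indicator K s *\<^sub>R (LINT x|lborel. G s x * w x))" by simp
qed

lemma L2_average:
  fixes G :: "real \<Rightarrow> real ^ 3 \<Rightarrow> complex"
  assumes m: "(\<lambda>(s, x). G s x) \<in> borel_measurable (borel \<Otimes>\<^sub>M borel)"
    and L: "\<And>s. a \<le> s \<Longrightarrow> s \<le> b \<Longrightarrow> G s \<in> L2" and B: "\<And>s. a \<le> s \<Longrightarrow> s
        \<le> b \<Longrightarrow> l2n (G s) \<le> B" and ab: "a \<le> b"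
  shows "(\<lambda>x. LINT s|lborel. indicator {a..b} s *\<^sub>R G s x) \<in> L2"
    "l2n (\<lambda>x. LINT s|lborel. indicator {a..b} s *\<^sub>R G s x) \<le> (b - a) * B"
    "w \<in> L2 \<Longrightarrow> integrable lborel (\<lambda>s. indicator {a..b} s *\<^sub>R (LINT x|lborel. G s x * w x))"
    "w \<in> L2 \<Longrightarrow> (LINT x|lborel. (LINT s|lborel. indicator {a..b} s *\<^sub>R G s x) * w x)
        = (LINT s|lborel. indicator {a..b} s *\<^sub>R (LINT x|lborel. G s x * w x))"
proof -
  have B0: "B \<ge> 0" using B[of a] ab l2n_nonneg[of "G a"] by linarith
  have k: "emeasure lborel {a..b} = ennreal (b - a)" "b - a \<ge> 0" using ab by auto
  note A = L2_average_set[OF m, of "{a..b}" B "b - a", OF _ _ B0 _ k]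
  show "(\<lambda>x. LINT s|lborel. indicator {a..b} s *\<^sub>R G s x) \<in> L2"
    "l2n (\<lambda>x. LINT s|lborel. indicator {a..b} s *\<^sub>R G s x) \<le> (b - a) * B"
    using L B by (auto intro!: A(1) A(2))
  assume w: "w \<in> L2"
  show "integrable lborel (\<lambda>s. indicator {a..b} s *\<^sub>R (LINT x|lborel. G s x * w x))"
    by (rule A(4)) (use L B w in auto)
  show "(LINT x|lborel. (LINT s|lborel. indicator {a..b} s *\<^sub>R G s x) * w x) = (LINT s|lborel. indicator {a..b} s *\<^sub>R (LINT x|lborel. G s x * w x))"
    by (rule A(5)) (use L B w in auto)
qed

lemma test_line_deriv:
  assumes p: "\<phi> \<in> test_functions"
  shows "((\<lambda>s. \<phi> (y + s *\<^sub>R axis i 1)) has_real_derivative partial i \<phi> (y + s *\<^sub>R axis i 1)) (at s)"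
proof -
  have a: "((\<lambda>s. y + s *\<^sub>R axis i 1) has_derivative (\<lambda>h. h *\<^sub>R axis i 1)) (at s)" by (auto intro!: derivative_eq_intros)
  have "((\<lambda>s. \<phi> (y + s *\<^sub>R axis i 1)) has_derivative (\<lambda>h. frechet_derivative \<phi> (at (y
      + s *\<^sub>R axis i 1)) (h *\<^sub>R axis i 1))) (at s)"
    by (rule has_derivative_compose[OF a partial_has_derivative[OF test_differentiable[OF p]]])
  then show ?thesis
    by (simp add: has_field_derivative_def partial_def linear_cmul[OF linear_frechet_derivative[OF test_differentiable[OF p]]] mult_commute_abs)
qed

lemma partial_continuous: "\<phi> \<in> test_functions \<Longrightarrow> continuous_on S (partial i \<phi>)"
  using kd_continuous[OF test_kd[OF test_partial[of \<phi> i], of 0]] continuous_on_subset by blast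

lemma L2_translate: assumes "f \<in> L2" shows "(\<lambda>x. f (x + w)) \<in> L2" "l2n (\<lambda>x. f (x + w)) = l2n f"
  using L2_affine[OF assms, of 1 w] by (simp_all add: add.commute)

lemma integral_translate:
  fixes f :: "real ^ 3 \<Rightarrow> complex"
  assumes "f \<in> borel_measurable borel" shows "(LINT x|lborel. f (x + w)) = (LINT x|lborel. f x)"
  using integral_affine[OF assms, of 1 w] by (simp add: add.commute)

text \<open>The identity is tested against \<open>\<phi>\<close>, to which the fundamental theorem
  of calculus applies classically along lines; Fubini and the definition of the weak derivative
  carry it over to \<open>u\<close>.\<close>

theorem weak_translation:
  assumes w: "is_weak_partial i u g" and u: "u \<in> L2" and h: "0 \<le> h"
  shows "AE x in lborel. u (x + h *\<^sub>R axis i 1) - u x = (LINT s|lborel. indicator {0..h} s *\<^sub>R g (x + s *\<^sub>R axis i 1))"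
proof -
  let ?e = "axis i 1 :: real^3"
  let ?v = "\<lambda>x. LINT s|lborel. indicator {0..h} s *\<^sub>R g (x + s *\<^sub>R ?e)"
  have g: "g \<in> L2" by (rule wpD(1)[OF w])
  note [measurable] = L2_meas[OF g] L2_meas[OF u]
  have gm: "(\<lambda>(s, x). g (x + s *\<^sub>R ?e)) \<in> borel_measurable (borel \<Otimes>\<^sub>M borel)" by measurable
  note A = L2_average[OF gm, of 0 h "l2n g", OF L2_translate(1)[OF g] eq_refl[OF L2_translate(2)[OF g]] h]
  have "AE x in lborel. (u (x + h *\<^sub>R ?e) - u x) - ?v x = 0"
  proof (rule fundamental_lemma)
    show "loc_L2 (\<lambda>x. (u (x + h *\<^sub>R ?e) - u x) - ?v x)"
      by (intro L2_loc_L2 L2_diff L2_translate u A(1))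
    fix \<phi> assume p: "\<phi> \<in> test_functions"
    note q = test_partial[OF p, of i]
    note [measurable] = test_measurable[OF p] test_measurable[OF q]
    have tr: "(\<lambda>x. \<phi> (x - s *\<^sub>R ?e)) \<in> test_functions" for s
      using test_affine[OF p, of 1 "- s *\<^sub>R ?e"] by simp
    have ptr: "partial i (\<lambda>x. \<phi> (x - s *\<^sub>R ?e)) x = partial i \<phi> (x - s *\<^sub>R ?e)" for s x
      using partial_affine(2)[OF test_differentiable[OF p], of i "- s *\<^sub>R ?e" 1 x] by simp
    \<comment> \<open>\<open>G s\<close> is the derivative in \<open>s\<close> of
      \<open>\<phi>\<close> translated by \<open>s\<close>, and also minus the \<open>i\<close>-th
      partial derivative of that translate, which is a test function; the second reading brings in
      \<open>g\<close>.\<close>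
    define G where "G s x = complex_of_real (- partial i \<phi> (x - s *\<^sub>R ?e))" for s x
    have Gm: "(\<lambda>(s, x). G s x) \<in> borel_measurable (borel \<Otimes>\<^sub>M borel)" unfolding G_def by measurable
    have GL: "G s \<in> L2 \<and> l2n (G s) \<le> l2n (\<lambda>x. complex_of_real (partial i \<phi> x))" for s
    proof -
      have "G s = (\<lambda>x. - complex_of_real (partial i \<phi> (x + (- s) *\<^sub>R ?e)))" by (auto simp: G_def)
      then show ?thesis
        using L2_translate[OF test_L2[OF q], of "(- s) *\<^sub>R ?e"] by (simp add: L2_uminus l2n_uminus)
    qed
    note AG = L2_average[OF Gm, of 0 h, OF conjunct1[OF GL] conjunct2[OF GL] h]
    have FTC: "(LINT s|lborel. indicator {0..h} s *\<^sub>R G s x) = complex_of_real (\<phi> (x - h *\<^sub>R ?e) - \<phi> x)" for x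
    proof -
      have "(LINT s|lborel. indicator {0..h} s *\<^sub>R (- partial i \<phi> (x - s *\<^sub>R ?e))) = \<phi> (x - h *\<^sub>R ?e) - \<phi> (x - 0 *\<^sub>R ?e)"
      proof (rule integral_FTC_Icc[OF h])
        fix s
        have "((\<lambda>s. \<phi> (x + (- s) *\<^sub>R ?e)) has_real_derivative partial i \<phi> (x + (- s) *\<^sub>R ?e) * (- 1)) (at s within {0..h})"
          by (rule DERIV_chain2[OF test_line_deriv[OF p]]) (auto intro!: derivative_eq_intros)
        then show "((\<lambda>s. \<phi> (x - s *\<^sub>R ?e)) has_vector_derivative - partial i \<phi> (x - s *\<^sub>R ?e)) (at s within {0..h})"
          by (simp add: has_real_derivative_iff_has_vector_derivative)
      next
        show "continuous_on {0..h} (\<lambda>s. - partial i \<phi> (x - s *\<^sub>R ?e))"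
          by (intro continuous_on_minus continuous_on_compose2[OF partial_continuous[OF p, of UNIV]] continuous_intros) auto
      qed
      then have "complex_of_real (LINT s|lborel. indicator {0..h} s *\<^sub>R (- partial i \<phi> (x - s *\<^sub>R ?e)))
          = of_real (\<phi> (x - h *\<^sub>R ?e) - \<phi> x)" by simp
      then show ?thesis unfolding G_def integral_complex_of_real[symmetric] by (simp add: scaleR_conv_of_real[of _ "_ :: complex"])
    qed
    have "(LINT x|lborel. u (x + h *\<^sub>R ?e) * of_real (\<phi> x)) = (LINT x|lborel. u x * of_real (\<phi> (x - h *\<^sub>R ?e)))"
      using integral_translate[of "\<lambda>x. u x * of_real (\<phi> (x - h *\<^sub>R ?e))" "h *\<^sub>R ?e"] by simp
    then have "(LINT x|lborel. u (x + h *\<^sub>R ?e) * of_real (\<phi> x)) - (LINT x|lborel. u x * of_real (\<phi> x))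
        = (LINT x|lborel. complex_of_real (\<phi> (x - h *\<^sub>R ?e) - \<phi> x) * u x)"
      using L2_test_integrable[OF u p] L2_test_integrable[OF u tr] by (simp add: right_diff_distrib mult.commute)
    also have "\<dots> = (LINT s|lborel. indicator {0..h} s *\<^sub>R (LINT x|lborel. G s x * u x))"
      unfolding FTC[symmetric] by (rule AG(4)[OF u])
    also have "\<dots> = (LINT s|lborel. indicator {0..h} s *\<^sub>R (LINT x|lborel. g (x + s *\<^sub>R ?e) * of_real (\<phi> x)))"
    proof (rule Bochner_Integration.integral_cong[OF refl])
      fix s
      have "(LINT x|lborel. G s x * u x) = - (LINT x|lborel. u x * of_real (partial i (\<lambda>x. \<phi> (x - s *\<^sub>R ?e)) x))"
        by (simp add: G_def ptr mult.commute)
      also have "\<dots> = (LINT x|lborel. g x * of_real (\<phi> (x - s *\<^sub>R ?e)))" by (simp add: wpD(2)[OF w tr])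
      also have "\<dots> = (LINT x|lborel. g (x + s *\<^sub>R ?e) * of_real (\<phi> x))"
        using integral_translate[of "\<lambda>x. g x * of_real (\<phi> (x - s *\<^sub>R ?e))" "s *\<^sub>R ?e"] by simp
      finally show "indicator {0..h} s *\<^sub>R (LINT x|lborel. G s x * u x) = indicator {0..h} s *\<^sub>R (LINT x|lborel. g (x
          + s *\<^sub>R ?e) * of_real (\<phi> x))" by (simp only:)
    qed
    also have "\<dots> = (LINT x|lborel. ?v x * of_real (\<phi> x))" by (rule A(4)[OF test_L2[OF p], symmetric])
    finally show "(LINT x|lborel. ((u (x + h *\<^sub>R ?e) - u x) - ?v x) * of_real (\<phi> x)) = 0"
      using L2_test_integrable[OF u p] L2_test_integrable[OF L2_translate(1)[OF u] p] L2_test_integrable[OF A(1) p]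
      by (simp add: left_diff_distrib)
  qed
  then show ?thesis by simp
qed

corollary translation_estimate:
  assumes w: "is_weak_partial i u g" and u: "u \<in> L2"
  shows "l2n (\<lambda>x. u (x + h *\<^sub>R axis i 1) - u x) \<le> \<bar>h\<bar> * l2n g"
proof -
  let ?e = "axis i 1 :: real^3"
  have g: "g \<in> L2" by (rule wpD(1)[OF w])
  note [measurable] = L2_meas[OF g] L2_meas[OF u]
  have pos: "l2n (\<lambda>x. u (x + h *\<^sub>R ?e) - u x) \<le> h * l2n g" if h: "h \<ge> 0" for h
  proof -
    have gm: "(\<lambda>(s, x). g (x + s *\<^sub>R ?e)) \<in> borel_measurable (borel \<Otimes>\<^sub>M borel)" by measurable
    note A = L2_average[OF gm, of 0 h "l2n g", OF L2_translate(1)[OF g] eq_refl[OF L2_translate(2)[OF g]] h]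
    have "l2n (\<lambda>x. u (x + h *\<^sub>R ?e) - u x) = l2n (\<lambda>x. LINT s|lborel. indicator {0..h} s *\<^sub>R g (x + s *\<^sub>R ?e))"
      by (rule l2n_AE[OF _ L2_meas[OF A(1)] weak_translation[OF w u h]]) measurable
    then show ?thesis using A(2) by simp
  qed
  show ?thesis
  proof (cases "h \<ge> 0")
    case True then show ?thesis using pos by simp
  next
    case False
    have "l2n (\<lambda>x. u (x + h *\<^sub>R ?e) - u x) = l2n (\<lambda>x. u x - u (x + h *\<^sub>R ?e))" by (rule l2n_diff_sym)
    also have "\<dots> = l2n (\<lambda>x. u (x + (- h) *\<^sub>R ?e) - u x)"
      using L2_translate(2)[OF L2_diff[OF u L2_translate(1)[OF u, of "h *\<^sub>R ?e"]], of "(- h) *\<^sub>R ?e"] by simp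
    finally show ?thesis using pos[of "- h"] False by simp
  qed
qed

lemma frechet_expand:
  assumes "\<phi> differentiable (at (x :: real^3))"
  shows "frechet_derivative \<phi> (at x) y = (\<Sum>i\<in>UNIV. y $ i * partial i \<phi> x)"
proof -
  note lin = linear_frechet_derivative[OF assms]
  have "frechet_derivative \<phi> (at x) y = frechet_derivative \<phi> (at x) (\<Sum>i\<in>UNIV. (y $ i) *\<^sub>R axis i 1)"
    using basis_expansion[of y] by (simp add: scalar_mult_eq_scaleR)
  then show ?thesis by (simp add: linear_sum[OF lin] linear_cmul[OF lin] partial_def)
qed

text \<open>The scheme of \<open>weak_translation\<close> for dilations. A change of variables moves
  the scale onto the test function, whose derivative in the scale is a divergence, so that the weak
  derivatives of \<open>u\<close> come in. Because of the factors \<open>x $ i\<close> the right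
  side is in general only locally square-integrable.\<close>

theorem weak_dilation:
  assumes w: "\<And>i. is_weak_partial i u (g i)" and u: "u \<in> L2" and a: "0 < a" and ab: "a \<le> b"
  shows "AE x in lborel. u (b *\<^sub>R x) - u (a *\<^sub>R x) = (\<Sum>i\<in>UNIV. of_real (x $ i) * (LINT s|lborel. indicator {a..b} s *\<^sub>R g i (s *\<^sub>R x)))"
proof -
  let ?V = "\<lambda>i x. LINT s|lborel. indicator {a..b} s *\<^sub>R g i (s *\<^sub>R x)"
  have b: "b > 0" using a ab by simp
  have g: "g i \<in> L2" for i by (rule wpD(1)[OF w])
  note [measurable] = L2_meas[OF g] L2_meas[OF u]
  have sb: "sqrt (1 / \<bar>s\<bar>^3) \<le> sqrt (1 / a^3)" if "a \<le> s" for s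
    using a that by (intro real_sqrt_le_mono divide_left_mono power_mono mult_pos_pos) auto
  have gm: "(\<lambda>(s, x). g i (s *\<^sub>R x)) \<in> borel_measurable (borel \<Otimes>\<^sub>M borel)" for i by measurable
  have gL: "(\<lambda>x. g i (s *\<^sub>R x)) \<in> L2 \<and> l2n (\<lambda>x. g i (s *\<^sub>R x)) \<le> sqrt (1 / a^3) * l2n (g i)" if "a \<le> s" for s i
    using L2_affine[OF g[of i], of s 0] that a sb[OF that] by (auto intro: mult_right_mono)
  note A = L2_average[OF gm, of a b, OF conjunct1[OF gL] conjunct2[OF gL] ab]
  have dil: "(\<lambda>x. u (c *\<^sub>R x)) \<in> L2" if "c > 0" for c using L2_affine(1)[OF u, of c 0] that by simp
  have Vl: "loc_L2 (\<lambda>x. of_real (x $ i) * ?V i x)" for i by (intro loc_L2_coord A(1)) auto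
  have sum3: "(\<Sum>i\<in>UNIV. f i) = f 1 + f 2 + f (3::3)" for f :: "3 \<Rightarrow> complex" by (simp add: sum_3)
  have "AE x in lborel. (u (b *\<^sub>R x) - u (a *\<^sub>R x)) - (\<Sum>i\<in>UNIV. of_real (x $ i) * ?V i x) = 0"
  proof (rule fundamental_lemma)
    show loc: "loc_L2 (\<lambda>x. (u (b *\<^sub>R x) - u (a *\<^sub>R x)) - (\<Sum>i\<in>UNIV. of_real (x $ i) * ?V i x))"
      unfolding sum3 by (intro loc_L2_diff loc_L2_add Vl L2_loc_L2 dil a b)
    fix \<phi> assume p: "\<phi> \<in> test_functions"
    define \<eta> where "\<eta> i x = x $ i * \<phi> x" for i :: 3 and x
    have cT: "\<eta> i \<in> test_functions" for i unfolding \<eta>_def by (rule test_mult_kd[OF p kd_coord])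
    have pc: "partial i (\<eta> i) x = \<phi> x + x $ i * partial i \<phi> x" for i x
      unfolding \<eta>_def by (subst partial_mult) (auto simp: coord_differentiable test_differentiable[OF p] partial_coord)
    note [measurable] = test_measurable[OF p] test_measurable[OF test_partial[OF cT]]
    \<comment> \<open>\<open>\<theta> s\<close> rescales \<open>\<phi>\<close> with its integral
      preserved. Its derivative in \<open>s\<close> is minus the divergence of the field with
      components \<open>\<psi> i s\<close>, which rescale \<open>x $ i * \<phi> x\<close> in the
      same way.\<close>
    define \<theta> where "\<theta> s x = (1 / s^3) * \<phi> ((1/s) *\<^sub>R x)" for s x
    define \<psi> where "\<psi> i s x = (1 / s^3) * \<eta> i ((1/s) *\<^sub>R x)" for i s x
    have pT: "\<psi> i s \<in> test_functions" if "s > 0" for i s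
      unfolding \<psi>_def using test_affine[OF cT[of i], of "1/s" 0] that by (intro test_scale) simp
    have pp: "partial i (\<psi> i s) x = (1 / s^4) * partial i (\<eta> i) ((1/s) *\<^sub>R x)" if "s > 0" for i s x
    proof -
      have "(\<lambda>x. \<eta> i ((1/s) *\<^sub>R x)) differentiable (at x)"
        using test_affine[OF cT[of i], of "1/s" 0] that by (intro test_differentiable) simp
      then have "partial i (\<psi> i s) x = (1 / s^3) * partial i (\<lambda>x. \<eta> i ((1/s) *\<^sub>R x)) x"
        unfolding \<psi>_def by (subst partial_mult) (auto simp: partial_eq[OF has_derivative_const])
      also have "partial i (\<lambda>x. \<eta> i ((1/s) *\<^sub>R x)) x = (1/s) * partial i (\<eta> i) ((1/s) *\<^sub>R x)"
        using partial_affine(2)[OF test_differentiable[OF cT], of i i 0 "1/s" x] by simp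
      finally show ?thesis by (simp add: power_Suc2 eval_nat_numeral)
    qed
    have th: "((\<lambda>s. \<theta> s x) has_real_derivative - (\<Sum>i\<in>UNIV. partial i (\<psi> i s) x)) (at s)" if s: "s > 0" for s x
    proof -
      have 1: "((\<lambda>s. (1/s) *\<^sub>R x) has_derivative (\<lambda>h. (- h / s\<^sup>2) *\<^sub>R x)) (at s)"
        using s by (auto intro!: derivative_eq_intros simp: power2_eq_square)
      have "((\<lambda>s. \<phi> ((1/s) *\<^sub>R x)) has_derivative (\<lambda>h. frechet_derivative \<phi> (at ((1/s) *\<^sub>R x)) ((- h /
          s\<^sup>2) *\<^sub>R x))) (at s)"
        by (rule has_derivative_compose[OF 1 partial_has_derivative[OF test_differentiable[OF p]]])
      then have 2: "((\<lambda>s. \<phi> ((1/s) *\<^sub>R x)) has_real_derivative - (1 / s\<^sup>2) * (\<Sum>i\<in>UNIV. x $ i * partial i \<phi>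
          ((1/s) *\<^sub>R x))) (at s)"
      proof -
        have "(\<lambda>h. frechet_derivative \<phi> (at ((1/s) *\<^sub>R x)) ((- h / s\<^sup>2) *\<^sub>R x))
            = (*) (- (1 / s\<^sup>2) * (\<Sum>i\<in>UNIV. x $ i * partial i \<phi> ((1/s) *\<^sub>R x)))"
          using s by (intro ext) (simp add: frechet_expand[OF test_differentiable[OF p]] sum_3 field_simps)
        then show ?thesis using \<open>((\<lambda>s. \<phi> ((1/s) *\<^sub>R x)) has_derivative _) _\<close> unfolding has_field_derivative_def by (simp only:)
      qed
      show ?thesis unfolding \<theta>_def
        using s by (auto intro!: derivative_eq_intros 2 simp: pp[OF s] pc sum_3 field_simps power2_eq_square power3_eq_cube eval_nat_numeral)
    qed
    define G where "G i s x = complex_of_real (- (1 / s^4) * partial i (\<eta> i) ((1/s) *\<^sub>R x))" for i s x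
    have Gm: "(\<lambda>(s, x). G i s x) \<in> borel_measurable (borel \<Otimes>\<^sub>M borel)" for i unfolding G_def by measurable
    have GL: "G i s \<in> L2 \<and> l2n (G i s) \<le> (1 / a^4) * (sqrt (b^3) * l2n (\<lambda>x. complex_of_real (partial i (\<eta> i) x)))" if s: "a
        \<le> s" "s \<le> b" for i s
    proof -
      have s0: "s > 0" using a s by simp
      note T = L2_affine[OF test_L2[OF test_partial[OF cT[of i], of i]], of "1/s" 0]
      have e: "G i s = (\<lambda>x. of_real (- (1 / s^4)) * complex_of_real (partial i (\<eta> i) ((1/s) *\<^sub>R x)))" by (auto simp: G_def)
      have "l2n (G i s) = (1 / s^4) * (sqrt (s^3) * l2n (\<lambda>x. complex_of_real (partial i (\<eta> i) x)))"
        unfolding e l2n_scale using T(2) s0 by (simp add: norm_divide norm_power power_divide)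
      also have "\<dots> \<le> (1 / a^4) * (sqrt (b^3) * l2n (\<lambda>x. complex_of_real (partial i (\<eta> i) x)))"
        using a s s0 by (intro mult_mono divide_left_mono power_mono real_sqrt_le_mono mult_pos_pos) auto
      finally have "l2n (G i s) \<le> (1 / a^4) * (sqrt (b^3) * l2n (\<lambda>x. complex_of_real (partial i (\<eta> i) x)))" .
      moreover have "G i s \<in> L2" unfolding e by (rule L2_scale) (use T(1) s0 in simp)
      ultimately show ?thesis by blast
    qed
    note AG = L2_average[OF Gm, of a b, OF conjunct1[OF GL] conjunct2[OF GL] ab]
    have Gp: "G i s x = of_real (- partial i (\<psi> i s) x)" if "s > 0" for i s x by (simp add: G_def pp[OF that])
    have cont: "continuous_on {a..b} (\<lambda>s. partial i (\<psi> i s) x)" for i x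
    proof -
      have "continuous_on {a..b} (\<lambda>s. (1 / s^4) * partial i (\<eta> i) ((1/s) *\<^sub>R x))"
        using a by (intro continuous_intros continuous_on_compose2[OF partial_continuous[OF cT, of UNIV]]) auto
      then show ?thesis using a by (subst continuous_on_cong[OF refl pp]) auto
    qed
    have FTC: "complex_of_real (\<theta> b x - \<theta> a x) = (\<Sum>i\<in>UNIV. LINT s|lborel. indicator {a..b} s *\<^sub>R G i s x)" for x
    proof -
      have ii: "integrable lborel (\<lambda>s. indicator {a..b} s *\<^sub>R (- partial i (\<psi> i s) x))" for i
        by (rule borel_integrable_compact[OF compact_Icc continuous_on_minus[OF cont]])
      have "(LINT s|lborel. indicator {a..b} s *\<^sub>R (- (\<Sum>i\<in>UNIV. partial i (\<psi> i s) x))) = \<theta> b x - \<theta> a x"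
      proof (rule integral_FTC_Icc[OF ab])
        fix s assume "a \<le> s" "s \<le> b"
        then show "((\<lambda>s. \<theta> s x) has_vector_derivative - (\<Sum>i\<in>UNIV. partial i (\<psi> i s) x)) (at s within {a..b})"
          using th[of s x] a by (auto simp: has_real_derivative_iff_has_vector_derivative[symmetric] intro: DERIV_subset)
      qed (intro continuous_intros cont)
      also have "(LINT s|lborel. indicator {a..b} s *\<^sub>R (- (\<Sum>i\<in>UNIV. partial i (\<psi> i s) x)))
          = (\<Sum>i\<in>UNIV. LINT s|lborel. indicator {a..b} s *\<^sub>R (- partial i (\<psi> i s) x))"
      proof -
        have "(LINT s|lborel. indicator {a..b} s *\<^sub>R (- (\<Sum>i\<in>UNIV. partial i (\<psi> i s) x)))
            = (LINT s|lborel. (\<Sum>i\<in>UNIV. indicator {a..b} s *\<^sub>R (- partial i (\<psi> i s) x)))"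
          by (intro Bochner_Integration.integral_cong refl) (simp add: sum_3 algebra_simps)
        also have "\<dots> = (\<Sum>i\<in>UNIV. LINT s|lborel. indicator {a..b} s *\<^sub>R (- partial i (\<psi> i s) x))"
          by (rule Bochner_Integration.integral_sum) (rule ii)
        finally show ?thesis .
      qed
      finally have "complex_of_real (\<theta> b x - \<theta> a x)
          = (\<Sum>i\<in>UNIV. complex_of_real (LINT s|lborel. indicator {a..b} s *\<^sub>R (- partial i (\<psi> i s) x)))"
        by (simp only: of_real_sum[symmetric])
      also have "\<dots> = (\<Sum>i\<in>UNIV. LINT s|lborel. indicator {a..b} s *\<^sub>R G i s x)"
        unfolding integral_complex_of_real[symmetric] using a
        by (intro sum.cong Bochner_Integration.integral_cong refl) (auto simp: indicator_def Gp)
      finally show ?thesis .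
    qed
    have sc: "(LINT x|lborel. u (c *\<^sub>R x) * of_real (\<phi> x)) = (LINT x|lborel. u x * of_real (\<theta> c x))" if c: "c > 0" for c
    proof -
      have "(LINT x|lborel. u (0 + c *\<^sub>R x) * of_real (\<phi> ((1/c) *\<^sub>R (0 + c *\<^sub>R x))))
          = (1 / \<bar>c\<bar>^3) *\<^sub>R (LINT x|lborel. u x * of_real (\<phi> ((1/c) *\<^sub>R x)))"
        by (rule integral_affine) (use c in auto)
      then have "(LINT x|lborel. u (c *\<^sub>R x) * of_real (\<phi> x)) = of_real (1 / c^3) * (LINT x|lborel. u x * of_real (\<phi> ((1/c) *\<^sub>R x)))"
        using c by (simp add: scaleR_conv_of_real[of _ "_ :: complex"])
      also have "\<dots> = (LINT x|lborel. of_real (1 / c^3) * (u x * of_real (\<phi> ((1/c) *\<^sub>R x))))" by (rule integral_mult_right_zero[symmetric])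
      also have "\<dots> = (LINT x|lborel. u x * of_real (\<theta> c x))" by (simp add: \<theta>_def mult_ac)
      finally show ?thesis .
    qed
    have thT: "\<theta> c \<in> test_functions" if "c > 0" for c
      unfolding \<theta>_def using test_affine[OF p, of "1/c" 0] that by (intro test_scale) simp
    have "(LINT x|lborel. u (b *\<^sub>R x) * of_real (\<phi> x)) - (LINT x|lborel. u (a *\<^sub>R x) * of_real (\<phi> x))
        = (LINT x|lborel. complex_of_real (\<theta> b x - \<theta> a x) * u x)"
      unfolding sc[OF a] sc[OF b] using L2_test_integrable[OF u thT[OF a]] L2_test_integrable[OF u thT[OF b]]
      by (simp add: right_diff_distrib mult.commute)
    also have "\<dots> = (\<Sum>i\<in>UNIV. LINT x|lborel. (LINT s|lborel. indicator {a..b} s *\<^sub>R G i s x) * u x)"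
      unfolding FTC sum_distrib_right by (rule Bochner_Integration.integral_sum) (intro L2_mult_integrable AG(1) u; simp)
    also have "\<dots> = (\<Sum>i\<in>UNIV. LINT s|lborel. indicator {a..b} s *\<^sub>R (LINT x|lborel. G i s x * u x))"
      by (intro sum.cong refl AG(4) u) auto
    also have "\<dots> = (\<Sum>i\<in>UNIV. LINT s|lborel. indicator {a..b} s *\<^sub>R (LINT x|lborel. g i (s *\<^sub>R x) * of_real (\<eta> i x)))"
    proof (intro sum.cong Bochner_Integration.integral_cong refl)
      fix i s
      show "indicator {a..b} s *\<^sub>R (LINT x|lborel. G i s x * u x) = indicator {a..b} s *\<^sub>R (LINT x|lborel. g i (s *\<^sub>R x) * of_real (\<eta> i x))"
      proof (cases "s \<in> {a..b}")
        case True
        then have s: "s > 0" using a by auto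
        note [measurable] = test_measurable[OF cT]
        have "(LINT x|lborel. G i s x * u x) = - (LINT x|lborel. u x * of_real (partial i (\<psi> i s) x))"
          by (simp add: Gp[OF s] mult.commute)
        also have "\<dots> = (LINT x|lborel. g i x * of_real (\<psi> i s x))" by (simp add: wpD(2)[OF w pT[OF s]])
        also have "\<dots> = (LINT x|lborel. of_real (1 / s^3) * (g i x * of_real (\<eta> i ((1/s) *\<^sub>R x))))" by (simp add: \<psi>_def mult_ac)
        also have "\<dots> = of_real (1 / s^3) * (LINT x|lborel. g i x * of_real (\<eta> i ((1/s) *\<^sub>R x)))" by (rule integral_mult_right_zero)
        also have "\<dots> = (1 / \<bar>s\<bar>^3) *\<^sub>R (LINT x|lborel. g i x * of_real (\<eta> i ((1/s) *\<^sub>R x)))" using s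
            by (simp add: scaleR_conv_of_real[of _ "_ :: complex"])
        also have "\<dots> = (LINT x|lborel. g i (0 + s *\<^sub>R x) * of_real (\<eta> i ((1/s) *\<^sub>R (0 + s *\<^sub>R x))))"
          by (rule integral_affine[symmetric]) (use s in auto)
        finally show ?thesis using s by simp
      qed simp
    qed
    also have "\<dots> = (\<Sum>i\<in>UNIV. LINT x|lborel. ?V i x * of_real (\<eta> i x))"
      by (intro sum.cong refl A(4)[symmetric] test_L2 cT) auto
    also have "\<dots> = (\<Sum>i\<in>UNIV. LINT x|lborel. of_real (x $ i) * ?V i x * of_real (\<phi> x))"
      by (intro sum.cong Bochner_Integration.integral_cong refl) (simp add: \<eta>_def)
    finally show "(LINT x|lborel. ((u (b *\<^sub>R x) - u (a *\<^sub>R x)) - (\<Sum>i\<in>UNIV. of_real (x $ i) * ?V i x)) * of_real (\<phi> x)) = 0"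
      using L2_test_integrable[OF dil[OF a] p] L2_test_integrable[OF dil[OF b] p] loc_L2_mult_test[OF Vl p]
      by (simp add: left_diff_distrib sum_3 distrib_right)
  qed
  then show ?thesis by simp
qed

subsection \<open>The Ladyzhenskaya inequality in three dimensions\<close>

text \<open>The square root is infinite at infinity, so that Cauchy-Schwarz can be iterated on
  extended integrals without finiteness conditions.\<close>

definition esqrt :: "ennreal \<Rightarrow> ennreal" where
  "esqrt a = (if a = \<infinity> then \<infinity> else ennreal (sqrt (enn2real a)))"

lemma esqrt_measurable[measurable]: "esqrt \<in> borel_measurable borel"
  unfolding esqrt_def by measurable

lemma esqrt_sq: "(esqrt a)\<^sup>2 = a"
proof (cases "a = \<infinity>")
  case False
  then show ?thesis unfolding esqrt_def
    by (cases a) (simp_all add: ennreal_power)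
qed (simp add: esqrt_def)

lemma ennreal_sq_le_imp: "(a::ennreal)\<^sup>2 \<le> b\<^sup>2 \<Longrightarrow> a \<le> b"
proof (rule ccontr)
  assume le: "a\<^sup>2 \<le> b\<^sup>2" and "\<not> a \<le> b"
  then have "b < a" by simp
  then obtain r where r: "r \<ge> 0" "b = ennreal r" by (cases b) auto
  show False
  proof (cases a)
    case (real s)
    then show False using le \<open>b < a\<close> r by (simp add: ennreal_power ennreal_less_iff abs_le_square_iff[symmetric])
  next
    case top
    then show False using le r by (simp add: ennreal_power top_unique)
  qed
qed

lemma cs_esqrt:
  assumes [measurable]: "f \<in> borel_measurable M" "g \<in> borel_measurable M"
  shows "(\<integral>\<^sup>+x. esqrt (f x) * esqrt (g x) \<partial>M)
      \<le> esqrt (\<integral>\<^sup>+x. f x \<partial>M) * esqrt (\<integral>\<^sup>+x. g x \<partial>M)"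
proof (rule ennreal_sq_le_imp)
  have "(\<integral>\<^sup>+x. esqrt (f x) * esqrt (g x) \<partial>M)\<^sup>2
      \<le> (\<integral>\<^sup>+x. (esqrt (f x))\<^sup>2 \<partial>M) * (\<integral>\<^sup>+x. (esqrt (g x))\<^sup>2 \<partial>M)"
    by (rule Cauchy_Schwarz_nn_integral) measurable
  then show "(\<integral>\<^sup>+x. esqrt (f x) * esqrt (g x) \<partial>M)\<^sup>2
      \<le> (esqrt (\<integral>\<^sup>+x. f x \<partial>M) * esqrt (\<integral>\<^sup>+x. g x \<partial>M))\<^sup>2"
    by (simp add: esqrt_sq power_mult_distrib)
qed

text \<open>By translation invariance the value does not depend on the \<open>i\<close>-th
  coordinate of \<open>x\<close>, which makes the iterated integrals below factorise.\<close>

definition line_sq :: "3 \<Rightarrow> (real ^ 3 \<Rightarrow> complex) \<Rightarrow> real ^ 3 \<Rightarrow> ennreal" where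
  "line_sq i u x = (\<integral>\<^sup>+s. ennreal ((norm (u (x + s *\<^sub>R axis i 1)))\<^sup>2) \<partial>lborel)"

lemma line_sq_measurable:
  assumes [measurable]: "u \<in> borel_measurable borel" shows "line_sq i u \<in> borel_measurable borel"
  unfolding line_sq_def by measurable

text \<open>Being constant in direction \<open>i\<close>, the function cannot be integrated over all
  of space. On the slab \<open>|x $ i| <= n\<close> its integral is \<open>2 n\<close> times the
  squared norm of \<open>u\<close>, and countably many slabs cover space.\<close>

lemma line_sq_finite:
  assumes u: "u \<in> L2" shows "AE x in lborel. line_sq i u x < \<infinity>"
proof -
  note [measurable] = L2_meas[OF u] line_sq_measurable[OF L2_meas[OF u]]
  have [measurable]: "(\<lambda>x::real^3. x $ i) \<in> borel_measurable borel"
    by (intro borel_measurable_continuous_onI continuous_intros)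
  let ?e = "axis i 1 :: real^3"
  have "AE x in lborel. indicator {- real n..real n} (x $ i) * line_sq i u x \<noteq> \<infinity>" for n :: nat
  proof (rule nn_integral_PInf_AE)
    have "(\<integral>\<^sup>+x. indicator {- real n..real n} (x $ i) * line_sq i u x \<partial>lborel)
      = (\<integral>\<^sup>+x. \<integral>\<^sup>+s. indicator {- real n..real n} (x $ i) * ennreal ((norm (u (x
          + s *\<^sub>R ?e)))\<^sup>2) \<partial>lborel \<partial>lborel)"
      unfolding line_sq_def by (intro nn_integral_cong, subst nn_integral_cmult) auto
    also have "\<dots> = (\<integral>\<^sup>+s. \<integral>\<^sup>+x. indicator {- real n..real n} (x $ i) * ennreal ((norm (u (x
        + s *\<^sub>R ?e)))\<^sup>2) \<partial>lborel \<partial>lborel)"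
      by (rule lborel_pair.Fubini') measurable
    also have "\<dots> = (\<integral>\<^sup>+s. \<integral>\<^sup>+x. indicator {- real n..real n} (x $ i - s) * ennreal ((norm (u x))\<^sup>2)
        \<partial>lborel \<partial>lborel)"
    proof (rule nn_integral_cong)
      fix s :: real
      have "(\<integral>\<^sup>+x. indicator {- real n..real n} ((s *\<^sub>R ?e + 1 *\<^sub>R x) $ i - s) * ennreal ((norm (u (s *\<^sub>R ?e
          + 1 *\<^sub>R x)))\<^sup>2) \<partial>lborel) = ennreal (1 / \<bar>1\<bar>^3) * (\<integral>\<^sup>+x. indicator {- real n..real n} (x $ i
          - s) * ennreal ((norm (u x))\<^sup>2) \<partial>lborel)"
        by (rule nn_integral_affine) auto
      then show "(\<integral>\<^sup>+x. indicator {- real n..real n} (x $ i) * ennreal ((norm (u (x + s *\<^sub>R ?e)))\<^sup>2) \<partial>lborel)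
          = (\<integral>\<^sup>+x. indicator {- real n..real n} (x $ i - s) * ennreal ((norm (u x))\<^sup>2) \<partial>lborel)"
        by (simp add: add.commute axis_def)
    qed
    also have "\<dots> = (\<integral>\<^sup>+x. \<integral>\<^sup>+s. indicator {- real n..real n} (x $ i - s) * ennreal ((norm (u x))\<^sup>2)
        \<partial>lborel \<partial>lborel)"
      by (rule lborel_pair.Fubini'[symmetric]) measurable
    also have "\<dots> = (\<integral>\<^sup>+x. ennreal (2 * real n) * ennreal ((norm (u x))\<^sup>2) \<partial>lborel)"
    proof (rule nn_integral_cong)
      fix x :: "real^3"
      have "(\<integral>\<^sup>+s. indicator {- real n..real n} (x $ i - s) * ennreal ((norm (u x))\<^sup>2) \<partial>lborel)
          = (\<integral>\<^sup>+s. ennreal ((norm (u x))\<^sup>2) * indicator {x $ i - real n..x $ i + real n} s \<partial>lborel)"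
        by (intro nn_integral_cong) (auto simp: indicator_def)
      also have "\<dots> = ennreal ((norm (u x))\<^sup>2) * emeasure lborel {x $ i - real n..x $ i + real n}" by (rule nn_integral_cmult_indicator) simp
      finally show "(\<integral>\<^sup>+s. indicator {- real n..real n} (x $ i - s) * ennreal ((norm (u x))\<^sup>2) \<partial>lborel)
          = ennreal (2 * real n) * ennreal ((norm (u x))\<^sup>2)"
        by (simp add: mult.commute)
    qed
    also have "\<dots> = ennreal (2 * real n) * ennreal ((l2n u)\<^sup>2)" by (subst nn_integral_cmult) (auto simp: nn_l2n[OF u])
    also have "\<dots> \<noteq> \<infinity>" by (simp add: ennreal_mult_eq_top_iff)
    finally show "(\<integral>\<^sup>+x. indicator {- real n..real n} (x $ i) * line_sq i u x \<partial>lborel) \<noteq> \<infinity>" .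
  qed measurable
  then have "AE x in lborel. \<forall>n::nat. indicator {- real n..real n} (x $ i) * line_sq i u x \<noteq> \<infinity>"
    by (rule AE_all_countable[THEN iffD2, rule_format])
  then show ?thesis
  proof eventually_elim
    case (elim x)
    obtain n where "\<bar>x $ i\<bar> < real n" using reals_Archimedean2 by blast
    then have "x $ i \<in> {- real n..real n}" by auto
    moreover have "indicator {- real n..real n} (x $ i) * line_sq i u x \<noteq> \<infinity>" using elim by (rule spec)
    ultimately show ?case by (simp add: less_top)
  qed
qed

lemma nn_integral_interval_cs:
  assumes [measurable]: "f \<in> borel_measurable borel" and l: "l \<ge> 0"
  shows "(\<integral>\<^sup>+s. ennreal (norm (f s)) * indicator {0..l} s \<partial>lborel)\<^sup>2
      \<le> ennreal l * (\<integral>\<^sup>+s. ennreal ((norm (f s))\<^sup>2) \<partial>(lborel :: real measure))"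
proof -
  have "(\<integral>\<^sup>+s. ennreal (norm (f s)) * indicator {0..l} s \<partial>lborel)\<^sup>2
      \<le> (\<integral>\<^sup>+s. (ennreal (norm (f s)))\<^sup>2 \<partial>lborel) * (\<integral>\<^sup>+s. (indicator {0..l} s)\<^sup>2
      \<partial>(lborel :: real measure))"
    by (rule Cauchy_Schwarz_nn_integral) measurable
  also have "(\<integral>\<^sup>+s. (indicator {0..l} s :: ennreal)\<^sup>2 \<partial>lborel)
      = (\<integral>\<^sup>+s. indicator {0..l} s \<partial>(lborel :: real measure))"
    by (intro nn_integral_cong) (auto simp: indicator_def)
  finally show ?thesis using l by (simp add: ennreal_power mult.commute)
qed

text \<open>Average \<open>\<bar>u x\<bar> \<le> \<bar>u (x + s e)\<bar> + \<integral>\<^sub>0\<^sup>l \<bar>g\<bar>\<close> over \<open>0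
    \<le> s \<le> l\<close>; optimising \<open>l\<close> gives the bound.\<close>

lemma line_bound:
  assumes w: "is_weak_partial i u g" and u: "u \<in> L2"
  shows "AE x in lborel. ennreal ((norm (u x))\<^sup>2) \<le> 4 * (esqrt (line_sq i u x) * esqrt (line_sq i g x))"
proof -
  let ?e = "axis i 1 :: real^3"
  have g: "g \<in> L2" by (rule wpD(1)[OF w])
  note [measurable] = L2_meas[OF g] L2_meas[OF u] line_sq_measurable[OF L2_meas[OF u]] line_sq_measurable[OF L2_meas[OF g]]
  let ?P = "\<lambda>x h. h \<ge> 0 \<longrightarrow> u (x + h *\<^sub>R ?e) - u x = (LINT s|lborel. indicator {0..h} s *\<^sub>R g (x + s *\<^sub>R ?e))"
  have "AE h in lborel. AE x in lborel. ?P x h"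
  proof (rule AE_I2)
    fix h :: real
    show "AE x in lborel. ?P x h"
    proof (cases "h \<ge> 0")
      case True
      from weak_translation[OF w u True] show ?thesis by eventually_elim simp
    qed simp
  qed
  \<comment> \<open>\<open>D\<close> vanishes exactly where the identity of
    \<open>weak_translation\<close> holds. Tonelli for its double integral exchanges the
    quantifiers: from every \<open>h\<close> and almost every \<open>x\<close> to almost every
    \<open>x\<close> and almost every \<open>h\<close>.\<close>
  define D where "D h x = ennreal (norm (u (x + h *\<^sub>R ?e) - u x - (LINT s|lborel. indicator {0..h} s *\<^sub>R g (x
      + s *\<^sub>R ?e)))) * indicator {0..} h" for h x
  have Dm[measurable]: "(\<lambda>(h, x). D h x) \<in> borel_measurable (borel \<Otimes>\<^sub>M borel)"   proof -
    have "D h x = (if 0 \<le> h then ennreal (norm (u (x + h *\<^sub>R ?e) - u x - (LINT s|lborel. (if 0 \<le> s \<and> s \<le> h then g (x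
        + s *\<^sub>R ?e) else 0)))) else 0)" for h x
    proof -
      have "indicator {0..h} s *\<^sub>R g (x + s *\<^sub>R ?e) = (if 0 \<le> s \<and> s \<le> h then g (x + s *\<^sub>R ?e) else 0)" for s by (simp add: indicator_def)
      then show ?thesis unfolding D_def by (simp add: indicator_def)
    qed
    then show ?thesis by (simp only:) measurable
  qed
  have Dm2: "(\<lambda>(x, h). D h x) \<in> borel_measurable (borel \<Otimes>\<^sub>M borel)"
    using measurable_compose[OF measurable_pair_swap'[of borel borel] Dm] by (simp add: case_prod_beta')
  have DP: "D h x = 0 \<longleftrightarrow> ?P x h" for h x by (auto simp: D_def indicator_def)
  have "(\<integral>\<^sup>+h. \<integral>\<^sup>+x. D h x \<partial>lborel \<partial>lborel) = (\<integral>\<^sup>+h. 0 \<partial>(lborel :: real measure))"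
  proof (rule nn_integral_cong_AE)
    show "AE h in lborel. (\<integral>\<^sup>+x. D h x \<partial>lborel) = 0"
      using \<open>AE h in lborel. AE x in lborel. ?P x h\<close>
    proof eventually_elim
      case (elim h)
      then have "AE x in lborel. D h x = 0" by (simp add: DP)
      then have "(\<integral>\<^sup>+x. D h x \<partial>lborel) = (\<integral>\<^sup>+x. 0 \<partial>(lborel :: (real^3) measure))" by (rule nn_integral_cong_AE)
      then show ?case by simp
    qed
  qed
  moreover have "(\<integral>\<^sup>+x. \<integral>\<^sup>+h. D h x \<partial>lborel \<partial>lborel)
      = (\<integral>\<^sup>+h. \<integral>\<^sup>+x. D h x \<partial>lborel \<partial>lborel)"
    by (rule lborel_pair.Fubini') measurable
  ultimately have "(\<integral>\<^sup>+x. \<integral>\<^sup>+h. D h x \<partial>lborel \<partial>lborel) = 0" by simp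
  moreover have "(\<lambda>x. \<integral>\<^sup>+h. D h x \<partial>lborel) \<in> borel_measurable lborel"
    by (rule lborel.borel_measurable_nn_integral) (use Dm2 in simp)
  ultimately have "AE x in lborel. (\<integral>\<^sup>+h. D h x \<partial>lborel) = 0"
    by (subst (asm) nn_integral_0_iff_AE)
  then have "AE x in lborel. AE h in lborel. ?P x h"
  proof eventually_elim
    case (elim x)
    have "(\<lambda>h. D h x) \<in> borel_measurable lborel" by measurable
    then have "AE h in lborel. D h x = 0" using elim by (simp add: nn_integral_0_iff_AE)
    then show ?case by (simp add: DP)
  qed
  then show ?thesis using line_sq_finite[OF u, of i] line_sq_finite[OF g, of i]
  proof eventually_elim
    case (elim x)
    define U where "U = enn2real (line_sq i u x)"
    define W where "W = enn2real (line_sq i g x)"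
    have U: "line_sq i u x = ennreal U" and W: "line_sq i g x = ennreal W" and UW0: "U \<ge> 0" "W \<ge> 0"
      using elim by (auto simp: U_def W_def)
    \<comment> \<open>Averaging over shifts in \<open>{0..l}\<close> and Cauchy-Schwarz give
      \<open>|u x| <= sqrt (U / l) + sqrt (l * W)\<close>; squaring costs a factor 2.\<close>
    have key: "(norm (u x))\<^sup>2 \<le> 2 * U / l + 2 * l * W" if l: "l > 0" for l
    proof -
      have "AE h in lborel. ennreal (norm (u x)) * indicator {0..l} h \<le> ennreal (norm (u (x + h *\<^sub>R ?e))) * indicator {0..l} h
          + (\<integral>\<^sup>+s. ennreal (norm (g (x + s *\<^sub>R ?e))) * indicator {0..l} s \<partial>lborel) * indicator {0..l} h"
        using elim(1)
      proof eventually_elim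
        case (elim h)
        show ?case
        proof (cases "h \<in> {0..l}")
          case True
          let ?I = "LINT s|lborel. indicator {0..h} s *\<^sub>R g (x + s *\<^sub>R ?e)"
          have "u x = u (x + h *\<^sub>R ?e) - ?I" using elim True by (auto simp: algebra_simps)
          then have "norm (u x) \<le> norm (u (x + h *\<^sub>R ?e)) + norm ?I"
            using norm_triangle_ineq4[of "u (x + h *\<^sub>R ?e)" ?I] by (simp only:)
          then have "ennreal (norm (u x)) \<le> ennreal (norm (u (x + h *\<^sub>R ?e))) + ennreal (norm ?I)"
            by (simp add: ennreal_plus[symmetric] del: ennreal_plus)
          also have "ennreal (norm ?I) \<le> (\<integral>\<^sup>+s. ennreal (norm (indicator {0..h} s *\<^sub>R g (x + s *\<^sub>R ?e))) \<partial>lborel)"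
          proof (cases "integrable lborel (\<lambda>s. indicator {0..h} s *\<^sub>R g (x + s *\<^sub>R ?e))")
            case True then show ?thesis by (rule integral_norm_bound_ennreal)
          qed (simp add: not_integrable_integral_eq)
          also have "\<dots> \<le> (\<integral>\<^sup>+s. ennreal (norm (g (x + s *\<^sub>R ?e))) * indicator {0..l} s \<partial>lborel)"
            by (intro nn_integral_mono) (use True in \<open>auto simp: indicator_def\<close>)
          finally show ?thesis using True by (simp add: add_mono)
        qed simp
      qed
      then have "(\<integral>\<^sup>+h. ennreal (norm (u x)) * indicator {0..l} h \<partial>lborel)
          \<le> (\<integral>\<^sup>+h. ennreal (norm (u (x + h *\<^sub>R ?e))) * indicator {0..l} h + (\<integral>\<^sup>+s. ennreal (norm (g (x
          + s *\<^sub>R ?e))) * indicator {0..l} s \<partial>lborel) * indicator {0..l} h \<partial>lborel)"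
        by (rule nn_integral_mono_AE)
      also have "\<dots> = (\<integral>\<^sup>+h. ennreal (norm (u (x + h *\<^sub>R ?e))) * indicator {0..l} h \<partial>lborel)
          + (\<integral>\<^sup>+s. ennreal (norm (g (x + s *\<^sub>R ?e))) * indicator {0..l} s \<partial>lborel) * ennreal l"
        using l by (subst nn_integral_add) (auto simp: nn_integral_cmult_indicator)
      also have "(\<integral>\<^sup>+h. ennreal (norm (u x)) * indicator {0..l} h \<partial>lborel) = ennreal (l * norm (u x))"
        using l by (simp add: nn_integral_cmult_indicator ennreal_mult mult.commute)
      also have "(\<integral>\<^sup>+h. ennreal (norm (u (x + h *\<^sub>R ?e))) * indicator {0..l} h \<partial>lborel) \<le> ennreal (sqrt (l * U))"
      proof (rule ennreal_sq_le_imp)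
        have "(\<integral>\<^sup>+h. ennreal (norm (u (x + h *\<^sub>R ?e))) * indicator {0..l} h \<partial>lborel)\<^sup>2 \<le> ennreal l * line_sq i u x"
          unfolding line_sq_def using l by (intro nn_integral_interval_cs) auto
        then show "(\<integral>\<^sup>+h. ennreal (norm (u (x + h *\<^sub>R ?e))) * indicator {0..l} h \<partial>lborel)\<^sup>2 \<le> (ennreal (sqrt (l * U)))\<^sup>2"
          using l UW0 by (simp add: U ennreal_power ennreal_mult)
      qed
      also have "(\<integral>\<^sup>+s. ennreal (norm (g (x + s *\<^sub>R ?e))) * indicator {0..l} s \<partial>lborel) \<le> ennreal (sqrt (l * W))"
      proof (rule ennreal_sq_le_imp)
        have "(\<integral>\<^sup>+h. ennreal (norm (g (x + h *\<^sub>R ?e))) * indicator {0..l} h \<partial>lborel)\<^sup>2 \<le> ennreal l * line_sq i g x"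
          unfolding line_sq_def using l by (intro nn_integral_interval_cs) auto
        then show "(\<integral>\<^sup>+h. ennreal (norm (g (x + h *\<^sub>R ?e))) * indicator {0..l} h \<partial>lborel)\<^sup>2 \<le> (ennreal (sqrt (l * W)))\<^sup>2"
          using l UW0 by (simp add: W ennreal_power ennreal_mult)
      qed
      finally have "ennreal (l * norm (u x)) \<le> ennreal (sqrt (l * U)) + ennreal (sqrt (l * W)) * ennreal l"
        by (simp add: add_mono mult_right_mono)
      also have "\<dots> = ennreal (sqrt (l * U) + sqrt (l * W) * l)" using l UW0 by (simp add: ennreal_mult)
      finally have "ennreal (l * norm (u x)) \<le> ennreal (sqrt (l * U) + sqrt (l * W) * l)" .
      then have "l * norm (u x) \<le> sqrt (l * U) + sqrt (l * W) * l"
        by (subst (asm) ennreal_le_iff) (use l UW0 in auto)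
      then have "(l * norm (u x))\<^sup>2 \<le> (sqrt (l * U) + sqrt (l * W) * l)\<^sup>2" using l by (intro power_mono) auto
      also have "\<dots> \<le> 2 * (sqrt (l * U))\<^sup>2 + 2 * (sqrt (l * W) * l)\<^sup>2"
        using sum_squares_bound[of "sqrt (l * U)" "sqrt (l * W) * l"] by (simp add: power2_sum)
      also have "\<dots> = 2 * (l * U) + 2 * (l * W * l\<^sup>2)" using l UW0 by (simp add: power_mult_distrib)
      finally have "l\<^sup>2 * (norm (u x))\<^sup>2 \<le> l\<^sup>2 * (2 * U / l + 2 * l * W)"
        using l by (simp add: power_mult_distrib algebra_simps power2_eq_square)
      then show ?thesis using l by simp
    qed
    \<comment> \<open>For positive \<open>U\<close> and \<open>W\<close> the length
      \<open>l = sqrt U / sqrt W\<close> balances the two terms. If \<open>U\<close> or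
      \<open>W\<close> vanishes, \<open>l\<close> is taken so small or so large, respectively, that
      the remaining term falls below the supposed gap \<open>d\<close>.\<close>
    have "(norm (u x))\<^sup>2 \<le> 4 * (sqrt U * sqrt W)"
    proof (rule ccontr)
      assume n: "\<not> ?thesis"
      define d where "d = (norm (u x))\<^sup>2 - 4 * (sqrt U * sqrt W)"
      have d: "d > 0" using n by (simp add: d_def)
      show False
      proof (cases "U = 0 \<or> W = 0")
        case False
        then have p: "U > 0" "W > 0" using UW0 by auto
        have "2 * U / (sqrt U / sqrt W) = 2 * (sqrt U * sqrt W)" "2 * (sqrt U / sqrt W) * W = 2 * (sqrt U * sqrt W)"
          using p by (simp_all add: field_simps)
        then show False using key[of "sqrt U / sqrt W"] p n by simp
      next
        case True
        then show False
        proof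
          assume "U = 0"
          have "2 * (d / (2 * W + 1) / 2) * W < d" using d UW0 by (simp add: field_simps add_pos_nonneg)
          then show False using key[of "d / (2 * W + 1) / 2"] \<open>U = 0\<close> d UW0 by (simp add: d_def)
        next
          assume "W = 0"
          have "2 * U / ((2 * U + 1) / d) < d" using d UW0 by (simp add: field_simps add_pos_nonneg)
          then show False using key[of "(2 * U + 1) / d"] \<open>W = 0\<close> d UW0 by (simp add: d_def)
        qed
      qed
    qed
    then show ?case using UW0 by (simp add: U W esqrt_def ennreal_mult[symmetric] ennreal_numeral[symmetric] del: ennreal_numeral)
  qed
qed

lemma v3_shift: "v3 (x, y, z) + s *\<^sub>R axis 1 1 = v3 (x + s, y, z)" "v3 (x, y, z) + s *\<^sub>R axis 2 1 = v3 (x, y + s, z)"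
  "v3 (x, y, z) + s *\<^sub>R axis 3 1 = v3 (x, y, z + s)"
  by (simp_all add: v3_def algebra_simps)

lemma nn_shift:
  fixes f :: "real \<Rightarrow> ennreal"
  assumes "f \<in> borel_measurable borel" shows "(\<integral>\<^sup>+s. f (x + s) \<partial>lborel) = (\<integral>\<^sup>+s. f s \<partial>lborel)"
  using nn_integral_real_affine[OF assms, of 1 x] by simp

text \<open>A curried form with its own measurability rule, since the three coordinates are
  integrated in several orders.\<close>

definition coord_sq :: "(real ^ 3 \<Rightarrow> complex) \<Rightarrow> real \<Rightarrow> real \<Rightarrow> real \<Rightarrow> ennreal" where
  "coord_sq v x y z = ennreal ((norm (v (v3 (x, y, z))))\<^sup>2)"

lemma coord_sq_measurable[measurable (raw)]:
  assumes [measurable]: "v \<in> borel_measurable borel" "f \<in> borel_measurable M" "h \<in> borel_measurable M" "k \<in> borel_measurable M"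
  shows "(\<lambda>p. coord_sq v (f p) (h p) (k p)) \<in> borel_measurable M"
  unfolding coord_sq_def by measurable

text \<open>For a fixed first coordinate, \<open>F 2\<close> does not depend on the second
  coordinate and \<open>F 3\<close> not on the third, so the slice integral of
  \<open>F 2 * F 3\<close> is a product. Cauchy-Schwarz on the factors produces the root of
  \<open>M u x\<close> twice, and \<open>M u x\<close> is bounded uniformly by \<open>S\<close>
  through the remaining direction. The constant 64 is the 4 of \<open>line_bound\<close>, once for
  each direction.\<close>

theorem ladyzhenskaya_nn:
  assumes w: "\<And>i. is_weak_partial i u (g i)" and u: "u \<in> L2"
  shows "(\<integral>\<^sup>+x. ennreal ((norm (u x))^4) \<partial>lborel)
      \<le> 64 * (esqrt (ennreal ((l2n u)\<^sup>2)) * esqrt (ennreal ((l2n (g 1))\<^sup>2)) * (esqrt (ennreal ((l2n (g 2))\<^sup>2)) * esqrt (ennreal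
      ((l2n (g 3))\<^sup>2))))"
proof -
  have g: "g i \<in> L2" for i by (rule wpD(1)[OF w])
  note [measurable] = L2_meas[OF g] L2_meas[OF u] line_sq_measurable[OF L2_meas[OF u]] line_sq_measurable[OF L2_meas[OF g]]
  define F where "F i x = 4 * (esqrt (line_sq i u x) * esqrt (line_sq i (g i) x))" for i x
  have [measurable]: "F i \<in> borel_measurable borel" for i unfolding F_def by measurable
  have l1: "line_sq 1 v (v3 (x, y, z)) = (\<integral>\<^sup>+s. coord_sq v s y z \<partial>lborel)" and l2: "line_sq 2 v (v3 (x, y, z))
      = (\<integral>\<^sup>+s. coord_sq v x s z \<partial>lborel)"
    and l3: "line_sq 3 v (v3 (x, y, z)) = (\<integral>\<^sup>+s. coord_sq v x y s \<partial>lborel)" if [measurable]: "v \<in> borel_measurable borel" for v x y z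
    unfolding line_sq_def v3_shift coord_sq_def
    using nn_shift[of "\<lambda>s. ennreal ((norm (v (v3 (s, y, z))))\<^sup>2)" x] nn_shift[of "\<lambda>s. ennreal ((norm (v (v3 (x, s,
        z))))\<^sup>2)" y] nn_shift[of "\<lambda>s. ennreal ((norm (v (v3 (x, y, s))))\<^sup>2)" z]
    by simp_all
  have tot: "(\<integral>\<^sup>+x. \<integral>\<^sup>+y. \<integral>\<^sup>+z. coord_sq v x y z \<partial>lborel \<partial>lborel \<partial>lborel)
      = ennreal ((l2n v)\<^sup>2)" if v: "v \<in> L2" for v
    unfolding coord_sq_def nn_l2n[OF v, symmetric] using L2_meas[OF v] by (subst nn_integral3) auto
  have sec: "(\<lambda>q. h (v3 (x, q))) \<in> borel_measurable (lborel \<Otimes>\<^sub>M lborel)" if "h \<in> borel_measurable borel" for h ::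
      "real^3 \<Rightarrow> ennreal" and x
  proof -
    have "(\<lambda>q. v3 (x, q)) \<in> borel_measurable borel"
      unfolding v3_def fst_conv snd_conv by (intro borel_measurable_continuous_onI continuous_intros)
    from measurable_compose[OF this that] show ?thesis by (simp add: lborel_prod)
  qed
  define M where "M v x = (\<integral>\<^sup>+y. \<integral>\<^sup>+z. coord_sq v x y z \<partial>lborel \<partial>lborel)" for v x
  have Mm[measurable]: "M v \<in> borel_measurable borel" if [measurable]: "v \<in> borel_measurable borel" for v unfolding M_def by measurable
  have swap: "(\<integral>\<^sup>+z. \<integral>\<^sup>+y. coord_sq v x y z \<partial>lborel \<partial>lborel)
      = M v x" if [measurable]: "v \<in> borel_measurable borel" for v x
    unfolding M_def by (rule lborel_pair.Fubini') measurable
  define S where "S = 4 * (esqrt (ennreal ((l2n u)\<^sup>2)) * esqrt (ennreal ((l2n (g 1))\<^sup>2)))"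
  \<comment> \<open>The line bound in direction 1 is integrated over a slice. There
    \<open>line_sq 1\<close> of a function integrates to its full squared norm, whatever the
    slice.\<close>
  have sup: "AE x in lborel. M u x \<le> S"
  proof -
    have "AE p in distr (lborel \<Otimes>\<^sub>M (lborel \<Otimes>\<^sub>M lborel)) borel v3. ennreal ((norm (u p))\<^sup>2) \<le> F 1 p"
      unfolding lborel_v3 F_def by (rule line_bound[OF w u])
    then have "AE p in (lborel \<Otimes>\<^sub>M (lborel \<Otimes>\<^sub>M lborel)). ennreal ((norm (u (v3 p)))\<^sup>2) \<le> F 1 (v3 p)"
      by (subst (asm) AE_distr_iff) (auto simp: lborel_prod)
    then have "AE p in (lborel \<Otimes>\<^sub>M (lborel :: (real \<times> real) measure)). ennreal ((norm (u (v3 p)))\<^sup>2) \<le> F 1 (v3 p)"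
      by (simp only: lborel_prod)
    from lborel_pair.AE_pair[OF this]
    have "AE x in lborel. AE q in (lborel \<Otimes>\<^sub>M lborel). ennreal ((norm (u (v3 (x, q))))\<^sup>2) \<le> F 1 (v3 (x, q))"
      by (simp only: lborel_prod)
    then show ?thesis
    proof eventually_elim
      case (elim x)
      then have "AE y in lborel. AE z in lborel. ennreal ((norm (u (v3 (x, y, z))))\<^sup>2) \<le> F 1 (v3 (x, y, z))"
        by (rule lborel_pair.AE_pair)
      then have "M u x \<le> (\<integral>\<^sup>+y. \<integral>\<^sup>+z. F 1 (v3 (x, y, z)) \<partial>lborel \<partial>lborel)"
        unfolding M_def coord_sq_def by (intro nn_integral_mono_AE) (auto elim!: eventually_mono intro!: nn_integral_mono_AE)
      also have "\<dots> = (\<integral>\<^sup>+q. F 1 (v3 (x, q)) \<partial>(lborel \<Otimes>\<^sub>M lborel))"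
        by (subst lborel.nn_integral_fst[symmetric]) (auto intro!: sec)
      also have "\<dots> = 4 * (\<integral>\<^sup>+q. esqrt (line_sq 1 u (v3 (x, q))) * esqrt (line_sq 1 (g 1) (v3 (x, q))) \<partial>(lborel \<Otimes>\<^sub>M lborel))"
        unfolding F_def by (rule nn_integral_cmult) (auto intro!: sec[where h="\<lambda>x. esqrt (line_sq 1 u x) * esqrt (line_sq 1 (g 1) x)"])
      also have "\<dots> \<le> 4 * (esqrt (\<integral>\<^sup>+q. line_sq 1 u (v3 (x, q)) \<partial>(lborel \<Otimes>\<^sub>M lborel)) * esqrt
          (\<integral>\<^sup>+q. line_sq 1 (g 1) (v3 (x, q)) \<partial>(lborel \<Otimes>\<^sub>M lborel)))"
        by (intro mult_left_mono cs_esqrt) (auto intro!: sec)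
      also have "\<dots> = S"
      proof -
        have "(\<integral>\<^sup>+q. line_sq 1 v (v3 (x, q)) \<partial>(lborel \<Otimes>\<^sub>M lborel)) = ennreal ((l2n v)\<^sup>2)" if v: "v \<in> L2" for v
        proof -
          note [measurable] = L2_meas[OF v] line_sq_measurable[OF L2_meas[OF v]]
          have "(\<integral>\<^sup>+q. line_sq 1 v (v3 (x, q)) \<partial>(lborel \<Otimes>\<^sub>M lborel))
              = (\<integral>\<^sup>+y. \<integral>\<^sup>+z. line_sq 1 v (v3 (x, y, z)) \<partial>lborel \<partial>lborel)"
            by (subst lborel.nn_integral_fst[symmetric]) (auto intro!: sec)
          also have "\<dots> = (\<integral>\<^sup>+y. \<integral>\<^sup>+z. \<integral>\<^sup>+s. coord_sq v s y z \<partial>lborel \<partial>lborel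
              \<partial>lborel)" by (simp add: l1)
          also have "\<dots> = (\<integral>\<^sup>+y. \<integral>\<^sup>+s. \<integral>\<^sup>+z. coord_sq v s y z \<partial>lborel \<partial>lborel \<partial>lborel)"
            by (intro nn_integral_cong lborel_pair.Fubini') measurable
          also have "\<dots> = (\<integral>\<^sup>+s. \<integral>\<^sup>+y. \<integral>\<^sup>+z. coord_sq v s y z \<partial>lborel \<partial>lborel \<partial>lborel)"
            by (intro lborel_pair.Fubini') measurable
          finally show ?thesis by (simp add: tot[OF v])
        qed
        then show ?thesis using u g by (simp add: S_def)
      qed
      finally show ?case .
    qed
  qed
  have "(\<integral>\<^sup>+x. ennreal ((norm (u x))^4) \<partial>lborel) \<le> (\<integral>\<^sup>+x. F 2 x * F 3 x \<partial>lborel)"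
  proof (rule nn_integral_mono_AE)
    show "AE x in lborel. ennreal ((norm (u x))^4) \<le> F 2 x * F 3 x"
      using line_bound[OF w[of 2] u] line_bound[OF w[of 3] u]
    proof eventually_elim
      case (elim x)
      have "ennreal ((norm (u x))^4) = ennreal ((norm (u x))\<^sup>2) * ennreal ((norm (u x))\<^sup>2)"
        by (simp add: ennreal_mult[symmetric] power_add[symmetric])
      also have "\<dots> \<le> F 2 x * F 3 x" unfolding F_def by (intro mult_mono elim) auto
      finally show ?case .
    qed
  qed
  also have "\<dots> = (\<integral>\<^sup>+x. \<integral>\<^sup>+y. \<integral>\<^sup>+z. F 2 (v3 (x, y, z)) * F 3 (v3 (x, y, z)) \<partial>lborel
      \<partial>lborel \<partial>lborel)"
    by (rule nn_integral3) measurable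
  also have "\<dots> \<le> (\<integral>\<^sup>+x. 16 * (S * (esqrt (M (g 2) x) * esqrt (M (g 3) x))) \<partial>lborel)"
  proof (rule nn_integral_mono_AE)
    show "AE x in lborel. (\<integral>\<^sup>+y. \<integral>\<^sup>+z. F 2 (v3 (x, y, z)) * F 3 (v3 (x, y, z)) \<partial>lborel \<partial>lborel)
        \<le> 16 * (S * (esqrt (M (g 2) x) * esqrt (M (g 3) x)))"
      using sup
    proof eventually_elim
      case (elim x)
      define a where "a z = esqrt (\<integral>\<^sup>+s. coord_sq u x s z \<partial>lborel) * esqrt (\<integral>\<^sup>+s. coord_sq (g 2) x s z \<partial>lborel)" for z
      define b where "b y = esqrt (\<integral>\<^sup>+s. coord_sq u x y s \<partial>lborel) * esqrt (\<integral>\<^sup>+s. coord_sq (g 3) x y s \<partial>lborel)" for y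
      have [measurable]: "a \<in> borel_measurable borel" "b \<in> borel_measurable borel" unfolding a_def b_def by measurable
      have "(\<integral>\<^sup>+y. \<integral>\<^sup>+z. F 2 (v3 (x, y, z)) * F 3 (v3 (x, y, z)) \<partial>lborel \<partial>lborel)
          = (\<integral>\<^sup>+y. \<integral>\<^sup>+z. (16 * b y) * a z \<partial>lborel \<partial>lborel)"
        by (intro nn_integral_cong) (simp add: F_def l2 l3 a_def b_def mult_ac)
      also have "\<dots> = (\<integral>\<^sup>+y. (16 * b y) * (\<integral>\<^sup>+z. a z \<partial>lborel) \<partial>lborel)"
        by (intro nn_integral_cong nn_integral_cmult) measurable
      also have "\<dots> = 16 * ((\<integral>\<^sup>+y. b y \<partial>lborel) * (\<integral>\<^sup>+z. a z \<partial>lborel))"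
        by (subst nn_integral_multc) (auto simp: nn_integral_cmult mult.assoc)
      also have "\<dots> \<le> 16 * ((esqrt (M u x) * esqrt (M (g 3) x)) * (esqrt (M u x) * esqrt (M (g 2) x)))"
      proof (intro mult_left_mono mult_mono)
        show "(\<integral>\<^sup>+y. b y \<partial>lborel) \<le> esqrt (M u x) * esqrt (M (g 3) x)"
          unfolding b_def M_def by (rule cs_esqrt) measurable
        have "(\<integral>\<^sup>+z. a z \<partial>lborel) \<le> esqrt (\<integral>\<^sup>+z. \<integral>\<^sup>+s. coord_sq u x s z \<partial>lborel
            \<partial>lborel) * esqrt (\<integral>\<^sup>+z. \<integral>\<^sup>+s. coord_sq (g 2) x s z \<partial>lborel \<partial>lborel)"
          unfolding a_def by (rule cs_esqrt) measurable
        then show "(\<integral>\<^sup>+z. a z \<partial>lborel) \<le> esqrt (M u x) * esqrt (M (g 2) x)" by (simp add: swap)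
      qed auto
      also have "\<dots> = 16 * ((esqrt (M u x))\<^sup>2 * (esqrt (M (g 2) x) * esqrt (M (g 3) x)))" by (simp add: power2_eq_square mult_ac)
      also have "\<dots> \<le> 16 * (S * (esqrt (M (g 2) x) * esqrt (M (g 3) x)))"
        unfolding esqrt_sq by (intro mult_left_mono mult_right_mono elim) auto
      finally show ?case .
    qed
  qed
  also have "\<dots> = 16 * (S * (\<integral>\<^sup>+x. esqrt (M (g 2) x) * esqrt (M (g 3) x) \<partial>lborel))"
    by (simp add: nn_integral_cmult)
  also have "\<dots> \<le> 16 * (S * (esqrt (\<integral>\<^sup>+x. M (g 2) x \<partial>lborel) * esqrt (\<integral>\<^sup>+x. M (g 3) x \<partial>lborel)))"
    by (intro mult_left_mono cs_esqrt) auto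
  also have "\<dots> = 16 * (S * (esqrt (ennreal ((l2n (g 2))\<^sup>2)) * esqrt (ennreal ((l2n (g 3))\<^sup>2))))"
    unfolding M_def by (simp add: tot g)
  finally show ?thesis by (simp add: S_def mult_ac)
qed

theorem ladyzhenskaya:
  assumes w: "\<And>i. is_weak_partial i u (g i)" and u: "u \<in> L2"
  shows "(\<lambda>x. of_real ((norm (u x))\<^sup>2)) \<in> L2"
    "(l2n (\<lambda>x. of_real ((norm (u x))\<^sup>2)))\<^sup>2 \<le> 64 * (l2n u * (l2n (g 1) * l2n (g 2) * l2n (g 3)))"
proof -
  note [measurable] = L2_meas[OF u]
  let ?r = "64 * (l2n u * (l2n (g 1) * l2n (g 2) * l2n (g 3)))"
  have "(\<integral>\<^sup>+x. ennreal ((norm (complex_of_real ((norm (u x))\<^sup>2)))\<^sup>2) \<partial>lborel)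
      = (\<integral>\<^sup>+x. ennreal ((norm (u x))^4) \<partial>lborel)"
    by (intro nn_integral_cong) (simp add: power_mult[symmetric] norm_power)
  also have "\<dots> \<le> ennreal ?r"
    using ladyzhenskaya_nn[OF w u] by (simp add: esqrt_def ennreal_mult[symmetric] ennreal_numeral[symmetric] mult_ac del: ennreal_numeral)
  also have "\<dots> = ennreal ((sqrt ?r)\<^sup>2)" by simp
  finally have fin: "(\<integral>\<^sup>+x. ennreal ((norm (complex_of_real ((norm (u x))\<^sup>2)))\<^sup>2) \<partial>lborel) \<le> ennreal ((sqrt ?r)\<^sup>2)" .
  have m: "(\<lambda>x. complex_of_real ((norm (u x))\<^sup>2)) \<in> borel_measurable borel" by measurable
  show "(\<lambda>x. of_real ((norm (u x))\<^sup>2)) \<in> L2" using L2_nnI(1)[OF m fin] by simp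
  have "(l2n (\<lambda>x. of_real ((norm (u x))\<^sup>2)))\<^sup>2 \<le> (sqrt ?r)\<^sup>2" using L2_nnI(2)[OF m fin] by (intro power_mono) auto
  then show "(l2n (\<lambda>x. of_real ((norm (u x))\<^sup>2)))\<^sup>2 \<le> ?r" by simp
qed

subsection \<open>Compactness of bounded sets of the energy space\<close>

lemma axis_decomposition: "(y::real^3) = (y$1 *\<^sub>R axis 1 1 + y$2 *\<^sub>R axis 2 1) + y$3 *\<^sub>R axis 3 1"
  using basis_expansion[of y] by (simp add: sum_3 scalar_mult_eq_scaleR)

text \<open>The shift is decomposed along the three axes, whence the factor 3.\<close>

lemma translation_estimate_vec:
  assumes w: "\<And>i. is_weak_partial i u (g i)" and u: "u \<in> L2" and C: "\<And>i. l2n (g i) \<le> C"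
  shows "l2n (\<lambda>x. u (x + y) - u x) \<le> 3 * norm y * C"
proof -
  define a where "a i = y$i *\<^sub>R (axis i 1 :: real^3)" for i
  have y: "y = (a 1 + a 2) + a 3" unfolding a_def by (rule axis_decomposition)
  have e: "l2n (\<lambda>x. u (x + a i) - u x) \<le> norm y * C" for i
  proof -
    have "l2n (\<lambda>x. u (x + a i) - u x) \<le> \<bar>y$i\<bar> * l2n (g i)" unfolding a_def by (rule translation_estimate[OF w u])
    also have "\<dots> \<le> norm y * C" using C[of i] component_le_norm_cart[of y i] by (intro mult_mono) auto
    finally show ?thesis .
  qed
  have sh: "l2n (\<lambda>x. u ((x + z) + a i) - u (x + z)) \<le> norm y * C" for z i
    using e[of i] L2_translate(2)[OF L2_diff[OF L2_translate(1)[OF u, of "a i"] u], of z] by simp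
  have L: "(\<lambda>x. u (x + z)) \<in> L2" for z by (rule L2_translate(1)[OF u])
  have L': "(\<lambda>x. u (x + z + z')) \<in> L2" for z z' using L[of "z + z'"] by (simp add: add.assoc)
  have "l2n (\<lambda>x. u (x + y) - u x) \<le> l2n (\<lambda>x. u (x + (a 1 + a 2) + a 3) - u (x + (a 1 + a 2))) + l2n (\<lambda>x. u (x + (a 1 + a 2)) - u x)"
    using l2n_dist_triangle[OF L' L u, of "a 1 + a 2" "a 3" "a 1 + a 2"] unfolding y by (simp add: add.assoc)
  also have "l2n (\<lambda>x. u (x + (a 1 + a 2)) - u x) \<le> l2n (\<lambda>x. u (x + a 1 + a 2) - u (x + a 1)) + l2n (\<lambda>x. u (x + a 1) - u x)"
    using l2n_dist_triangle[OF L' L u, of "a 1" "a 2" "a 1"] by (simp add: add.assoc)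
  finally show ?thesis using sh[of "a 1 + a 2" 3] sh[of "a 1" 2] e[of 1] by simp
qed

lemma L2_cball_integrable:
  assumes "f \<in> L2" shows "integrable lborel (\<lambda>x. indicator (cball 0 R) x *\<^sub>R f x)"
proof -
  have "indicator (cball 0 R) x *\<^sub>R f x = trunc R f x" for x by (auto simp: trunc_def indicator_def)
  then show ?thesis using trunc_integrable[OF assms] by simp
qed

lemma cball_average_bound:
  assumes f: "f \<in> L2" and k: "emeasure lborel (cball (0::real^3) \<eta>) = ennreal \<kappa>" "\<kappa> \<ge> 0"
  shows "norm (LINT y|lborel. indicator (cball 0 \<eta>) y *\<^sub>R f y) \<le> sqrt \<kappa> * l2n f"
proof -
  have "norm (LINT y|lborel. (1 * indicator (cball 0 \<eta>) y) * f y) \<le> l2n (\<lambda>y. 1 * indicator (cball 0 \<eta>) y) * l2n f"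
    by (rule norm_int_mult_le[OF L2_indicator_cball f])
  moreover have "l2n (\<lambda>y. 1 * indicator (cball 0 \<eta>) y :: complex) = sqrt \<kappa>"
  proof -
    have "(\<lambda>y::real^3. (norm (1 * indicator (cball 0 \<eta>) y :: complex))\<^sup>2) = indicator (cball 0 \<eta>)" by (auto simp: indicator_def fun_eq_iff)
    then show ?thesis using k by (simp add: l2n_def measure_def)
  qed
  moreover have "(1 * indicator (cball 0 \<eta>) y) * f y = indicator (cball 0 \<eta>) y *\<^sub>R f y" for y by (auto simp: indicator_def)
  ultimately show ?thesis by simp
qed

text \<open>Rellich's argument at a fixed tolerance. Averages over balls of radius
  \<open>\<eta>\<close> are bounded and equicontinuous, so Arzela-Ascoli makes them converge
  uniformly on \<open>cball 0 R\<close>. Averaging costs little because the gradients are bounded,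
  and the moments control what lies outside the ball.\<close>

lemma almost_cauchy_subsequence:
  fixes u :: "nat \<Rightarrow> real ^ 3 \<Rightarrow> complex"
  assumes u: "\<And>n. u n \<in> L2" and w: "\<And>n i. is_weak_partial i (u n) (g n i)"
    and Cu: "\<And>n. l2n (u n) \<le> C" and Cg: "\<And>n i. l2n (g n i) \<le> C"
    and x: "\<And>n. (\<lambda>x. of_real (norm x) * u n x) \<in> L2" and Cx: "\<And>n. l2n (\<lambda>x. of_real (norm x) * u n x) \<le> C"
    and e: "e > 0"
  shows "\<exists>r. strict_mono (r::nat\<Rightarrow>nat) \<and> (\<exists>N. \<forall>m\<ge>N. \<forall>n\<ge>N. l2n (\<lambda>x. u (r m) x - u (r n) x) \<le> e)"
proof -
  have C0: "C \<ge> 0" using Cu[of 0] l2n_nonneg[of "u 0"] by linarith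
  \<comment> \<open>For a difference of two members, at most \<open>2 * C / R\<close> remains
    outside the ball and averaging costs at most \<open>6 * \<eta> * C\<close>; both are at most
    \<open>e / 4\<close>. The summand 1 covers \<open>C = 0\<close>.\<close>
  define R where "R = 8 * (C + 1) / e"
  define \<eta> where "\<eta> = e / (24 * (C + 1))"
  have R: "R > 0" and n0: "\<eta> > 0" using e C0 by (auto simp: R_def \<eta>_def add_nonneg_pos)
  define \<kappa> where "\<kappa> = measure lborel (cball (0::real^3) \<eta>)"
  have k: "emeasure lborel (cball (0::real^3) \<eta>) = ennreal \<kappa>"
    unfolding \<kappa>_def by (rule emeasure_eq_ennreal_measure) (use emeasure_lborel_cball_finite[of "0::real^3" \<eta>] in auto)
  have k0: "\<kappa> > 0"
    using content_cball_pos[OF n0, of "0::real^3"] by (simp add: \<kappa>_def measure_completion)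
  define S where "S v x = (1 / \<kappa>) *\<^sub>R (LINT y|lborel. indicator (cball 0 \<eta>) y *\<^sub>R v (x + y))" for v :: "real^3 \<Rightarrow> complex" and x
  have tr: "(\<lambda>y. v (x + y)) \<in> L2" "l2n (\<lambda>y. v (x + y)) = l2n v" if "v \<in> L2" for v x
    using L2_translate[OF that, of x] by (simp_all add: add.commute)
  have Sb: "norm (S v x) \<le> (1 / sqrt \<kappa>) * l2n v" if v: "v \<in> L2" for v x
  proof -
    have "norm (S v x) \<le> (1 / \<kappa>) * (sqrt \<kappa> * l2n v)"
      unfolding S_def using cball_average_bound[OF tr(1)[OF v, of x] k] k0 by (simp add: tr(2)[OF v] divide_right_mono)
    also have "\<dots> = (1 / sqrt \<kappa>) * l2n v" using k0 by (simp add: field_simps)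
    finally show ?thesis .
  qed
  \<comment> \<open>One identity for two purposes: with \<open>v' = v\<close> it gives
    equicontinuity of the averages, with \<open>x' = x\<close> their additivity.\<close>
  have Sd: "S v x - S v' x' = S (\<lambda>z. v z - v' (z + (x' - x))) x" if v: "v \<in> L2" "v' \<in> L2" for v v' x x'
  proof -
    have "S v x - S v' x' = (1 / \<kappa>) *\<^sub>R ((LINT y|lborel. indicator (cball 0 \<eta>) y *\<^sub>R v (x
        + y)) - (LINT y|lborel. indicator (cball 0 \<eta>) y *\<^sub>R v' (x' + y)))"
      by (simp add: S_def scaleR_diff_right)
    also have "\<dots> = S (\<lambda>z. v z - v' (z + (x' - x))) x"
      unfolding S_def using L2_cball_integrable[OF tr(1)[OF v(1), of x], of \<eta>] L2_cball_integrable[OF tr(1)[OF v(2), of x'], of \<eta>]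
      by (simp add: scaleR_diff_right algebra_simps)
    finally show ?thesis .
  qed
  \<comment> \<open>\<open>S v - v\<close> is the average of the translation differences of
    \<open>v\<close>, each of which \<open>translation_estimate_vec\<close> controls by the
    gradient.\<close>
  have Sappr: "(\<lambda>x. S v x - v x) \<in> L2 \<and> l2n (\<lambda>x. S v x - v x) \<le> 3 * \<eta> * C'"
    if v: "v \<in> L2" and wv: "\<And>i. is_weak_partial i v (h i)" and Ch: "\<And>i. l2n (h i) \<le> C'" for v h C'
  proof -
    note [measurable] = L2_meas[OF v]
    have C'0: "C' \<ge> 0" using Ch[of 1] l2n_nonneg[of "h 1"] by linarith
    define G where "G y x = v (x + y) - v x" for y x
    have Gm: "(\<lambda>(y, x). G y x) \<in> borel_measurable (borel \<Otimes>\<^sub>M borel)" unfolding G_def by measurable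
    have GL: "G y \<in> L2" for y unfolding G_def by (intro L2_diff L2_translate v)
    have GB: "l2n (G y) \<le> 3 * \<eta> * C'" if "y \<in> cball 0 \<eta>" for y
    proof -
      have "l2n (G y) \<le> 3 * norm y * C'" unfolding G_def by (rule translation_estimate_vec[OF wv v Ch])
      also have "\<dots> \<le> 3 * \<eta> * C'" using that C'0 by (intro mult_right_mono) auto
      finally show ?thesis .
    qed
    have B0: "3 * \<eta> * C' \<ge> 0" using n0 C'0 by simp
    note A = L2_average_set[OF Gm, of "cball 0 \<eta>" "3 * \<eta> * C'" \<kappa>, OF GL GB B0 _ k less_imp_le[OF k0]]
    have eq: "S v x - v x = of_real (1 / \<kappa>) * (LINT y|lborel. indicator (cball 0 \<eta>) y *\<^sub>R G y x)" for x
    proof -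
      have "(LINT y|lborel. indicator (cball 0 \<eta>) y *\<^sub>R G y x) = (LINT y|lborel. indicator (cball 0 \<eta>) y *\<^sub>R v (x
          + y) - indicator (cball 0 \<eta>) y *\<^sub>R v x)"
        by (simp add: G_def scaleR_diff_right)
      also have "\<dots> = (LINT y|lborel. indicator (cball 0 \<eta>) y *\<^sub>R v (x + y)) - (LINT y|lborel. indicator (cball (0::real^3) \<eta>) y *\<^sub>R v x)"
        by (rule Bochner_Integration.integral_diff[OF L2_cball_integrable[OF tr(1)[OF v]]])
           (use emeasure_lborel_cball_finite[of "0::real^3" \<eta>] in \<open>auto intro!: integrable_scaleR_left integrable_real_indicator\<close>)
      also have "(LINT y|lborel. indicator (cball (0::real^3) \<eta>) y *\<^sub>R v x) = \<kappa> *\<^sub>R v x"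
        using emeasure_lborel_cball_finite[of "0::real^3" \<eta>] by (subst integral_scaleR_left) (auto simp: \<kappa>_def intro!: integrable_real_indicator)
      finally show ?thesis using k0 by (simp add: S_def scaleR_conv_of_real[of _ "_ :: complex"] field_simps)
    qed
    have "l2n (\<lambda>x. S v x - v x) = (1 / \<kappa>) * l2n (\<lambda>x. LINT y|lborel. indicator (cball 0 \<eta>) y *\<^sub>R G y x)"
      unfolding eq l2n_scale using k0 by (simp add: norm_divide)
    also have "\<dots> \<le> (1 / \<kappa>) * (\<kappa> * (3 * \<eta> * C'))" using A(2) k0 by (intro mult_left_mono) auto
    finally have "l2n (\<lambda>x. S v x - v x) \<le> 3 * \<eta> * C'" using k0 by simp
    moreover have "(\<lambda>x. S v x - v x) \<in> L2" unfolding eq by (rule L2_scale) (rule A(1); auto)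
    ultimately show ?thesis by blast
  qed
  obtain G r where r: "strict_mono (r :: nat \<Rightarrow> nat)" and conv: "\<And>e. 0 < e
      \<Longrightarrow> \<exists>N. \<forall>n x. n \<ge> N \<and> x \<in> cball 0 R \<longrightarrow> norm (S (u (r n)) x - G x) < e"
  proof (rule Arzela_Ascoli[of "cball (0::real^3) R" "\<lambda>n. S (u n)" "(1 / sqrt \<kappa>) * C"])
    show "norm (S (u n) x) \<le> (1 / sqrt \<kappa>) * C" for n x
      by (rule order_trans[OF Sb[OF u] mult_left_mono[OF Cu]]) (use k0 in simp)
    show "\<exists>d>0. \<forall>n y. y \<in> cball 0 R \<and> norm (x - y) < d \<longrightarrow> norm (S (u n) x - S (u n) y) < \<epsilon>" if
        "\<epsilon> > 0" for x \<epsilon>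
    proof (intro exI[of _ "\<epsilon> / (3 * (C + 1) / sqrt \<kappa>)"] conjI allI impI)
      show "0 < \<epsilon> / (3 * (C + 1) / sqrt \<kappa>)" using that C0 k0 by (simp add: add_nonneg_pos)
      fix n y assume y: "y \<in> cball 0 R \<and> norm (x - y) < \<epsilon> / (3 * (C + 1) / sqrt \<kappa>)"
      have "norm (S (u n) x - S (u n) y) \<le> (1 / sqrt \<kappa>) * l2n (\<lambda>z. u n z - u n (z + (y - x)))"
        unfolding Sd[OF u u] by (intro Sb L2_diff u L2_translate)
      also have "\<dots> \<le> (1 / sqrt \<kappa>) * (3 * norm (y - x) * C)"
        using translation_estimate_vec[OF w u Cg, of n "y - x"] k0 by (intro mult_left_mono) (auto simp: l2n_diff_sym[of "u n"])
      also have "\<dots> \<le> (3 * (C + 1) / sqrt \<kappa>) * norm (x - y)"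
        using k0 C0 by (simp add: norm_minus_commute field_simps)
      also have "\<dots> < \<epsilon>" using y k0 C0 by (simp add: pos_less_divide_eq pos_divide_less_eq add_nonneg_pos mult.commute)
      finally show "norm (S (u n) x - S (u n) y) < \<epsilon>" .
    qed
  qed auto
  define V where "V = measure lborel (cball (0::real^3) R)"
  have V0: "V \<ge> 0" by (simp add: V_def)
  \<comment> \<open>A uniform distance of \<open>2 * \<delta>\<close> on a ball of volume
    \<open>V\<close> contributes \<open>2 * \<delta> * sqrt V\<close>, the last share of
    \<open>e / 4\<close>.\<close>
  define \<delta> where "\<delta> = e / (8 * (sqrt V + 1))"
  have d0: "\<delta> > 0" using e V0 by (simp add: \<delta>_def add_nonneg_pos)
  obtain N where N: "\<And>n x. n \<ge> N \<Longrightarrow> x \<in> cball 0 R \<Longrightarrow> norm (S (u (r n)) x - G x) < \<delta>" using conv[OF d0] by blast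
  have "l2n (\<lambda>x. u (r m) x - u (r n) x) \<le> e" if mn: "m \<ge> N" "n \<ge> N" for m n
  proof -
    define v where "v x = u (r m) x - u (r n) x" for x
    have vL: "v \<in> L2" unfolding v_def by (intro L2_diff u)
    have vw: "is_weak_partial i v (\<lambda>x. g (r m) i x + (- 1) * g (r n) i x)" for i
      using wp_add[OF w[where n="r m" and i=i] wp_scale[OF w[where n="r n" and i=i], of "-1"] u L2_scale[OF u]] by (simp add: v_def[abs_def])
    have vg: "l2n (\<lambda>x. g (r m) i x + (- 1) * g (r n) i x) \<le> 2 * C" for i
      using l2n_triangle[OF wpD(1)[OF w[where n="r m" and i=i]] L2_scale[OF wpD(1)[OF w[where n="r n" and i=i]], of "-1"]] Cg[of "r m" i] Cg[of "r n" i]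
      by (simp add: l2n_uminus)
    note [measurable] = L2_meas[OF vL]
    have SvL: "(\<lambda>x. S v x - v x) \<in> L2" and Svn: "l2n (\<lambda>x. S v x - v x) \<le> 3 * \<eta> * (2 * C)" using Sappr[OF vL vw vg] by auto
    have Sv: "S v \<in> L2" using L2_add[OF SvL vL] by simp
    have Sv2: "norm (S v x) \<le> 2 * \<delta>" if "x \<in> cball 0 R" for x
    proof -
      have "S v x = (S (u (r m)) x - G x) - (S (u (r n)) x - G x)"
        using Sd[OF u u, of "r m" x "r n" x] by (simp add: v_def[abs_def])
      then show ?thesis using norm_triangle_ineq4[of "S (u (r m)) x - G x" "S (u (r n)) x - G x"] N[OF mn(1) that] N[OF mn(2) that] by simp
    qed
    have near: "l2n (trunc R (S v)) \<le> 2 * \<delta> * sqrt V"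
    proof -
      have "l2n (trunc R (S v)) \<le> l2n (\<lambda>x. of_real (2 * \<delta>) * indicator (cball 0 R) x)"
        unfolding l2n_def
      proof (intro real_sqrt_le_mono integral_mono L2_int trunc_L2 Sv L2_indicator_cball power_mono)
        fix x show "norm (trunc R (S v) x) \<le> norm (of_real (2 * \<delta>) * indicator (cball 0 R) x :: complex)"
          using Sv2[of x] d0 by (auto simp: trunc_def indicator_def norm_mult)
      qed auto
      also have "\<dots> = 2 * \<delta> * l2n (\<lambda>x. indicator (cball 0 R) x)" using d0 by (simp add: l2n_scale norm_mult)
      also have "l2n (\<lambda>x. indicator (cball (0::real^3) R) x :: complex) = sqrt V"
      proof -
        have "(\<lambda>y::real^3. (norm (indicator (cball 0 R) y :: complex))\<^sup>2) = indicator (cball 0 R)" by (auto simp: indicator_def fun_eq_iff)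
        then show ?thesis by (simp add: l2n_def V_def)
      qed
      finally show ?thesis .
    qed
    have far: "l2n (\<lambda>x. v x - trunc R v x) \<le> (1 / R) * (2 * C)"
    proof -
      have xv: "(\<lambda>x. of_real (norm x) * v x) \<in> L2" "l2n (\<lambda>x. of_real (norm x) * v x) \<le> 2 * C"
        using L2_diff[OF x[of "r m"] x[of "r n"]] l2n_triangle_diff[OF x[of "r m"] x[of "r n"]] Cx[of "r m"] Cx[of "r n"] by (simp_all add: v_def right_diff_distrib)
      define q :: "real^3 \<Rightarrow> complex" where "q x = (if norm x \<le> R then 0 else of_real (1 / norm x))" for x
      have qm: "q \<in> borel_measurable borel" unfolding q_def by measurable
      have qb: "norm (q x) \<le> 1 / R" for x using R by (auto simp: q_def norm_divide intro!: divide_left_mono mult_pos_pos)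
      have "v x - trunc R v x = q x * (of_real (norm x) * v x)" for x using R by (auto simp: trunc_def q_def)
      then have "l2n (\<lambda>x. v x - trunc R v x) \<le> (1 / R) * l2n (\<lambda>x. of_real (norm x) * v x)"
        using L2_mult_bounded(2)[OF xv(1) qm qb] by simp
      also have "\<dots> \<le> (1 / R) * (2 * C)" using xv(2) R by (intro mult_left_mono) auto
      finally show ?thesis .
    qed
    have mid: "l2n (\<lambda>x. trunc R v x - trunc R (S v) x) \<le> 3 * \<eta> * (2 * C)"
    proof -
      have eq: "trunc R v x - trunc R (S v) x = indicator (cball 0 R) x * (v x - S v x)" for x by (simp add: trunc_def right_diff_distrib)
      have "l2n (\<lambda>x. trunc R v x - trunc R (S v) x) \<le> 1 * l2n (\<lambda>x. v x - S v x)"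
        unfolding eq by (rule L2_mult_bounded(2)[OF L2_diff[OF vL Sv]]) (measurable, auto simp: indicator_def)
      then show ?thesis using Svn l2n_diff_sym[of v "S v"] by simp
    qed
    have "l2n v \<le> l2n (\<lambda>x. v x - trunc R v x) + l2n (trunc R v)"
      using l2n_triangle[OF L2_diff[OF vL trunc_L2[OF vL, of R]] trunc_L2[OF vL, of R]] by simp
    moreover have "l2n (trunc R v) \<le> l2n (\<lambda>x. trunc R v x - trunc R (S v) x) + l2n (trunc R (S v))"
      using l2n_triangle[OF L2_diff[OF trunc_L2[OF vL, of R] trunc_L2[OF Sv, of R]] trunc_L2[OF Sv, of R]] by simp
    moreover have "(1 / R) * (2 * C) \<le> e / 4"
      using e C0 by (simp add: R_def field_simps)
    moreover have "3 * \<eta> * (2 * C) \<le> e / 4"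
      using e C0 by (simp add: \<eta>_def field_simps)
    moreover have "2 * \<delta> * sqrt V \<le> e / 4"
    proof -
      have "sqrt V / (sqrt V + 1) \<le> 1" using V0 by (simp add: add_nonneg_pos)
      then have "e / 4 * (sqrt V / (sqrt V + 1)) \<le> e / 4 * 1" using e by (intro mult_left_mono) auto
      moreover have "2 * (e / (8 * X)) * Y = e / 4 * (Y / X)" for X Y :: real by (cases "X = 0") (auto simp: field_simps)
      ultimately show ?thesis unfolding \<delta>_def by (simp only: mult_1_right)
    qed
    ultimately have "l2n v \<le> e" using near far mid e by linarith
    then show ?thesis by (simp add: v_def[abs_def])
  qed
  then show ?thesis using r by blast
qed

text \<open>A diagonal sequence over the tolerances \<open>1 / (k + 1)\<close>; being eventually
  within a tolerance survives passage to subsequences.\<close>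

theorem energy_space_compactness:
  fixes u :: "nat \<Rightarrow> real ^ 3 \<Rightarrow> complex"
  assumes u: "\<And>n. u n \<in> L2" and w: "\<And>n i. is_weak_partial i (u n) (g n i)"
    and Cu: "\<And>n. l2n (u n) \<le> C" and Cg: "\<And>n i. l2n (g n i) \<le> C"
    and x: "\<And>n. (\<lambda>x. of_real (norm x) * u n x) \<in> L2" and Cx: "\<And>n. l2n (\<lambda>x. of_real (norm x) * u n x) \<le> C"
  shows "\<exists>r. strict_mono (r::nat\<Rightarrow>nat) \<and> (\<forall>e>0. \<exists>N. \<forall>m\<ge>N. \<forall>n\<ge>N. l2n (\<lambda>x. u (r
      m) x - u (r n) x) \<le> e)"
proof -
  define P where "P k s \<longleftrightarrow> (\<exists>N. \<forall>m\<ge>N. \<forall>n\<ge>N. l2n (\<lambda>x. u (s m) x - u (s n) x)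
      \<le> 1 / real (Suc k))" for k and s :: "nat \<Rightarrow> nat"
  interpret subseqs P
  proof
    fix k and s :: "nat \<Rightarrow> nat" assume "strict_mono s"
    show "\<exists>r'. strict_mono r' \<and> P k (s \<circ> r')"
      unfolding P_def using almost_cauchy_subsequence[of "\<lambda>n. u (s n)" "\<lambda>n. g (s n)" C "1 / real (Suc k)"] u w Cu Cg x Cx by simp
  qed
  have st: "P k (s \<circ> r)" if r: "strict_mono r" and Ps: "P k s" for r s k
  proof -
    obtain N where N: "\<And>m n. m \<ge> N \<Longrightarrow> n \<ge> N \<Longrightarrow> l2n (\<lambda>x. u (s m) x - u (s n) x)
        \<le> 1 / real (Suc k)" using Ps by (auto simp: P_def)
    have "r m \<ge> N" if "m \<ge> N" for m using seq_suble[OF r, of m] that by linarith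
    then show ?thesis unfolding P_def comp_def by (intro exI[of _ N] allI impI N)
  qed
  have "\<exists>N. \<forall>m\<ge>N. \<forall>n\<ge>N. l2n (\<lambda>x. u (diagseq m) x - u (diagseq n) x) \<le> e" if e: "e > 0" for e
  proof -
    obtain k where k: "1 / real (Suc k) < e" using e by (metis nat_approx_posE)
    \<comment> \<open>Tolerance \<open>k\<close> is guaranteed for the diagonal sequence only from
      index \<open>Suc k\<close> on, hence the shift.\<close>
    have "P k (diagseq \<circ> ((+) (Suc k)))" by (rule diagseq_holds[OF st])
    then obtain N where N: "\<And>m n. m \<ge> N \<Longrightarrow> n \<ge> N \<Longrightarrow> l2n (\<lambda>x. u (diagseq (Suc k
        + m)) x - u (diagseq (Suc k + n)) x) \<le> 1 / real (Suc k)"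
      by (auto simp: P_def)
    have "l2n (\<lambda>x. u (diagseq m) x - u (diagseq n) x) \<le> e" if "m \<ge> Suc k + N" "n \<ge> Suc k + N" for m n
    proof -
      have "N \<le> m - Suc k" "N \<le> n - Suc k" using that by auto
      from N[OF this] show ?thesis using that k by simp
    qed
    then show ?thesis by blast
  qed
  then show ?thesis using subseq_diagseq by blast
qed

subsection \<open>Integration by parts and the derivative along dilations\<close>

text \<open>The difference of \<open>\<phi>\<close> and its unit translate has integral 0 by
  translation invariance, and the integral of the partial derivative by the fundamental theorem and
  Fubini. The cut-off \<open>w\<close> stands for the constant 1, which is not in
  \<open>L2\<close>.\<close>

lemma test_partial_integral_zero:
  assumes p: "\<phi> \<in> test_functions" shows "(LINT x|lborel. complex_of_real (partial i \<phi> x)) = 0"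
proof -
  let ?e = "axis i 1 :: real^3"
  note q = test_partial[OF p, of i]
  note [measurable] = test_measurable[OF p] test_measurable[OF q]
  obtain R1 where R1: "R1 > 0" "\<And>x. norm x > R1 \<Longrightarrow> \<phi> x = 0" using test_support[OF p] by metis
  obtain R2 where R2: "R2 > 0" "\<And>x. norm x > R2 \<Longrightarrow> partial i \<phi> x = 0" using test_support[OF q] by metis
  \<comment> \<open>The extra 1 covers shifts up to length 1.\<close>
  define R where "R = max R1 R2 + 1"
  define w :: "real^3 \<Rightarrow> complex" where "w x = 1 * indicator (cball 0 R) x" for x
  have wL: "w \<in> L2" unfolding w_def by (rule L2_indicator_cball)
  define G where "G s x = complex_of_real (partial i \<phi> (x + s *\<^sub>R ?e))" for s x
  have Gm: "(\<lambda>(s, x). G s x) \<in> borel_measurable (borel \<Otimes>\<^sub>M borel)" unfolding G_def by measurable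
  have GL: "G s \<in> L2" "l2n (G s) \<le> l2n (\<lambda>x. complex_of_real (partial i \<phi> x))" for s
    unfolding G_def using L2_translate[OF test_L2[OF q], of "s *\<^sub>R ?e"] by auto
  have big: "norm (x + s *\<^sub>R ?e) > max R1 R2" if "norm x > R" "0 \<le> s" "s \<le> 1" for x and s :: real
  proof -
    have "norm (s *\<^sub>R ?e) \<le> 1" using that by simp
    then show ?thesis using that(1) norm_diff_ineq[of x "s *\<^sub>R ?e"] unfolding R_def by linarith
  qed
  have Gw: "G s x * w x = G s x" if "0 \<le> s" "s \<le> 1" for s x
    using big[of x s] R2(2)[of "x + s *\<^sub>R ?e"] that by (auto simp: w_def G_def indicator_def)
  have FTC: "(LINT s|lborel. indicator {0..1} s *\<^sub>R G s x) = complex_of_real (\<phi> (x + 1 *\<^sub>R ?e)) - complex_of_real (\<phi> (x + 0 *\<^sub>R ?e))" for x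
  proof -
    have "(LINT s|lborel. indicator {0..1} s *\<^sub>R partial i \<phi> (x + s *\<^sub>R ?e)) = \<phi> (x + 1 *\<^sub>R ?e) - \<phi> (x + 0 *\<^sub>R ?e)"
    proof (rule integral_FTC_Icc)
      show "((\<lambda>s. \<phi> (x + s *\<^sub>R ?e)) has_vector_derivative partial i \<phi> (x + s *\<^sub>R ?e)) (at s within {0..1})" for s
        using test_line_deriv[OF p, of x i s] by (auto simp: has_real_derivative_iff_has_vector_derivative[symmetric] intro: DERIV_subset)
      show "continuous_on {0..1} (\<lambda>s. partial i \<phi> (x + s *\<^sub>R ?e))"
        by (intro continuous_on_compose2[OF partial_continuous[OF p, of UNIV]] continuous_intros) auto
    qed simp
    then have "complex_of_real (LINT s|lborel. indicator {0..1} s *\<^sub>R partial i \<phi> (x + s *\<^sub>R ?e)) = of_real (\<phi> (x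
        + 1 *\<^sub>R ?e)) - of_real (\<phi> (x + 0 *\<^sub>R ?e))" by (simp only: of_real_diff)
    then show ?thesis unfolding G_def integral_complex_of_real[symmetric] by (simp add: scaleR_conv_of_real[of _ "_ :: complex"])
  qed
  have pw: "(complex_of_real (\<phi> (x + 1 *\<^sub>R ?e)) - complex_of_real (\<phi> (x + 0 *\<^sub>R ?e))) * w x = complex_of_real (\<phi> (x
      + 1 *\<^sub>R ?e)) - complex_of_real (\<phi> x)" for x
    using big[of x 1] big[of x 0] R1(2)[of x] R1(2)[of "x + ?e"] by (auto simp: w_def indicator_def)
  have pi: "integrable lborel (\<lambda>x. complex_of_real (\<phi> x))"
  proof -
    have "integrable lborel (\<lambda>x. w x * complex_of_real (\<phi> x))" by (intro L2_mult_integrable wL test_L2 p)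
    moreover have "w x * complex_of_real (\<phi> x) = complex_of_real (\<phi> x)" for x using R1(2)[of x] by (auto simp: w_def indicator_def R_def)
    ultimately show ?thesis by simp
  qed
  have pi': "integrable lborel (\<lambda>x. complex_of_real (\<phi> (x + 1 *\<^sub>R ?e)))"
    using integrable_affine[OF pi, of 1 "?e"] by (simp add: add.commute)
  have "0 = (LINT x|lborel. complex_of_real (\<phi> (x + 1 *\<^sub>R ?e)) - complex_of_real (\<phi> x))"
    using integral_translate[of "\<lambda>x. complex_of_real (\<phi> x)" "1 *\<^sub>R ?e"] pi pi' by simp
  also have "\<dots> = (LINT x|lborel. (LINT s|lborel. indicator {0..1} s *\<^sub>R G s x) * w x)"
    unfolding FTC pw ..
  also have "\<dots> = (LINT s|lborel. indicator {0..1} s *\<^sub>R (LINT x|lborel. G s x * w x))"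
    by (rule L2_average(4)[OF Gm _ _ _ wL]) (auto intro: GL)
  also have "\<dots> = (LINT s|(lborel::real measure). indicator {0..1} s *\<^sub>R (LINT x|lborel. complex_of_real (partial i \<phi> x)))"
  proof (rule Bochner_Integration.integral_cong[OF refl])
    fix s :: real
    show "indicator {0..1} s *\<^sub>R (LINT x|lborel. G s x * w x) = indicator {0..1} s *\<^sub>R (LINT x|lborel. complex_of_real (partial i \<phi> x))"
    proof (cases "s \<in> {0..1}")
      case True
      then have "(LINT x|lborel. G s x * w x) = (LINT x|lborel. G s x)" by (simp add: Gw)
      also have "\<dots> = (LINT x|lborel. complex_of_real (partial i \<phi> x))"
        unfolding G_def by (rule integral_translate[of "\<lambda>x. complex_of_real (partial i \<phi> x)"]) measurable
      finally show ?thesis by simp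
    qed simp
  qed
  also have "\<dots> = (LINT x|lborel. complex_of_real (partial i \<phi> x))"
    by (subst integral_scaleR_left) auto
  finally show ?thesis by simp
qed

lemma wp_test:
  assumes p: "\<phi> \<in> test_functions"
  shows "is_weak_partial i (\<lambda>x. of_real (\<phi> x)) (\<lambda>x. of_real (partial i \<phi> x))"
  unfolding is_weak_partial_def
proof (intro conjI ballI)
  show "(\<lambda>x. complex_of_real (partial i \<phi> x)) \<in> L2" by (intro test_L2 test_partial p)
  fix \<psi> assume q: "\<psi> \<in> test_functions"
  have "partial i (\<lambda>x. \<phi> x * \<psi> x) x = \<phi> x * partial i \<psi> x + partial i \<phi> x * \<psi> x" for x
    by (intro partial_mult test_differentiable p q)
  then have "(LINT x|lborel. complex_of_real (\<phi> x) * of_real (partial i \<psi> x) + of_real (partial i \<phi> x) * of_real (\<psi> x)) = 0"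
    using test_partial_integral_zero[OF test_mult[OF q p], of i] by simp
  then show "(LINT x|lborel. complex_of_real (\<phi> x) * of_real (partial i \<psi> x)) = - (LINT x|lborel. complex_of_real (partial i \<phi> x) * of_real (\<psi> x))"
    using L2_mult_integrable[OF test_L2[OF p] test_L2[OF test_partial[OF q, of i]]] L2_mult_integrable[OF test_L2[OF test_partial[OF p, of i]] test_L2[OF q]]
    by (simp add: add_eq_0_iff2)
qed

lemma dilation_L2: "f \<in> L2 \<Longrightarrow> c > 0 \<Longrightarrow> (\<lambda>x. f (c *\<^sub>R x)) \<in> L2" "f \<in> L2
    \<Longrightarrow> c > 0 \<Longrightarrow> l2n (\<lambda>x. f (c *\<^sub>R x)) = sqrt (1 / c^3) * l2n f"
  using L2_affine[of f c 0] by auto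

lemma dilation_continuity:
  assumes f: "f \<in> L2" shows "((\<lambda>s. l2n (\<lambda>x. f (s *\<^sub>R x) - f x)) \<longlongrightarrow> 0) (at 1)"
  unfolding tendsto_at_iff_sequentially comp_def
proof (intro allI impI)
  fix X :: "nat \<Rightarrow> real" assume X: "\<forall>i. X i \<in> UNIV - {1}" "X \<longlonglongrightarrow> 1"
  \<comment> \<open>\<open>affine_continuity\<close> asks for nonzero scales. The zeros of
    \<open>X\<close>, only finitely many because \<open>X\<close> tends to 1, are replaced by
    1.\<close>
  define Y where "Y n = (if X n = 0 then 1 else X n)" for n
  have ev: "\<forall>\<^sub>F n in sequentially. X n = Y n"
    using order_tendstoD(1)[OF X(2), of 0] by (auto simp: Y_def elim: eventually_mono)
  have "Y \<longlonglongrightarrow> 1" using X(2) ev by (rule Lim_transform_eventually)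
  then have "(\<lambda>n. l2n (\<lambda>x. f (0 + Y n *\<^sub>R x) - f x)) \<longlonglongrightarrow> 0"
    by (rule affine_continuity[OF f _ tendsto_const]) (simp add: Y_def)
  then have "(\<lambda>n. l2n (\<lambda>x. f (Y n *\<^sub>R x) - f x)) \<longlonglongrightarrow> 0" by simp
  then show "(\<lambda>n. l2n (\<lambda>x. f (X n *\<^sub>R x) - f x)) \<longlonglongrightarrow> 0"
    by (rule Lim_transform_eventually) (use ev in \<open>auto elim: eventually_mono\<close>)
qed

text \<open>By \<open>weak_dilation\<close> the increments of the pairing are integrals of
  \<open>q\<close>, and \<open>q\<close> is continuous at 1 because dilations are continuous in
  \<open>L2\<close>; this suffices for a derivative at 1. The coordinate weight is paired with
  \<open>u\<close>, whose moments are finite, and not with its derivatives.\<close>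

lemma dilation_derivative:
  assumes w: "\<And>i. is_weak_partial i u (g i)" and u: "u \<in> L2" and xu: "\<And>i. (\<lambda>x. of_real (x $ i) * u x) \<in> L2"
  shows "((\<lambda>t. ip (\<lambda>x. u (t *\<^sub>R x)) u) has_real_derivative (\<Sum>i\<in>UNIV. ip (g i) (\<lambda>x. of_real (x $ i) * u x))) (at 1)"
proof -
  define y where "y i x = cnj (of_real (x $ i) * u x)" for i :: 3 and x
  have yL: "y i \<in> L2" for i unfolding y_def by (intro L2_cnj xu)
  have g: "g i \<in> L2" for i by (rule wpD(1)[OF w])
  note [measurable] = L2_meas[OF g] L2_meas[OF u]
  define q where "q s = (\<Sum>i\<in>UNIV. Re (LINT x|lborel. g i (s *\<^sub>R x) * y i x))" for s
  define p where "p t = ip (\<lambda>x. u (t *\<^sub>R x)) u" for t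
  have q1: "q 1 = (\<Sum>i\<in>UNIV. ip (g i) (\<lambda>x. of_real (x $ i) * u x))" by (simp add: q_def ip_def y_def)
  have incr: "integrable lborel (\<lambda>s. indicator {a..b} s * q s) \<and> p b - p a
      = (LINT s|lborel. indicator {a..b} s * q s)" if a: "0 < a" and ab: "a \<le> b" for a b
  proof -
    let ?V = "\<lambda>i x. LINT s|lborel. indicator {a..b} s *\<^sub>R g i (s *\<^sub>R x)"
    have gm: "(\<lambda>(s, x). g i (s *\<^sub>R x)) \<in> borel_measurable (borel \<Otimes>\<^sub>M borel)" for i by measurable
    have gL: "(\<lambda>x. g i (s *\<^sub>R x)) \<in> L2 \<and> l2n (\<lambda>x. g i (s *\<^sub>R x)) \<le> sqrt (1 / a^3) * l2n (g i)" if "a \<le> s" for s i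
    proof -
      have "sqrt (1 / s^3) \<le> sqrt (1 / a^3)"
        using a that by (intro real_sqrt_le_mono divide_left_mono power_mono mult_pos_pos) auto
      then show ?thesis using dilation_L2[OF g[of i], of s] that a by (auto intro: mult_right_mono)
    qed
    note A = L2_average[OF gm, of a b, OF conjunct1[OF gL] conjunct2[OF gL] ab]
    have bb: "b > 0" using a ab by simp
    have int: "integrable lborel (\<lambda>s. indicator {a..b} s *\<^sub>R (LINT x|lborel. g i (s *\<^sub>R x) * y i x))" for i by (rule A(3)[OF _ _ yL]) auto
    have intR: "integrable lborel (\<lambda>s. indicator {a..b} s * Re (LINT x|lborel. g i (s *\<^sub>R x) * y i x))" for i
      using integrable_Re[OF int[of i]] by simp
    have qe: "indicator {a..b} s * q s = (\<Sum>i\<in>UNIV. indicator {a..b} s * Re (LINT x|lborel. g i (s *\<^sub>R x) * y i x))" for s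
      by (simp add: q_def sum_distrib_left)
    have "p b - p a = ip (\<lambda>x. u (b *\<^sub>R x) - u (a *\<^sub>R x)) u"
      unfolding p_def using dilation_L2(1)[OF u] a bb u by (simp add: ip_diff_left)
    also have "\<dots> = Re (LINT x|lborel. (\<Sum>i\<in>UNIV. ?V i x * y i x))"
      unfolding ip_def
    proof (intro arg_cong[of _ _ Re] integral_cong_AE)
      show "AE x in lborel. (u (b *\<^sub>R x) - u (a *\<^sub>R x)) * cnj (u x) = (\<Sum>i\<in>UNIV. ?V i x * y i x)"
        using weak_dilation[OF w u a ab]
      proof eventually_elim
        case (elim x)
        show ?case unfolding elim sum_distrib_right by (intro sum.cong) (auto simp: y_def)
      qed
      have "(\<lambda>x. ?V i x * y i x) \<in> borel_measurable borel" for i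
        by (intro borel_measurable_times L2_meas A(1) yL) auto
      then show "(\<lambda>x. \<Sum>i\<in>UNIV. ?V i x * y i x) \<in> borel_measurable lborel" by simp
    qed measurable
    also have "(LINT x|lborel. (\<Sum>i\<in>UNIV. ?V i x * y i x)) = (\<Sum>i\<in>UNIV. LINT x|lborel. ?V i x * y i x)"
      by (rule Bochner_Integration.integral_sum) (intro L2_mult_integrable A(1) yL; simp)
    also have "\<dots> = (\<Sum>i\<in>UNIV. LINT s|lborel. indicator {a..b} s *\<^sub>R (LINT x|lborel. g i (s *\<^sub>R x) * y i x))"
      by (intro sum.cong refl A(4) yL) auto
    also have "Re \<dots> = (\<Sum>i\<in>UNIV. LINT s|lborel. indicator {a..b} s * Re (LINT x|lborel. g i (s *\<^sub>R x) * y i x))"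
      unfolding Re_sum by (intro sum.cong refl) (simp add: integral_Re[OF int, symmetric])
    also have "\<dots> = (LINT s|lborel. indicator {a..b} s * q s)"
      unfolding qe by (rule Bochner_Integration.integral_sum[symmetric]) (rule intR)
    finally have "p b - p a = (LINT s|lborel. indicator {a..b} s * q s)" .
    moreover have "integrable lborel (\<lambda>s. indicator {a..b} s * q s)"
      unfolding qe by (rule Bochner_Integration.integrable_sum) (rule intR)
    ultimately show ?thesis by blast
  qed
  have qc: "(q \<longlongrightarrow> q 1) (at 1)"
    unfolding q_def
  proof (intro tendsto_sum tendsto_Re)
    fix i :: 3
    show "((\<lambda>s. LINT x|lborel. g i (s *\<^sub>R x) * y i x) \<longlongrightarrow> (LINT x|lborel. g i (1 *\<^sub>R x) * y i x)) (at 1)"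
    proof (rule LIM_zero_cancel, rule Lim_null_comparison)
      have "((\<lambda>s. l2n (\<lambda>x. g i (s *\<^sub>R x) - g i x) * l2n (y i)) \<longlongrightarrow> 0 * l2n (y i)) (at 1)"
        by (intro tendsto_intros dilation_continuity g)
      then show "((\<lambda>s. l2n (\<lambda>x. g i (s *\<^sub>R x) - g i x) * l2n (y i)) \<longlongrightarrow> 0) (at 1)" by simp
      have "\<forall>\<^sub>F s::real in at 1. s > 0" by (rule order_tendstoD(1)[OF tendsto_ident_at]) simp
      then show "\<forall>\<^sub>F s in at 1. norm ((LINT x|lborel. g i (s *\<^sub>R x) * y i x) - (LINT x|lborel. g i (1 *\<^sub>R x) * y i x))
          \<le> l2n (\<lambda>x. g i (s *\<^sub>R x) - g i x) * l2n (y i)"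
      proof eventually_elim
        case (elim s)
        have "(LINT x|lborel. g i (s *\<^sub>R x) * y i x) - (LINT x|lborel. g i (1 *\<^sub>R x) * y i x) = (LINT x|lborel. (g i (s *\<^sub>R x) - g i x) * y i x)"
          using L2_mult_integrable[OF dilation_L2(1)[OF g[of i] elim] yL[of i]] L2_mult_integrable[OF g[of i] yL[of i]] by (simp add: left_diff_distrib)
        then show ?case using norm_int_mult_le[OF L2_diff[OF dilation_L2(1)[OF g[of i] elim] g[of i]] yL[of i]] by simp
      qed
    qed
  qed
  have est: "\<bar>(p b - p a) - (b - a) * q 1\<bar> \<le> (b - a) * \<epsilon>" if a: "0 < a" and ab: "a \<le> b" and qe: "\<And>s. a
      \<le> s \<Longrightarrow> s \<le> b \<Longrightarrow> \<bar>q s - q 1\<bar> \<le> \<epsilon>" for a b \<epsilon>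
  proof -
    have i1: "integrable lborel (\<lambda>s. indicator {a..b} s * c)" for c :: real
      by (intro integrable_mult_left integrable_real_indicator) (use ab in auto)
    have v: "(LINT s|lborel. indicator {a..b} s * c) = (b - a) * c" for c :: real using ab by simp
    have "(LINT s|lborel. indicator {a..b} s * q s) - (b - a) * q 1 = (LINT s|lborel. indicator {a..b} s * q s - indicator {a..b} s * q 1)"
      using incr[OF a ab] i1 by (simp add: v[symmetric] del: integral_mult_left_zero)
    also have "\<bar>\<dots>\<bar> \<le> (LINT s|lborel. indicator {a..b} s * \<epsilon>)"
    proof (rule integral_abs_bound_integral)
      show "integrable lborel (\<lambda>s. indicator {a..b} s * q s - indicator {a..b} s * q 1)" using incr[OF a ab] i1 by auto
      show "integrable lborel (\<lambda>s. indicator {a..b} s * \<epsilon>)" by (rule i1)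
      show "\<bar>indicator {a..b} s * q s - indicator {a..b} s * q 1\<bar> \<le> indicator {a..b} s * \<epsilon>" for s
        using qe[of s] by (auto simp: indicator_def)
    qed
    finally show ?thesis using incr[OF a ab] ab by (simp add: v)
  qed
  have "(\<lambda>h. (p (1 + h) - p 1) / h) \<midarrow>0\<rightarrow> q 1"
  proof (rule LIM_I)
    fix r :: real assume r: "r > 0"
    obtain d where d: "d > 0" "\<And>s. s \<noteq> 1 \<Longrightarrow> \<bar>s - 1\<bar> < d \<Longrightarrow> \<bar>q s - q 1\<bar> < r / 2"
      using LIM_D[OF qc, of "r/2"] r by auto
    have d': "\<bar>q s - q 1\<bar> \<le> r / 2" if "\<bar>s - 1\<bar> < d" for s using d(2)[of s] that r by (cases "s = 1") auto
    show "\<exists>s>0. \<forall>x. x \<noteq> 0 \<and> norm (x - 0) < s \<longrightarrow> norm ((p (1 + x) - p 1) / x - q 1) < r"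
    proof (intro exI[of _ "min d 1"] conjI allI impI)
      fix h :: real assume h: "h \<noteq> 0 \<and> norm (h - 0) < min d 1"
      have "\<bar>(p (1 + h) - p 1) - h * q 1\<bar> \<le> \<bar>h\<bar> * (r / 2)"
      proof (cases "h > 0")
        case True
        then show ?thesis using est[of 1 "1 + h" "r/2"] h d' by simp
      next
        case False
        have "\<bar>(p 1 - p (1 + h)) - (1 - (1 + h)) * q 1\<bar> \<le> (1 - (1 + h)) * (r/2)"
          by (rule est) (use False h d' in auto)
        then show ?thesis using False h by (simp add: abs_if split: if_splits)
      qed
      then have "\<bar>(p (1 + h) - p 1) / h - q 1\<bar> \<le> r / 2"
        using h by (simp add: abs_le_iff field_simps abs_if split: if_splits)
      then show "norm ((p (1 + h) - p 1) / h - q 1) < r" using r by simp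
    qed (use d in simp)
  qed
  then have "(p has_real_derivative q 1) (at 1)" by (simp add: DERIV_def)
  then show ?thesis unfolding q1 by (simp add: p_def[abs_def])
qed

subsection \<open>The quadratic and quartic forms of the energy\<close>

lemma ip_cong_AE:
  assumes "f \<in> L2" "f' \<in> L2" "g \<in> L2" "g' \<in> L2" "AE x in lborel. f x = f' x" "AE x in lborel. g x = g' x"
  shows "ip f g = ip f' g'"
proof -
  note [measurable] = L2_meas[OF assms(1)] L2_meas[OF assms(2)] L2_meas[OF assms(3)] L2_meas[OF assms(4)]
  show ?thesis unfolding ip_def
    by (intro arg_cong[of _ _ Re] integral_cong_AE) (use assms(5,6) in auto)
qed

lemma dipolar_symbol_measurable[measurable]: "dipolar_symbol \<in> borel_measurable borel"
  unfolding dipolar_symbol_def by measurable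

lemma dipolar_symbol_bound: "\<bar>dipolar_symbol \<xi>\<bar> \<le> 8 / 3 * pi"
proof -
  have "\<bar>(2 * (\<xi> $ 3)\<^sup>2 - (\<xi> $ 1)\<^sup>2 - (\<xi> $ 2)\<^sup>2) / (norm \<xi>)\<^sup>2\<bar> \<le> 2"
  proof (cases "\<xi> = 0")
    case False
    then have "(norm \<xi>)\<^sup>2 > 0" by simp
    moreover have "\<bar>2 * (\<xi> $ 3)\<^sup>2 - (\<xi> $ 1)\<^sup>2 - (\<xi> $ 2)\<^sup>2\<bar> \<le> 2 * (norm \<xi>)\<^sup>2"
      unfolding norm3_sq by (simp add: abs_le_iff)
    ultimately show ?thesis by (simp add: abs_divide pos_divide_le_eq)
  qed simp
  then have "4 / 3 * pi * \<bar>(2 * (\<xi> $ 3)\<^sup>2 - (\<xi> $ 1)\<^sup>2 - (\<xi> $ 2)\<^sup>2) / (norm \<xi>)\<^sup>2\<bar> \<le> 4 / 3 * pi * 2"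
    by (intro mult_left_mono) auto
  then show ?thesis by (simp add: dipolar_symbol_def abs_mult)
qed

lemma dipolar_symbol_even: "dipolar_symbol (- \<xi>) = dipolar_symbol \<xi>"
  by (simp add: dipolar_symbol_def)

lemma dipolar_symbol_homogeneous: "c > 0 \<Longrightarrow> dipolar_symbol (c *\<^sub>R \<xi>) = dipolar_symbol \<xi>"
proof -
  assume c: "c > 0"
  have "2 * (c * \<xi> $ 3)\<^sup>2 - (c * \<xi> $ 1)\<^sup>2 - (c * \<xi> $ 2)\<^sup>2
      = c\<^sup>2 * (2 * (\<xi> $ 3)\<^sup>2 - (\<xi> $ 1)\<^sup>2 - (\<xi> $ 2)\<^sup>2)"
    by (simp add: power_mult_distrib algebra_simps)
  then show ?thesis using c by (simp add: dipolar_symbol_def power_mult_distrib)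
qed

lemma dipolar_image: "f \<in> L2 \<Longrightarrow> is_multiplier_image dipolar_symbol f (dipolar_conv f)"
  unfolding dipolar_conv_def by (rule multiplier_image[OF _ dipolar_symbol_measurable dipolar_symbol_bound])

lemma dipolar_L2: "f \<in> L2 \<Longrightarrow> dipolar_conv f \<in> L2"
  using multiplier_image_L2(2)[OF dipolar_image] .

lemma dipolar_unique: "f \<in> L2 \<Longrightarrow> is_multiplier_image dipolar_symbol f g \<Longrightarrow> AE x in lborel. dipolar_conv f x = g x"
  by (rule multiplier_image_unique[OF dipolar_image _ dipolar_symbol_measurable])

text \<open>The interaction as a bilinear form in the densities, so that the quartic part of the
  energy is handled by quadratic algebra.\<close>

definition nl :: "real \<Rightarrow> real \<Rightarrow> (real ^ 3 \<Rightarrow> complex) \<Rightarrow> (real ^ 3 \<Rightarrow> complex) \<Rightarrow> real" where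
  "nl l1 l2 \<rho> \<sigma> = l1 * ip \<rho> \<sigma> + l2 * ip (dipolar_conv \<rho>) \<sigma>"

text \<open>The factor \<open>8 / 3 * pi\<close> bounds the dipolar symbol; the summand 1 keeps the
  constant positive, so that it may be divided by.\<close>

definition nl_const :: "real \<Rightarrow> real \<Rightarrow> real" where
  "nl_const l1 l2 = \<bar>l1\<bar> + \<bar>l2\<bar> * (8 / 3 * pi) + 1"

lemma nl_const_pos: "nl_const l1 l2 > 0"
  by (simp add: nl_const_def add_nonneg_pos)

lemma nl_sym: assumes "\<rho> \<in> L2" "\<sigma> \<in> L2" shows "nl l1 l2 \<rho> \<sigma> = nl l1 l2 \<sigma> \<rho>"
proof -
  have "ip (dipolar_conv \<rho>) \<sigma> = ip \<rho> (dipolar_conv \<sigma>)"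
    by (rule multiplier_image_symmetric[OF dipolar_image dipolar_image]) (use assms in auto)
  then show ?thesis by (simp add: nl_def ip_sym)
qed

lemma nl_add_right: "\<rho> \<in> L2 \<Longrightarrow> \<sigma> \<in> L2 \<Longrightarrow> \<tau> \<in> L2
    \<Longrightarrow> nl l1 l2 \<rho> (\<lambda>x. \<sigma> x + \<tau> x) = nl l1 l2 \<rho> \<sigma> + nl l1 l2 \<rho> \<tau>"
  by (simp add: nl_def ip_add_right dipolar_L2 distrib_left)

lemma nl_scale_right: "nl l1 l2 \<rho> (\<lambda>x. of_real r * \<sigma> x) = r * nl l1 l2 \<rho> \<sigma>"
  by (simp add: nl_def ip_scale_right algebra_simps)

lemma nl_add_left: "\<rho> \<in> L2 \<Longrightarrow> \<sigma> \<in> L2 \<Longrightarrow> \<tau> \<in> L2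
    \<Longrightarrow> nl l1 l2 (\<lambda>x. \<sigma> x + \<tau> x) \<rho> = nl l1 l2 \<sigma> \<rho> + nl l1 l2 \<tau> \<rho>"
  using nl_add_right[of \<rho> \<sigma> \<tau> l1 l2] by (simp add: nl_sym[of _ \<rho>] L2_add)

lemma nl_scale_left: "\<rho> \<in> L2 \<Longrightarrow> \<sigma> \<in> L2 \<Longrightarrow> nl l1 l2 (\<lambda>x. of_real r * \<sigma> x) \<rho>
    = r * nl l1 l2 \<sigma> \<rho>"
  using nl_scale_right[of l1 l2 \<rho> r \<sigma>] by (simp add: nl_sym[of _ \<rho>] L2_scale)

lemma nl_bound: assumes "\<rho> \<in> L2" "\<sigma> \<in> L2" shows "\<bar>nl l1 l2 \<rho> \<sigma>\<bar> \<le> nl_const l1 l2 * (l2n \<rho> * l2n \<sigma>)"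
proof -
  have "\<bar>ip (dipolar_conv \<rho>) \<sigma>\<bar> \<le> l2n (dipolar_conv \<rho>) * l2n \<sigma>" by (rule ip_le[OF dipolar_L2]) (use assms in auto)
  also have "\<dots> \<le> (8 / 3 * pi * l2n \<rho>) * l2n \<sigma>"
    by (intro mult_right_mono multiplier_image_bound[OF dipolar_image dipolar_symbol_measurable dipolar_symbol_bound] assms) auto
  finally have 1: "\<bar>ip (dipolar_conv \<rho>) \<sigma>\<bar> \<le> 8 / 3 * pi * (l2n \<rho> * l2n \<sigma>)" by simp
  have "\<bar>nl l1 l2 \<rho> \<sigma>\<bar> \<le> \<bar>l1\<bar> * \<bar>ip \<rho> \<sigma>\<bar> + \<bar>l2\<bar> * \<bar>ip (dipolar_conv \<rho>) \<sigma>\<bar>"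
    unfolding nl_def using abs_triangle_ineq[of "l1 * ip \<rho> \<sigma>" "l2 * ip (dipolar_conv \<rho>) \<sigma>"] by (simp add: abs_mult)
  also have "\<dots> \<le> \<bar>l1\<bar> * (l2n \<rho> * l2n \<sigma>) + \<bar>l2\<bar> * (8 / 3 * pi * (l2n \<rho> * l2n \<sigma>))"
    by (intro add_mono mult_left_mono ip_le assms 1) auto
  also have "\<dots> \<le> nl_const l1 l2 * (l2n \<rho> * l2n \<sigma>)" by (simp add: nl_const_def distrib_right)
  finally show ?thesis .
qed

text \<open>The dipolar multiplier commutes with dilations, so only the Jacobian remains.\<close>

lemma nl_dilation:
  assumes "\<rho> \<in> L2" "\<sigma> \<in> L2" "c > 0"
  shows "nl l1 l2 (\<lambda>x. \<rho> (c *\<^sub>R x)) (\<lambda>x. \<sigma> (c *\<^sub>R x)) = (1 / c^3) * nl l1 l2 \<rho> \<sigma>"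
proof -
  have ipd: "ip (\<lambda>x. f (c *\<^sub>R x)) (\<lambda>x. g (c *\<^sub>R x)) = (1 / c^3) * ip f g" if "f \<in> L2" "g \<in> L2" for f g
  proof -
    have m: "(\<lambda>x. f x * cnj (g x)) \<in> borel_measurable borel"
      using ip_integrable[OF that] by (auto dest: borel_measurable_integrable)
    show ?thesis using integral_affine[OF m, of c 0] \<open>c > 0\<close> by (simp add: ip_def)
  qed
  have "ip (dipolar_conv (\<lambda>x. \<rho> (c *\<^sub>R x))) (\<lambda>x. \<sigma> (c *\<^sub>R x))
      = ip (\<lambda>x. dipolar_conv \<rho> (c *\<^sub>R x)) (\<lambda>x. \<sigma> (c *\<^sub>R x))"
  proof (rule ip_cong_AE)
    show "AE x in lborel. dipolar_conv (\<lambda>x. \<rho> (c *\<^sub>R x)) x = dipolar_conv \<rho> (c *\<^sub>R x)"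
      by (rule dipolar_unique[OF dilation_L2(1) multiplier_image_dilation[OF dipolar_image dipolar_symbol_homogeneous]]) (use assms in auto)
  qed (use assms in \<open>auto intro: dipolar_L2 dilation_L2(1) dilation_L2(1)[OF dipolar_L2]\<close>)
  then show ?thesis using assms by (simp add: nl_def ipd dipolar_L2 algebra_simps)
qed

text \<open>The symbol is real and even. Reality is needed to rewrite the derivative of the
  interaction as a distribution.\<close>

lemma dipolar_real:
  assumes "\<rho> \<in> L2" and r: "\<And>x. cnj (\<rho> x) = \<rho> x" shows "AE x in lborel. cnj (dipolar_conv \<rho> x) = dipolar_conv \<rho> x"
proof -
  have "is_multiplier_image dipolar_symbol (\<lambda>x. cnj (\<rho> x)) (\<lambda>x. cnj (dipolar_conv \<rho> x))"
    by (rule multiplier_image_cnj[OF dipolar_image[OF assms(1)] dipolar_symbol_even])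
  then have "is_multiplier_image dipolar_symbol \<rho> (\<lambda>x. cnj (dipolar_conv \<rho> x))" by (simp add: r)
  from dipolar_unique[OF assms(1) this] show ?thesis by eventually_elim simp
qed

section \<open>The energy space and its quadratic form\<close>

definition xmul :: "(real ^ 3 \<Rightarrow> complex) \<Rightarrow> real ^ 3 \<Rightarrow> complex" where
  "xmul u x = of_real (norm x) * u x"

lemma ES_L2: "u \<in> energy_space \<Longrightarrow> u \<in> L2"
  by (simp add: energy_space_def H1_def)

lemma ES_wp: assumes "u \<in> energy_space" shows "is_weak_partial i u (weak_partial i u)"
proof -
  have "\<exists>g. is_weak_partial i u g" using assms by (simp add: energy_space_def H1_def)
  from someI_ex[OF this] show ?thesis unfolding weak_partial_def .
qed

lemma ES_grad_L2: "u \<in> energy_space \<Longrightarrow> weak_partial i u \<in> L2"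
  by (rule wpD(1)[OF ES_wp])

lemma xmul_sq: "(norm (xmul u x))\<^sup>2 = (norm x)\<^sup>2 * (norm (u x))\<^sup>2"
  by (simp add: xmul_def norm_mult power_mult_distrib)

lemma ES_xmul: assumes "u \<in> energy_space" shows "xmul u \<in> L2"
proof (rule L2I)
  note [measurable] = L2_meas[OF ES_L2[OF assms]]
  show "xmul u \<in> borel_measurable borel" unfolding xmul_def by measurable
  show "integrable lborel (\<lambda>x. (norm (xmul u x))\<^sup>2)" using assms by (simp add: xmul_sq energy_space_def)
qed

lemma ESI:
  assumes "u \<in> L2" "\<And>i. is_weak_partial i u (g i)" "xmul u \<in> L2" shows "u \<in> energy_space"
  using assms L2_int[OF assms(3)] by (auto simp: energy_space_def H1_def xmul_sq)

lemma ES_add: "u \<in> energy_space \<Longrightarrow> v \<in> energy_space \<Longrightarrow> (\<lambda>x. u x + v x) \<in> energy_space"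
  using L2_add[OF ES_xmul[of u] ES_xmul[of v]]
  by (intro ESI[OF L2_add wp_add[OF ES_wp ES_wp]]) (auto simp: ES_L2 xmul_def[abs_def] distrib_left)

lemma ES_scale: "u \<in> energy_space \<Longrightarrow> (\<lambda>x. c * u x) \<in> energy_space"
  using L2_scale[OF ES_xmul[of u], of c]
  by (intro ESI[OF L2_scale wp_scale[OF ES_wp]]) (auto simp: ES_L2 xmul_def[abs_def] mult.left_commute)

lemma ES_diff: "u \<in> energy_space \<Longrightarrow> v \<in> energy_space \<Longrightarrow> (\<lambda>x. u x - v x) \<in> energy_space"
  using ES_add[of u "\<lambda>x. (-1) * v x"] ES_scale[of v "-1"] by simp

definition gr :: "(real ^ 3 \<Rightarrow> complex) \<Rightarrow> (real ^ 3 \<Rightarrow> complex) \<Rightarrow> real" where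
  "gr u v = (\<Sum>i\<in>UNIV. ip (weak_partial i u) (weak_partial i v))"

definition qf :: "real \<Rightarrow> (real ^ 3 \<Rightarrow> complex) \<Rightarrow> (real ^ 3 \<Rightarrow> complex) \<Rightarrow> real" where
  "qf a u v = gr u v + a\<^sup>2 * ip (xmul u) (xmul v)"

lemma gradient_sq_gr: "gradient_sq u = gr u u"
  by (simp add: gradient_sq_def gr_def ip_self l2n_sq)

lemma moment_sq_ip: "moment_sq u = ip (xmul u) (xmul u)"
  by (simp add: moment_sq_def ip_self l2n_sq xmul_sq)

text \<open>\<open>weak_partial\<close> is a choice; this evaluates the form through any other weak
  derivatives at hand.\<close>

lemma gr_eq:
  assumes u: "u \<in> energy_space" and v: "v \<in> energy_space" and g: "\<And>i. is_weak_partial i u (g i)" and h: "\<And>i. is_weak_partial i v (h i)"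
  shows "gr u v = (\<Sum>i\<in>UNIV. ip (g i) (h i))"
  unfolding gr_def
  by (intro sum.cong refl ip_cong_AE wp_unique[OF ES_wp[OF u] g] wp_unique[OF ES_wp[OF v] h] ES_grad_L2 u v wpD(1)[OF g] wpD(1)[OF h])

lemma gr_add_right: assumes "u \<in> energy_space" "v \<in> energy_space" "w \<in> energy_space"
  shows "gr u (\<lambda>x. v x + w x) = gr u v + gr u w"
  by (subst gr_eq[OF assms(1) ES_add[OF assms(2,3)] ES_wp[OF assms(1)] wp_add[OF ES_wp[OF assms(2)] ES_wp[OF assms(3)] ES_L2[OF assms(2)] ES_L2[OF assms(3)]]])
     (simp add: gr_def ip_add_right ES_grad_L2 assms sum.distrib)

lemma gr_scale_right: assumes "u \<in> energy_space" "v \<in> energy_space"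
  shows "gr u (\<lambda>x. of_real r * v x) = r * gr u v"
  by (subst gr_eq[OF assms(1) ES_scale[OF assms(2)] ES_wp[OF assms(1)] wp_scale[OF ES_wp[OF assms(2)]]])
     (simp add: gr_def ip_scale_right sum_distrib_left)

lemma gr_sym: "gr u v = gr v u" by (simp add: gr_def ip_sym)

lemma xmul_add: "xmul (\<lambda>x. u x + v x) = (\<lambda>x. xmul u x + xmul v x)" and xmul_scale: "xmul (\<lambda>x. c * u x) = (\<lambda>x. c * xmul u x)"
  by (auto simp: xmul_def algebra_simps)

lemma qf_add_right: assumes "u \<in> energy_space" "v \<in> energy_space" "w \<in> energy_space"
  shows "qf a u (\<lambda>x. v x + w x) = qf a u v + qf a u w"
  using assms by (simp add: qf_def gr_add_right xmul_add ip_add_right ES_xmul algebra_simps)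

lemma qf_scale_right: assumes "u \<in> energy_space" "v \<in> energy_space"
  shows "qf a u (\<lambda>x. of_real r * v x) = r * qf a u v"
  using assms by (simp add: qf_def gr_scale_right xmul_scale ip_scale_right algebra_simps)

lemma qf_sym: "qf a u v = qf a v u" by (simp add: qf_def gr_sym ip_sym)

lemma gr_nonneg: "gr u u \<ge> 0" by (auto simp: gr_def ip_self intro!: sum_nonneg)

lemma qf_nonneg: "qf a u u \<ge> gr u u" by (simp add: qf_def ip_self)

lemma qf_add: assumes "u \<in> energy_space" "v \<in> energy_space"
  shows "qf a (\<lambda>x. u x + v x) (\<lambda>x. u x + v x) = qf a u u + 2 * qf a u v + qf a v v"
proof -
  note s = ES_add[OF assms]
  have "qf a (\<lambda>x. u x + v x) (\<lambda>x. u x + v x) = qf a u (\<lambda>x. u x + v x) + qf a v (\<lambda>x. u x + v x)"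
    unfolding qf_add_right[OF s assms] by (intro arg_cong2[of _ _ _ _ "(+)"] qf_sym)
  then show ?thesis using assms qf_sym[of a v u] by (simp add: qf_add_right)
qed

lemma qf_scale: assumes "u \<in> energy_space"
  shows "qf a (\<lambda>x. of_real r * u x) (\<lambda>x. of_real r * u x) = r\<^sup>2 * qf a u u"
proof -
  have "qf a (\<lambda>x. of_real r * u x) (\<lambda>x. of_real r * u x) = r * qf a (\<lambda>x. of_real r * u x) u"
    by (rule qf_scale_right[OF ES_scale[OF assms] assms])
  also have "qf a (\<lambda>x. of_real r * u x) u = qf a u (\<lambda>x. of_real r * u x)" by (rule qf_sym)
  also have "\<dots> = r * qf a u u" by (rule qf_scale_right[OF assms assms])
  finally show ?thesis by (simp add: power2_eq_square)
qed

text \<open>Lets the rules for \<open>qf\<close> serve for the gradient form at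
  \<open>a = 0\<close>.\<close>

lemma gr_qf: "gr u v = qf 0 u v" by (simp add: qf_def)

lemma l2n_grad_le: "l2n (weak_partial i u) \<le> sqrt (gr u u)"
proof (rule real_le_rsqrt)
  show "(l2n (weak_partial i u))\<^sup>2 \<le> gr u u"
    unfolding gr_def ip_self by (rule member_le_sum[of i UNIV "\<lambda>i. (l2n (weak_partial i u))\<^sup>2"]) auto
qed

section \<open>Densities and their polarisation\<close>

abbreviation "dens \<equiv> particle_density"

lemma dens_def': "dens u = (\<lambda>x. of_real ((norm (u x))\<^sup>2))"
  by (rule ext) (simp add: particle_density_def)

lemma dens_L2: assumes "u \<in> energy_space" shows "dens u \<in> L2"
  unfolding dens_def' by (rule ladyzhenskaya(1)[OF ES_wp[OF assms] ES_L2[OF assms]])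

lemma dens_sq_bound: assumes u: "u \<in> energy_space" shows "(l2n (dens u))\<^sup>2 \<le> 64 * (l2n u * (sqrt (gr u u))^3)"
proof -
  have "(l2n (dens u))\<^sup>2 \<le> 64 * (l2n u * (l2n (weak_partial 1 u) * l2n (weak_partial 2 u) * l2n (weak_partial 3 u)))"
    unfolding dens_def' by (rule ladyzhenskaya(2)[OF ES_wp[OF u] ES_L2[OF u]])
  also have "\<dots> \<le> 64 * (l2n u * (sqrt (gr u u) * sqrt (gr u u) * sqrt (gr u u)))"
    by (intro mult_left_mono mult_mono l2n_grad_le) (auto simp: gr_nonneg)
  finally show ?thesis by (simp add: power3_eq_cube)
qed

text \<open>Half the derivative of the density at \<open>u\<close> in direction \<open>v\<close>;
  its modulus is at most the geometric mean of the two densities.\<close>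

definition cross :: "(real ^ 3 \<Rightarrow> complex) \<Rightarrow> (real ^ 3 \<Rightarrow> complex) \<Rightarrow> real ^ 3 \<Rightarrow> complex" where
  "cross u v x = of_real (Re (cnj (u x) * v x))"

lemma cross_L2:
  assumes u: "u \<in> energy_space" and v: "v \<in> energy_space"
  shows "cross u v \<in> L2" "(l2n (cross u v))\<^sup>2 \<le> l2n (dens u) * l2n (dens v)"
proof -
  note [measurable] = L2_meas[OF ES_L2[OF u]] L2_meas[OF ES_L2[OF v]]
  have m: "cross u v \<in> borel_measurable borel" unfolding cross_def by measurable
  have b: "(norm (cross u v x))\<^sup>2 \<le> norm (dens u x * dens v x)" for x
  proof -
    have "norm (cross u v x) \<le> norm (u x) * norm (v x)"
      using abs_Re_le_cmod[of "cnj (u x) * v x"] unfolding cross_def norm_of_real by (simp only: norm_mult complex_mod_cnj)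
    then have "(norm (cross u v x))\<^sup>2 \<le> (norm (u x) * norm (v x))\<^sup>2" by (intro power_mono) auto
    then show ?thesis by (simp add: particle_density_def norm_mult power_mult_distrib norm_power)
  qed
  have i: "integrable lborel (\<lambda>x. norm (dens u x * dens v x))"
    by (intro integrable_norm L2_mult_integrable dens_L2 u v)
  show L: "cross u v \<in> L2" by (rule L2_bound[OF m i b])
  have "(l2n (cross u v))\<^sup>2 \<le> (LINT x|lborel. norm (dens u x * dens v x))"
    unfolding l2n_sq by (intro integral_mono L2_int L i b)
  also have "\<dots> \<le> l2n (dens u) * l2n (dens v)" by (intro nn_mult_le dens_L2 u v)
  finally show "(l2n (cross u v))\<^sup>2 \<le> l2n (dens u) * l2n (dens v)" .
qed

lemma cross_self: "cross u u = dens u"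
  by (rule ext) (simp add: cross_def particle_density_def complex_norm_square[symmetric] mult.commute del: of_real_power)

lemma cross_add: "cross u (\<lambda>x. v x + w x) = (\<lambda>x. cross u v x + cross u w x)"
  by (rule ext) (simp add: cross_def algebra_simps)

lemma cross_scale: "cross u (\<lambda>x. of_real r * v x) = (\<lambda>x. of_real r * cross u v x)"
  by (rule ext) (simp add: cross_def algebra_simps)

lemma dens_add: "dens (\<lambda>x. u x + v x) = (\<lambda>x. dens u x + (of_real 2 * cross u v x + dens v x))"
proof (rule ext)
  fix x
  have "(norm (u x + v x))\<^sup>2 = (norm (u x))\<^sup>2 + (2 * Re (cnj (u x) * v x) + (norm (v x))\<^sup>2)"
    unfolding cmod_power2 by (simp add: power2_eq_square algebra_simps)
  then show "dens (\<lambda>x. u x + v x) x = dens u x + (of_real 2 * cross u v x + dens v x)"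
    by (simp only: particle_density_def cross_def of_real_add of_real_mult)
qed

lemma dens_scale: "dens (\<lambda>x. of_real r * u x) = (\<lambda>x. of_real (r\<^sup>2) * dens u x)"
  by (rule ext) (simp add: particle_density_def norm_mult power_mult_distrib)

lemma energy_eq:
  assumes u: "u \<in> energy_space"
  shows "energy l1 l2 a u = 1/2 * qf a u u + 1/2 * nl l1 l2 (dens u) (dens u)"
proof -
  have r: "cnj (dens u x) = dens u x" for x by (simp add: particle_density_def)
  have "(LINT x|lborel. (norm (u x)) ^ 4) = ip (dens u) (dens u)"
    unfolding ip_self l2n_sq by (intro Bochner_Integration.integral_cong) (auto simp: particle_density_def norm_power power_mult[symmetric])
  moreover have "Re (LINT x|lborel. dipolar_conv (dens u) x * dens u x) = ip (dipolar_conv (dens u)) (dens u)"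
    by (simp add: ip_def r)
  ultimately show ?thesis
    by (simp add: energy_def qf_def nl_def gradient_sq_gr moment_sq_ip algebra_simps)
qed

subsection \<open>Differentiability of the energy\<close>

text \<open>Of the factor 1/2 in front of the interaction and the two factors 2, from the symmetry
  of \<open>nl\<close> and from the derivative of the density, one 2 remains.\<close>

definition denergy :: "real \<Rightarrow> real \<Rightarrow> real \<Rightarrow> (real ^ 3 \<Rightarrow> complex) \<Rightarrow> (real ^ 3
    \<Rightarrow> complex) \<Rightarrow> real" where
  "denergy l1 l2 a u h = qf a u h + 2 * nl l1 l2 (dens u) (cross u h)"

lemma denergy_add: assumes "u \<in> energy_space" "h \<in> energy_space" "k \<in> energy_space"
  shows "denergy l1 l2 a u (\<lambda>x. h x + k x) = denergy l1 l2 a u h + denergy l1 l2 a u k"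
  using assms by (simp add: denergy_def qf_add_right cross_add nl_add_right dens_L2 cross_L2)

lemma denergy_scale: assumes "u \<in> energy_space" "h \<in> energy_space"
  shows "denergy l1 l2 a u (\<lambda>x. of_real r * h x) = r * denergy l1 l2 a u h"
  using assms by (simp add: denergy_def qf_scale_right cross_scale nl_scale_right algebra_simps)

text \<open>The density of \<open>u + w\<close> is that of \<open>u\<close> plus
  \<open>\<eta>\<close>, so the remainder is explicit. It is bounded through the density of
  \<open>w\<close> rather than the energy norm, so that the gradient can absorb it later. The
  constants are \<open>5 = 1 + 8 / 2\<close> and \<open>1 = 2 / 2\<close>.\<close>

lemma energy_expansion:
  assumes u: "u \<in> energy_space" and w: "w \<in> energy_space"
  defines "r \<equiv> l2n (dens u)" and "d \<equiv> l2n (dens w)"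
  shows "\<bar>energy l1 l2 a (\<lambda>x. u x + w x) - energy l1 l2 a u - denergy l1 l2 a u w - 1/2 * qf a w w\<bar> \<le> nl_const l1 l2 * (5 * (r * d) + d\<^sup>2)"
proof -
  let ?K = "nl_const l1 l2" and ?n = "nl l1 l2"
  define \<eta> where "\<eta> x = of_real 2 * cross u w x + dens w x" for x
  note L = dens_L2[OF u] dens_L2[OF w] cross_L2(1)[OF u w]
  have \<eta>: "\<eta> \<in> L2" unfolding \<eta>_def by (intro L2_add L2_scale L)
  have d\<eta>: "dens (\<lambda>x. u x + w x) = (\<lambda>x. dens u x + \<eta> x)" unfolding \<eta>_def by (rule dens_add)
  have 1: "?n (dens u) \<eta> = 2 * ?n (dens u) (cross u w) + ?n (dens u) (dens w)"
    unfolding \<eta>_def by (simp only: nl_add_right L2_scale L nl_scale_right)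
  have 2: "?n (\<lambda>x. dens u x + \<eta> x) (\<lambda>x. dens u x + \<eta> x) = ?n (dens u) (dens u) + 2 * ?n (dens u) \<eta> + ?n \<eta> \<eta>"
    using nl_sym[OF \<eta> L(1), of l1 l2] by (simp add: nl_add_left nl_add_right L2_add \<eta> L)
  have eq: "energy l1 l2 a (\<lambda>x. u x + w x) - energy l1 l2 a u - denergy l1 l2 a u w - 1/2 * qf a w w = ?n (dens u) (dens w) + 1/2 * ?n \<eta> \<eta>"
    unfolding energy_eq[OF u] energy_eq[OF ES_add[OF u w]] denergy_def d\<eta> 2 1 qf_add[OF u w] by (simp add: field_simps)
  have c: "l2n (cross u w) \<le> sqrt (r * d)"
    unfolding r_def d_def by (rule real_le_rsqrt[OF cross_L2(2)[OF u w]])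
  have rd: "r \<ge> 0" "d \<ge> 0" "r * d \<ge> 0" by (auto simp: r_def d_def)
  have "l2n \<eta> \<le> 2 * sqrt (r * d) + d"
    using l2n_triangle[OF L2_scale[OF L(3), of "of_real 2"] L(2)] c unfolding \<eta>_def l2n_scale d_def by simp
  then have "(l2n \<eta>)\<^sup>2 \<le> (2 * sqrt (r * d) + d)\<^sup>2" by (rule power_mono) simp
  also have "\<dots> \<le> 2 * (2 * sqrt (r * d))\<^sup>2 + 2 * d\<^sup>2"
    using sum_squares_bound[of "2 * sqrt (r * d)" d] by (simp add: power2_sum)
  also have "\<dots> = 8 * (r * d) + 2 * d\<^sup>2" using rd by (simp add: power_mult_distrib)
  finally have e2: "(l2n \<eta>)\<^sup>2 \<le> 8 * (r * d) + 2 * d\<^sup>2" .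
  have "\<bar>?n \<eta> \<eta>\<bar> \<le> ?K * (l2n \<eta> * l2n \<eta>)" by (rule nl_bound[OF \<eta> \<eta>])
  also have "\<dots> \<le> ?K * (8 * (r * d) + 2 * d\<^sup>2)"
    using e2 nl_const_pos[of l1 l2] by (intro mult_left_mono) (auto simp: power2_eq_square)
  finally have b1: "\<bar>?n \<eta> \<eta>\<bar> \<le> ?K * (8 * (r * d) + 2 * d\<^sup>2)" .
  have b2: "\<bar>?n (dens u) (dens w)\<bar> \<le> ?K * (r * d)" unfolding r_def d_def by (rule nl_bound[OF L(1,2)])
  have "\<bar>?n (dens u) (dens w) + 1/2 * ?n \<eta> \<eta>\<bar> \<le> ?K * (r * d) + 1/2 * (?K * (8 * (r * d) + 2 * d\<^sup>2))"
    using b1 b2 by linarith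
  also have "\<dots> = ?K * (5 * (r * d) + d\<^sup>2)" by (simp add: algebra_simps)
  finally show ?thesis unfolding eq .
qed

lemma energy_space_norm_sq: "u \<in> energy_space \<Longrightarrow> (energy_space_norm u)\<^sup>2 = (l2n u)\<^sup>2 + gr u u + (l2n (xmul u))\<^sup>2"
  by (simp add: energy_space_norm_def mass_l2n gradient_sq_gr moment_sq_ip ip_self gr_nonneg)

lemma energy_space_norm_nonneg: "energy_space_norm u \<ge> 0"
  by (simp add: energy_space_norm_def mass_l2n gradient_sq_gr moment_sq_ip ip_self gr_nonneg)

lemma energy_space_norm_bounds:
  assumes u: "u \<in> energy_space"
  shows "l2n u \<le> energy_space_norm u" "sqrt (gr u u) \<le> energy_space_norm u" "l2n (xmul u) \<le> energy_space_norm u"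
proof -
  note n = energy_space_norm_sq[OF u] gr_nonneg[of u]
  show "l2n u \<le> energy_space_norm u"
    by (rule power2_le_imp_le[OF _ energy_space_norm_nonneg]) (use n in simp)
  show "l2n (xmul u) \<le> energy_space_norm u"
    by (rule power2_le_imp_le[OF _ energy_space_norm_nonneg]) (use n in simp)
  show "sqrt (gr u u) \<le> energy_space_norm u"
    by (rule real_le_lsqrt) (use n energy_space_norm_nonneg in auto)
qed

lemma dens_le_norm: assumes u: "u \<in> energy_space" shows "l2n (dens u) \<le> 8 * (energy_space_norm u)\<^sup>2"
proof (rule power2_le_imp_le)
  let ?N = "energy_space_norm u"
  have "(l2n (dens u))\<^sup>2 \<le> 64 * (l2n u * (sqrt (gr u u))^3)" by (rule dens_sq_bound[OF u])
  also have "\<dots> \<le> 64 * (?N * ?N^3)"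
    using energy_space_norm_bounds[OF u] energy_space_norm_nonneg[of u] gr_nonneg[of u] by (intro mult_left_mono mult_mono power_mono) auto
  also have "\<dots> = (8 * ?N\<^sup>2)\<^sup>2" by (simp add: power2_eq_square power3_eq_cube)
  finally show "(l2n (dens u))\<^sup>2 \<le> (8 * ?N\<^sup>2)\<^sup>2" .
qed (use energy_space_norm_nonneg in simp)

lemma qf_self_le: assumes u: "u \<in> energy_space" shows "qf a u u \<le> (1 + a\<^sup>2) * (energy_space_norm u)\<^sup>2"
proof -
  have "gr u u + a\<^sup>2 * (l2n (xmul u))\<^sup>2 \<le> 1 * (energy_space_norm u)\<^sup>2 + a\<^sup>2 * (energy_space_norm u)\<^sup>2"
    using energy_space_norm_sq[OF u] gr_nonneg[of u] by (intro add_mono mult_left_mono) auto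
  then show ?thesis by (simp add: qf_def ip_self algebra_simps)
qed

lemma qf_cauchy_schwarz: assumes u: "u \<in> energy_space" and v: "v \<in> energy_space"
  shows "\<bar>qf a u v\<bar> \<le> (3 + a\<^sup>2) * (energy_space_norm u * energy_space_norm v)"
proof -
  let ?N = "energy_space_norm u * energy_space_norm v"
  have "\<bar>ip (weak_partial i u) (weak_partial i v)\<bar> \<le> ?N" for i
  proof -
    have "\<bar>ip (weak_partial i u) (weak_partial i v)\<bar> \<le> l2n (weak_partial i u) * l2n (weak_partial i v)"
      by (intro ip_le ES_grad_L2 u v)
    also have "\<dots> \<le> ?N"
      using order_trans[OF l2n_grad_le energy_space_norm_bounds(2)[OF u]] order_trans[OF l2n_grad_le energy_space_norm_bounds(2)[OF v]] energy_space_norm_nonneg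
      by (intro mult_mono) auto
    finally show ?thesis .
  qed
  from this[of 1] this[of 2] this[of 3] have "\<bar>gr u v\<bar> \<le> 3 * ?N" unfolding gr_def sum_3 by linarith
  moreover have "\<bar>ip (xmul u) (xmul v)\<bar> \<le> ?N"
  proof -
    have "\<bar>ip (xmul u) (xmul v)\<bar> \<le> l2n (xmul u) * l2n (xmul v)" by (intro ip_le ES_xmul u v)
    also have "\<dots> \<le> ?N" using energy_space_norm_bounds(3)[OF u] energy_space_norm_bounds(3)[OF v] energy_space_norm_nonneg by (intro mult_mono) auto
    finally show ?thesis .
  qed
  then have "\<bar>a\<^sup>2 * ip (xmul u) (xmul v)\<bar> \<le> a\<^sup>2 * ?N" by (simp add: abs_mult mult_left_mono)
  ultimately show ?thesis unfolding qf_def by (simp add: distrib_right)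
qed

lemma energy_space_norm_scale: assumes "u \<in> energy_space" shows "energy_space_norm (\<lambda>x. of_real r * u x) = \<bar>r\<bar> * energy_space_norm u"
proof -
  have "(energy_space_norm (\<lambda>x. of_real r * u x))\<^sup>2 = (\<bar>r\<bar> * energy_space_norm u)\<^sup>2"
    unfolding energy_space_norm_sq[OF ES_scale[OF assms]] power_mult_distrib energy_space_norm_sq[OF assms] gr_qf qf_scale[OF assms] xmul_scale l2n_scale
    by (simp add: power_mult_distrib algebra_simps)
  then show ?thesis using energy_space_norm_nonneg[of u] energy_space_norm_nonneg[of "\<lambda>x. of_real r * u x"] by (simp add: power2_eq_iff_nonneg)
qed

lemma denergy_bounded: assumes u: "u \<in> energy_space"
  shows "\<exists>C. \<forall>h\<in>energy_space. \<bar>denergy l1 l2 a u h\<bar> \<le> C * energy_space_norm h"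
proof (intro exI ballI)
  fix h assume h: "h \<in> energy_space"
  let ?K = "nl_const l1 l2" and ?r = "l2n (dens u)"
  have "l2n (cross u h) \<le> sqrt (?r * l2n (dens h))" by (rule real_le_rsqrt[OF cross_L2(2)[OF u h]])
  also have "\<dots> \<le> sqrt (?r * (8 * (energy_space_norm h)\<^sup>2))"
    by (intro real_sqrt_le_mono mult_left_mono dens_le_norm h) auto
  also have "\<dots> = sqrt (8 * ?r) * energy_space_norm h" using energy_space_norm_nonneg[of h] by (simp add: real_sqrt_mult mult_ac)
  finally have c: "l2n (cross u h) \<le> sqrt (8 * ?r) * energy_space_norm h" .
  have "\<bar>nl l1 l2 (dens u) (cross u h)\<bar> \<le> ?K * (?r * l2n (cross u h))" by (rule nl_bound[OF dens_L2[OF u] cross_L2(1)[OF u h]])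
  also have "\<dots> \<le> ?K * (?r * (sqrt (8 * ?r) * energy_space_norm h))"
    using nl_const_pos[of l1 l2] by (intro mult_left_mono c) auto
  finally have "\<bar>denergy l1 l2 a u h\<bar> \<le> (3 + a\<^sup>2) * (energy_space_norm u * energy_space_norm h)
      + 2 * (?K * (?r * (sqrt (8 * ?r) * energy_space_norm h)))"
    unfolding denergy_def using qf_cauchy_schwarz[OF u h, of a] by linarith
  then show "\<bar>denergy l1 l2 a u h\<bar> \<le> ((3 + a\<^sup>2) * energy_space_norm u + 2 * (?K * (?r * sqrt (8 * ?r)))) * energy_space_norm h"
    by (simp add: algebra_simps)
qed

theorem energy_has_derivative:
  assumes u: "u \<in> energy_space"
  shows "has_energy_space_derivative (energy l1 l2 a) (denergy l1 l2 a u) u"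
  unfolding has_energy_space_derivative_def
proof (intro conjI ballI allI impI)
  show "denergy l1 l2 a u (\<lambda>x. h x + k x) = denergy l1 l2 a u h + denergy l1 l2 a u k" if "h \<in> energy_space" "k \<in> energy_space" for h k
    by (rule denergy_add[OF u that])
  show "denergy l1 l2 a u (\<lambda>x. of_real r * h x) = r * denergy l1 l2 a u h" if "h \<in> energy_space" for r h
    by (rule denergy_scale[OF u that])
  show "\<exists>C. \<forall>h\<in>energy_space. \<bar>denergy l1 l2 a u h\<bar> \<le> C * energy_space_norm h" by (rule denergy_bounded[OF u])
  fix \<epsilon> :: real assume e: "\<epsilon> > 0"
  let ?K = "nl_const l1 l2" and ?r = "l2n (dens u)"
  \<comment> \<open>Half the bound of the quadratic form, plus the remainder of
    \<open>energy_expansion\<close> with \<open>8 * N^2\<close> inserted for the norm of the density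
    and \<open>N <= 1\<close>: \<open>40 = 5 * 8\<close> and \<open>64 = 8 * 8\<close>.\<close>
  define C where "C = (1 + a\<^sup>2) / 2 + ?K * (40 * ?r + 64)"
  have C: "C > 0" unfolding C_def using nl_const_pos[of l1 l2] by (intro add_pos_nonneg mult_nonneg_nonneg) (auto simp: add_pos_nonneg)
  show "\<exists>\<delta>>0. \<forall>h\<in>energy_space. energy_space_norm h < \<delta> \<longrightarrow> \<bar>energy l1 l2 a (\<lambda>x. u x
      + h x) - energy l1 l2 a u - denergy l1 l2 a u h\<bar> \<le> \<epsilon> * energy_space_norm h"
  proof (intro exI[of _ "min 1 (\<epsilon> / C)"] conjI ballI impI)
    show "0 < min 1 (\<epsilon> / C)" using e C by simp
    fix h assume h: "h \<in> energy_space" and hn: "energy_space_norm h < min 1 (\<epsilon> / C)"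
    let ?N = "energy_space_norm h" and ?d = "l2n (dens h)"
    have N0: "?N \<ge> 0" by (rule energy_space_norm_nonneg)
    have d: "?d \<le> 8 * ?N\<^sup>2" by (rule dens_le_norm[OF h])
    have N1: "?N\<^sup>2 \<le> 1" using hn N0 by (simp add: power_le_one)
    have d2: "?d\<^sup>2 \<le> 64 * ?N\<^sup>2"
    proof -
      have "?d\<^sup>2 \<le> (8 * ?N\<^sup>2)\<^sup>2" by (intro power_mono d) simp
      also have "\<dots> = 64 * (?N\<^sup>2 * ?N\<^sup>2)" by (simp add: power2_eq_square)
      also have "\<dots> \<le> 64 * (?N\<^sup>2 * 1)" by (intro mult_left_mono N1) auto
      finally show ?thesis by simp
    qed
    have "\<bar>energy l1 l2 a (\<lambda>x. u x + h x) - energy l1 l2 a u - denergy l1 l2 a u h - 1/2 * qf a h h\<bar> \<le> ?K * (5 * (?r * ?d) + ?d\<^sup>2)"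
      by (rule energy_expansion[OF u h])
    also have "\<dots> \<le> ?K * (5 * (?r * (8 * ?N\<^sup>2)) + 64 * ?N\<^sup>2)"
      using nl_const_pos[of l1 l2] by (intro mult_left_mono add_mono d d2) auto
    finally have 1: "\<bar>energy l1 l2 a (\<lambda>x. u x + h x) - energy l1 l2 a u - denergy l1 l2 a u h - 1/2 * qf a h h\<bar> \<le> ?K * (40 * ?r + 64) * ?N\<^sup>2"
      by (simp add: algebra_simps)
    have 2: "\<bar>1/2 * qf a h h\<bar> \<le> (1 + a\<^sup>2) / 2 * ?N\<^sup>2"
      using qf_self_le[OF h, of a] qf_nonneg[of h a] gr_nonneg[of h] by simp
    have "\<bar>energy l1 l2 a (\<lambda>x. u x + h x) - energy l1 l2 a u - denergy l1 l2 a u h\<bar> \<le> C * ?N\<^sup>2"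
      using 1 2 unfolding C_def distrib_right by linarith
    also have "\<dots> = (C * ?N) * ?N" by (simp add: power2_eq_square)
    also have "\<dots> \<le> \<epsilon> * ?N"
    proof (rule mult_right_mono[OF _ N0])
      have "?N < \<epsilon> / C" using hn by simp
      then show "C * ?N \<le> \<epsilon>" using C by (simp add: pos_less_divide_eq mult.commute)
    qed
    finally show "\<bar>energy l1 l2 a (\<lambda>x. u x + h x) - energy l1 l2 a u - denergy l1 l2 a u h\<bar> \<le> \<epsilon> * ?N" .
  qed
qed

text \<open>Criticality speaks of some derivative; scaling a direction below both error radii
  identifies it with \<open>denergy\<close>.\<close>

lemma energy_derivative_unique:
  assumes u: "u \<in> energy_space" and D: "has_energy_space_derivative (energy l1 l2 a) D u" and h: "h \<in> energy_space"
  shows "D h = denergy l1 l2 a u h"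
proof -
  let ?T = "D h - denergy l1 l2 a u h" and ?N = "energy_space_norm h"
  have D0: "has_energy_space_derivative (energy l1 l2 a) (denergy l1 l2 a u) u" by (rule energy_has_derivative[OF u])
  have bound: "\<bar>?T\<bar> \<le> 2 * \<epsilon> * ?N" if e: "\<epsilon> > 0" for \<epsilon>
  proof -
    obtain d1 where d1: "d1 > 0" "\<And>h. h \<in> energy_space \<Longrightarrow> energy_space_norm h < d1
        \<Longrightarrow> \<bar>energy l1 l2 a (\<lambda>x. u x + h x) - energy l1 l2 a u - D h\<bar> \<le> \<epsilon> * energy_space_norm h"
      using D e unfolding has_energy_space_derivative_def by meson
    obtain d2 where d2: "d2 > 0" "\<And>h. h \<in> energy_space \<Longrightarrow> energy_space_norm h < d2
        \<Longrightarrow> \<bar>energy l1 l2 a (\<lambda>x. u x + h x) - energy l1 l2 a u - denergy l1 l2 a u h\<bar> \<le> \<epsilon> * energy_space_norm h"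
      using D0 e unfolding has_energy_space_derivative_def by meson
    \<comment> \<open>The summand 1 covers directions of norm 0.\<close>
    define s where "s = min d1 d2 / (?N + 1)"
    have N0: "?N \<ge> 0" by (rule energy_space_norm_nonneg)
    have s: "s > 0" using d1 d2 N0 by (simp add: s_def add_nonneg_pos)
    define k where "k x = of_real s * h x" for x
    have k: "k \<in> energy_space" unfolding k_def by (rule ES_scale[OF h])
    have kn: "energy_space_norm k = s * ?N" using energy_space_norm_scale[OF h, of s] s by (simp add: k_def[abs_def])
    have "s * ?N < min d1 d2"
    proof -
      have "s * ?N < s * (?N + 1)" using s by simp
      also have "\<dots> = min d1 d2" using N0 by (simp add: s_def add_nonneg_pos)
      finally show ?thesis .
    qed
    then have "\<bar>D k - denergy l1 l2 a u k\<bar> \<le> 2 * \<epsilon> * (s * ?N)"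
      using d1(2)[OF k] d2(2)[OF k] unfolding kn by linarith
    moreover have "D k = s * D h" using D h unfolding has_energy_space_derivative_def k_def[abs_def] by blast
    moreover have "denergy l1 l2 a u k = s * denergy l1 l2 a u h" unfolding k_def[abs_def] by (rule denergy_scale[OF u h])
    ultimately have "s * \<bar>?T\<bar> \<le> s * (2 * \<epsilon> * ?N)" using s by (simp add: right_diff_distrib[symmetric] abs_mult mult_ac)
    then show ?thesis using s by simp
  qed
  have "?T = 0"
  proof (rule ccontr)
    assume n: "?T \<noteq> 0"
    have N0: "?N \<ge> 0" by (rule energy_space_norm_nonneg)
    define e where "e = \<bar>?T\<bar> / (4 * (?N + 1))"
    have e: "e > 0" using n N0 by (simp add: e_def add_nonneg_pos)
    have "2 * e * ?N < 4 * (?N + 1) * e" using e mult_nonneg_nonneg[OF less_imp_le[OF e] N0] by (simp add: algebra_simps)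
    also have "\<dots> = \<bar>?T\<bar>" using N0 by (simp add: e_def add_nonneg_pos)
    finally show False using bound[OF e] by simp
  qed
  then show ?thesis by simp
qed

text \<open>Removing from \<open>h\<close> its component along \<open>u\<close> makes it tangent to
  the sphere, so the derivative only sees that component; its value at \<open>u\<close> gives the
  multiplier.\<close>

lemma critical_lagrange:
  assumes cr: "constrained_critical_point l1 l2 a c u" and c: "c > 0"
  shows "u \<in> energy_space" "(l2n u)\<^sup>2 = c" "h \<in> energy_space \<Longrightarrow> denergy l1 l2 a u h = denergy l1 l2 a u u / c * ip u h"
proof -
  show u: "u \<in> energy_space" and m: "(l2n u)\<^sup>2 = c" using cr by (auto simp: constrained_critical_point_def mass_sphere_def mass_l2n)
  obtain D where D: "has_energy_space_derivative (energy l1 l2 a) D u" and z: "\<And>h. h \<in> energy_space \<Longrightarrow> ip u h = 0 \<Longrightarrow> D h = 0"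
    using cr by (auto simp: constrained_critical_point_def ip_def)
  assume h: "h \<in> energy_space"
  define s where "s = - ip u h / c"
  define k where "k x = h x + of_real s * u x" for x
  have k: "k \<in> energy_space" unfolding k_def by (intro ES_add ES_scale h u)
  have "ip u k = ip u h + s * ip u u"
    unfolding k_def using ES_L2[OF u] ES_L2[OF h] by (simp add: ip_add_right L2_scale ip_scale_right)
  then have "ip u k = 0" using c by (simp add: ip_self m s_def)
  then have "denergy l1 l2 a u k = 0" using z[OF k] energy_derivative_unique[OF u D k] by simp
  moreover have "denergy l1 l2 a u k = denergy l1 l2 a u h + s * denergy l1 l2 a u u"
    unfolding k_def by (simp only: denergy_add[OF u h ES_scale[OF u]] denergy_scale[OF u u])
  ultimately show "denergy l1 l2 a u h = denergy l1 l2 a u u / c * ip u h" by (simp add: s_def field_simps)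
qed

lemma denergy_self: "denergy l1 l2 a u u = qf a u u + 2 * nl l1 l2 (dens u) (dens u)"
  by (simp add: denergy_def cross_self)

subsection \<open>Mass-preserving dilations and the virial identity\<close>

text \<open>The factor \<open>t^(3/2)\<close>, which preserves the mass, is written as
  \<open>sqrt t ^ 3\<close> to stay with natural powers.\<close>

definition dil :: "real \<Rightarrow> (real ^ 3 \<Rightarrow> complex) \<Rightarrow> real ^ 3 \<Rightarrow> complex" where
  "dil t u x = of_real (sqrt t ^ 3) * u (t *\<^sub>R x)"

lemma dil_facts:
  assumes u: "u \<in> energy_space" and t: "t > 0"
  shows "dil t u \<in> energy_space" "l2n (dil t u) = l2n u" "gr (dil t u) (dil t u) = t\<^sup>2 * gr u u"
    "ip (xmul (dil t u)) (xmul (dil t u)) = ip (xmul u) (xmul u) / t\<^sup>2"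
    "nl l1 l2 (dens (dil t u)) (dens (dil t u)) = t^3 * nl l1 l2 (dens u) (dens u)"
proof -
  have "(sqrt t ^ 3)\<^sup>2 = ((sqrt t)\<^sup>2)^3" by (simp only: power_mult[symmetric]) simp
  then have s2: "(sqrt t ^ 3)\<^sup>2 = t^3" using t by simp
  have "sqrt t ^ 6 = ((sqrt t)\<^sup>2)^3" by (simp only: power_mult[symmetric]) simp
  then have s6: "sqrt t ^ 6 = t^3" using t by simp
  have sq: "sqrt t ^ 3 * (sqrt (1 / t^3) * y) = y" for y
  proof -
    have "sqrt t ^ 3 = sqrt (t^3)" using t by (simp add: real_sqrt_power)
    then show ?thesis using t by (simp add: real_sqrt_divide)
  qed
  have L: "dil t u \<in> L2" unfolding dil_def by (intro L2_scale dilation_L2 ES_L2 u t)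
  have W: "is_weak_partial i (dil t u) (\<lambda>x. of_real (sqrt t ^ 3) * (of_real t * weak_partial i u (t *\<^sub>R x)))" for i
    unfolding dil_def[abs_def] by (intro wp_scale wp_dilation ES_wp ES_L2 u t)
  have X: "xmul (dil t u) = (\<lambda>x. of_real (1 / t) * (of_real (sqrt t ^ 3) * xmul u (t *\<^sub>R x)))"
    using t by (auto simp: xmul_def dil_def)
  have nd: "l2n (\<lambda>x. of_real (sqrt t ^ 3) * f (t *\<^sub>R x)) = l2n f" if "f \<in> L2" for f
    unfolding l2n_scale dilation_L2(2)[OF that t] using t by (simp only: norm_of_real abs_of_nonneg sq zero_le_power real_sqrt_ge_zero less_imp_le)
  show D: "dil t u \<in> energy_space"
    by (rule ESI[OF L W]) (unfold X, intro L2_scale dilation_L2 ES_xmul u t)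
  show "l2n (dil t u) = l2n u" unfolding dil_def[abs_def] by (rule nd[OF ES_L2[OF u]])
  have "l2n (\<lambda>x. of_real (sqrt t ^ 3) * (of_real t * weak_partial i u (t *\<^sub>R x))) = t * l2n (weak_partial i u)" for i
  proof -
    have "(\<lambda>x. of_real (sqrt t ^ 3) * (of_real t * weak_partial i u (t *\<^sub>R x)))
        = (\<lambda>x. of_real t * (of_real (sqrt t ^ 3) * weak_partial i u (t *\<^sub>R x)))"
      by (simp add: mult.left_commute)
    then show ?thesis using nd[OF ES_grad_L2[OF u, of i]] t by (simp only: l2n_scale[of "of_real t"]) simp
  qed
  then show "gr (dil t u) (dil t u) = t\<^sup>2 * gr u u"
    unfolding gr_eq[OF D D W W] ip_self by (simp add: gr_def ip_self power_mult_distrib sum_distrib_left)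
  show "ip (xmul (dil t u)) (xmul (dil t u)) = ip (xmul u) (xmul u) / t\<^sup>2"
    unfolding ip_self X l2n_scale[of "of_real (1/t)"] nd[OF ES_xmul[OF u]] using t by (simp add: power_mult_distrib power_divide norm_divide)
  have "dens (dil t u) = (\<lambda>x. of_real (t^3) * dens u (t *\<^sub>R x))"
    by (rule ext) (simp add: particle_density_def dil_def norm_mult power_mult_distrib norm_power s6 del: of_real_power)
  then show "nl l1 l2 (dens (dil t u)) (dens (dil t u)) = t^3 * nl l1 l2 (dens u) (dens u)"
    using t by (simp only: nl_scale_right nl_scale_left dilation_L2(1)[OF dens_L2[OF u] t] L2_scale nl_dilation[OF dens_L2[OF u] dens_L2[OF u] t]) simp
qed

lemma energy_dil:
  assumes u: "u \<in> energy_space" and t: "t > 0"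
  shows "energy l1 l2 a (dil t u) = 1/2 * (t\<^sup>2 * gr u u) + 1/2 * (a\<^sup>2 * (ip (xmul u) (xmul u) / t\<^sup>2)) + 1/2 * (t^3 * nl l1 l2 (dens u) (dens u))"
  unfolding energy_eq[OF dil_facts(1)[OF u t]] qf_def dil_facts(3-5)[OF u t] by (simp add: algebra_simps)

text \<open>Split at \<open>L * \<mu> = \<alpha> / 2\<close>: below, the left side is absorbed by
  half of \<open>\<alpha>^4\<close>; above, \<open>\<alpha>\<close> is at most
  \<open>2 * L * \<mu>\<close>, whence \<open>8 = 2^3\<close>.\<close>

lemma young_quartic: fixes L \<mu> \<alpha> :: real assumes "L \<ge> 0" "\<mu> \<ge> 0" "\<alpha> \<ge> 0" shows "L * \<mu> * \<alpha>^3
    \<le> 1/2 * \<alpha>^4 + 8 * L^4 * \<mu>^4"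
proof (cases "L * \<mu> \<le> \<alpha> / 2")
  case True
  then have "(L * \<mu>) * \<alpha>^3 \<le> (\<alpha> / 2) * \<alpha>^3" using assms by (intro mult_right_mono) auto
  moreover have "(\<alpha> / 2) * \<alpha>^3 = 1/2 * \<alpha>^4" by (simp add: eval_nat_numeral)
  moreover have "0 \<le> 8 * L^4 * \<mu>^4" using assms by simp
  ultimately show ?thesis by linarith
next
  case False
  then have "\<alpha>^3 \<le> (2 * (L * \<mu>))^3" using assms by (intro power_mono) auto
  then have "(L * \<mu>) * \<alpha>^3 \<le> (L * \<mu>) * (2 * (L * \<mu>))^3" using assms by (intro mult_left_mono) auto
  also have "\<dots> = 8 * L^4 * \<mu>^4" by (simp add: power_mult_distrib eval_nat_numeral)
  finally show ?thesis using assms by (simp add: add_increasing)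
qed

lemma sqrt_power4: "x \<ge> 0 \<Longrightarrow> sqrt x ^ 4 = x\<^sup>2"
proof -
  have "sqrt x ^ 4 = ((sqrt x)\<^sup>2)\<^sup>2" by (simp only: power_mult[symmetric]) simp
  then show "x \<ge> 0 \<Longrightarrow> sqrt x ^ 4 = x\<^sup>2" by simp
qed

text \<open>The Gagliardo-Nirenberg powers 1/2 and 3/2 of the two norms, written with iterated roots
  so that \<open>young_quartic\<close> applies with \<open>\<alpha>^4 = gr w w\<close>.\<close>

lemma dens_quarter: assumes w: "w \<in> energy_space"
  shows "l2n (dens w) \<le> 8 * (sqrt (l2n w) * (sqrt (sqrt (gr w w)))^3)"
proof (rule power2_le_imp_le)
  have "(8 * (sqrt (l2n w) * (sqrt (sqrt (gr w w)))^3))\<^sup>2 = 64 * ((sqrt (l2n w))\<^sup>2 * ((sqrt (sqrt (gr w w)))\<^sup>2)^3)"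
    by (simp add: power_mult_distrib power_mult[symmetric] mult.commute)
  then show "(l2n (dens w))\<^sup>2 \<le> (8 * (sqrt (l2n w) * (sqrt (sqrt (gr w w)))^3))\<^sup>2"
    using dens_sq_bound[OF w] gr_nonneg[of w] by simp
qed (simp add: gr_nonneg)

text \<open>The gradient part of the quadratic form absorbs the quartic term by Young's inequality, so only an
  \<open>L\<^sup>2\<close> error remains.\<close>

lemma energy_semiconvex:
  fixes l1 l2 :: real
  assumes u: "u \<in> energy_space" and w: "w \<in> energy_space" and B: "l2n (dens w) \<le> B"
  defines "L \<equiv> nl_const l1 l2 * (5 * l2n (dens u) + B) * 8"
  shows "energy l1 l2 a (\<lambda>x. u x + w x) - energy l1 l2 a u - denergy l1 l2 a u w \<ge> - (8 * L^4) * (l2n w)\<^sup>2"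
proof -
  let ?K = "nl_const l1 l2" and ?r = "l2n (dens u)" and ?d = "l2n (dens w)"
  have K: "?K > 0" by (rule nl_const_pos)
  have B0: "B \<ge> 0" using B l2n_nonneg[of "dens w"] by linarith
  have "?K * (5 * (?r * ?d) + ?d\<^sup>2) = ?K * ((5 * ?r + ?d) * ?d)" by (simp add: power2_eq_square algebra_simps)
  also have "\<dots> \<le> ?K * ((5 * ?r + B) * ?d)" using K B by (intro mult_left_mono mult_right_mono) auto
  also have "\<dots> \<le> ?K * ((5 * ?r + B) * (8 * (sqrt (l2n w) * (sqrt (sqrt (gr w w)))^3)))"
    using K B0 by (intro mult_left_mono dens_quarter w) auto
  also have "\<dots> = L * sqrt (l2n w) * (sqrt (sqrt (gr w w)))^3" by (simp add: L_def mult_ac)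
  also have "\<dots> \<le> 1/2 * (sqrt (sqrt (gr w w)))^4 + 8 * L^4 * (sqrt (l2n w))^4"
    by (rule young_quartic) (use K B0 gr_nonneg[of w] in \<open>auto simp: L_def\<close>)
  also have "(sqrt (sqrt (gr w w)))^4 = gr w w" using gr_nonneg[of w] by (simp add: sqrt_power4)
  also have "(sqrt (l2n w))^4 = (l2n w)\<^sup>2" by (simp add: sqrt_power4)
  finally show ?thesis using energy_expansion[OF u w, of l1 l2 a] qf_nonneg[of w a] by linarith
qed

theorem virial:
  assumes cr: "constrained_critical_point l1 l2 a c u" and c: "c > 0"
  shows "gr u u - a\<^sup>2 * ip (xmul u) (xmul u) + 3/2 * nl l1 l2 (dens u) (dens u) = 0"
proof -
  note u = critical_lagrange(1)[OF cr c] and m = critical_lagrange(2)[OF cr c]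
  define la where "la = denergy l1 l2 a u u / c"
  define A where "A = gr u u"
  define D where "D = ip (xmul u) (xmul u)"
  define N where "N = nl l1 l2 (dens u) (dens u)"
  define e where "e t = 1/2 * (t\<^sup>2 * A) + 1/2 * (a\<^sup>2 * (D / t\<^sup>2)) + 1/2 * (t^3 * N)" for t
  define p where "p t = ip (\<lambda>x. u (t *\<^sub>R x)) u" for t
  define s where "s t = sqrt t ^ 3 * p t" for t
  define w where "w t x = dil t u x - u x" for t x
  have uL: "u \<in> L2" by (rule ES_L2[OF u])
  have xi: "(\<lambda>x. of_real (x $ i) * u x) \<in> L2" for i
  proof (rule L2_bound[OF _ L2_int[OF ES_xmul[OF u]]])
    note [measurable] = L2_meas[OF uL]
    show "(\<lambda>x. of_real (x $ i) * u x) \<in> borel_measurable borel" by measurable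
    show "(norm (of_real (x $ i) * u x))\<^sup>2 \<le> (norm (xmul u x))\<^sup>2" for x
      unfolding xmul_def using component_le_norm_cart[of x i] by (intro power_mono) (auto simp: norm_mult mult_right_mono)
  qed
  obtain p' where p': "(p has_real_derivative p') (at 1)"
    unfolding p_def using dilation_derivative[OF ES_wp[OF u] uL xi] by blast
  have dL: "dil t u \<in> L2" if "t > 0" for t using dil_facts(1)[OF u that] by (rule ES_L2)
  have sip: "s t = ip (dil t u) u" if "t > 0" for t
    unfolding s_def p_def dil_def[abs_def] by (rule ip_scale_left[symmetric])
  have s1: "s 1 = c" by (simp add: s_def p_def ip_self m)
  have sle: "s t \<le> s 1" if "t > 0" for t
    using ip_le[OF dL[OF that] uL] dil_facts(2)[OF u that] unfolding sip[OF that] s1 m[symmetric] by (simp add: power2_eq_square)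
  have s': "(s has_real_derivative 3/2 * c + p') (at 1)"
    unfolding s_def using s1 by (auto intro!: derivative_eq_intros p' simp: s_def)
  have "3/2 * c + p' = 0"
    by (rule DERIV_local_max[OF s', of 1]) (use sle in auto)
  with s' have s0: "(s has_real_derivative 0) (at 1)" by simp
  have wE: "w t \<in> energy_space" if "t > 0" for t unfolding w_def by (intro ES_diff dil_facts u that)
  have wn: "(l2n (w t))\<^sup>2 = 2 * c - 2 * s t" if "t > 0" for t
    unfolding w_def l2n_diff_sq[OF dL[OF that] uL] dil_facts(2)[OF u that] m sip[OF that] by simp
  \<comment> \<open>Valid for \<open>1/2 < t < 2\<close>: the difference of \<open>dil t u\<close>
    and \<open>u\<close> has norm at most \<open>2 * sqrt c\<close> and gradient form at most
    \<open>2 * 4 * A + 2 * A\<close>.\<close>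
  define B where "B = 8 * (sqrt (2 * sqrt c) * (sqrt (sqrt (10 * A)))^3)"
  have A0: "A \<ge> 0" unfolding A_def by (rule gr_nonneg)
  have dB: "l2n (dens (w t)) \<le> B" if t: "1/2 < t" "t < 2" for t
  proof -
    have t0: "t > 0" using t by simp
    have un: "l2n u = sqrt c" using m by (simp add: real_sqrt_unique)
    have 1: "l2n (w t) \<le> 2 * sqrt c" unfolding w_def using l2n_triangle_diff[OF dL[OF t0] uL] dil_facts(2)[OF u t0] un by simp
    have "gr (w t) (w t) \<le> 2 * gr (dil t u) (dil t u) + 2 * gr u u"
    proof -
      have e1: "w t = (\<lambda>x. dil t u x + of_real (-1) * u x)" by (auto simp: w_def)
      have "gr (w t) (w t) = gr (dil t u) (dil t u) - 2 * gr (dil t u) u + gr u u"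
        unfolding e1 gr_qf qf_add[OF dil_facts(1)[OF u t0] ES_scale[OF u]] qf_scale[OF u] qf_scale_right[OF dil_facts(1)[OF u t0] u] by simp
      moreover have "0 \<le> gr (\<lambda>x. dil t u x + u x) (\<lambda>x. dil t u x + u x)" by (rule gr_nonneg)
      then have "0 \<le> gr (dil t u) (dil t u) + 2 * gr (dil t u) u + gr u u" unfolding gr_qf qf_add[OF dil_facts(1)[OF u t0] u] .
      ultimately show ?thesis by linarith
    qed
    also have "\<dots> = 2 * (t\<^sup>2 * A) + 2 * A" unfolding dil_facts(3)[OF u t0] A_def ..
    also have "\<dots> \<le> 2 * (2\<^sup>2 * A) + 2 * A" using t A0 by (intro add_mono mult_left_mono mult_right_mono power_mono) auto
    finally have 2: "gr (w t) (w t) \<le> 10 * A" by simp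
    have "l2n (dens (w t)) \<le> 8 * (sqrt (l2n (w t)) * (sqrt (sqrt (gr (w t) (w t))))^3)" by (rule dens_quarter[OF wE[OF t0]])
    also have "\<dots> \<le> B" unfolding B_def using 1 2 gr_nonneg[of "w t"] c A0
      by (intro mult_left_mono mult_mono power_mono real_sqrt_le_mono) auto
    finally show ?thesis .
  qed
  define C where "C = 8 * (nl_const l1 l2 * (5 * l2n (dens u) + B) * 8)^4 + \<bar>la\<bar>"
  \<comment> \<open>The squared distance of \<open>dil t u\<close> and \<open>u\<close> is
    \<open>2 * c - 2 * s t\<close>. Adding \<open>C\<close> times it to the energy absorbs the
    one-sided error and the multiplier term, so a function differentiable at 1 has a local minimum
    there.\<close>
  have low: "e 1 + C * (2 * c - 2 * s 1) \<le> e t + C * (2 * c - 2 * s t)" if t: "1/2 < t" "t < 2" for t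
  proof -
    have t0: "t > 0" using t by simp
    have uw: "(\<lambda>x. u x + w t x) = dil t u" by (auto simp: w_def)
    have "ip u (w t) = s t - c"
      unfolding w_def by (simp add: ip_diff_right dL[OF t0] uL ip_self m ip_sym[of u "dil t u"] sip[OF t0])
    moreover have "denergy l1 l2 a u (w t) = la * ip u (w t)" unfolding la_def by (rule critical_lagrange(3)[OF cr c wE[OF t0]])
    ultimately have "denergy l1 l2 a u (w t) = la * (s t - c)" by (simp only:)
    also have "\<dots> = - (la / 2) * (l2n (w t))\<^sup>2" unfolding wn[OF t0] by (simp add: algebra_simps)
    finally have "denergy l1 l2 a u (w t) = - (la / 2) * (l2n (w t))\<^sup>2" .
    moreover have "\<bar>la / 2 * (l2n (w t))\<^sup>2\<bar> \<le> \<bar>la\<bar> * (l2n (w t))\<^sup>2" by (simp add: abs_mult mult_right_mono)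
    moreover have "energy l1 l2 a (dil t u) = e t" "energy l1 l2 a u = e 1"
      unfolding e_def energy_dil[OF u t0] energy_eq[OF u] qf_def A_def D_def N_def by simp_all
    ultimately have "e t - e 1 \<ge> - C * (l2n (w t))\<^sup>2"
      using energy_semiconvex[OF u wE[OF t0] dB[OF t], of l1 l2 a] unfolding uw C_def
      by (simp add: algebra_simps abs_le_iff)
    then show ?thesis unfolding wn[OF t0] s1 by simp
  qed
  have e': "(e has_real_derivative A - a\<^sup>2 * D + 3/2 * N) (at 1)"
    unfolding e_def by (auto intro!: derivative_eq_intros)
  have "((\<lambda>t. e t + C * (2 * c - 2 * s t)) has_real_derivative A - a\<^sup>2 * D + 3/2 * N) (at 1)"
    by (rule derivative_eq_intros e' s0 refl | simp)+
  then have "A - a\<^sup>2 * D + 3/2 * N = 0"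
  proof (rule DERIV_local_min[of _ _ _ "1/2"])
    show "\<forall>y. \<bar>1 - y\<bar> < 1/2 \<longrightarrow> e 1 + C * (2 * c - 2 * s 1) \<le> e y + C * (2 * c - 2 * s y)"
    proof (intro allI impI)
      fix y :: real assume "\<bar>1 - y\<bar> < 1/2"
      then have "1/2 < y" "y < 2" by linarith+
      then show "e 1 + C * (2 * c - 2 * s 1) \<le> e y + C * (2 * c - 2 * s y)" by (rule low)
    qed
  qed simp
  then show ?thesis by (simp add: A_def D_def N_def)
qed

corollary critical_energy:
  assumes cr: "constrained_critical_point l1 l2 a c u" and c: "c > 0"
  shows "energy l1 l2 a u = gr u u / 6 + 5/6 * (a\<^sup>2 * ip (xmul u) (xmul u))"
proof -
  have n: "nl l1 l2 (dens u) (dens u) = 2/3 * (a\<^sup>2 * ip (xmul u) (xmul u) - gr u u)" using virial[OF assms] by simp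
  show ?thesis unfolding energy_eq[OF critical_lagrange(1)[OF assms]] qf_def n by (simp add: field_simps)
qed

subsection \<open>Completeness of the energy space\<close>

lemma weak_partial_diff_AE:
  assumes "u \<in> energy_space" "v \<in> energy_space"
  shows "AE x in lborel. weak_partial i (\<lambda>x. u x - v x) x = weak_partial i u x - weak_partial i v x"
proof -
  have "is_weak_partial i (\<lambda>x. u x + (-1) * v x) (\<lambda>x. weak_partial i u x + (-1) * weak_partial i v x)"
    using assms by (intro wp_add wp_scale ES_wp L2_scale ES_L2)
  then have "is_weak_partial i (\<lambda>x. u x - v x) (\<lambda>x. weak_partial i u x - weak_partial i v x)" by simp
  then show ?thesis by (rule wp_unique[OF ES_wp[OF ES_diff[OF assms]]])
qed

lemma l2n_weak_partial_diff:
  assumes "u \<in> energy_space" "v \<in> energy_space"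
  shows "l2n (\<lambda>x. weak_partial i u x - weak_partial i v x) = l2n (weak_partial i (\<lambda>x. u x - v x))"
  by (rule l2n_AE[symmetric])
     (use weak_partial_diff_AE[OF assms] L2_meas[OF ES_grad_L2[OF ES_diff[OF assms]]] L2_meas[OF L2_diff[OF ES_grad_L2[OF assms(1)] ES_grad_L2[OF assms(2)]]] in auto)

lemma xmul_diff: "xmul (\<lambda>x. u x - v x) = (\<lambda>x. xmul u x - xmul v x)"
  by (auto simp: xmul_def right_diff_distrib)

text \<open>The gradients converge because weak differentiation is closed. The moments are treated
  by Fatou along an almost everywhere convergent subsequence, which yields \<open>xmul u\<close>
  directly as their limit.\<close>

lemma ES_complete:
  assumes v: "\<And>n. v n \<in> energy_space"
    and C: "\<And>e. e > 0 \<Longrightarrow> \<exists>N. \<forall>m\<ge>N. \<forall>n\<ge>N. energy_space_norm (\<lambda>x. v m x - v n x) \<le> e"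
  shows "\<exists>u\<in>energy_space. (\<lambda>n. energy_space_norm (\<lambda>x. v n x - u x)) \<longlonglongrightarrow> 0"
proof -
  note vd = ES_diff[OF v v]
  have C1: "\<exists>N. \<forall>m\<ge>N. \<forall>n\<ge>N. l2n (\<lambda>x. v m x - v n x) \<le> e" if e: "e > 0" for e
  proof -
    obtain N where N: "\<forall>m\<ge>N. \<forall>n\<ge>N. energy_space_norm (\<lambda>x. v m x - v n x) \<le> e" using C[OF e] by blast
    show ?thesis by (intro exI[of _ N] allI impI order_trans[OF energy_space_norm_bounds(1)[OF vd]]) (use N in blast)
  qed
  have C2: "\<exists>N. \<forall>m\<ge>N. \<forall>n\<ge>N. l2n (\<lambda>x. weak_partial i (v m) x - weak_partial i (v n) x) \<le> e" if e: "e > 0" for e i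
  proof -
    obtain N where N: "\<forall>m\<ge>N. \<forall>n\<ge>N. energy_space_norm (\<lambda>x. v m x - v n x) \<le> e" using C[OF e] by blast
    show ?thesis unfolding l2n_weak_partial_diff[OF v v]
      by (intro exI[of _ N] allI impI order_trans[OF order_trans[OF l2n_grad_le energy_space_norm_bounds(2)[OF vd]]]) (use N in blast)
  qed
  have "\<exists>u\<in>L2. \<exists>r. strict_mono (r::nat\<Rightarrow>nat)
      \<and> (\<lambda>n. l2n (\<lambda>x. v n x - u x)) \<longlonglongrightarrow> 0 \<and> (AE x in lborel. (\<lambda>n. v (r n) x) \<longlonglongrightarrow> u x)"
    by (rule L2_complete[OF ES_L2[OF v]]) (rule C1)
  then obtain u r where u: "u \<in> L2" and r: "strict_mono (r::nat\<Rightarrow>nat)" and ul: "(\<lambda>n. l2n (\<lambda>x. v n x - u x)) \<longlonglongrightarrow> 0"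
    and ae: "AE x in lborel. (\<lambda>n. v (r n) x) \<longlonglongrightarrow> u x"
    by (elim bexE exE conjE) (rule that)
  have "\<forall>i. \<exists>h. h \<in> L2 \<and> (\<lambda>n. l2n (\<lambda>x. weak_partial i (v n) x - h x)) \<longlonglongrightarrow> 0"
  proof
    fix i
    have "\<exists>h\<in>L2. \<exists>r. strict_mono (r::nat\<Rightarrow>nat)
        \<and> (\<lambda>n. l2n (\<lambda>x. weak_partial i (v n) x - h x)) \<longlonglongrightarrow> 0
        \<and> (AE x in lborel. (\<lambda>n. weak_partial i (v (r n)) x) \<longlonglongrightarrow> h x)"
      by (rule L2_complete[OF ES_grad_L2[OF v]]) (rule C2)
    then show "\<exists>h. h \<in> L2 \<and> (\<lambda>n. l2n (\<lambda>x. weak_partial i (v n) x - h x)) \<longlonglongrightarrow> 0" by blast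
  qed
  from choice[OF this] obtain h where "\<forall>i. h i \<in> L2
      \<and> (\<lambda>n. l2n (\<lambda>x. weak_partial i (v n) x - h i x)) \<longlonglongrightarrow> 0" by (rule exE)
  then have hh: "h i \<in> L2 \<and> (\<lambda>n. l2n (\<lambda>x. weak_partial i (v n) x - h i x)) \<longlonglongrightarrow> 0" for i by (rule spec)
  note h = conjunct1[OF hh] conjunct2[OF hh]
  have w: "is_weak_partial i u (h i)" for i
    by (rule wp_limit[OF ES_wp[OF v] ES_L2[OF v] u h(1) ul h(2)])
  note [measurable] = L2_meas[OF u] L2_meas[OF ES_L2[OF v]]
  have X: "(\<lambda>x. xmul u x - xmul (v n) x) \<in> L2 \<and> l2n (\<lambda>x. xmul u x - xmul (v n) x) \<le> e"
    if e: "e > 0" and N: "\<forall>m\<ge>N. \<forall>n\<ge>N. energy_space_norm (\<lambda>x. v m x - v n x) \<le> e" and n: "n \<ge> N" for e N n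
  proof -
    have L: "(\<lambda>x. xmul (v (r k)) x - xmul (v n) x) \<in> L2" for k by (intro L2_diff ES_xmul v)
    have ae': "AE x in lborel. (\<lambda>k. xmul (v (r k)) x - xmul (v n) x) \<longlonglongrightarrow> xmul u x - xmul (v n) x"
      using ae by eventually_elim (auto simp: xmul_def intro!: tendsto_intros)
    have "\<forall>\<^sub>F k in sequentially. r k \<ge> N"
      using filterlim_subseq[OF r] by (simp add: filterlim_at_top)
    then have ev: "\<forall>\<^sub>F k in sequentially. l2n (\<lambda>x. xmul (v (r k)) x - xmul (v n) x) \<le> e"
    proof eventually_elim
      case (elim k)
      have "l2n (xmul (\<lambda>x. v (r k) x - v n x)) \<le> energy_space_norm (\<lambda>x. v (r k) x - v n x)" by (rule energy_space_norm_bounds(3)[OF vd])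
      then show ?case using N elim n unfolding xmul_diff by force
    qed
    have m: "(\<lambda>x. xmul u x - xmul (v n) x) \<in> borel_measurable borel" unfolding xmul_def by measurable
    show ?thesis using L2_Fatou[OF L m ae' ev] e by auto
  qed
  obtain N where N: "\<forall>m\<ge>N. \<forall>n\<ge>N. energy_space_norm (\<lambda>x. v m x - v n x) \<le> 1" using C[of 1] by auto
  have "(\<lambda>x. xmul u x - xmul (v N) x) \<in> L2" using X[OF _ N] by auto
  from L2_add[OF this ES_xmul[OF v[of N]]] have "xmul u \<in> L2" by simp
  with u w have uE: "u \<in> energy_space" by (rule ESI)
  have Xl: "(\<lambda>n. l2n (\<lambda>x. xmul (v n) x - xmul u x)) \<longlonglongrightarrow> 0"
  proof (rule LIMSEQ_I)
    fix e :: real assume "e > 0"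
    then obtain N where N: "\<forall>m\<ge>N. \<forall>n\<ge>N. energy_space_norm (\<lambda>x. v m x - v n x) \<le> e/2" using C[of "e/2"] by auto
    have "l2n (\<lambda>x. xmul (v n) x - xmul u x) < e" if "n \<ge> N" for n
      using X[OF _ N that] \<open>e > 0\<close> l2n_diff_sym[of "xmul (v n)" "xmul u"] by auto
    then show "\<exists>no. \<forall>n\<ge>no. norm (l2n (\<lambda>x. xmul (v n) x - xmul u x) - 0) < e" by auto
  qed
  have gl: "(\<lambda>n. l2n (weak_partial i (\<lambda>x. v n x - u x))) \<longlonglongrightarrow> 0" for i
  proof -
    have "l2n (weak_partial i (\<lambda>x. v n x - u x)) = l2n (\<lambda>x. weak_partial i (v n) x - h i x)" for n
    proof -
      have "l2n (weak_partial i (\<lambda>x. v n x - u x)) = l2n (\<lambda>x. weak_partial i (v n) x - weak_partial i u x)"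
        by (rule l2n_weak_partial_diff[OF v uE, symmetric])
      also have "\<dots> = l2n (\<lambda>x. weak_partial i (v n) x - h i x)"
        by (rule l2n_AE) (use wp_unique[OF ES_wp[OF uE] w] L2_meas[OF L2_diff[OF ES_grad_L2[OF v] ES_grad_L2[OF uE]]] L2_meas[OF L2_diff[OF
            ES_grad_L2[OF v] h(1)]] in auto)
      finally show ?thesis .
    qed
    then show ?thesis using h(2) by simp
  qed
  have "(\<lambda>n. sqrt ((l2n (\<lambda>x. v n x - u x))\<^sup>2 + (\<Sum>i\<in>UNIV. (l2n (weak_partial i (\<lambda>x. v n x - u x)))\<^sup>2)
      + (l2n (\<lambda>x. xmul (v n) x - xmul u x))\<^sup>2)) \<longlonglongrightarrow> sqrt (0\<^sup>2 + (\<Sum>i\<in>(UNIV::3 set). 0\<^sup>2) + 0\<^sup>2)"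
    by (intro tendsto_intros ul gl Xl)
  moreover have "energy_space_norm (\<lambda>x. v n x - u x) = sqrt ((l2n (\<lambda>x. v n x - u x))\<^sup>2
      + (\<Sum>i\<in>UNIV. (l2n (weak_partial i (\<lambda>x. v n x - u x)))\<^sup>2) + (l2n (\<lambda>x. xmul (v n) x - xmul u x))\<^sup>2)" for n
    by (simp add: energy_space_norm_def mass_l2n gradient_sq_gr gr_def moment_sq_ip ip_self xmul_diff)
  ultimately have "(\<lambda>n. energy_space_norm (\<lambda>x. v n x - u x)) \<longlonglongrightarrow> 0" by simp
  then show ?thesis using uE by (rule bexI)
qed

lemma energy_continuous:
  assumes u: "u \<in> energy_space" and v: "\<And>n. v n \<in> energy_space"
      and l: "(\<lambda>n. energy_space_norm (\<lambda>x. v n x - u x)) \<longlonglongrightarrow> 0"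
  shows "(\<lambda>n. energy l1 l2 a (v n)) \<longlonglongrightarrow> energy l1 l2 a u"
proof -
  obtain C where C: "\<And>h. h \<in> energy_space \<Longrightarrow> \<bar>denergy l1 l2 a u h\<bar> \<le> C * energy_space_norm h" using denergy_bounded[OF u] by blast
  have "\<exists>\<delta>>0. \<forall>h\<in>energy_space. energy_space_norm h < \<delta> \<longrightarrow> \<bar>energy l1 l2 a (\<lambda>x. u x
      + h x) - energy l1 l2 a u - denergy l1 l2 a u h\<bar> \<le> 1 * energy_space_norm h"
    using energy_has_derivative[OF u, of l1 l2 a] unfolding has_energy_space_derivative_def by (meson zero_less_one)
  then obtain d where d: "d > 0" "\<And>h. h \<in> energy_space \<Longrightarrow> energy_space_norm h < d
      \<Longrightarrow> \<bar>energy l1 l2 a (\<lambda>x. u x + h x) - energy l1 l2 a u - denergy l1 l2 a u h\<bar> \<le> 1 * energy_space_norm h"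
    by blast
  show ?thesis
  proof (rule LIM_zero_cancel, rule Lim_null_comparison)
    have "\<forall>\<^sub>F n in sequentially. energy_space_norm (\<lambda>x. v n x - u x) < d" by (rule order_tendstoD(2)[OF l d(1)])
    then show "\<forall>\<^sub>F n in sequentially. norm (energy l1 l2 a (v n) - energy l1 l2 a u) \<le> (C + 1) * energy_space_norm (\<lambda>x. v n x - u x)"
    proof eventually_elim
      case (elim n)
      have h: "(\<lambda>x. v n x - u x) \<in> energy_space" by (intro ES_diff v u)
      show ?case using d(2)[OF h elim] C[OF h] by (simp add: distrib_right)
    qed
    have "(\<lambda>n. (C + 1) * energy_space_norm (\<lambda>x. v n x - u x)) \<longlonglongrightarrow> (C + 1) * 0" by (intro tendsto_intros l)
    then show "(\<lambda>n. (C + 1) * energy_space_norm (\<lambda>x. v n x - u x)) \<longlonglongrightarrow> 0" by simp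
  qed
qed

lemma gr_continuous:
  assumes u: "u \<in> energy_space" and v: "\<And>n. v n \<in> energy_space"
      and l: "(\<lambda>n. energy_space_norm (\<lambda>x. v n x - u x)) \<longlonglongrightarrow> 0"
  shows "(\<lambda>n. gr (v n) (v n)) \<longlonglongrightarrow> gr u u" "(\<lambda>n. l2n (v n)) \<longlonglongrightarrow> l2n u"
proof -
  note vd = ES_diff[OF v u]
  have "(\<lambda>n. l2n (\<lambda>x. v n x - u x)) \<longlonglongrightarrow> 0"
    by (rule Lim_null_comparison[OF _ l]) (use energy_space_norm_bounds(1)[OF vd] in \<open>auto intro: always_eventually\<close>)
  then show "(\<lambda>n. l2n (v n)) \<longlonglongrightarrow> l2n u" by (rule l2n_tendsto[OF ES_L2[OF v] ES_L2[OF u]])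
  have "(\<lambda>n. l2n (weak_partial i (v n))) \<longlonglongrightarrow> l2n (weak_partial i u)" for i
  proof (rule l2n_tendsto[OF ES_grad_L2[OF v] ES_grad_L2[OF u]])
    show "(\<lambda>n. l2n (\<lambda>x. weak_partial i (v n) x - weak_partial i u x)) \<longlonglongrightarrow> 0"
      unfolding l2n_weak_partial_diff[OF v u]
      by (rule Lim_null_comparison[OF _ l]) (use order_trans[OF l2n_grad_le energy_space_norm_bounds(2)[OF vd]] in \<open>auto intro: always_eventually\<close>)
  qed
  then show "(\<lambda>n. gr (v n) (v n)) \<longlonglongrightarrow> gr u u" unfolding gr_def ip_self by (intro tendsto_intros)
qed

subsection \<open>Test functions in the energy space\<close>

text \<open>The complex factor provides real and imaginary directions, from which the complex
  equation is recovered.\<close>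

lemma test_ES: assumes p: "\<phi> \<in> test_functions" shows "(\<lambda>x. \<kappa> * of_real (\<phi> x)) \<in> energy_space"
proof (rule ESI[OF L2_scale[OF test_L2[OF p]] wp_scale[OF wp_test[OF p]]])
  obtain R where R: "R > 0" "\<And>x. norm x > R \<Longrightarrow> \<phi> x = 0" using test_support[OF p] by metis
  have "(\<lambda>x. complex_of_real (norm x * \<phi> x)) \<in> Cc"
    unfolding Cc_def using R kd_continuous[OF test_kd[OF p, of 0]] by (auto intro!: continuous_intros exI[of _ R])
  then have "(\<lambda>x. \<kappa> * complex_of_real (norm x * \<phi> x)) \<in> L2" by (intro L2_scale Cc_L2)
  then show "xmul (\<lambda>x. \<kappa> * of_real (\<phi> x)) \<in> L2" by (simp add: xmul_def[abs_def] mult_ac)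
qed

text \<open>If all cut-offs of a box vanished almost everywhere, their limit 1 on the box would make
  a nonempty open set null.\<close>

lemma nontrivial_test: obtains \<phi> where "\<phi> \<in> test_functions" "l2n (\<lambda>x. of_real (\<phi> x)) > 0"
proof -
  obtain \<phi> :: "nat \<Rightarrow> real^3 \<Rightarrow> real" where p: "\<And>n. \<phi> n \<in> test_functions" "\<And>x. x \<in> box (- One) One
      \<Longrightarrow> (\<lambda>n. \<phi> n x) \<longlonglongrightarrow> 1"
    using test_box[of "- One" One] by metis
  have "\<exists>n. l2n (\<lambda>x. complex_of_real (\<phi> n x)) > 0"
  proof (rule ccontr)
    assume "\<nexists>n. l2n (\<lambda>x. complex_of_real (\<phi> n x)) > 0"
    then have z: "l2n (\<lambda>x. complex_of_real (\<phi> n x)) = 0" for n using l2n_nonneg[of "\<lambda>x. complex_of_real (\<phi> n x)"]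
        by (auto simp: not_less order_antisym)
    have "AE x in lborel. complex_of_real (\<phi> n x) = 0" for n by (rule l2n_zero_AE[OF test_L2[OF p(1)] z])
    then have "AE x in lborel. \<forall>n. complex_of_real (\<phi> n x) = 0" by (rule AE_all_countable[THEN iffD2, rule_format])
    then have "AE x in lborel. x \<notin> (box (- One) One :: (real^3) set)"
    proof eventually_elim
      case (elim x)
      show ?case
      proof
        assume "x \<in> box (- One) One"
        from p(2)[OF this] elim have "(\<lambda>n::nat. 0::real) \<longlonglongrightarrow> 1" by simp
        then show False by (simp add: LIMSEQ_const_iff)
      qed
    qed
    then have "(box (- One) One :: (real^3) set) \<in> null_sets lborel" by (subst AE_iff_null_sets) auto
    then have "negligible (box (- One) One :: (real^3) set)" unfolding negligible_iff_null_sets by (rule null_sets_completionI)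
    moreover have "(0::real^3) \<in> box (- One) One" by (auto simp: mem_box)
    ultimately show False using open_not_negligible[OF open_box] by blast
  qed
  then show ?thesis using that p(1) by blast
qed

subsection \<open>The local minimiser\<close>

text \<open>At this value of the gradient form \<open>A\<close>, the product
  \<open>64 * nl_const l1 l2 * sqrt c * sqrt A\<close> equals 1/4; 64 is the Ladyzhenskaya constant
  and \<open>256 = 4 * 64\<close>.\<close>

definition grad_threshold :: "real \<Rightarrow> real \<Rightarrow> real \<Rightarrow> real" where
  "grad_threshold l1 l2 c = (1 / (256 * nl_const l1 l2 * sqrt c))\<^sup>2"

lemma grad_threshold_pos: "c > 0 \<Longrightarrow> grad_threshold l1 l2 c > 0"
  using nl_const_pos[of l1 l2] by (simp add: grad_threshold_def)

lemma nl_small: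
  assumes u: "u \<in> energy_space" and m: "(l2n u)\<^sup>2 \<le> c" and g: "gr u u \<le> grad_threshold l1 l2 c" and c: "c > 0"
  shows "\<bar>nl l1 l2 (dens u) (dens u)\<bar> \<le> gr u u / 4"
proof -
  let ?K = "nl_const l1 l2" and ?A = "gr u u"
  have K: "?K > 0" by (rule nl_const_pos)
  have A: "?A \<ge> 0" by (rule gr_nonneg)
  have lu: "l2n u \<le> sqrt c" using m by (rule real_le_rsqrt)
  have sA: "sqrt ?A \<le> 1 / (256 * ?K * sqrt c)"
    using g K c unfolding grad_threshold_def by (intro real_le_lsqrt) auto
  have "\<bar>nl l1 l2 (dens u) (dens u)\<bar> \<le> ?K * (l2n (dens u))\<^sup>2" using nl_bound[OF dens_L2[OF u] dens_L2[OF u], of l1 l2] by (simp add: power2_eq_square)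
  also have "\<dots> \<le> ?K * (64 * (l2n u * (sqrt ?A)^3))" using K by (intro mult_left_mono dens_sq_bound u) auto
  also have "\<dots> \<le> ?K * (64 * (sqrt c * (sqrt ?A)^3))" using K lu A by (intro mult_left_mono mult_right_mono) auto
  also have "\<dots> = (64 * ?K * sqrt c * sqrt ?A) * ?A" using A by (simp add: power3_eq_cube)
  also have "\<dots> \<le> (64 * ?K * sqrt c * (1 / (256 * ?K * sqrt c))) * ?A" using K c sA A by (intro mult_left_mono mult_right_mono) auto
  also have "64 * ?K * sqrt c * (1 / (256 * ?K * sqrt c)) = 1 / 4" using K c by simp
  finally show ?thesis by simp
qed

text \<open>The constant is \<open>3/8 = 1/2 - 1/8\<close>: the interaction, itself halved, takes at
  most a quarter of the gradient form.\<close>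

lemma energy_coercive:
  assumes u: "u \<in> energy_space" and m: "(l2n u)\<^sup>2 \<le> c" and g: "gr u u \<le> grad_threshold l1 l2 c" and c: "c > 0"
  shows "3/8 * (gr u u + a\<^sup>2 * (l2n (xmul u))\<^sup>2) \<le> energy l1 l2 a u"
proof -
  have "0 \<le> a\<^sup>2 * (l2n (xmul u))\<^sup>2" by simp
  moreover have "- (gr u u / 4) \<le> nl l1 l2 (dens u) (dens u)" using nl_small[OF assms] by linarith
  ultimately show ?thesis unfolding energy_eq[OF u] qf_def ip_self by argo
qed

text \<open>The gradient constraint is not strict, so that limits in the energy norm stay in the
  set.\<close>

definition admissible :: "real \<Rightarrow> real \<Rightarrow> real \<Rightarrow> (real ^ 3 \<Rightarrow> complex) set" where
  "admissible l1 l2 c = {u \<in> energy_space. (l2n u)\<^sup>2 = c \<and> gr u u \<le> grad_threshold l1 l2 c}"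

section \<open>Near-convexity of the energy at midpoints\<close>

lemma dens_parallelogram:
  "dens (\<lambda>x. of_real (1/2) * (v x + w x)) = (\<lambda>x. of_real (1/2) * (dens v x + dens w x) + of_real (-1/4) * dens (\<lambda>x. v x - w x) x)"
proof (rule ext)
  fix x
  have "(norm (of_real (1/2) * (v x + w x)))\<^sup>2 = 1/2 * ((norm (v x))\<^sup>2 + (norm (w x))\<^sup>2) + (-1/4) * (norm (v x - w x))\<^sup>2"
    unfolding cmod_power2 by (simp add: power2_eq_square field_simps)
  then show "dens (\<lambda>x. of_real (1/2) * (v x + w x)) x = of_real (1/2) * (dens v x + dens w x) + of_real (-1/4) * dens (\<lambda>x. v x - w x) x"
    by (simp only: particle_density_def of_real_add of_real_mult)
qed

text \<open>The convexity defect is expressed by the difference \<open>q\<close> of the two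
  densities and the density \<open>\<sigma>\<close> of \<open>v - w\<close>. Both are small when
  \<open>d\<close> is, so no sign of the form is required. The separate bounds add up to
  \<open>5/2 * r * d + 9/16 * d^2\<close> times the constant, which is rounded up.\<close>

lemma nl_midpoint:
  assumes v: "v \<in> energy_space" and w: "w \<in> energy_space" and r: "l2n (dens v) \<le> r" "l2n (dens w) \<le> r"
  defines "d \<equiv> l2n (dens (\<lambda>x. v x - w x))"
  shows "nl l1 l2 (dens (\<lambda>x. of_real (1/2) * (v x + w x))) (dens (\<lambda>x. of_real (1/2) * (v x + w x))) \<le>
    1/2 * nl l1 l2 (dens v) (dens v) + 1/2 * nl l1 l2 (dens w) (dens w) + nl_const l1 l2 * (3 * (r * d) + d\<^sup>2)"
proof -
  let ?n = "nl l1 l2" and ?K = "nl_const l1 l2"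
  have vw: "(\<lambda>x. v x - w x) \<in> energy_space" by (rule ES_diff[OF v w])
  define \<sigma> where "\<sigma> = dens (\<lambda>x. v x - w x)"
  define p where "p x = dens v x + dens w x" for x
  define q where "q x = dens v x + of_real (-1) * dens w x" for x
  have L: "dens v \<in> L2" "dens w \<in> L2" "\<sigma> \<in> L2" unfolding \<sigma>_def by (intro dens_L2 v w vw)+
  have pL: "p \<in> L2" and qL: "q \<in> L2" unfolding p_def q_def by (intro L2_add L2_scale L)+
  have K: "?K > 0" by (rule nl_const_pos)
  have d0: "d \<ge> 0" and r0: "r \<ge> 0" using order_trans[OF l2n_nonneg r(1)] by (auto simp: d_def)
  have dz: "dens (\<lambda>x. of_real (1/2) * (v x + w x)) = (\<lambda>x. of_real (1/2) * p x + of_real (-1/4) * \<sigma> x)"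
    unfolding dens_parallelogram p_def \<sigma>_def ..
  have e1: "?n (\<lambda>x. of_real (1/2) * p x + of_real (-1/4) * \<sigma> x) (\<lambda>x. of_real (1/2) * p x + of_real (-1/4) * \<sigma> x)
      = 1/4 * ?n p p - 1/4 * ?n p \<sigma> + 1/16 * ?n \<sigma> \<sigma>"
    using nl_sym[OF L(3) pL, of l1 l2] by (simp only: nl_add_left nl_add_right L2_add L2_scale pL L nl_scale_left nl_scale_right)
  have e2: "?n p p = ?n (dens v) (dens v) + 2 * ?n (dens v) (dens w) + ?n (dens w) (dens w)"
    unfolding p_def using nl_sym[OF L(2,1), of l1 l2] by (simp only: nl_add_left nl_add_right L2_add L)
  have e3: "?n q q = ?n (dens v) (dens v) - 2 * ?n (dens v) (dens w) + ?n (dens w) (dens w)"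
    unfolding q_def using nl_sym[OF L(2,1), of l1 l2] by (simp only: nl_add_left nl_add_right L2_add L2_scale L nl_scale_left nl_scale_right)
  have q: "q = (\<lambda>x. of_real 2 * cross w (\<lambda>x. v x - w x) x + \<sigma> x)"
  proof (rule ext)
    fix x
    have "dens (\<lambda>x. w x + (v x - w x)) x = dens w x + (of_real 2 * cross w (\<lambda>x. v x - w x) x + \<sigma> x)" unfolding \<sigma>_def dens_add ..
    then show "q x = of_real 2 * cross w (\<lambda>x. v x - w x) x + \<sigma> x" by (simp add: q_def)
  qed
  have "l2n (cross w (\<lambda>x. v x - w x)) \<le> sqrt (l2n (dens w) * d)" unfolding d_def by (rule real_le_rsqrt[OF cross_L2(2)[OF w vw]])
  also have "\<dots> \<le> sqrt (r * d)" using r d0 by (intro real_sqrt_le_mono mult_right_mono) auto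
  finally have cb: "l2n (cross w (\<lambda>x. v x - w x)) \<le> sqrt (r * d)" .
  have "l2n q \<le> 2 * sqrt (r * d) + d"
    using l2n_triangle[OF L2_scale[OF cross_L2(1)[OF w vw], of "of_real 2"] L(3)] cb unfolding q l2n_scale by (simp add: d_def \<sigma>_def)
  then have "(l2n q)\<^sup>2 \<le> (2 * sqrt (r * d) + d)\<^sup>2" by (rule power_mono) simp
  also have "\<dots> \<le> 2 * (2 * sqrt (r * d))\<^sup>2 + 2 * d\<^sup>2"
    using sum_squares_bound[of "2 * sqrt (r * d)" d] by (simp add: power2_sum)
  also have "\<dots> = 8 * (r * d) + 2 * d\<^sup>2" using r0 d0 by (simp add: power_mult_distrib)
  finally have qb: "(l2n q)\<^sup>2 \<le> 8 * (r * d) + 2 * d\<^sup>2" .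
  have "\<bar>?n q q\<bar> \<le> ?K * (l2n q)\<^sup>2" using nl_bound[OF qL qL, of l1 l2] by (simp add: power2_eq_square)
  also have "\<dots> \<le> ?K * (8 * (r * d) + 2 * d\<^sup>2)" using K by (intro mult_left_mono qb) auto
  finally have b1: "\<bar>?n q q\<bar> \<le> 8 * (?K * (r * d)) + 2 * (?K * d\<^sup>2)" by (simp add: algebra_simps)
  have "l2n p \<le> 2 * r" using l2n_triangle[OF L(1,2)] r by (simp add: p_def[abs_def])
  then have "?K * (l2n p * l2n \<sigma>) \<le> ?K * ((2 * r) * d)" using K d0 by (intro mult_left_mono mult_mono) (auto simp: d_def \<sigma>_def r0)
  then have b2: "\<bar>?n p \<sigma>\<bar> \<le> 2 * (?K * (r * d))" using nl_bound[OF pL L(3), of l1 l2] by simp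
  have b3: "\<bar>?n \<sigma> \<sigma>\<bar> \<le> ?K * d\<^sup>2" using nl_bound[OF L(3) L(3), of l1 l2] by (simp add: d_def \<sigma>_def power2_eq_square)
  have pos: "0 \<le> ?K * (r * d)" "0 \<le> ?K * d\<^sup>2" using K r0 d0 by auto
  have "?n p p = 2 * ?n (dens v) (dens v) + 2 * ?n (dens w) (dens w) - ?n q q" using e2 e3 by simp
  moreover note abs_le_D2[OF b1] abs_le_D2[OF b2] abs_le_D1[OF b3] pos
  ultimately show ?thesis unfolding dz e1 distrib_left[of ?K] mult.left_commute[of ?K 3] by linarith
qed

lemma qf_midpoint:
  assumes v: "v \<in> energy_space" and w: "w \<in> energy_space"
  shows "qf a (\<lambda>x. of_real (1/2) * (v x + w x)) (\<lambda>x. of_real (1/2) * (v x + w x)) = 1/2 * qf a v v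
      + 1/2 * qf a w w - 1/4 * qf a (\<lambda>x. v x - w x) (\<lambda>x. v x - w x)"
proof -
  have e: "(\<lambda>x. v x - w x) = (\<lambda>x. v x + of_real (-1) * w x)" by auto
  show ?thesis unfolding qf_scale[OF ES_add[OF v w]] qf_add[OF v w] e qf_add[OF v ES_scale[OF w]] qf_scale[OF w] qf_scale_right[OF v w]
    by (simp add: power2_eq_square field_simps)
qed

text \<open>The midpoint of two almost minimisers has slightly smaller mass. Scaled back to the
  sphere it remains admissible, because both gradient forms are at most half the threshold.
  Comparing its energy with the lower bound \<open>I\<close> and using the parallelogram law bounds
  the quadratic form of \<open>v - w\<close>.\<close>

lemma minimising_pair:
  assumes c: "c > 0" and v: "v \<in> admissible l1 l2 c" and w: "w \<in> admissible l1 l2 c"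
    and gv: "gr v v \<le> grad_threshold l1 l2 c / 2" and gw: "gr w w \<le> grad_threshold l1 l2 c / 2"
    and I: "\<And>z. z \<in> admissible l1 l2 c \<Longrightarrow> I \<le> energy l1 l2 a z" and I0: "0 \<le> I" "I \<le> grad_threshold l1 l2 c"
    and ev: "energy l1 l2 a v \<le> I + \<epsilon>" and ew: "energy l1 l2 a w \<le> I + \<epsilon>"
    and r: "l2n (dens v) \<le> r" "l2n (dens w) \<le> r"
    and \<delta>: "(l2n (\<lambda>x. v x - w x))\<^sup>2 \<le> 2 * c"
  defines "d \<equiv> l2n (dens (\<lambda>x. v x - w x))"
  shows "1/8 * qf a (\<lambda>x. v x - w x) (\<lambda>x. v x - w x) \<le> \<epsilon> + nl_const l1 l2 * (3 * (r * d) + d\<^sup>2)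
      + grad_threshold l1 l2 c * (l2n (\<lambda>x. v x - w x))\<^sup>2 / c"
proof -
  let ?k = "grad_threshold l1 l2 c" and ?D = "(l2n (\<lambda>x. v x - w x))\<^sup>2" and ?n = "nl l1 l2"
  have vE: "v \<in> energy_space" and wE: "w \<in> energy_space" and mv: "(l2n v)\<^sup>2 = c" and mw: "(l2n w)\<^sup>2 = c"
    using v w by (auto simp: admissible_def)
  have k: "?k > 0" by (rule grad_threshold_pos[OF c])
  define z where "z x = of_real (1/2) * (v x + w x)" for x
  have zE: "z \<in> energy_space" unfolding z_def by (intro ES_scale ES_add vE wE)
  \<comment> \<open>The ratio of the midpoint's mass to \<open>c\<close>; the assumption on the
    \<open>L2\<close> distance keeps it at least 1/2.\<close>
  define T where "T = 1 - ?D / (4 * c)"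
  have T: "T \<ge> 1/2" "T \<le> 1" "T > 0" using \<delta> c by (auto simp: T_def field_simps)
  have "(l2n z)\<^sup>2 = 1/4 * (l2n (\<lambda>x. v x + w x))\<^sup>2" unfolding z_def[abs_def] l2n_scale by (simp add: power2_eq_square norm_divide)
  also have "\<dots> = c - ?D / 4"
    unfolding l2n_add_sq[OF ES_L2[OF vE] ES_L2[OF wE]] l2n_diff_sq[OF ES_L2[OF vE] ES_L2[OF wE]] mv mw by (simp add: field_simps)
  also have "\<dots> = c * T" using c by (simp add: T_def field_simps)
  finally have mz: "(l2n z)\<^sup>2 = c * T" .
  have gz: "gr z z \<le> ?k / 2"
    using qf_midpoint[OF vE wE, of 0] gr_nonneg[of "\<lambda>x. v x - w x"] gv gw unfolding gr_qf[symmetric] z_def[abs_def] by simp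
  have nz: "\<bar>?n (dens z) (dens z)\<bar> \<le> ?k / 8"
  proof -
    have "\<bar>?n (dens z) (dens z)\<bar> \<le> gr z z / 4"
      by (rule nl_small[OF zE _ _ c]) (use mz T c gz k in \<open>auto simp: mult_le_cancel_left2\<close>)
    then show ?thesis using gz by simp
  qed
  define s where "s = 1 / sqrt T"
  have s2: "s\<^sup>2 = 1 / T" using T by (simp add: s_def power_divide)
  define y where "y x = of_real s * z x" for x
  have yE: "y \<in> energy_space" unfolding y_def by (rule ES_scale[OF zE])
  have "y \<in> admissible l1 l2 c"
  proof -
    have "(l2n y)\<^sup>2 = s\<^sup>2 * (l2n z)\<^sup>2" unfolding y_def[abs_def] l2n_scale by (simp add: power_mult_distrib)
    then have "(l2n y)\<^sup>2 = c" using T by (simp add: s2 mz)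
    moreover have "gr y y = gr z z / T" unfolding y_def[abs_def] gr_qf qf_scale[OF zE] s2 by simp
    then have "gr y y \<le> ?k"
    proof -
      have "?k * (1/2) \<le> ?k * T" by (rule mult_left_mono) (use T k in auto)
      then have "gr z z \<le> ?k * T" using gz by linarith
      then show ?thesis using T \<open>gr y y = gr z z / T\<close> by (simp add: pos_divide_le_eq)
    qed
    ultimately show ?thesis using yE by (simp add: admissible_def)
  qed
  then have "I \<le> energy l1 l2 a y" by (rule I)
  also have "energy l1 l2 a y = 1/2 * (qf a z z / T) + 1/2 * (?n (dens z) (dens z) / T\<^sup>2)"
  proof -
    have dy: "dens y = (\<lambda>x. of_real (s\<^sup>2) * dens z x)" unfolding y_def[abs_def] by (rule dens_scale)
    have qy: "qf a y y = s\<^sup>2 * qf a z z" unfolding y_def[abs_def] by (rule qf_scale[OF zE])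
    have "?n (dens y) (dens y) = s\<^sup>2 * (s\<^sup>2 * ?n (dens z) (dens z))"
      unfolding dy nl_scale_right by (simp only: nl_scale_left dens_L2 zE)
    then show ?thesis unfolding energy_eq[OF yE] qy by (simp only: s2) (simp add: power2_eq_square)
  qed
  finally have "T * I \<le> T * (1/2 * (qf a z z / T) + 1/2 * (?n (dens z) (dens z) / T\<^sup>2))" using T by (intro mult_left_mono) auto
  also have "\<dots> = 1/2 * qf a z z + 1/2 * (?n (dens z) (dens z) / T)" using T by (simp add: power2_eq_square field_simps)
  also have "?n (dens z) (dens z) / T \<le> ?n (dens z) (dens z) + ?k / 8 * (?D / (2 * c))"
  proof -
    have "?n (dens z) (dens z) / T - ?n (dens z) (dens z) = ?n (dens z) (dens z) * ((1 - T) / T)" using T by (simp add: field_simps)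
    also have "\<dots> \<le> ?k / 8 * ((1 - T) / T)" using nz T by (intro mult_right_mono) (auto simp: abs_le_iff)
    also have "(1 - T) / T \<le> (1 - T) / (1/2)" using T by (intro divide_left_mono) auto
    then have "?k / 8 * ((1 - T) / T) \<le> ?k / 8 * ((1 - T) / (1/2))" using k by (intro mult_left_mono) auto
    also have "(1 - T) / (1/2) = ?D / (2 * c)" using c by (simp add: T_def field_simps)
    finally show ?thesis by simp
  qed
  finally have 1: "T * I \<le> 1/2 * qf a z z + 1/2 * (?n (dens z) (dens z) + ?k / 8 * (?D / (2 * c)))" by simp
  have 2: "T * I \<ge> I - ?k * (?D / (4 * c))"
  proof -
    have "?D / (4 * c) * I \<le> ?D / (4 * c) * ?k" using I0 c by (intro mult_left_mono) auto
    moreover have "T * I = I - ?D / (4 * c) * I" unfolding T_def by (simp add: left_diff_distrib)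
    ultimately show ?thesis unfolding mult.commute[of ?k] by linarith
  qed
  have 3: "qf a z z = 1/2 * qf a v v + 1/2 * qf a w w - 1/4 * qf a (\<lambda>x. v x - w x) (\<lambda>x. v x - w x)"
    unfolding z_def[abs_def] by (rule qf_midpoint[OF vE wE])
  have 4: "?n (dens z) (dens z) \<le> 1/2 * ?n (dens v) (dens v) + 1/2 * ?n (dens w) (dens w) + nl_const l1 l2 * (3 * (r * d) + d\<^sup>2)"
    unfolding z_def[abs_def] d_def by (rule nl_midpoint[OF vE wE r])
  have E0: "0 \<le> nl_const l1 l2 * (3 * (r * d) + d\<^sup>2)"
  proof -
    have "r \<ge> 0" using r(1) l2n_nonneg[of "dens v"] by linarith
    then show ?thesis using nl_const_pos[of l1 l2] by (intro mult_nonneg_nonneg add_nonneg_nonneg) (auto simp: d_def)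
  qed
  define X where "X = ?k * (?D / c)"
  have X: "?k * (?D / (4 * c)) = X / 4" "?k / 8 * (?D / (2 * c)) = X / 16" "X \<ge> 0" "?k * ?D / c = X" using k c by (auto simp: X_def)
  show ?thesis using 1 2 4 ev ew E0 X(3) unfolding 3 energy_eq[OF vE] energy_eq[OF wE] X(1,2,4) by argo
qed

text \<open>Coercivity bounds a minimising sequence, so a subsequence is Cauchy in
  \<open>L2\<close>. \<open>minimising_pair\<close> upgrades this to the energy norm, because for
  bounded gradients its error vanishes with the \<open>L2\<close> distance and the energy defect.
  Continuity of the energy concludes.\<close>

lemma minimiser_exists:
  assumes c: "c > 0" and a: "a > 0" and v0: "v0 \<in> admissible l1 l2 c" "energy l1 l2 a v0 \<le> grad_threshold l1 l2 c / 32"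
  shows "\<exists>u\<in>admissible l1 l2 c. \<forall>w\<in>admissible l1 l2 c. energy l1 l2 a u \<le> energy l1 l2 a w"
proof -
  let ?k = "grad_threshold l1 l2 c" and ?A = "admissible l1 l2 c" and ?E = "energy l1 l2 a"
  have k: "?k > 0" by (rule grad_threshold_pos[OF c])
  have co: "3/8 * (gr z z + a\<^sup>2 * (l2n (xmul z))\<^sup>2) \<le> ?E z" if "z \<in> ?A" for z
    by (rule energy_coercive[OF _ _ _ c]) (use that in \<open>auto simp: admissible_def\<close>)
  have E0: "0 \<le> ?E z" if "z \<in> ?A" for z
  proof -
    have "0 \<le> 3/8 * (gr z z + a\<^sup>2 * (l2n (xmul z))\<^sup>2)" using gr_nonneg[of z] by simp
    then show ?thesis using co[OF that] by linarith
  qed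
  define I where "I = Inf (?E ` ?A)"
  have bd: "bdd_below (?E ` ?A)" using E0 by (auto intro!: bdd_belowI[of _ 0])
  have ne: "?E ` ?A \<noteq> {}" using v0 by auto
  have Il: "I \<le> ?E z" if "z \<in> ?A" for z unfolding I_def by (rule cInf_lower[OF _ bd]) (use that in auto)
  have I0: "0 \<le> I" unfolding I_def by (rule cInf_greatest[OF ne]) (use E0 in auto)
  have I1: "I \<le> ?k / 32" using Il[OF v0(1)] v0(2) by linarith
  \<comment> \<open>All energies are then at most \<open>?k / 16\<close>, and coercivity keeps the
    gradient forms at most \<open>?k / 6\<close>, inside the bound \<open>?k / 2\<close> of
    \<open>minimising_pair\<close>.\<close>
  define \<epsilon> where "\<epsilon> n = ?k / 32 / real (Suc n)" for n
  have e0: "\<epsilon> n > 0" and e1: "\<epsilon> n \<le> ?k / 32" for n using k by (auto simp: \<epsilon>_def field_simps)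
  have "\<forall>n. \<exists>v. v \<in> ?A \<and> ?E v < I + \<epsilon> n"
  proof
    fix n
    have "Inf (?E ` ?A) < I + \<epsilon> n" using e0[of n] by (simp add: I_def)
    from cInf_lessD[OF ne this] show "\<exists>v. v \<in> ?A \<and> ?E v < I + \<epsilon> n" by auto
  qed
  from choice[OF this] obtain v where v: "\<forall>n. v n \<in> ?A \<and> ?E (v n) < I + \<epsilon> n" by (rule exE)
  have vA: "v n \<in> ?A" and vE: "v n \<in> energy_space" and vm: "l2n (v n) = sqrt c" and ve: "?E (v n) \<le> I + \<epsilon> n" for n
  proof -
    show A: "v n \<in> ?A" using v by blast
    show "v n \<in> energy_space" using A by (simp add: admissible_def)
    have "(l2n (v n))\<^sup>2 = c" using A by (simp add: admissible_def)
    then show "l2n (v n) = sqrt c" by (simp add: real_sqrt_unique)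
    show "?E (v n) \<le> I + \<epsilon> n" using v by (blast intro: less_imp_le)
  qed
  have vb: "gr (v n) (v n) \<le> ?k / 6" "a\<^sup>2 * (l2n (xmul (v n)))\<^sup>2 \<le> ?k" for n
  proof -
    define X where "X = a\<^sup>2 * (l2n (xmul (v n)))\<^sup>2"
    have x: "0 \<le> X" by (simp add: X_def)
    have "3/8 * (gr (v n) (v n) + X) \<le> ?k / 16" using co[OF vA[of n]] ve[of n] e1[of n] I1 unfolding X_def by linarith
    then show "gr (v n) (v n) \<le> ?k / 6" "a\<^sup>2 * (l2n (xmul (v n)))\<^sup>2 \<le> ?k" using x gr_nonneg[of "v n"] k unfolding X_def[symmetric] by argo+
  qed
  define C where "C = sqrt c + sqrt ?k + sqrt ?k / a"
  have Cp: "sqrt c \<le> C" "sqrt ?k \<le> C" "sqrt ?k / a \<le> C" using c k a by (auto simp: C_def)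
  have gk: "sqrt (gr (v n) (v n)) \<le> sqrt ?k" for n using vb(1)[of n] k by (intro real_sqrt_le_mono) linarith
  have "\<exists>r. strict_mono (r::nat\<Rightarrow>nat) \<and> (\<forall>e>0. \<exists>N. \<forall>m\<ge>N. \<forall>n\<ge>N. l2n (\<lambda>x. v (r
      m) x - v (r n) x) \<le> e)"
  proof (rule energy_space_compactness[where g="\<lambda>n i. weak_partial i (v n)" and C=C])
    show "v n \<in> L2" for n by (rule ES_L2[OF vE])
    show "is_weak_partial i (v n) (weak_partial i (v n))" for n i by (rule ES_wp[OF vE])
    show "l2n (v n) \<le> C" for n using Cp(1) by (simp add: vm)
    show "l2n (weak_partial i (v n)) \<le> C" for n i using l2n_grad_le[of i "v n"] gk[of n] Cp(2) by linarith
    show "(\<lambda>x. of_real (norm x) * v n x) \<in> L2" for n using ES_xmul[OF vE[of n]] by (simp add: xmul_def[abs_def])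
    show "l2n (\<lambda>x. of_real (norm x) * v n x) \<le> C" for n
    proof -
      have "(a * l2n (xmul (v n)))\<^sup>2 \<le> ?k" using vb(2)[of n] by (simp add: power_mult_distrib)
      then have "a * l2n (xmul (v n)) \<le> sqrt ?k" by (rule real_le_rsqrt)
      then have "l2n (xmul (v n)) \<le> sqrt ?k / a" using a by (simp add: field_simps)
      then show ?thesis using Cp(3) by (simp add: xmul_def[abs_def])
    qed
  qed
  then obtain r where r: "strict_mono (r::nat\<Rightarrow>nat)" and rc: "\<And>e. e > 0
      \<Longrightarrow> \<exists>N. \<forall>m\<ge>N. \<forall>n\<ge>N. l2n (\<lambda>x. v (r m) x - v (r n) x) \<le> e"
    by (elim exE conjE) (rule that, auto)
  define w where "w n = v (r n)" for n
  have wA: "w n \<in> ?A" and wE: "w n \<in> energy_space" for n unfolding w_def by (rule vA, rule vE)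
  have we: "?E (w n) \<le> I + \<epsilon> n" for n
  proof -
    have "\<epsilon> (r n) \<le> \<epsilon> n" unfolding \<epsilon>_def using seq_suble[OF r, of n] k by (intro divide_left_mono) auto
    then show ?thesis using ve[of "r n"] by (simp add: w_def)
  qed
  define r0 where "r0 = sqrt (64 * (sqrt c * (sqrt ?k)^3))"
  have wd: "l2n (dens (w n)) \<le> r0" for n
    unfolding r0_def
  proof (rule real_le_rsqrt)
    have "(l2n (dens (w n)))\<^sup>2 \<le> 64 * (l2n (w n) * (sqrt (gr (w n) (w n)))^3)" by (rule dens_sq_bound[OF wE])
    also have "\<dots> \<le> 64 * (sqrt c * (sqrt ?k)^3)"
      unfolding w_def vm using gk[of "r n"] gr_nonneg[of "v (r n)"] c by (intro mult_left_mono power_mono) auto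
    finally show "(l2n (dens (w n)))\<^sup>2 \<le> 64 * (sqrt c * (sqrt ?k)^3)" .
  qed
  have r00: "r0 \<ge> 0" using order_trans[OF l2n_nonneg wd] .
  \<comment> \<open>A bound for the density of a difference at \<open>L2\<close> distance
    \<open>t\<close>, whose gradient form is at most \<open>2 * ?k\<close>. \<open>P\<close> is the
    resulting error in \<open>minimising_pair\<close>. \<open>B\<close> undoes the factor 1/8 there
    and recovers the moment from the quadratic form, which divides by the square of
    \<open>a\<close>.\<close>
  define D where "D t = 8 * (sqrt t * (sqrt (sqrt (2 * ?k)))^3)" for t
  define P where "P t = nl_const l1 l2 * (3 * (r0 * D t) + (D t)\<^sup>2) + ?k * t\<^sup>2 / c" for t
  define B where "B = 8 * (1 + 1 / a\<^sup>2)"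
  have B: "B > 0" using a by (simp add: B_def add_pos_nonneg)
  have pair: "(energy_space_norm (\<lambda>x. w m x - w n x))\<^sup>2 \<le> t\<^sup>2 + B * (\<epsilon> N + P t)"
    if mn: "m \<ge> N" "n \<ge> N" and t: "t = l2n (\<lambda>x. w m x - w n x)" "t\<^sup>2 \<le> 2 * c" for m n N t
  proof -
    let ?h = "\<lambda>x. w m x - w n x"
    have hE: "?h \<in> energy_space" by (rule ES_diff[OF wE wE])
    have emono: "\<epsilon> m \<le> \<epsilon> N" if "m \<ge> N" for m unfolding \<epsilon>_def using that k by (intro divide_left_mono) auto
    have t0: "t \<ge> 0" by (simp add: t)
    have gw: "gr (w n) (w n) \<le> ?k / 2" for n using vb(1)[of "r n"] k unfolding w_def by linarith
    have gh: "gr ?h ?h \<le> 2 * ?k"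
    proof -
      have "0 \<le> gr (\<lambda>x. of_real (1/2) * (w m x + w n x)) (\<lambda>x. of_real (1/2) * (w m x + w n x))" by (rule gr_nonneg)
      also have "\<dots> = 1/2 * gr (w m) (w m) + 1/2 * gr (w n) (w n) - 1/4 * gr ?h ?h" unfolding gr_qf by (rule qf_midpoint[OF wE wE])
      finally show ?thesis using gw[of m] gw[of n] k by linarith
    qed
    have d: "l2n (dens ?h) \<le> D t"
    proof -
      have "l2n (dens ?h) \<le> 8 * (sqrt t * (sqrt (sqrt (gr ?h ?h)))^3)" unfolding t(1) by (rule dens_quarter[OF hE])
      also have "\<dots> \<le> D t" unfolding D_def using gh gr_nonneg[of ?h] t0 by (intro mult_left_mono power_mono real_sqrt_le_mono) auto
      finally show ?thesis .
    qed
    have "1/8 * qf a ?h ?h \<le> \<epsilon> N + nl_const l1 l2 * (3 * (r0 * l2n (dens ?h)) + (l2n (dens ?h))\<^sup>2) + ?k * (l2n ?h)\<^sup>2 / c"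
    proof (rule minimising_pair[OF c wA wA gw gw Il I0 _ _ _ wd wd])
      show "I \<le> ?k" using I1 k by linarith
      show "?E (w m) \<le> I + \<epsilon> N" "?E (w n) \<le> I + \<epsilon> N" using we[of m] we[of n] emono[OF mn(1)] emono[OF mn(2)] by linarith+
      show "(l2n ?h)\<^sup>2 \<le> 2 * c" using t by simp
    qed
    also have "\<dots> \<le> \<epsilon> N + nl_const l1 l2 * (3 * (r0 * D t) + (D t)\<^sup>2) + ?k * t\<^sup>2 / c"
      unfolding t(1)[symmetric] using d r00 nl_const_pos[of l1 l2] by (intro add_mono mult_left_mono power_mono order_refl) auto
    also have "\<dots> = \<epsilon> N + P t" by (simp only: P_def add.assoc)
    finally have "1/8 * qf a ?h ?h \<le> \<epsilon> N + P t" .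
    moreover have "y \<le> 8 * z" if "1/8 * y \<le> z" for y z :: real using that by simp
    ultimately have q: "qf a ?h ?h \<le> 8 * (\<epsilon> N + P t)" by (simp only:)
    have "(energy_space_norm ?h)\<^sup>2 = t\<^sup>2 + gr ?h ?h + (l2n (xmul ?h))\<^sup>2" unfolding energy_space_norm_sq[OF hE] t(1) ..
    also have "\<dots> \<le> t\<^sup>2 + qf a ?h ?h + qf a ?h ?h / a\<^sup>2"
    proof -
      have "(l2n (xmul ?h))\<^sup>2 \<le> qf a ?h ?h / a\<^sup>2"
        unfolding qf_def ip_self using gr_nonneg[of ?h] a by (simp add: field_simps)
      then show ?thesis using qf_nonneg[of ?h a] by linarith
    qed
    also have "\<dots> = t\<^sup>2 + (1 + 1 / a\<^sup>2) * qf a ?h ?h" by (simp add: distrib_right)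
    also have "\<dots> \<le> t\<^sup>2 + (1 + 1 / a\<^sup>2) * (8 * (\<epsilon> N + P t))" using q by (intro add_left_mono mult_left_mono) auto
    finally show ?thesis by (simp only: B_def mult_ac)
  qed
  \<comment> \<open>The part of the estimate \<open>pair\<close> that depends on the
    \<open>L2\<close> distance; it is continuous and vanishes at 0.\<close>
  define f where "f t = t\<^sup>2 + B * P t" for t
  have fc: "isCont f 0" unfolding f_def P_def D_def using c by (intro continuous_intros) auto
  have f0: "f 0 = 0" by (simp add: f_def P_def D_def)
  have cauchy: "\<exists>N. \<forall>m\<ge>N. \<forall>n\<ge>N. energy_space_norm (\<lambda>x. w m x - w n x) \<le> e" if e: "e > 0" for e
  proof -
    have e2: "e\<^sup>2 / 2 > 0" using e by simp
    obtain t0 where t0: "t0 > 0" "\<And>t. dist t 0 < t0 \<Longrightarrow> dist (f t) (f 0) < e\<^sup>2 / 2"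
      using fc e2 unfolding continuous_at_eps_delta by blast
    define t1 where "t1 = min (t0 / 2) (sqrt (2 * c))"
    have t1: "t1 > 0" using t0 c by (simp add: t1_def)
    obtain N1 where N1: "\<forall>m\<ge>N1. \<forall>n\<ge>N1. l2n (\<lambda>x. v (r m) x - v (r n) x) \<le> t1" using rc[OF t1] by blast
    have "\<epsilon> \<longlonglongrightarrow> 0" unfolding \<epsilon>_def by real_asymp
    then have "\<forall>\<^sub>F n in sequentially. \<epsilon> n < e\<^sup>2 / 2 / B" by (rule order_tendstoD) (use e2 B in simp)
    then obtain N2 where N2: "\<And>n. n \<ge> N2 \<Longrightarrow> \<epsilon> n < e\<^sup>2 / 2 / B" by (auto simp: eventually_sequentially)
    define N where "N = max N1 N2"
    have "energy_space_norm (\<lambda>x. w m x - w n x) \<le> e" if mn: "m \<ge> N" "n \<ge> N" for m n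
    proof (rule power2_le_imp_le)
      define t where "t = l2n (\<lambda>x. w m x - w n x)"
      have tt: "0 \<le> t" "t \<le> t1" using N1 mn by (auto simp: t_def w_def N_def)
      have "t\<^sup>2 \<le> (sqrt (2 * c))\<^sup>2" using tt by (intro power_mono) (auto simp: t1_def)
      then have t2: "t\<^sup>2 \<le> 2 * c" using c by simp
      have "dist t 0 < t0" using tt t0(1) by (simp add: t1_def)
      from t0(2)[OF this] have "f t < e\<^sup>2 / 2" by (simp add: f0 dist_real_def)
      moreover have "B * \<epsilon> N < e\<^sup>2 / 2"
      proof -
        have "\<epsilon> N < e\<^sup>2 / 2 / B" by (rule N2) (simp add: N_def)
        then show ?thesis unfolding pos_less_divide_eq[OF B] by (simp only: mult.commute)
      qed
      ultimately show "(energy_space_norm (\<lambda>x. w m x - w n x))\<^sup>2 \<le> e\<^sup>2"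
        using pair[OF mn t_def t2] unfolding f_def distrib_left by linarith
    qed (use e in simp)
    then show ?thesis by blast
  qed
  from ES_complete[of w, OF wE cauchy] obtain u where u: "u \<in> energy_space"
      and ul: "(\<lambda>n. energy_space_norm (\<lambda>x. w n x - u x)) \<longlonglongrightarrow> 0" by blast
  note lims = gr_continuous[OF u wE ul] energy_continuous[OF u wE ul, of l1 l2 a]
  have "(\<lambda>n. l2n (w n)) \<longlonglongrightarrow> sqrt c" unfolding w_def vm by simp
  then have "l2n u = sqrt c" using lims(2) LIMSEQ_unique by blast
  then have um: "(l2n u)\<^sup>2 = c" using c by simp
  have "gr u u \<le> ?k" by (rule LIMSEQ_le_const2[OF lims(1)]) (use wA in \<open>auto simp: admissible_def\<close>)
  then have uA: "u \<in> ?A" using u um by (simp add: admissible_def)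
  have "(\<lambda>n. I + \<epsilon> n) \<longlonglongrightarrow> I + 0" unfolding \<epsilon>_def by (intro tendsto_intros) real_asymp
  then have "?E u \<le> I" using LIMSEQ_le[OF lims(3)] we by fastforce
  then show ?thesis using uA Il by (meson order_trans)
qed

text \<open>For a tangent direction \<open>h\<close> the line \<open>u + s h\<close> is scaled back
  to the sphere. Since the gradient constraint is not active at \<open>u\<close>, the curve is
  admissible for small \<open>s\<close>, and the energy along it is an explicit function whose
  derivative at 0 is \<open>denergy\<close>.\<close>

lemma minimiser_critical:
  assumes c: "c > 0" and u: "u \<in> admissible l1 l2 c" and g: "gr u u < grad_threshold l1 l2 c"
    and min: "\<And>w. w \<in> admissible l1 l2 c \<Longrightarrow> energy l1 l2 a u \<le> energy l1 l2 a w"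
  shows "constrained_critical_point l1 l2 a c u"
proof -
  let ?k = "grad_threshold l1 l2 c" and ?n = "nl l1 l2"
  have uE: "u \<in> energy_space" and um: "(l2n u)\<^sup>2 = c" using u by (auto simp: admissible_def)
  have "denergy l1 l2 a u h = 0" if h: "h \<in> energy_space" and orth: "ip u h = 0" for h
  proof -
    define m where "m = (l2n h)\<^sup>2"
    \<comment> \<open>The square of the scaling factor. Orthogonality removes the linear term of the
      mass, so \<open>q\<close> has derivative 0 at 0 and does not affect the first
      variation.\<close>
    define q where "q s = c / (c + s\<^sup>2 * m)" for s
    have m0: "m \<ge> 0" by (simp add: m_def)
    have cs: "c + s\<^sup>2 * m > 0" for s using c m0 by (simp add: add_pos_nonneg)
    define Q where "Q b s = qf b u u + 2 * (s * qf b u h) + s\<^sup>2 * qf b h h" for b s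
    define N where "N s = ?n (dens u) (dens u) + 4 * (s * ?n (dens u) (cross u h)) + 2 * (s\<^sup>2 * ?n (dens u) (dens h))
        + 4 * (s\<^sup>2 * ?n (cross u h) (cross u h)) + 4 * (s^3 * ?n (cross u h) (dens h)) + s^4 * ?n (dens h) (dens h)" for s
    define f where "f s = 1/2 * (q s * Q a s) + 1/2 * ((q s)\<^sup>2 * N s)" for s
    note L = dens_L2[OF uE] dens_L2[OF h] cross_L2(1)[OF uE h]
    have curve: "\<exists>w\<in>energy_space. (l2n w)\<^sup>2 = c \<and> gr w w = q s * Q 0 s \<and> energy l1 l2 a w = f s" for s
    proof -
      define z where "z x = u x + of_real s * h x" for x
      have hs: "(\<lambda>x. of_real s * h x) \<in> energy_space" by (rule ES_scale[OF h])
      have z: "z \<in> energy_space" unfolding z_def by (rule ES_add[OF uE hs])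
      define w where "w x = of_real (sqrt (q s)) * z x" for x
      have q0: "q s > 0" unfolding q_def using c cs by simp
      have q2: "(sqrt (q s))\<^sup>2 = q s" using q0 by simp
      have w: "w \<in> energy_space" unfolding w_def by (rule ES_scale[OF z])
      have "(l2n z)\<^sup>2 = c + s\<^sup>2 * m"
        unfolding z_def[abs_def] l2n_add_sq[OF ES_L2[OF uE] ES_L2[OF hs]] ip_scale_right orth l2n_scale by (simp add: um m_def power_mult_distrib)
      then have "(l2n w)\<^sup>2 = q s * (c + s\<^sup>2 * m)" unfolding w_def[abs_def] l2n_scale using q0 by (simp add: power_mult_distrib)
      then have 1: "(l2n w)\<^sup>2 = c" using cs[of s] by (simp add: q_def)
      have qz: "qf b z z = Q b s" for b
        unfolding z_def[abs_def] qf_add[OF uE hs] qf_scale[OF h] qf_scale_right[OF uE h] Q_def by simp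
      have qw: "qf b w w = q s * Q b s" for b unfolding w_def[abs_def] qf_scale[OF z] q2 qz ..
      define \<eta> where "\<eta> x = of_real (2 * s) * cross u h x + of_real (s\<^sup>2) * dens h x" for x
      have dz: "dens z = (\<lambda>x. dens u x + \<eta> x)"
        unfolding z_def[abs_def] dens_add dens_scale cross_scale \<eta>_def by (simp add: mult.assoc)
      have \<eta>L: "\<eta> \<in> L2" unfolding \<eta>_def by (intro L2_add L2_scale L)
      have n1: "?n (dens u) \<eta> = 2 * s * ?n (dens u) (cross u h) + s\<^sup>2 * ?n (dens u) (dens h)"
        unfolding \<eta>_def by (simp only: nl_add_right L2_scale L nl_scale_right)
      have n2: "?n \<eta> \<eta> = (2 * s)\<^sup>2 * ?n (cross u h) (cross u h) + 2 * (2 * s * s\<^sup>2 * ?n (cross u h) (dens h))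
          + (s\<^sup>2)\<^sup>2 * ?n (dens h) (dens h)"
        unfolding \<eta>_def using nl_sym[OF L(2) L(3), of l1 l2]
        by (simp only: nl_add_right nl_add_left L2_add L2_scale L nl_scale_right nl_scale_left) (simp add: power2_eq_square algebra_simps)
      have "?n (dens z) (dens z) = ?n (dens u) (dens u) + 2 * ?n (dens u) \<eta> + ?n \<eta> \<eta>"
        unfolding dz using nl_sym[OF \<eta>L L(1), of l1 l2] by (simp add: nl_add_left nl_add_right L2_add \<eta>L L)
      also have "\<dots> = N s" unfolding n1 n2 N_def by (simp add: power2_eq_square power3_eq_cube power4_eq_xxxx algebra_simps)
      finally have nz: "?n (dens z) (dens z) = N s" .
      have dw: "dens w = (\<lambda>x. of_real (q s) * dens z x)" unfolding w_def[abs_def] dens_scale q2 ..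
      have "?n (dens w) (dens w) = q s * (q s * N s)"
        unfolding dw nl_scale_right by (simp only: nl_scale_left dens_L2 z nz)
      then have "energy l1 l2 a w = f s" unfolding energy_eq[OF w] qw f_def by (simp add: power2_eq_square)
      then show ?thesis using w 1 qw[of 0] unfolding gr_qf by blast
    qed
    have q1: "q 0 = 1" using c by (simp add: q_def)
    have Gc: "isCont (\<lambda>s. q s * Q 0 s) 0" unfolding q_def Q_def using c by (intro continuous_intros) auto
    have G0: "q 0 * Q 0 0 = gr u u" by (simp add: q1 Q_def gr_qf)
    have gp: "?k - gr u u > 0" using g by simp
    obtain d where d: "d > 0" "\<And>s. dist s 0 < d \<Longrightarrow> dist (q s * Q 0 s) (q 0 * Q 0 0) < ?k - gr u u"
      using Gc gp unfolding continuous_at_eps_delta by blast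
    have f0: "f 0 = energy l1 l2 a u" unfolding energy_eq[OF uE] by (simp add: f_def q1 Q_def N_def)
    have lm: "f 0 \<le> f s" if "\<bar>0 - s\<bar> < d" for s
    proof -
      obtain w where w: "w \<in> energy_space" "(l2n w)\<^sup>2 = c" "gr w w = q s * Q 0 s" "energy l1 l2 a w = f s" using curve by blast
      have "dist (q s * Q 0 s) (q 0 * Q 0 0) < ?k - gr u u" by (rule d(2)) (use that in \<open>simp add: dist_real_def\<close>)
      then have "gr w w \<le> ?k" unfolding w(3) G0 dist_real_def by linarith
      then show ?thesis using min[of w] w f0 by (simp add: admissible_def)
    qed
    have dq: "(q has_real_derivative 0) (at 0)" unfolding q_def using c by (auto intro!: derivative_eq_intros)
    have dQ: "(Q a has_real_derivative 2 * qf a u h) (at 0)" unfolding Q_def[abs_def] by (auto intro!: derivative_eq_intros)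
    have dN: "(N has_real_derivative 4 * ?n (dens u) (cross u h)) (at 0)" unfolding N_def[abs_def] by (auto intro!: derivative_eq_intros)
    have "(f has_real_derivative denergy l1 l2 a u h) (at 0)"
      unfolding f_def denergy_def by (rule derivative_eq_intros dq dQ dN refl | simp add: q1)+
    then show ?thesis by (rule DERIV_local_min[OF _ d(1)]) (use lm in blast)
  qed
  then have "\<forall>h\<in>energy_space. Re (LINT x|lborel. u x * cnj (h x)) = 0 \<longrightarrow> denergy l1 l2 a u h = 0" unfolding ip_def by blast
  with energy_has_derivative[OF uE, of l1 l2 a] uE um show ?thesis
    unfolding constrained_critical_point_def mass_sphere_def mass_l2n by blast
qed

text \<open>The energy bound and coercivity keep the minimiser away from the gradient constraint, so
  it is critical. Critical points in \<open>admissible\<close> cannot have less energy; those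
  outside have energy above a sixth of the threshold by \<open>critical_energy\<close>.\<close>

lemma minimiser_ground_state:
  assumes c: "c > 0" and u: "u \<in> admissible l1 l2 c" and e: "energy l1 l2 a u \<le> grad_threshold l1 l2 c / 32"
    and min: "\<And>w. w \<in> admissible l1 l2 c \<Longrightarrow> energy l1 l2 a u \<le> energy l1 l2 a w"
  shows "ground_state l1 l2 a c u"
proof -
  let ?k = "grad_threshold l1 l2 c"
  have k: "?k > 0" by (rule grad_threshold_pos[OF c])
  define X where "X = a\<^sup>2 * (l2n (xmul u))\<^sup>2"
  have "3/8 * (gr u u + X) \<le> ?k / 32"
    unfolding X_def by (rule order_trans[OF energy_coercive[OF _ _ _ c] e]) (use u in \<open>auto simp: admissible_def\<close>)
  moreover have "0 \<le> X" by (simp add: X_def)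
  ultimately have "gr u u < ?k" using k by argo
  then have cr: "constrained_critical_point l1 l2 a c u" by (rule minimiser_critical[OF c u _ min])
  have "energy l1 l2 a u \<le> energy l1 l2 a w" if w: "constrained_critical_point l1 l2 a c w" for w
  proof (cases "gr w w \<le> ?k")
    case True
    then show ?thesis using critical_lagrange(1,2)[OF w c] by (intro min) (simp add: admissible_def)
  next
    case False
    have "0 \<le> 5/6 * (a\<^sup>2 * ip (xmul w) (xmul w))" by (simp add: ip_self)
    then show ?thesis using critical_energy[OF w c] False e k by linarith
  qed
  then have "ereal (energy l1 l2 a u) = (INF w\<in>{w. constrained_critical_point l1 l2 a c w}. ereal (energy l1 l2 a w))"
    using cr by (intro antisym INF_greatest INF_lower) auto
  then show ?thesis using cr by (simp add: ground_state_def)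
qed

text \<open>Dilating a fixed profile to the length scale \<open>a\<^sup>-\<^sup>1\<^sup>/\<^sup>2\<close> of the trap makes its energy \<open>O(a)\<close>.\<close>

lemma small_energy:
  assumes c: "c > 0"
  shows "\<exists>a1>0. \<forall>a\<in>{0<..a1}. \<exists>v\<in>admissible l1 l2 c. energy l1 l2 a v \<le> grad_threshold l1 l2 c / 32"
proof -
  let ?k = "grad_threshold l1 l2 c"
  have k: "?k > 0" by (rule grad_threshold_pos[OF c])
  obtain \<phi> where p: "\<phi> \<in> test_functions" and pos: "l2n (\<lambda>x. of_real (\<phi> x)) > 0" by (rule nontrivial_test)
  define v where "v x = of_real (sqrt c / l2n (\<lambda>x. of_real (\<phi> x))) * complex_of_real (\<phi> x)" for x
  have v: "v \<in> energy_space" unfolding v_def by (rule test_ES[OF p])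
  have "l2n v = sqrt c" unfolding v_def[abs_def] l2n_scale using pos c by (simp add: norm_divide)
  then have vm: "(l2n v)\<^sup>2 = c" using c by simp
  define A where "A = gr v v"
  define D where "D = ip (xmul v) (xmul v)"
  define N where "N = nl l1 l2 (dens v) (dens v)"
  have nn: "A \<ge> 0" "D \<ge> 0" by (auto simp: A_def D_def gr_nonneg ip_self)
  define C where "C = A + D + \<bar>N\<bar> + 1"
  have C: "C > 0" "A \<le> C" using nn by (auto simp: C_def)
  \<comment> \<open>The bound 1 gives \<open>sqrt a ^ 3 <= a\<close> for the interaction; the other
    makes \<open>a * C\<close> at most \<open>?k / 32\<close>.\<close>
  define a1 where "a1 = min 1 (?k / (32 * C))"
  have "\<exists>w\<in>admissible l1 l2 c. energy l1 l2 a w \<le> ?k / 32" if "a \<in> {0<..a1}" for a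
  proof -
    have a: "a > 0" "a \<le> 1" "a \<le> ?k / (32 * C)" using that by (auto simp: a1_def)
    then have aC: "a * C \<le> ?k / 32" using C by (simp add: field_simps)
    have s: "sqrt a > 0" "(sqrt a)\<^sup>2 = a" "sqrt a \<le> 1" using a by auto
    note F = dil_facts[OF v s(1)]
    have "gr (dil (sqrt a) v) (dil (sqrt a) v) \<le> ?k"
    proof -
      have "gr (dil (sqrt a) v) (dil (sqrt a) v) = a * A" unfolding F(3) s(2) A_def ..
      also have "\<dots> \<le> a * C" using C(2) a by (intro mult_left_mono) auto
      finally show ?thesis using aC k by linarith
    qed
    then have adm: "dil (sqrt a) v \<in> admissible l1 l2 c" using F(1,2) vm by (simp add: admissible_def)
    have "energy l1 l2 a (dil (sqrt a) v) = 1/2 * (a * A) + 1/2 * (a\<^sup>2 * (D / a)) + 1/2 * (sqrt a ^ 3 * N)"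
      unfolding energy_dil[OF v s(1)] s(2) A_def D_def N_def ..
    also have "a\<^sup>2 * (D / a) = a * D" using a by (simp add: power2_eq_square)
    also have "sqrt a ^ 3 * N \<le> a * \<bar>N\<bar>"
    proof -
      have "sqrt a ^ 3 = sqrt a * a" using s by (simp add: power3_eq_cube power2_eq_square)
      also have "\<dots> \<le> 1 * a" using s a by (intro mult_right_mono) auto
      finally have "sqrt a ^ 3 * \<bar>N\<bar> \<le> a * \<bar>N\<bar>" by (intro mult_right_mono) auto
      moreover have "sqrt a ^ 3 * N \<le> sqrt a ^ 3 * \<bar>N\<bar>" using s by (intro mult_left_mono) auto
      ultimately show ?thesis by linarith
    qed
    finally have "energy l1 l2 a (dil (sqrt a) v) \<le> 1/2 * (a * A) + 1/2 * (a * D) + 1/2 * (a * \<bar>N\<bar>)" by simp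
    also have "\<dots> \<le> a * C"
    proof -
      have "0 \<le> a * A" "0 \<le> a * D" "0 \<le> a * \<bar>N\<bar>" using a nn by simp_all
      then show ?thesis unfolding C_def distrib_left using a by linarith
    qed
    finally have "energy l1 l2 a (dil (sqrt a) v) \<le> ?k / 32" using aC by linarith
    then show ?thesis using adm by blast
  qed
  moreover have "a1 > 0" using k C by (simp add: a1_def)
  ultimately show ?thesis by blast
qed

text \<open>A ground state has at most the energy of the minimiser, so its gradient form is below
  the threshold and \<open>nl_small\<close> applies: the interaction, counted twice in
  \<open>denergy_self\<close>, costs at most half of the gradient form.\<close>

lemma ground_state_small:
  assumes c: "c > 0" and a: "a > 0" and v: "v \<in> admissible l1 l2 c" "energy l1 l2 a v \<le> grad_threshold l1 l2 c / 32"
  shows "\<exists>u. ground_state l1 l2 a c u"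
    "ground_state l1 l2 a c w \<Longrightarrow> denergy l1 l2 a w w > 0"
proof -
  let ?k = "grad_threshold l1 l2 c"
  obtain u where u: "u \<in> admissible l1 l2 c" and min: "\<And>w. w \<in> admissible l1 l2 c \<Longrightarrow> energy l1 l2 a u \<le> energy l1 l2 a w"
    using minimiser_exists[OF c a v] by blast
  have eu: "energy l1 l2 a u \<le> ?k / 32" using min[OF v(1)] v(2) by linarith
  have gs: "ground_state l1 l2 a c u" by (rule minimiser_ground_state[OF c u eu min])
  then show "\<exists>u. ground_state l1 l2 a c u" by blast
  assume w: "ground_state l1 l2 a c w"
  have cw: "constrained_critical_point l1 l2 a c w" and cu: "constrained_critical_point l1 l2 a c u"
    using w gs by (auto simp: ground_state_def)
  have "ereal (energy l1 l2 a w) \<le> ereal (energy l1 l2 a u)"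
    using w cu by (auto simp: ground_state_def intro: INF_lower)
  then have ew: "energy l1 l2 a w \<le> ?k / 32" using eu by simp
  have k: "?k > 0" by (rule grad_threshold_pos[OF c])
  note wE = critical_lagrange(1)[OF cw c] and wm = critical_lagrange(2)[OF cw c]
  have X0: "0 \<le> a\<^sup>2 * ip (xmul w) (xmul w)" by (simp add: ip_self)
  have "gr w w / 6 \<le> ?k / 32" using critical_energy[OF cw c] ew X0 by linarith
  then have g: "gr w w \<le> ?k" using k by linarith
  have n: "\<bar>nl l1 l2 (dens w) (dens w)\<bar> \<le> gr w w / 4" by (rule nl_small[OF wE _ g c]) (simp add: wm)
  \<comment> \<open>Strict positivity comes from the moment: it cannot vanish, because
    \<open>w\<close> has positive mass and the origin is a null set.\<close>
  have "ip (xmul w) (xmul w) > 0"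
  proof (rule ccontr)
    assume "\<not> ?thesis"
    then have "(l2n (xmul w))\<^sup>2 \<le> 0" unfolding ip_self by simp
    then have "l2n (xmul w) = 0" by simp
    then have z: "AE x in lborel. xmul w x = 0" by (rule l2n_zero_AE[OF ES_xmul[OF wE]])
    have "AE x in lborel. (x::real^3) \<noteq> 0" by (rule AE_lborel_singleton)
    with z have "AE x in lborel. w x = 0" by eventually_elim (simp add: xmul_def)
    then have "l2n w = l2n (\<lambda>x. 0)" by (intro l2n_AE L2_meas[OF ES_L2[OF wE]]) auto
    then show False using wm c by (simp add: l2n_def)
  qed
  then have "a\<^sup>2 * ip (xmul w) (xmul w) > 0" using a by simp
  then show "denergy l1 l2 a w w > 0"
    unfolding denergy_self qf_def using n gr_nonneg[of w] by (simp add: abs_le_iff)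
qed

subsection \<open>The stationary equation\<close>

lemma L2_mult_test: assumes f: "f \<in> L2" and p: "\<phi> \<in> test_functions" shows "(\<lambda>x. f x * of_real (\<phi> x)) \<in> L2"
proof -
  obtain R M where RM: "\<And>x. norm (complex_of_real (\<phi> x)) \<le> M * indicator (cball 0 R) x" "M > 0" using Cc_bounded[OF test_Cc[OF p]] by metis
  have b: "norm (complex_of_real (\<phi> x)) \<le> M" for x using RM(1)[of x] RM(2) by (auto simp: indicator_def split: if_splits intro: order_trans)
  have "(\<lambda>x. of_real (\<phi> x) * f x) \<in> L2" by (rule L2_mult_bounded(1)[OF f _ b]) (use test_measurable[OF p] in simp)
  then show ?thesis by (simp add: mult.commute)
qed

text \<open>Reality of \<open>R\<close> allows the real part inside \<open>cross\<close> to be taken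
  outside the integral.\<close>

lemma ip_cross_test:
  assumes u: "u \<in> energy_space" and p: "\<phi> \<in> test_functions" and R: "R \<in> L2" and real: "AE x in lborel. cnj (R x) = R x"
  shows "ip R (cross u (\<lambda>x. \<kappa> * of_real (\<phi> x))) = Re (cnj \<kappa> * (LINT x|lborel. R x * (u x * of_real (\<phi> x))))"
proof -
  note h = test_ES[OF p, of \<kappa>]
  have uL: "u \<in> L2" by (rule ES_L2[OF u])
  have i1: "integrable lborel (\<lambda>x. R x * cnj (cross u (\<lambda>x. \<kappa> * of_real (\<phi> x)) x))" by (intro ip_integrable R cross_L2 u h)
  have i2: "integrable lborel (\<lambda>x. cnj \<kappa> * (R x * (u x * of_real (\<phi> x))))"
    by (intro integrable_mult_right L2_mult_integrable R L2_mult_test uL p)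
  have "ip R (cross u (\<lambda>x. \<kappa> * of_real (\<phi> x))) = (LINT x|lborel. Re (R x * cnj (cross u (\<lambda>x. \<kappa> * of_real (\<phi> x)) x)))"
    unfolding ip_def using integral_Re[OF i1] by simp
  also have "\<dots> = (LINT x|lborel. Re (cnj \<kappa> * (R x * (u x * of_real (\<phi> x)))))"
  proof (rule integral_cong_AE)
    show "AE x in lborel. Re (R x * cnj (cross u (\<lambda>x. \<kappa> * of_real (\<phi> x)) x)) = Re (cnj \<kappa> * (R x * (u x * of_real (\<phi> x))))"
      using real
    proof eventually_elim
      case (elim x)
      then have "Im (R x) = 0" by (metis complex_cnj_cancel_iff cnj.simps(2) neg_equal_zero)
      then show ?case by (simp add: cross_def algebra_simps)
    qed
    show "(\<lambda>x. Re (R x * cnj (cross u (\<lambda>x. \<kappa> * of_real (\<phi> x)) x))) \<in> borel_measurable lborel"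
      using integrable_Re[OF i1] by (rule borel_measurable_integrable)
    show "(\<lambda>x. Re (cnj \<kappa> * (R x * (u x * of_real (\<phi> x))))) \<in> borel_measurable lborel"
      using integrable_Re[OF i2] by (rule borel_measurable_integrable)
  qed
  also have "\<dots> = Re (LINT x|lborel. cnj \<kappa> * (R x * (u x * of_real (\<phi> x))))" by (rule integral_Re[OF i2])
  also have "(LINT x|lborel. cnj \<kappa> * (R x * (u x * of_real (\<phi> x)))) = cnj \<kappa> * (LINT x|lborel. R x * (u x * of_real (\<phi> x)))"
    by (rule integral_mult_right_zero)
  finally show ?thesis .
qed

lemma ip_test:
  "ip f (\<lambda>x. \<kappa> * of_real (\<phi> x)) = Re (cnj \<kappa> * (LINT x|lborel. f x * of_real (\<phi> x)))"
proof -
  have "(LINT x|lborel. f x * cnj (\<kappa> * of_real (\<phi> x))) = (LINT x|lborel. cnj \<kappa> * (f x * of_real (\<phi> x)))" by (simp add: mult_ac)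
  also have "\<dots> = cnj \<kappa> * (LINT x|lborel. f x * of_real (\<phi> x))" by (rule integral_mult_right_zero)
  finally show ?thesis by (simp add: ip_def)
qed

text \<open>The Lagrange equation in direction \<open>\<kappa> * \<phi>\<close> is twice the real
  part of the tested stationary equation times \<open>cnj \<kappa>\<close>, whence the factor 1/2.
  Any other \<open>\<mu>\<close> would make \<open>u\<close> integrate to 0 against all test
  functions, contradicting its positive mass.\<close>

theorem stationary_iff:
  assumes cr: "constrained_critical_point l1 l2 a c u" and c: "c > 0"
  shows "solves_stationary l1 l2 a \<mu> u \<longleftrightarrow> \<mu> = - (denergy l1 l2 a u u / c) / 2"
proof -
  define la where "la = denergy l1 l2 a u u / c"
  note u = critical_lagrange(1)[OF cr c] and um = critical_lagrange(2)[OF cr c]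
  have uL: "u \<in> L2" by (rule ES_L2[OF u])
  let ?\<rho> = "dens u" and ?K = "dipolar_conv (dens u)"
  have \<rho>: "?\<rho> \<in> L2" by (rule dens_L2[OF u])
  have K: "?K \<in> L2" by (rule dipolar_L2[OF \<rho>])
  have \<rho>r: "cnj (?\<rho> x) = ?\<rho> x" for x by (simp add: particle_density_def)
  have main: "(LINT x|lborel. - (1 / 2) * u x * of_real (laplacian \<phi> x)
           + (of_real (a\<^sup>2 / 2 * (norm x)\<^sup>2) * u x + of_real l1 * ?\<rho> x * u x + of_real l2 * ?K x * u x + of_real \<mu> * u x) * of_real (\<phi> x))
     = of_real (\<mu> + la / 2) * (LINT x|lborel. u x * of_real (\<phi> x))" if p: "\<phi> \<in> test_functions" for \<phi> \<mu>
  proof -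
    note pp = test_partial[OF p] and ppp = test_partial[OF test_partial[OF p]]
    define T where "T x = norm x * \<phi> x" for x
    have TL: "(\<lambda>x. of_real (T x)) \<in> L2"
      using ES_xmul[OF test_ES[OF p, of 1]] by (simp add: xmul_def[abs_def] T_def)
    define P1 where "P1 = (LINT x|lborel. u x * of_real (laplacian \<phi> x))"
    define P2 where "P2 = (LINT x|lborel. xmul u x * of_real (T x))"
    define P3 where "P3 = (LINT x|lborel. ?\<rho> x * (u x * of_real (\<phi> x)))"
    define P4 where "P4 = (LINT x|lborel. ?K x * (u x * of_real (\<phi> x)))"
    define P5 where "P5 = (LINT x|lborel. u x * of_real (\<phi> x))"
    have lap: "u x * of_real (laplacian \<phi> x) = (\<Sum>i\<in>UNIV. u x * of_real (partial i (partial i \<phi>) x))" for x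
      by (simp add: laplacian_def sum_distrib_left)
    have j1: "integrable lborel (\<lambda>x. u x * of_real (laplacian \<phi> x))"
      unfolding lap by (intro Bochner_Integration.integrable_sum L2_test_integrable uL ppp)
    have j2: "integrable lborel (\<lambda>x. xmul u x * of_real (T x))" by (intro L2_mult_integrable ES_xmul u TL)
    have j3: "integrable lborel (\<lambda>x. ?\<rho> x * (u x * of_real (\<phi> x)))" by (intro L2_mult_integrable \<rho> L2_mult_test uL p)
    have j4: "integrable lborel (\<lambda>x. ?K x * (u x * of_real (\<phi> x)))" by (intro L2_mult_integrable K L2_mult_test uL p)
    have j5: "integrable lborel (\<lambda>x. u x * of_real (\<phi> x))" by (intro L2_test_integrable uL p)
    have P1: "P1 = - (\<Sum>i\<in>UNIV. LINT x|lborel. weak_partial i u x * of_real (partial i \<phi> x))"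
    proof -
      have "P1 = (\<Sum>i\<in>UNIV. LINT x|lborel. u x * of_real (partial i (partial i \<phi>) x))"
        unfolding P1_def lap by (intro Bochner_Integration.integral_sum L2_test_integrable uL ppp)
      also have "\<dots> = (\<Sum>i\<in>UNIV. - (LINT x|lborel. weak_partial i u x * of_real (partial i \<phi> x)))"
        by (intro sum.cong refl wpD(2)[OF ES_wp[OF u]] pp)
      finally show ?thesis by (simp add: sum_negf)
    qed
    \<comment> \<open>Twice the tested equation at \<open>\<mu> = - la / 2\<close>. The values 1 and
      \<open>\<i>\<close> for \<open>\<kappa>\<close> show that its real and imaginary parts
      vanish.\<close>
    define Z where "Z = - P1 + of_real (a\<^sup>2) * P2 + of_real (2 * l1) * P3 + of_real (2 * l2) * P4 - of_real la * P5"
    have ReZ: "Re (cnj \<kappa> * Z) = 0" for \<kappa>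
    proof -
      let ?h = "\<lambda>x. \<kappa> * of_real (\<phi> x)"
      have h: "?h \<in> energy_space" by (rule test_ES[OF p])
      have "gr u ?h = (\<Sum>i\<in>UNIV. ip (weak_partial i u) (\<lambda>x. \<kappa> * of_real (partial i \<phi> x)))"
        by (rule gr_eq[OF u h ES_wp[OF u] wp_scale[OF wp_test[OF p]]])
      also have "\<dots> = Re (cnj \<kappa> * (- P1))" unfolding P1 ip_test by (simp add: sum_3 algebra_simps)
      finally have g: "gr u ?h = Re (cnj \<kappa> * (- P1))" .
      have "xmul ?h = (\<lambda>x. \<kappa> * of_real (T x))" by (auto simp: xmul_def T_def)
      then have x: "ip (xmul u) (xmul ?h) = Re (cnj \<kappa> * P2)" by (simp only: ip_test P2_def)
      have n1: "ip ?\<rho> (cross u ?h) = Re (cnj \<kappa> * P3)" unfolding P3_def by (rule ip_cross_test[OF u p \<rho>]) (simp add: \<rho>r)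
      have n2: "ip ?K (cross u ?h) = Re (cnj \<kappa> * P4)" unfolding P4_def by (rule ip_cross_test[OF u p K dipolar_real[OF \<rho> \<rho>r]])
      have "denergy l1 l2 a u ?h = la * ip u ?h" unfolding la_def by (rule critical_lagrange(3)[OF cr c h])
      then have "Re (cnj \<kappa> * (- P1)) + a\<^sup>2 * Re (cnj \<kappa> * P2) + 2 * (l1 * Re (cnj \<kappa> * P3) + l2 * Re (cnj \<kappa> * P4))
          = la * Re (cnj \<kappa> * P5)"
        unfolding denergy_def qf_def nl_def g x n1 n2 ip_test P5_def .
      then show ?thesis unfolding Z_def by (simp add: algebra_simps)
    qed
    have "Z = 0" using ReZ[of 1] ReZ[of \<i>] by (simp add: complex_eq_iff)
    have "(LINT x|lborel. - (1 / 2) * u x * of_real (laplacian \<phi> x)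
           + (of_real (a\<^sup>2 / 2 * (norm x)\<^sup>2) * u x + of_real l1 * ?\<rho> x * u x + of_real l2 * ?K x * u x + of_real \<mu> * u x) * of_real (\<phi> x))
      = (LINT x|lborel. (- (1/2)) * (u x * of_real (laplacian \<phi> x)) + (of_real (a\<^sup>2 / 2) * (xmul u x * of_real (T x))
          + (of_real l1 * (?\<rho> x * (u x * of_real (\<phi> x))) + (of_real l2 * (?K x * (u x * of_real (\<phi> x))) + of_real \<mu> * (u x * of_real (\<phi> x))))))"
      by (intro Bochner_Integration.integral_cong refl) (simp add: xmul_def T_def power2_eq_square algebra_simps)
    also have "\<dots> = (- (1/2)) * P1 + (of_real (a\<^sup>2 / 2) * P2 + (of_real l1 * P3 + (of_real l2 * P4 + of_real \<mu> * P5)))"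
      unfolding P1_def P2_def P3_def P4_def P5_def using j1 j2 j3 j4 j5 by simp
    also have "\<dots> = 1/2 * Z + of_real (\<mu> + la / 2) * P5" unfolding Z_def by (simp add: field_simps)
    finally show ?thesis unfolding \<open>Z = 0\<close> P5_def by simp
  qed
  have "solves_stationary l1 l2 a \<mu> u \<longleftrightarrow> \<mu> + la / 2 = 0"
  proof
    assume "\<mu> + la / 2 = 0"
    then show "solves_stationary l1 l2 a \<mu> u" unfolding solves_stationary_def using main[of _ \<mu>] by simp
  next
    assume s: "solves_stationary l1 l2 a \<mu> u"
    show "\<mu> + la / 2 = 0"
    proof (rule ccontr)
      assume n: "\<mu> + la / 2 \<noteq> 0"
      have n': "complex_of_real (\<mu> + la / 2) \<noteq> 0" using n by (simp only: of_real_eq_0_iff not_False_eq_True)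
      have "(LINT x|lborel. u x * of_real (\<phi> x)) = 0" if p: "\<phi> \<in> test_functions" for \<phi>
      proof -
        have "of_real (\<mu> + la / 2) * (LINT x|lborel. u x * of_real (\<phi> x)) = 0"
          using s p unfolding solves_stationary_def main[OF p, of \<mu>, symmetric] by blast
        then show ?thesis using n' by (simp only: mult_eq_0_iff) blast
      qed
      then have "AE x in lborel. u x = 0" by (rule fundamental_lemma[OF L2_loc_L2[OF uL]])
      then have "l2n u = l2n (\<lambda>x. 0)" by (intro l2n_AE L2_meas[OF uL]) auto
      then show False using um c by (simp add: l2n_def)
    qed
  qed
  then show ?thesis unfolding la_def by auto
qed

theorem theorem1p8:
  fixes c lam1 lam2 :: real
  assumes "c > 0" and "unstable_regime lam1 lam2"
  shows "(\<exists>a0>0. \<forall>a\<in>{0<..a0}. \<exists>u. ground_state lam1 lam2 a c u) \<and>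
    (\<forall>a0>0. (\<forall>a\<in>{0<..a0}. \<exists>u. ground_state lam1 lam2 a c u) \<longrightarrow>
      (\<exists>a1\<in>{0<..a0}. \<forall>a\<in>{0<..a1}. \<forall>u. ground_state lam1 lam2 a c u \<longrightarrow>
        (\<exists>!\<mu>. solves_stationary lam1 lam2 a \<mu> u) \<and>
        (\<forall>\<mu>. solves_stationary lam1 lam2 a \<mu> u \<longrightarrow> \<mu> < 0)))"
proof -
  obtain a1 where a1: "a1 > 0" and small: "\<And>a. a \<in> {0<..a1}
      \<Longrightarrow> \<exists>v\<in>admissible lam1 lam2 c. energy lam1 lam2 a v \<le> grad_threshold lam1 lam2 c / 32"
    using small_energy[OF assms(1), of lam1 lam2] by blast
  have 1: "\<exists>u. ground_state lam1 lam2 a c u" if a: "a \<in> {0<..a1}" for a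
    using small[OF a] ground_state_small(1)[OF assms(1), of a] a by auto
  have 2: "(\<exists>!\<mu>. solves_stationary lam1 lam2 a \<mu> u) \<and> (\<forall>\<mu>. solves_stationary lam1 lam2 a \<mu> u \<longrightarrow> \<mu> < 0)"
    if a: "a \<in> {0<..a1}" and u: "ground_state lam1 lam2 a c u" for a u
  proof -
    have "constrained_critical_point lam1 lam2 a c u" using u by (simp add: ground_state_def)
    note st = stationary_iff[OF this assms(1)]
    have "denergy lam1 lam2 a u u > 0"
      using small[OF a] ground_state_small(2)[OF assms(1) _ _ _ u] a by auto
    then show ?thesis unfolding st using assms(1) by auto
  qed
  show ?thesis
  proof (intro conjI allI impI)
    show "\<exists>a0>0. \<forall>a\<in>{0<..a0}. \<exists>u. ground_state lam1 lam2 a c u" using 1 a1 by blast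
    fix a0 :: real assume "a0 > 0"
    then show "\<exists>a1\<in>{0<..a0}. \<forall>a\<in>{0<..a1}. \<forall>u. ground_state lam1 lam2 a c u \<longrightarrow>
        (\<exists>!\<mu>. solves_stationary lam1 lam2 a \<mu> u) \<and> (\<forall>\<mu>. solves_stationary lam1 lam2 a \<mu> u \<longrightarrow> \<mu> < 0)"
      \<comment> \<open>The bound supplied by \<open>small_energy\<close> does not depend on
        \<open>a0\<close>; taking the minimum places it in the prescribed interval.\<close>
      using 2 a1 by (intro bexI[of _ "min a0 a1"]) auto
  qed
qed

end
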